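(* All maximal open subalgebras of $L=E(5,10)$ are, up to conjugation, the graded subalgebras of type $(2,1,1,1,1)$, $(3,3,2,2,2)$, $(2,2,2,1,1)$ and $(2,2,2,2,2)$.
   Context: The ground field is $\mathbb{C}$. $W_5$ is the Lie algebra of formal vector fields in $x_1,\dots,x_5$, $S_5\subset W_5$ the subalgebra of divergence-free vector fields, $\Omega^k(5)$ the space of differential $k$-forms with coefficients in $\mathbb{C}[[x_1,\dots,x_5]]$. $E(5,10)$ is the linearly compact Lie superalgebra with even part $S_5$ and odd part $d\Omega^1(5)$ (closed $2$-forms); $S_5$ acts on $d\Omega^1(5)$ by Lie derivative, and for $\omega_1,\omega_2\in d\Omega^1(5)$, $[\omega_1,\omega_2]=\omega_1\wedge\omega_2\in\Omega^4(5)$, where $\Omega^4(5)$ is identified with $W_5$ via contraction of vector fields with the volume form $dx_1\wedge\dots\wedge dx_5$ (closed $4$-forms corresponding to elements of $S_5$). The $\mathbb{Z}$-grading of type $(a_1,\dots,a_5)$, with $a_i$ positive integers and $\sum a_i$ even: $\deg x_i=-\deg\frac{\partial}{\partial x_i}=a_i$, $\deg d=-\frac14\sum_ia_i$, so that $\deg(dx_i\wedge dx_j)=a_i+a_j-\frac12\sum_ka_k$. The graded subalgebra of this type is $\prod_{j\ge0}L_j$. Maximal open subalgebras are taken among proper subalgebras. "Conjugation" means conjugation by the group of inner automorphisms of $\mathrm{Der}\,L$ (continuous derivations), generated by $\exp(\mathrm{ad}\,a)$ for exponentiable even $a\in\mathrm{Der}\,L$ (those for which $\exp(t\,\mathrm{ad}\,a)$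 converges for all $t\in\mathbb{C}$ to a continuous automorphism). *)

theory Defs
  imports
    "HOL-Analysis.Analysis"
    "HOL-Algebra.Bij"
    "HOL-Algebra.Generated_Groups"
    "HOL-Library.Function_Algebras"
    "HOL-Library.Numeral_Type"
begin

section \<open>Formal power series in finitely many variables\<close>

text \<open>The variables are indexed by \<open>'n\<close>; a monomial is its exponent function \<open>'n \<Rightarrow> nat\<close>.\<close>

typedef 'n mps = "UNIV :: (('n \<Rightarrow> nat) \<Rightarrow> complex) set"
  morphisms mps_coeff Abs_mps ..

lemma mps_coeff_Abs [simp]: "mps_coeff (Abs_mps f) = f"
  by (simp add: Abs_mps_inverse)

lemma mps_eqI: "(\<And>m. mps_coeff f m = mps_coeff g m) \<Longrightarrow> f = g"
  by (metis mps_coeff_inject ext)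

definition mps_const :: "complex \<Rightarrow> 'n mps" where
  "mps_const c = Abs_mps (\<lambda>m. if m = 0 then c else 0)"

lemma finite_exponent_splits: "finite {(k, l). k + l = (m :: 'n::finite \<Rightarrow> nat)}"
proof (rule finite_subset)
  let ?B = "PiE UNIV (\<lambda>i. {..m i})"
  show "{(k, l). k + l = m} \<subseteq> ?B \<times> ?B"
    by (auto simp: PiE_def)
  show "finite (?B \<times> ?B)"
    by (intro finite_cartesian_product finite_PiE) auto
qed

instantiation mps :: (finite) comm_ring_1
begin

definition zero_mps :: "'a mps" where "0 = Abs_mps (\<lambda>_. 0)"
definition one_mps :: "'a mps" where "1 = mps_const 1"
definition plus_mps :: "'a mps \<Rightarrow> 'a mps \<Rightarrow> 'a mps" where
  "f + g = Abs_mps (\<lambda>m. mps_coeff f m + mps_coeff g m)"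
definition minus_mps :: "'a mps \<Rightarrow> 'a mps \<Rightarrow> 'a mps" where
  "f - g = Abs_mps (\<lambda>m. mps_coeff f m - mps_coeff g m)"
definition uminus_mps :: "'a mps \<Rightarrow> 'a mps" where
  "- f = Abs_mps (\<lambda>m. - mps_coeff f m)"
definition times_mps :: "'a mps \<Rightarrow> 'a mps \<Rightarrow> 'a mps" where
  "f * g = Abs_mps (\<lambda>m. \<Sum>(k, l)\<in>{(k, l). k + l = m}. mps_coeff f k * mps_coeff g l)"

instance
proof
  fix f g h :: "'a mps"
  show "f + g + h = f + (g + h)" "f + g = g + f" "0 + f = f" "- f + f = 0" "f - g = f + - g"
    by (auto intro!: mps_eqI simp: plus_mps_def zero_mps_def uminus_mps_def minus_mps_def)
  show "(0 :: 'a mps) \<noteq> 1"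
  proof
    assume "(0 :: 'a mps) = 1"
    then have "mps_coeff (0 :: 'a mps) 0 = mps_coeff 1 0" by simp
    then show False by (simp add: zero_mps_def one_mps_def mps_const_def)
  qed
  show "f * g = g * f"
    by (rule mps_eqI, simp add: times_mps_def,
        rule sum.reindex_bij_witness[of _ prod.swap prod.swap]) (auto simp: add.commute)
  show "(f + g) * h = f * h + g * h"
    by (rule mps_eqI)
       (simp add: times_mps_def plus_mps_def split_def distrib_right sum.distrib)
  show "1 * f = f"
  proof (rule mps_eqI)
    fix m
    have "mps_coeff (1 * f) m =
      (\<Sum>(k, l)\<in>{(k, l). k + l = m}. (if k = 0 then 1 else 0) * mps_coeff f l)"
      by (simp add: times_mps_def one_mps_def mps_const_def)
    also have "\<dots> = (\<Sum>(k, l)\<in>{(0 :: 'a \<Rightarrow> nat, m)}. (if k = 0 then 1 else 0) * mps_coeff f l)"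
      by (rule sum.mono_neutral_right) (auto simp: finite_exponent_splits split: if_splits)
    finally show "mps_coeff (1 * f) m = mps_coeff f m" by simp
  qed
  show "f * g * h = f * (g * h)"
  proof (rule mps_eqI)
    fix m :: "'a \<Rightarrow> nat"
    let ?S = "\<lambda>m :: 'a \<Rightarrow> nat. {(k, l). k + l = m}"
    let ?t = "\<lambda>a b c. mps_coeff f a * mps_coeff g b * mps_coeff h c"
    have "mps_coeff (f * g * h) m = (\<Sum>p\<in>?S m. \<Sum>q\<in>?S (fst p). ?t (fst q) (snd q) (snd p))"
      by (simp add: times_mps_def split_def sum_distrib_right)
    also have "\<dots> = (\<Sum>(p, q)\<in>Sigma (?S m) (\<lambda>p. ?S (fst p)). ?t (fst q) (snd q) (snd p))"
      by (rule sum.Sigma) (auto simp: finite_exponent_splits split: if_splits)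
    also have "\<dots> = (\<Sum>(p, q)\<in>Sigma (?S m) (\<lambda>p. ?S (snd p)). ?t (fst p) (fst q) (snd q))"
      by (rule sum.reindex_bij_witness[of _
            "\<lambda>(p, q). ((fst p + fst q, snd q), (fst p, fst q))"
            "\<lambda>(p, q). ((fst q, snd q + snd p), (snd q, snd p))"])
         (auto simp: add.assoc)
    also have "\<dots> = (\<Sum>p\<in>?S m. \<Sum>q\<in>?S (snd p). ?t (fst p) (fst q) (snd q))"
      by (rule sum.Sigma[symmetric]) (auto simp: finite_exponent_splits split: if_splits)
    also have "\<dots> = mps_coeff (f * (g * h)) m"
      by (simp add: times_mps_def split_def sum_distrib_left mult.assoc)
    finally show "mps_coeff (f * g * h) m = mps_coeff (f * (g * h)) m" .
  qed
qed

end

definition mps_partial :: "'n \<Rightarrow> 'n mps \<Rightarrow> 'n mps" where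
  "mps_partial i f = Abs_mps (\<lambda>m. of_nat (Suc (m i)) * mps_coeff f (m(i := Suc (m i))))"


section \<open>Formal vector fields and differential forms\<close>

text \<open>
  The vector field \<open>\<Sum>i. X i * \<partial>/\<partial>x\<^sub>i\<close> is represented by \<open>X\<close>, and the (possibly
  inhomogeneous) differential form \<open>\<Sum>I. \<alpha> I * dx\<^sub>I\<close> by \<open>\<alpha>\<close>, where
  \<open>dx\<^sub>I = dx\<^sub>i \<and> dx\<^sub>j \<and> \<dots>\<close> with \<open>I = {i < j < \<dots>}\<close>.
\<close>

type_synonym 'n vfield = "'n \<Rightarrow> 'n mps"
type_synonym 'n dform = "'n set \<Rightarrow> 'n mps"

definition vf_bracket :: "'n::finite vfield \<Rightarrow> 'n vfield \<Rightarrow> 'n vfield" where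
  "vf_bracket X Y = (\<lambda>i. \<Sum>j\<in>UNIV. X j * mps_partial j (Y i) - Y j * mps_partial j (X i))"

definition divergence :: "'n::finite vfield \<Rightarrow> 'n mps" where
  "divergence X = (\<Sum>i\<in>UNIV. mps_partial i (X i))"

definition Omega :: "nat \<Rightarrow> 'n::finite dform set" where
  "Omega k = {\<alpha>. \<forall>I. card I \<noteq> k \<longrightarrow> \<alpha> I = 0}"

text \<open>For disjoint \<open>I\<close> and \<open>J\<close>: \<open>dx\<^sub>I \<and> dx\<^sub>J = shuffle_sign I J * dx\<^bsub>I \<union> J\<^esub>\<close>.\<close>

definition shuffle_sign :: "'n::linorder set \<Rightarrow> 'n set \<Rightarrow> 'a::comm_ring_1" where
  "shuffle_sign I J = (-1) ^ card {(i, j). i \<in> I \<and> j \<in> J \<and> j < i}"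

definition wedge :: "'n::{finite,linorder} dform \<Rightarrow> 'n dform \<Rightarrow> 'n dform" where
  "wedge \<alpha> \<beta> = (\<lambda>K. \<Sum>I\<in>Pow K. shuffle_sign I (K - I) * \<alpha> I * \<beta> (K - I))"

definition ext_d :: "'n::{finite,linorder} dform \<Rightarrow> 'n dform" where
  "ext_d \<alpha> = (\<lambda>K. \<Sum>i\<in>K. shuffle_sign {i} (K - {i}) * mps_partial i (\<alpha> (K - {i})))"

definition contraction :: "'n::{finite,linorder} vfield \<Rightarrow> 'n dform \<Rightarrow> 'n dform" where
  "contraction X \<alpha> = (\<lambda>J. \<Sum>i\<in>- J. shuffle_sign {i} J * X i * \<alpha> (insert i J))"

text \<open>Cartan's formula.\<close>

definition lie_deriv :: "'n::{finite,linorder} vfield \<Rightarrow> 'n dform \<Rightarrow> 'n dform" where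
  "lie_deriv X \<alpha> = contraction X (ext_d \<alpha>) + ext_d (contraction X \<alpha>)"

definition volume_form :: "'n::finite dform" where
  "volume_form = (\<lambda>I. if I = UNIV then 1 else 0)"

text \<open>
  The vector field whose contraction with the volume form is a given form of codegree one;
  the two lemmas below show that this is the inverse of \<open>X \<mapsto> contraction X volume_form\<close>.
\<close>

definition vf_of_form :: "'n::{finite,linorder} dform \<Rightarrow> 'n vfield" where
  "vf_of_form \<beta> = (\<lambda>i. shuffle_sign {i} (- {i}) * \<beta> (- {i}))"

lemma shuffle_sign_square: "shuffle_sign I J * (shuffle_sign I J * a) = (a :: 'a::comm_ring_1)"
  by (simp add: shuffle_sign_def mult.assoc[symmetric] power_add[symmetric])

lemma contraction_volume_form:
  "contraction X volume_form (- {i}) = shuffle_sign {i} (- {i}) * X i"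
proof -
  have "insert i (- {i}) = UNIV" by auto
  then show ?thesis by (simp add: contraction_def volume_form_def)
qed

lemma vf_of_form_contraction: "vf_of_form (contraction X volume_form) = X"
  by (simp add: vf_of_form_def contraction_volume_form shuffle_sign_square)

lemma contraction_vf_of_form:
  fixes \<beta> :: "'n::{finite,linorder} dform"
  assumes "\<beta> \<in> Omega (CARD('n) - 1)"
  shows "contraction (vf_of_form \<beta>) volume_form = \<beta>"
proof
  fix J :: "'n set"
  show "contraction (vf_of_form \<beta>) volume_form J = \<beta> J"
  proof (cases "card J = CARD('n) - 1")
    case True
    have "card (- J) = 1"
      using True card_Diff_subset[of J UNIV] finite_UNIV_card_ge_0[where 'a = 'n]
      by (simp add: Compl_eq_Diff_UNIV)
    then obtain i where "- J = {i}" by (auto simp: card_1_singleton_iff)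
    then have J: "J = - {i}" by auto
    show ?thesis
      unfolding J contraction_volume_form by (simp add: vf_of_form_def shuffle_sign_square)
  next
    case False
    have "insert i J \<noteq> UNIV" if "i \<notin> J" for i
      using False that card_insert_disjoint[of J i] by (metis diff_Suc_1 finite_code)
    then have "contraction (vf_of_form \<beta>) volume_form J = 0"
      by (auto simp: contraction_def volume_form_def intro!: sum.neutral)
    then show ?thesis using assms False by (simp add: Omega_def)
  qed
qed


section \<open>The Lie superalgebra \<open>E(5,10)\<close>\<close>

text \<open>
  The five variables are indexed by the type \<open>5\<close>, with elements \<open>1, 2, 3, 4, 5\<close>. In this type
  \<open>5 = 0\<close> is the least element, so the volume form is
  \<open>dx\<^sub>5 \<and> dx\<^sub>1 \<and> dx\<^sub>2 \<and> dx\<^sub>3 \<and> dx\<^sub>4 = dx\<^sub>1 \<and> dx\<^sub>2 \<and> dx\<^sub>3 \<and> dx\<^sub>4 \<and> dx\<^sub>5\<close>.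
  Elements are pairs of a vector field (even part) and a 2-form (odd part).
\<close>

type_synonym elt = "5 vfield \<times> 5 dform"

definition E510 :: "elt set" where
  "E510 = {X. divergence X = 0} \<times> ext_d ` Omega 1"

definition elt_scale :: "complex \<Rightarrow> elt \<Rightarrow> elt" where
  "elt_scale c u = ((\<lambda>i. mps_const c * fst u i), (\<lambda>I. mps_const c * snd u I))"

text \<open>Parities are natural numbers modulo 2.\<close>

definition E510_part :: "nat \<Rightarrow> elt set" where
  "E510_part p = {u \<in> E510. if even p then snd u = 0 else fst u = 0}"

definition E510_bracket :: "elt \<Rightarrow> elt \<Rightarrow> elt" where
  "E510_bracket u v =
     (vf_bracket (fst u) (fst v) + vf_of_form (wedge (snd u) (snd v)),
      lie_deriv (fst u) (snd v) - lie_deriv (fst v) (snd u))"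

text \<open>
  Coordinates of an element: \<open>(Inl i, m)\<close> is the coefficient of \<open>x\<^sup>m \<partial>/\<partial>x\<^sub>i\<close> and
  \<open>(Inr I, m)\<close> that of \<open>x\<^sup>m dx\<^sub>I\<close>.
\<close>

type_synonym coord = "(5 + 5 set) \<times> (5 \<Rightarrow> nat)"

definition elt_coord :: "elt \<Rightarrow> coord \<Rightarrow> complex" where
  "elt_coord u = (\<lambda>(b, m). case b of Inl i \<Rightarrow> mps_coeff (fst u i) m | Inr I \<Rightarrow> mps_coeff (snd u I) m)"

text \<open>
  The linearly compact topology: coordinatewise convergence, where the ground field carries the
  discrete topology.
\<close>

definition E510_top :: "elt topology" where
  "E510_top = pullback_topology E510 elt_coord (product_topology (\<lambda>_. discrete_topology UNIV) UNIV)"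

text \<open>Subalgebras of a Lie superalgebra are \<open>\<int>/2\<close>-graded subspaces closed under the bracket.\<close>

definition E510_subalgebra :: "elt set \<Rightarrow> bool" where
  "E510_subalgebra M \<longleftrightarrow> M \<subseteq> E510 \<and> 0 \<in> M \<and>
     (\<forall>u\<in>M. \<forall>v\<in>M. u + v \<in> M) \<and> (\<forall>c. \<forall>u\<in>M. elt_scale c u \<in> M) \<and>
     (\<forall>u\<in>M. (fst u, 0) \<in> M \<and> (0, snd u) \<in> M) \<and>
     (\<forall>u\<in>M. \<forall>v\<in>M. E510_bracket u v \<in> M)"

definition maximal_open_subalgebra :: "elt set \<Rightarrow> bool" where
  "maximal_open_subalgebra M \<longleftrightarrow>
     E510_subalgebra M \<and> openin E510_top M \<and> M \<noteq> E510 \<and>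
     (\<forall>N. E510_subalgebra N \<and> M \<subseteq> N \<and> N \<noteq> E510 \<longrightarrow> N = M)"


section \<open>Gradings\<close>

text \<open>
  The degree of \<open>x\<^sup>m \<partial>/\<partial>x\<^sub>i\<close>, respectively \<open>x\<^sup>m dx\<^sub>I\<close> with \<open>card I = 2\<close>, in the grading of
  type \<open>a\<close>. The halved sum is exact because types have even sum.
\<close>

definition coord_degree :: "(5 \<Rightarrow> nat) \<Rightarrow> coord \<Rightarrow> int" where
  "coord_degree a = (\<lambda>(b, m). (\<Sum>k\<in>UNIV. int (m k) * int (a k)) +
     (case b of Inl i \<Rightarrow> - int (a i)
              | Inr I \<Rightarrow> (\<Sum>i\<in>I. int (a i)) - (\<Sum>k\<in>UNIV. int (a k)) div 2))"

text \<open>The product \<open>\<Prod>j\<ge>0. L\<^sub>j\<close> of the nonnegative homogeneous components of \<open>L = E(5,10)\<close>.\<close>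

definition graded_subalgebra :: "(5 \<Rightarrow> nat) \<Rightarrow> elt set" where
  "graded_subalgebra a = {u \<in> E510. \<forall>b. elt_coord u b \<noteq> 0 \<longrightarrow> coord_degree a b \<ge> 0}"


section \<open>Continuous derivations and inner automorphisms\<close>

text \<open>
  Maps on \<open>E510\<close> are extensional, so that equality of derivations is equality of functions.
\<close>

definition Der_part :: "nat \<Rightarrow> (elt \<Rightarrow> elt) set" where
  "Der_part p = {D \<in> E510 \<rightarrow>\<^sub>E E510.
     (\<forall>u\<in>E510. \<forall>v\<in>E510. D (u + v) = D u + D v) \<and>
     (\<forall>c. \<forall>u\<in>E510. D (elt_scale c u) = elt_scale c (D u)) \<and>
     (\<forall>q. D ` E510_part q \<subseteq> E510_part (p + q)) \<and>
     (\<forall>q. \<forall>u\<in>E510_part q. \<forall>v\<in>E510.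
        D (E510_bracket u v) =
          E510_bracket (D u) v + elt_scale ((-1) ^ (p * q)) (E510_bracket u (D v))) \<and>
     continuous_map E510_top E510_top D}"

definition Der_add :: "(elt \<Rightarrow> elt) \<Rightarrow> (elt \<Rightarrow> elt) \<Rightarrow> elt \<Rightarrow> elt" where
  "Der_add D D' = (\<lambda>u\<in>E510. D u + D' u)"

definition Der_scale :: "complex \<Rightarrow> (elt \<Rightarrow> elt) \<Rightarrow> elt \<Rightarrow> elt" where
  "Der_scale c D = (\<lambda>u\<in>E510. elt_scale c (D u))"

definition Der :: "(elt \<Rightarrow> elt) set" where
  "Der = {Der_add D D' | D D'. D \<in> Der_part 0 \<and> D' \<in> Der_part 1}"

text \<open>The bracket of derivations of parities \<open>p\<close> and \<open>q\<close>.\<close>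

definition Der_bracket :: "nat \<Rightarrow> nat \<Rightarrow> (elt \<Rightarrow> elt) \<Rightarrow> (elt \<Rightarrow> elt) \<Rightarrow> elt \<Rightarrow> elt" where
  "Der_bracket p q D D' = (\<lambda>u\<in>E510. D (D' u) - elt_scale ((-1) ^ (p * q)) (D' (D u)))"

text \<open>
  The adjoint action of an even derivation on \<open>Der\<close>; as the first argument is even, the sign in
  the bracket does not depend on the parity of the second one.
\<close>

definition Der_ad :: "(elt \<Rightarrow> elt) \<Rightarrow> (elt \<Rightarrow> elt) \<Rightarrow> elt \<Rightarrow> elt" where
  "Der_ad a D = Der_bracket 0 0 a D"

definition Der_top :: "(elt \<Rightarrow> elt) topology" where
  "Der_top = subtopology (product_topology (\<lambda>_. E510_top) E510) Der"

definition continuous_Der_aut :: "((elt \<Rightarrow> elt) \<Rightarrow> (elt \<Rightarrow> elt)) \<Rightarrow> bool" where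
  "continuous_Der_aut \<phi> \<longleftrightarrow> \<phi> \<in> Bij Der \<and>
     (\<forall>D\<in>Der. \<forall>D'\<in>Der. \<phi> (Der_add D D') = Der_add (\<phi> D) (\<phi> D')) \<and>
     (\<forall>c. \<forall>D\<in>Der. \<phi> (Der_scale c D) = Der_scale c (\<phi> D)) \<and>
     (\<forall>p. \<phi> ` Der_part p \<subseteq> Der_part p) \<and>
     (\<forall>p q. \<forall>D\<in>Der_part p. \<forall>D'\<in>Der_part q.
        \<phi> (Der_bracket p q D D') = Der_bracket p q (\<phi> D) (\<phi> D')) \<and>
     continuous_map Der_top Der_top \<phi>"

text \<open>
  \<open>exp_ad a t \<phi>\<close>: the series \<open>\<Sum>n. (t\<^sup>n / n!) (ad a)\<^sup>n D\<close> converges to \<open>\<phi> D\<close> for every \<open>D\<close>. Unlike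
  continuity, convergence of the series refers to the usual topology of the ground field: each
  coordinate of each value \<open>\<phi> D u\<close> is the sum of a convergent series of complex numbers. (For
  the discrete topology the exponential of the adjoint action of, say,
  \<open>x\<^sub>1 \<partial>/\<partial>x\<^sub>1 - x\<^sub>2 \<partial>/\<partial>x\<^sub>2\<close> would not converge.)
\<close>

definition exp_ad :: "(elt \<Rightarrow> elt) \<Rightarrow> complex \<Rightarrow> ((elt \<Rightarrow> elt) \<Rightarrow> (elt \<Rightarrow> elt)) \<Rightarrow> bool" where
  "exp_ad a t \<phi> \<longleftrightarrow> (\<forall>D\<in>Der. \<forall>u\<in>E510. \<forall>b.
     (\<lambda>n. t ^ n / fact n * elt_coord ((Der_ad a ^^ n) D u) b) sums elt_coord (\<phi> D u) b)"

definition exponentiable :: "(elt \<Rightarrow> elt) \<Rightarrow> bool" where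
  "exponentiable a \<longleftrightarrow> a \<in> Der_part 0 \<and> (\<forall>t. \<exists>\<phi>. continuous_Der_aut \<phi> \<and> exp_ad a t \<phi>)"

definition inner_automorphisms :: "((elt \<Rightarrow> elt) \<Rightarrow> (elt \<Rightarrow> elt)) set" where
  "inner_automorphisms =
     generate (BijGroup Der) {\<phi>. continuous_Der_aut \<phi> \<and> (\<exists>a. exponentiable a \<and> exp_ad a 1 \<phi>)}"

text \<open>
  Inner automorphisms act on \<open>Der\<close>, of which \<open>E510\<close> is regarded as a subalgebra by means of its
  adjoint representation.
\<close>

definition E510_ad :: "elt \<Rightarrow> elt \<Rightarrow> elt" where
  "E510_ad u = (\<lambda>v\<in>E510. E510_bracket u v)"

definition conjugate :: "elt set \<Rightarrow> elt set \<Rightarrow> bool" where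
  "conjugate M M' \<longleftrightarrow> M \<subseteq> E510 \<and> M' \<subseteq> E510 \<and>
     (\<exists>\<phi>\<in>inner_automorphisms. \<phi> ` (E510_ad ` M) = E510_ad ` M')"

end

theory Submission
  imports Defs
begin

text \<open>
  An open subalgebra with a vector field that does not vanish at the origin is everything, because
  bracketing with that field lowers the order of vanishing of its elements. So the even part of a proper
  open subalgebra \<open>M\<close> vanishes at the origin. Then \<open>[\<omega>, \<eta>] = \<omega> \<and> \<eta>\<close> forces the values at the origin of the odd
  part of \<open>M\<close> to form a subspace \<open>U\<close> of \<open>\<Lambda>\<^sup>2 V\<^sup>*\<close> (\<open>V\<^sup>*\<close> the span of the \<open>dx\<^sub>i\<close>) on which the wedge product is zero:
  \<open>U = 0\<close>, \<open>U = \<Lambda>\<^sup>2 W\<close> with \<open>dim W\<close> 2 or 3, or \<open>U \<subseteq> l \<and> V\<^sup>*\<close> with \<open>dim U \<ge> 2\<close> for a line \<open>l\<close>. The linear parts of the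
  even elements of \<open>M\<close> stabilise \<open>U\<close>, hence \<open>W\<close> or \<open>l\<close>, and \<open>M\<close> is contained in one of the four graded
  subalgebras once a product of transvections \<open>exp (t ad (x\<^sub>i \<partial>/\<partial>x\<^sub>j))\<close> has moved \<open>W\<close> or \<open>l\<close> to a coordinate subspace.
  The same invariants show that each of the four is maximal.

  Inner automorphisms preserve the adjoint copy of \<open>E(5,10)\<close> in its derivation algebra, since
  \<open>exp (ad a) (ad u) = ad (exp a u)\<close>, and so they preserve maximality.
\<close>

section \<open>Calculus of formal power series\<close>

text \<open>Two topologies meet here: continuity refers to the discrete ground field, the
  exponential series to the usual one. They are reconciled because each coordinate of the image
  under a continuous linear map is a finite combination of coordinates, so such a map commutes with
  coordinatewise limits. A general exponentiable derivation is only given through the exponential of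
  its adjoint action on \<open>Der\<close>; its exponential on the algebra itself is recovered
  because every coordinate of \<open>w\<close> is, up to a scalar, a coordinate of a bracket of
  \<open>w\<close> with a fixed \<open>v\<close>. Transvections, by contrast, are locally nilpotent,
  and their series are finite in each coordinate.

  Only Taylor coefficients of order 0 and 1 decide containment in a graded subalgebra, since for the
  four types all coordinates of higher order have nonnegative degree. Type (2,2,2,1,1) is the only
  one for which the first-order part of odd elements enters: x_4 dx_4 dx_5 and x_5 dx_4 dx_5 have
  degree -1. The fifth variable appears as index \<open>0\<close>.\<close>

lemma mps_coeff_zero [simp]: "mps_coeff 0 m = 0"
  and mps_coeff_add [simp]: "mps_coeff (f + g) m = mps_coeff f m + mps_coeff g m"
  and mps_coeff_diff [simp]: "mps_coeff (f - g) m = mps_coeff f m - mps_coeff g m"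
  and mps_coeff_uminus [simp]: "mps_coeff (- f) m = - mps_coeff f m"
  by (simp_all add: zero_mps_def plus_mps_def minus_mps_def uminus_mps_def)

lemma mps_coeff_sum [simp]: "mps_coeff (sum f A) m = (\<Sum>a\<in>A. mps_coeff (f a) m)"
  by (induction A rule: infinite_finite_induct) auto

lemma mps_coeff_mult:
  "mps_coeff (f * g) m = (\<Sum>p\<in>{p. fst p + snd p = m}. mps_coeff f (fst p) * mps_coeff g (snd p))"
  by (simp add: times_mps_def split_def)

lemma finite_exponent_splits': "finite {p. fst p + snd p = (m :: 'n::finite \<Rightarrow> nat)}"
  using finite_exponent_splits[of m] by (simp add: split_def)

lemma mps_coeff_mult_nonzero:
  assumes "mps_coeff (f * g) m \<noteq> 0"
  obtains k l where "k + l = m" "mps_coeff f k \<noteq> 0" "mps_coeff g l \<noteq> 0"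
proof -
  obtain p where "fst p + snd p = m" "mps_coeff f (fst p) * mps_coeff g (snd p) \<noteq> 0"
    using assms unfolding mps_coeff_mult by (metis (mono_tags, lifting) mem_Collect_eq sum.neutral)
  then show ?thesis using that[of "fst p" "snd p"] by auto
qed

lemma mps_coeff_const: "mps_coeff (mps_const c) m = (if m = 0 then c else 0)"
  by (simp add: mps_const_def)

text \<open>Such an \<open>f\<close> is a multiple of one monomial, so the product only shifts
  exponents by \<open>e\<close>. The exponents 0 and \<open>unit_exp i\<close> yield the rules for
  constants and for variables.\<close>

lemma mps_coeff_mult_supported:
  assumes "\<And>k. k \<noteq> e \<Longrightarrow> mps_coeff f k = 0"
  shows "mps_coeff (f * g) m = (if e \<le> m then mps_coeff f e * mps_coeff g (m - e) else 0)"
proof (cases "e \<le> m")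
  case True
  have 1: "e + (m - e) = m" using True by (auto simp: le_fun_def fun_eq_iff)
  have 2: "p = (e, m - e)" if "fst p + snd p = m" "fst p = e" for p
  proof -
    have "snd p k = m k - e k" for k using fun_cong[OF that(1), of k] unfolding that(2) by simp
    then show ?thesis using that(2) by (intro prod_eqI) (auto simp: fun_eq_iff)
  qed
  have "mps_coeff (f * g) m =
      (\<Sum>p\<in>{(e, m - e)}. mps_coeff f (fst p) * mps_coeff g (snd p))"
    unfolding mps_coeff_mult
  proof (rule sum.mono_neutral_right)
    show "\<forall>p\<in>{p. fst p + snd p = m} - {(e, m - e)}. mps_coeff f (fst p) * mps_coeff g (snd p) = 0"
    proof
      fix p assume "p \<in> {p. fst p + snd p = m} - {(e, m - e)}"
      then have "fst p \<noteq> e" using 2[of p] by blast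
      then show "mps_coeff f (fst p) * mps_coeff g (snd p) = 0" using assms by simp
    qed
  qed (use 1 finite_exponent_splits' in auto)
  then show ?thesis using True by simp
next
  case False
  have "mps_coeff f (fst p) * mps_coeff g (snd p) = 0" if "fst p + snd p = m" for p
  proof -
    have "fst p \<noteq> e" using that False by (auto simp: le_fun_def)
    then show ?thesis using assms by simp
  qed
  then show ?thesis using False unfolding mps_coeff_mult by (auto intro!: sum.neutral)
qed

lemma mps_coeff_const_mult [simp]: "mps_coeff (mps_const c * f) m = c * mps_coeff f m"
  using mps_coeff_mult_supported[of 0 "mps_const c" f m] by (simp add: mps_coeff_const le_fun_def)

lemma mps_const_simps:
  "mps_const 0 = 0" "mps_const 1 = 1" "mps_const (a + b) = mps_const a + mps_const b"
  "mps_const (- a) = - mps_const a"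
  "mps_const (a * b) = mps_const a * mps_const b"
proof -
  show "mps_const 1 = 1" by (simp add: one_mps_def)
  have "mps_const a * mps_const b = mps_const a * (mps_const b * 1)" by simp
  show "mps_const 0 = 0" "mps_const (a + b) = mps_const a + mps_const b"
  "mps_const (- a) = - mps_const a"
  "mps_const (a * b) = mps_const a * mps_const b"
    by (auto intro!: mps_eqI simp: mps_coeff_const)
qed

definition unit_exp :: "'n \<Rightarrow> 'n \<Rightarrow> nat" where
  "unit_exp i = (\<lambda>k. if k = i then 1 else 0)"

lemma unit_exp_simps [simp]: "unit_exp i i = 1" "k \<noteq> i \<Longrightarrow> unit_exp i k = 0"
  by (simp_all add: unit_exp_def)

lemma unit_exp_eq_iff [simp]: "unit_exp i = unit_exp j \<longleftrightarrow> i = j"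
  by (auto simp: unit_exp_def fun_eq_iff split: if_splits)

lemma unit_exp_neq_0 [simp]: "unit_exp i \<noteq> 0" "0 \<noteq> unit_exp i"
  by (auto simp: unit_exp_def fun_eq_iff)

lemma mps_coeff_partial:
  "mps_coeff (mps_partial i f) m = of_nat (Suc (m i)) * mps_coeff f (m + unit_exp i)"
proof -
  have "m(i := Suc (m i)) = m + unit_exp i" by (auto simp: fun_eq_iff unit_exp_def)
  then show ?thesis by (simp add: mps_partial_def)
qed

lemma mps_partial_0 [simp]: "mps_partial i 0 = 0"
  and mps_partial_add: "mps_partial i (f + g) = mps_partial i f + mps_partial i g"
  and mps_partial_diff: "mps_partial i (f - g) = mps_partial i f - mps_partial i g"
  and mps_partial_uminus: "mps_partial i (- f) = - mps_partial i f"
  and mps_partial_sum: "mps_partial i (sum h A) = (\<Sum>a\<in>A. mps_partial i (h a))"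
  and mps_partial_const [simp]: "mps_partial i (mps_const c) = 0"
  by (auto intro!: mps_eqI simp: mps_coeff_partial algebra_simps sum_distrib_left mps_coeff_const
        fun_eq_iff unit_exp_def)

lemma mps_partial_commute: "mps_partial i (mps_partial j f) = mps_partial j (mps_partial i f)"
proof (rule mps_eqI)
  fix m
  have "m + unit_exp j + unit_exp i = m + unit_exp i + unit_exp j" by (simp add: ac_simps)
  then show "mps_coeff (mps_partial i (mps_partial j f)) m = mps_coeff (mps_partial j (mps_partial i f)) m"
    by (cases "i = j") (auto simp: mps_coeff_partial ac_simps)
qed

text \<open>The weight \<open>fst p i\<close> kills the splits whose first part omits the variable
  \<open>i\<close>; the others come from a split of \<open>m\<close> by adding
  \<open>unit_exp i\<close> to the first part. This is one half of the Leibniz rule; the other half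
  follows by the symmetry of splits.\<close>

lemma sum_exponent_splits_shift:
  fixes m :: "'n::finite \<Rightarrow> nat" and F :: "_ \<Rightarrow> complex"
  shows "(\<Sum>p\<in>{p. fst p + snd p = m + unit_exp i}. of_nat (fst p i) * F p) =
         (\<Sum>p\<in>{p. fst p + snd p = m}. of_nat (Suc (fst p i)) * F (fst p + unit_exp i, snd p))"
proof -
  let ?S = "{p. fst p + snd p = m + unit_exp i}"
  have "(\<Sum>p\<in>?S. of_nat (fst p i) * F p) = (\<Sum>p\<in>{p\<in>?S. fst p i > 0}. of_nat (fst p i) * F p)"
    using finite_exponent_splits'[of "m + unit_exp i"] by (intro sum.mono_neutral_right) auto
  also have "\<dots> = (\<Sum>p\<in>{p. fst p + snd p = m}. of_nat (Suc (fst p i)) * F (fst p + unit_exp i, snd p))"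
  proof (rule sum.reindex_bij_witness[of _ "\<lambda>p. (fst p + unit_exp i, snd p)"
        "\<lambda>p. (fst p - unit_exp i, snd p)"])
    fix p assume "p \<in> {p\<in>?S. fst p i > 0}"
    then have p: "fst p + snd p = m + unit_exp i" "fst p i > 0" by auto
    have *: "fst p - unit_exp i + unit_exp i = fst p"
      using p(2) by (auto simp: fun_eq_iff unit_exp_def)
    then show "(fst (fst p - unit_exp i, snd p) + unit_exp i, snd (fst p - unit_exp i, snd p)) = p"
      by simp
    have "fst p k - unit_exp i k + snd p k = m k" for k
      using fun_cong[OF p(1), of k] p(2) by (cases "k = i") auto
    then show "(fst p - unit_exp i, snd p) \<in> {p. fst p + snd p = m}"
      by (auto simp: fun_eq_iff)
    show "of_nat (Suc (fst (fst p - unit_exp i, snd p) i)) *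
      F (fst (fst p - unit_exp i, snd p) + unit_exp i, snd (fst p - unit_exp i, snd p)) = of_nat (fst p i) * F p"
      using * p(2) by simp
  qed (auto simp: ac_simps)
  finally show ?thesis .
qed

lemma mps_partial_mult: "mps_partial i (f * g) = mps_partial i f * g + f * mps_partial i g"
proof (rule mps_eqI)
  fix m
  let ?S = "\<lambda>m. {p. fst p + snd p = m}"
  let ?c = "\<lambda>p. mps_coeff f (fst p) * mps_coeff g (snd p)"
  have swap: "(\<Sum>p\<in>?S m. F p) = (\<Sum>p\<in>?S m. F (prod.swap p))" for m :: "'a \<Rightarrow> nat" and F :: "_ \<Rightarrow> complex"
    by (rule sum.reindex_bij_witness[of _ prod.swap prod.swap]) (auto simp: add.commute)
  have "mps_coeff (mps_partial i (f * g)) m = (\<Sum>p\<in>?S (m + unit_exp i). of_nat (Suc (m i)) * ?c p)"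
    by (simp add: mps_coeff_partial mps_coeff_mult sum_distrib_left)
  also have "\<dots> = (\<Sum>p\<in>?S (m + unit_exp i). of_nat (fst p i) * ?c p + of_nat (snd p i) * ?c p)"
  proof (rule sum.cong)
    fix p assume "p \<in> ?S (m + unit_exp i)"
    then have "fst p i + snd p i = Suc (m i)" by (auto simp: fun_eq_iff dest: spec[of _ i])
    then have "of_nat (Suc (m i)) = (of_nat (fst p i) + of_nat (snd p i) :: complex)"
      by (metis of_nat_add)
    then show "of_nat (Suc (m i)) * ?c p = of_nat (fst p i) * ?c p + of_nat (snd p i) * ?c p"
      by (simp only: distrib_right)
  qed simp
  also have "\<dots> = (\<Sum>p\<in>?S (m + unit_exp i). of_nat (fst p i) * ?c p) +
      (\<Sum>p\<in>?S (m + unit_exp i). of_nat (fst p i) * ?c (prod.swap p))"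
    by (simp add: sum.distrib swap[of "\<lambda>p. of_nat (snd p i) * ?c p"])
  also have "\<dots> = mps_coeff (mps_partial i f * g) m + (\<Sum>p\<in>?S m. of_nat (Suc (fst p i)) * ?c (snd p, fst p + unit_exp i))"
    by (simp add: sum_exponent_splits_shift mps_coeff_mult mps_coeff_partial mult.assoc)
  also have "(\<Sum>p\<in>?S m. of_nat (Suc (fst p i)) * ?c (snd p, fst p + unit_exp i)) =
      mps_coeff (f * mps_partial i g) m"
    by (subst swap) (simp add: mps_coeff_mult mps_coeff_partial ac_simps)
  finally show "mps_coeff (mps_partial i (f * g)) m = mps_coeff (mps_partial i f * g + f * mps_partial i g) m"
    by simp
qed

lemma mps_partial_const_mult: "mps_partial i (mps_const c * f) = mps_const c * mps_partial i f"
  by (simp add: mps_partial_mult)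

definition mps_var :: "'n \<Rightarrow> 'n mps" where
  "mps_var i = Abs_mps (\<lambda>m. if m = unit_exp i then 1 else 0)"

lemma mps_coeff_var: "mps_coeff (mps_var i) m = (if m = unit_exp i then 1 else 0)"
  by (simp add: mps_var_def)

lemma mps_coeff_var_mult:
  "mps_coeff (mps_var i * f) m = (if m i = 0 then 0 else mps_coeff f (m - unit_exp i))"
  using mps_coeff_mult_supported[of "unit_exp i" "mps_var i" f m]
  by (auto simp: mps_coeff_var le_fun_def unit_exp_def)

lemma mps_partial_var: "mps_partial i (mps_var j) = (if i = j then 1 else 0)"
proof -
  have *: "m + unit_exp i = unit_exp i \<longleftrightarrow> m = 0" for m :: "'a \<Rightarrow> nat" by (auto simp: fun_eq_iff)
  have "m + unit_exp i \<noteq> unit_exp j" if "i \<noteq> j" for m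
    using that by (auto simp: fun_eq_iff intro!: exI[of _ i])
  then show ?thesis
    by (auto intro!: mps_eqI simp: mps_coeff_partial mps_coeff_var * one_mps_def mps_coeff_const)
qed

section \<open>Vector fields as derivations of the power series ring\<close>

definition vf_apply :: "'n::finite vfield \<Rightarrow> 'n mps \<Rightarrow> 'n mps" where
  "vf_apply X f = (\<Sum>k\<in>UNIV. X k * mps_partial k f)"

lemma vf_apply_linear:
  "vf_apply X 0 = 0" "vf_apply X (f + g) = vf_apply X f + vf_apply X g" "vf_apply X (f - g) = vf_apply X f - vf_apply X g"
  "vf_apply X (- f) = - vf_apply X f" "vf_apply X (sum h A) = (\<Sum>a\<in>A. vf_apply X (h a))"
  "vf_apply X (mps_const c * f) = mps_const c * vf_apply X f"
proof -
  show "vf_apply X (sum h A) = (\<Sum>a\<in>A. vf_apply X (h a))"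
    by (simp add: vf_apply_def mps_partial_sum sum_distrib_left sum.swap[of _ A])
  show "vf_apply X (mps_const c * f) = mps_const c * vf_apply X f"
    by (simp add: vf_apply_def mps_partial_const_mult sum_distrib_left mult.left_commute)
qed (simp_all add: vf_apply_def mps_partial_add mps_partial_diff mps_partial_uminus
   algebra_simps sum.distrib sum_subtractf sum_negf)

lemma vf_apply_add_left: "vf_apply (X + Y) f = vf_apply X f + vf_apply Y f"
  and vf_apply_diff_left: "vf_apply (X - Y) f = vf_apply X f - vf_apply Y f"
  by (simp_all add: vf_apply_def algebra_simps sum.distrib sum_subtractf)

lemma vf_apply_mult: "vf_apply X (f * g) = vf_apply X f * g + f * vf_apply X g"
  by (simp add: vf_apply_def mps_partial_mult algebra_simps sum.distrib sum_distrib_left sum_distrib_right)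

lemma mps_partial_vf_apply:
  "mps_partial i (vf_apply Y f) = (\<Sum>k\<in>UNIV. mps_partial i (Y k) * mps_partial k f) + vf_apply Y (mps_partial i f)"
  by (simp add: vf_apply_def mps_partial_sum mps_partial_mult sum.distrib mps_partial_commute[of i])

lemma vf_bracket_eq: "vf_bracket X Y i = vf_apply X (Y i) - vf_apply Y (X i)"
  by (simp add: vf_bracket_def vf_apply_def sum_subtractf)

text \<open>In the commutator of two first-order operators the second-order terms cancel because
  mixed partial derivatives commute; what is left differentiates the coefficients of one field along
  the other.\<close>

lemma vf_apply_bracket:
  "vf_apply (vf_bracket X Y) f = vf_apply X (vf_apply Y f) - vf_apply Y (vf_apply X f)"
proof -
  have expand: "vf_apply X (vf_apply Y f) = vf_apply (\<lambda>k. vf_apply X (Y k)) f + (\<Sum>k\<in>UNIV. Y k * vf_apply X (mps_partial k f))" for X Y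
    by (simp add: vf_apply_def[of Y] vf_apply_def[of "\<lambda>k. vf_apply X (Y k)"] vf_apply_linear vf_apply_mult sum.distrib)
  have sym: "(\<Sum>k\<in>UNIV. Y k * vf_apply X (mps_partial k f)) = (\<Sum>k\<in>UNIV. X k * vf_apply Y (mps_partial k f))"
    unfolding vf_apply_def sum_distrib_left
    by (subst sum.swap) (simp add: mult.left_commute mps_partial_commute)
  have "vf_apply (vf_bracket X Y) f = vf_apply (\<lambda>k. vf_apply X (Y k)) f - vf_apply (\<lambda>k. vf_apply Y (X k)) f"
    by (simp add: vf_apply_def[of "vf_bracket X Y"] vf_bracket_eq vf_apply_def[of "\<lambda>k. vf_apply _ (_ k)"] left_diff_distrib sum_subtractf)
  then show ?thesis unfolding expand by (simp add: sym)
qed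

lemma vf_bracket_Jacobi:
  "vf_bracket X (vf_bracket Y Z) = vf_bracket (vf_bracket X Y) Z + vf_bracket Y (vf_bracket X Z)"
  by (rule ext) (simp add: vf_bracket_eq[of _ "vf_bracket _ _"] vf_bracket_eq[of "vf_bracket _ _"] vf_apply_bracket,
      simp add: vf_bracket_eq vf_apply_linear)

lemma divergence_vf_bracket:
  "divergence (vf_bracket X Y) = vf_apply X (divergence Y) - vf_apply Y (divergence X)"
proof -
  \<comment> \<open>The terms quadratic in first derivatives are the trace of a product of two
    Jacobians, hence symmetric in \<open>X\<close> and \<open>Y\<close>.\<close>
  have "(\<Sum>i\<in>UNIV. \<Sum>k\<in>UNIV. mps_partial i (X k) * mps_partial k (Y i)) =
        (\<Sum>i\<in>UNIV. \<Sum>k\<in>UNIV. mps_partial i (Y k) * mps_partial k (X i))"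
    by (subst sum.swap) (simp add: mult.commute)
  then show ?thesis
    by (simp add: divergence_def vf_bracket_eq mps_partial_diff mps_partial_vf_apply sum_subtractf sum.distrib
         vf_apply_linear)
qed

section \<open>Two-forms as antisymmetric matrices\<close>

text \<open>Forms indexed by sets carry signs that depend on the order of the indices. The
  antisymmetric coefficient matrix absorbs them, so that the formulas below can sum over all
  indices.\<close>

definition form_matrix :: "'n::{finite,linorder} dform \<Rightarrow> 'n \<Rightarrow> 'n \<Rightarrow> 'n mps" where
  "form_matrix \<omega> i j = (if i < j then \<omega> {i, j} else if j < i then - \<omega> {i, j} else 0)"

lemma form_matrix_same [simp]: "form_matrix \<omega> i i = 0"
  by (simp add: form_matrix_def)

lemma form_matrix_antisym: "form_matrix \<omega> j i = - form_matrix \<omega> i j"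
  by (auto simp: form_matrix_def insert_commute)

lemma Omega_2_eqI:
  assumes "\<omega> \<in> Omega 2" "\<eta> \<in> Omega 2" "\<And>i j. i < j \<Longrightarrow> form_matrix \<omega> i j = form_matrix \<eta> i j"
  shows "\<omega> = \<eta>"
proof
  fix I :: "'a set"
  show "\<omega> I = \<eta> I"
  proof (cases "card I = 2")
    case True
    then obtain i j where "I = {i, j}" "i \<noteq> j" by (auto simp: card_2_iff)
    then obtain i j where "I = {i, j}" "i < j" by (metis insert_commute linorder_less_linear)
    then show ?thesis using assms(3)[of i j] by (simp add: form_matrix_def)
  qed (use assms in \<open>auto simp: Omega_def\<close>)
qed

lemma form_matrix_linear:
  "form_matrix 0 i j = 0" "form_matrix (\<omega> + \<eta>) i j = form_matrix \<omega> i j + form_matrix \<eta> i j"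
  "form_matrix (\<omega> - \<eta>) i j = form_matrix \<omega> i j - form_matrix \<eta> i j"
  "form_matrix (- \<omega>) i j = - form_matrix \<omega> i j"
  "form_matrix (\<lambda>I. mps_const c * \<omega> I) i j = mps_const c * form_matrix \<omega> i j"
  by (auto simp: form_matrix_def)

lemma shuffle_sign_singleton:
  "shuffle_sign {i} J = (-1) ^ card {j \<in> J. j < i}"
proof -
  have "{(i', j). i' \<in> {i} \<and> j \<in> J \<and> j < i'} = Pair i ` {j \<in> J. j < i}" by auto
  then show ?thesis by (simp add: shuffle_sign_def card_image inj_on_def)
qed

lemma shuffle_sign_singleton_1: "shuffle_sign {i} {j} = (if j < i then - 1 else 1)"
  and shuffle_sign_singleton_2:
    "j \<noteq> k \<Longrightarrow> shuffle_sign {i} {j, k} = (if j < i then - 1 else 1) * (if k < i then - 1 else 1)"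
proof -
  have "{l \<in> {j}. l < i} = (if j < i then {j} else {})" by auto
  then show "shuffle_sign {i} {j} = (if j < i then - 1 else 1)" by (simp add: shuffle_sign_singleton)
  have "{l \<in> {j, k}. l < i} = (if j < i then {j} else {}) \<union> (if k < i then {k} else {})" by auto
  then show "shuffle_sign {i} {j, k} = (if j < i then - 1 else 1) * (if k < i then - 1 else 1)" if "j \<noteq> k"
    using that unfolding shuffle_sign_singleton by auto
qed

lemma contraction_singleton:
  "contraction X \<omega> {j} = (\<Sum>i\<in>UNIV. X i * form_matrix \<omega> i j)"
proof -
  have "contraction X \<omega> {j} = (\<Sum>i\<in>-{j}. X i * form_matrix \<omega> i j)"
    unfolding contraction_def
  proof (rule sum.cong)
    fix i assume "i \<in> - {j}"
    then show "shuffle_sign {i} {j} * X i * \<omega> (insert i {j}) = X i * form_matrix \<omega> i j"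
      by (auto simp: form_matrix_def shuffle_sign_singleton_1 insert_commute)
  qed simp
  also have "\<dots> = (\<Sum>i\<in>UNIV. X i * form_matrix \<omega> i j)"
    by (rule sum.mono_neutral_left) auto
  finally show ?thesis .
qed

lemma form_matrix_ext_d:
  "form_matrix (ext_d \<alpha>) i j = mps_partial i (\<alpha> {j}) - mps_partial j (\<alpha> {i})"
proof -
  have *: "ext_d \<alpha> {i, j} = mps_partial i (\<alpha> {j}) - mps_partial j (\<alpha> {i})" if "i < j" for i j :: 'a
  proof -
    have "{i, j} - {i} = {j}" "{i, j} - {j} = {i}"
      using that by auto
    then show ?thesis using that by (auto simp add: ext_d_def shuffle_sign_singleton_1)
  qed
  show ?thesis using *[of i j] *[of j i] by (auto simp: form_matrix_def insert_commute not_less_iff_gr_or_eq)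
qed

lemma ext_d_Omega:
  assumes "\<alpha> \<in> Omega k"
  shows "ext_d \<alpha> \<in> Omega (Suc k)"
proof -
  have "card K = Suc (card (K - {i}))" if "i \<in> K" for i and K :: "'a set"
    using that by (intro card.remove) auto
  then have "\<alpha> (K - {i}) = 0" if "card K \<noteq> Suc k" "i \<in> K" for i K
    using that assms unfolding Omega_def by (metis (mono_tags, lifting) mem_Collect_eq)
  then show ?thesis by (auto simp: Omega_def ext_d_def)
qed

lemma contraction_Omega:
  assumes "\<omega> \<in> Omega (Suc k)"
  shows "contraction X \<omega> \<in> Omega k"
  using assms by (auto simp: Omega_def contraction_def intro!: sum.neutral)

lemma ext_d_triple:
  assumes "i < j" "j < k"
  shows "ext_d \<omega> {i, j, k} =
    mps_partial i (form_matrix \<omega> j k) + mps_partial j (form_matrix \<omega> k i) + mps_partial k (form_matrix \<omega> i j)"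
proof -
  have ne: "i \<noteq> j" "i \<noteq> k" "j \<noteq> k" "i < k" "\<not> j < i" "\<not> k < i" "\<not> k < j" using assms by auto
  have "{i, j, k} - {i} = {j, k}" "{i, j, k} - {j} = {i, k}" "{i, j, k} - {k} = {i, j}"
    using ne by auto
  then show ?thesis using assms ne
    by (simp add: ext_d_def shuffle_sign_singleton_2 form_matrix_def mps_partial_uminus insert_commute)
qed

section \<open>Closed two-forms and their Lie derivatives\<close>

definition closed_matrix :: "('n::finite \<Rightarrow> 'n \<Rightarrow> 'n mps) \<Rightarrow> bool" where
  "closed_matrix w \<longleftrightarrow> (\<forall>i j k. mps_partial i (w j k) + mps_partial j (w k i) + mps_partial k (w i j) = 0)"

lemma closed_matrix_iff:
  assumes "\<omega> \<in> Omega 2"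
  shows "ext_d \<omega> = 0 \<longleftrightarrow> closed_matrix (form_matrix \<omega>)"
proof
  let ?s = "\<lambda>i j k. mps_partial i (form_matrix \<omega> j k) + mps_partial j (form_matrix \<omega> k i) + mps_partial k (form_matrix \<omega> i j)"
  assume d: "ext_d \<omega> = 0"
  \<comment> \<open>The cyclic sum is alternating in its three indices, so its values on increasing
    triples determine it.\<close>
  have sorted: "?s i j k = 0" if "i < j" "j < k" for i j k
    using ext_d_triple[OF that, of \<omega>] d by simp
  have cyc: "?s i j k = ?s j k i" for i j k by (simp add: ac_simps)
  have swap: "?s i j k = - ?s j i k" for i j k
    by (simp add: form_matrix_antisym[of \<omega> k] form_matrix_antisym[of \<omega> j i] mps_partial_uminus)
  have "?s i j k = 0" for i j k
  proof -
    consider "i = j \<or> j = k \<or> i = k" | "i < j" "j < k" | "i < k" "k < j" | "j < i" "i < k"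
      | "j < k" "k < i" | "k < i" "i < j" | "k < j" "j < i" by fastforce
    then show ?thesis
    proof cases
      case 1 then show ?thesis
        by (auto simp: form_matrix_antisym[of \<omega> k j] form_matrix_antisym[of \<omega> k i] form_matrix_antisym[of \<omega> j i] mps_partial_uminus)
    qed (use sorted cyc swap in \<open>metis minus_zero\<close>)+
  qed
  then show "closed_matrix (form_matrix \<omega>)" unfolding closed_matrix_def by blast
next
  assume *: "closed_matrix (form_matrix \<omega>)"
  have "ext_d \<omega> K = 0" for K
  proof (cases "card K = 3")
    case True
    then have "finite K" by (intro card_ge_0_finite) simp
    define i where "i = Min K"
    define K' where "K' = K - {i}"
    define j where "j = Min K'"
    have i: "i \<in> K" "\<forall>x\<in>K. i \<le> x" unfolding i_def using True \<open>finite K\<close> by (auto intro!: Min_in)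
    have "card K' = 2" using i(1) True by (simp add: K'_def)
    then have "K' \<noteq> {}" "finite K'" using card_ge_0_finite by force+
    then have j: "j \<in> K'" "\<forall>x\<in>K'. j \<le> x" unfolding j_def by auto
    have "card (K' - {j}) = 1" using j(1) \<open>card K' = 2\<close> by simp
    then obtain k where k: "K' - {j} = {k}" by (auto simp: card_1_singleton_iff)
    have "K = {i, j, k}" "i < j" "j < k" using i j k unfolding K'_def by (auto simp: order.order_iff_strict)
    then show ?thesis using ext_d_triple[of i j k \<omega>] * by (simp add: closed_matrix_def)
  next
    case False
    have "ext_d \<omega> \<in> Omega (Suc 2)" by (rule ext_d_Omega[OF assms])
    then show ?thesis using False by (simp add: Omega_def)
  qed
  then show "ext_d \<omega> = 0" by (simp add: fun_eq_iff)
qed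

lemma ext_d_linear:
  "ext_d 0 = 0" "ext_d (\<alpha> + \<beta>) = ext_d \<alpha> + ext_d \<beta>" "ext_d (\<alpha> - \<beta>) = ext_d \<alpha> - ext_d \<beta>"
  "ext_d (- \<alpha>) = - ext_d \<alpha>"
  by (auto simp: ext_d_def mps_partial_add mps_partial_diff mps_partial_uminus algebra_simps sum.distrib
      sum_subtractf sum_negf)

lemma contraction_linear:
  "contraction (X + Y) \<omega> = contraction X \<omega> + contraction Y \<omega>"
  "contraction (X - Y) \<omega> = contraction X \<omega> - contraction Y \<omega>"
  "contraction (- X) \<omega> = - contraction X \<omega>"
  "contraction X (\<omega> + \<eta>) = contraction X \<omega> + contraction X \<eta>"
  "contraction X (\<omega> - \<eta>) = contraction X \<omega> - contraction X \<eta>"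
  "contraction X (- \<omega>) = - contraction X \<omega>"
  "contraction 0 \<omega> = 0" "contraction X 0 = 0"
  by (auto simp: contraction_def algebra_simps sum.distrib sum_subtractf sum_negf)

lemma ext_d_ext_d_1:
  assumes "\<alpha> \<in> Omega 1"
  shows "ext_d (ext_d \<alpha>) = 0"
proof -
  have "ext_d \<alpha> \<in> Omega 2" using ext_d_Omega[OF assms] by (simp add: numeral_2_eq_2)
  then show ?thesis
    by (subst closed_matrix_iff) (auto simp: closed_matrix_def form_matrix_ext_d mps_partial_diff mps_partial_commute)
qed

definition lie_matrix :: "'n::finite vfield \<Rightarrow> ('n \<Rightarrow> 'n \<Rightarrow> 'n mps) \<Rightarrow> 'n \<Rightarrow> 'n \<Rightarrow> 'n mps" where
  "lie_matrix X w i j = vf_apply X (w i j) +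
     (\<Sum>k\<in>UNIV. mps_partial i (X k) * w k j + mps_partial j (X k) * w i k)"

lemma lie_deriv_closed: "ext_d \<omega> = 0 \<Longrightarrow> lie_deriv X \<omega> = ext_d (contraction X \<omega>)"
  by (simp add: lie_deriv_def contraction_linear)

text \<open>Besides the Jacobian terms, Cartan's formula produces the differences
  \<open>mps_partial i (w k j) - mps_partial j (w k i)\<close>; closedness turns each into
  \<open>mps_partial k (w i j)\<close>, so that together they differentiate the coefficient along
  \<open>X\<close>.\<close>

lemma form_matrix_lie_deriv:
  assumes "\<omega> \<in> Omega 2" "ext_d \<omega> = 0"
  shows "form_matrix (lie_deriv X \<omega>) i j = lie_matrix X (form_matrix \<omega>) i j"
proof -
  let ?w = "form_matrix \<omega>"
  have closed: "mps_partial i (?w k j) - mps_partial j (?w k i) = mps_partial k (?w i j)" for k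
  proof -
    have "mps_partial i (?w j k) + mps_partial j (?w k i) + mps_partial k (?w i j) = 0"
      using assms closed_matrix_iff unfolding closed_matrix_def by blast
    then show ?thesis
      by (simp add: form_matrix_antisym[of \<omega> j k] mps_partial_uminus algebra_simps eq_neg_iff_add_eq_0)
  qed
  have "form_matrix (lie_deriv X \<omega>) i j = (\<Sum>k\<in>UNIV. mps_partial i (X k) * ?w k j + X k * mps_partial i (?w k j)) -
      (\<Sum>k\<in>UNIV. mps_partial j (X k) * ?w k i + X k * mps_partial j (?w k i))"
    by (simp add: lie_deriv_closed assms form_matrix_ext_d contraction_singleton mps_partial_sum mps_partial_mult)
  also have "\<dots> = (\<Sum>k\<in>UNIV. X k * (mps_partial i (?w k j) - mps_partial j (?w k i)) +
      (mps_partial i (X k) * ?w k j + mps_partial j (X k) * ?w i k))"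
    by (simp add: sum_subtractf[symmetric] form_matrix_antisym[of \<omega> i] algebra_simps)
  finally show ?thesis by (simp add: closed sum.distrib lie_matrix_def vf_apply_def)
qed

lemma lie_matrix_bracket:
  "lie_matrix (vf_bracket X Y) w i j = lie_matrix X (lie_matrix Y w) i j - lie_matrix Y (lie_matrix X w) i j"
proof -
  let ?d = mps_partial
  \<comment> \<open>\<open>A\<close> collects the terms where one field acts on an index and the
    other differentiates the coefficient, \<open>E\<close> those where both act, on different
    indices; each occurs symmetrized and cancels in the commutator. \<open>B\<close> (second
    derivatives of a field) and \<open>C\<close> (both fields on the same index) survive and make up
    the Jacobian of the bracket.\<close>
  define A where "A X Y i j = (\<Sum>k\<in>UNIV. ?d i (X k) * vf_apply Y (w k j) + ?d j (X k) * vf_apply Y (w i k))" for X Y i j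
  define B where "B X Y i j = (\<Sum>k\<in>UNIV. vf_apply X (?d i (Y k)) * w k j + vf_apply X (?d j (Y k)) * w i k)" for X Y i j
  define C where "C X Y i j = (\<Sum>k\<in>UNIV. \<Sum>l\<in>UNIV. ?d i (X k) * ?d k (Y l) * w l j + ?d j (X k) * ?d k (Y l) * w i l)" for X Y i j
  define E where "E X Y i j = (\<Sum>k\<in>UNIV. \<Sum>l\<in>UNIV. ?d i (X k) * ?d j (Y l) * w k l)" for X Y i j
  have LL: "lie_matrix X (lie_matrix Y w) i j = vf_apply X (vf_apply Y (w i j)) + A Y X i j + A X Y i j + B X Y i j + C X Y i j + (E X Y i j + E Y X i j)" for X Y
  proof -
    have "E Y X i j = (\<Sum>k\<in>UNIV. \<Sum>l\<in>UNIV. ?d j (X k) * ?d i (Y l) * w l k)"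
      unfolding E_def by (subst sum.swap) (simp add: ac_simps)
    then show ?thesis
      by (simp add: lie_matrix_def A_def B_def C_def E_def vf_apply_linear vf_apply_mult sum.distrib
        sum_distrib_left distrib_left ac_simps)
  qed
  have br: "?d i (vf_bracket X Y k) = (\<Sum>l\<in>UNIV. ?d i (X l) * ?d l (Y k)) + vf_apply X (?d i (Y k))
     - ((\<Sum>l\<in>UNIV. ?d i (Y l) * ?d l (X k)) + vf_apply Y (?d i (X k)))" for i k
    by (simp add: vf_bracket_eq mps_partial_diff mps_partial_vf_apply)
  have C': "C X Y i j = (\<Sum>k\<in>UNIV. (\<Sum>l\<in>UNIV. ?d i (X l) * ?d l (Y k)) * w k j + (\<Sum>l\<in>UNIV. ?d j (X l) * ?d l (Y k)) * w i k)" for X Y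
    unfolding C_def by (subst sum.swap) (simp add: sum_distrib_right sum.distrib)
  have "lie_matrix (vf_bracket X Y) w i j = vf_apply (vf_bracket X Y) (w i j) + (B X Y i j + C X Y i j - B Y X i j - C Y X i j)"
    unfolding lie_matrix_def br C' B_def
    by (simp add: algebra_simps sum.distrib sum_subtractf)
  then show ?thesis unfolding LL vf_apply_bracket by simp
qed

section \<open>The bracket of \<open>E(5,10)\<close>\<close>

lemma UNIV_5: "(UNIV :: 5 set) = {0, 1, 2, 3, 4}"
proof -
  have "card {0, 1, 2, 3, 4 :: 5} = CARD(5)" by simp
  then show ?thesis by (metis card_subset_eq finite subset_UNIV)
qed

lemma less_5 [simp]:
  "(0::5) < 1" "(0::5) < 2" "(0::5) < 3" "(0::5) < 4" "(1::5) < 2" "(1::5) < 3" "(1::5) < 4"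
  "(2::5) < 3" "(2::5) < 4" "(3::5) < 4"
  by (simp_all add: less_bit1_def bit1.Rep_numeral bit1.Rep_0 bit1.Rep_1)

lemma not_less_5 [simp]:
  "\<not> (1::5) < 0" "\<not> (2::5) < 0" "\<not> (3::5) < 0" "\<not> (4::5) < 0" "\<not> (2::5) < 1" "\<not> (3::5) < 1" "\<not> (4::5) < 1"
  "\<not> (3::5) < 2" "\<not> (4::5) < 2" "\<not> (4::5) < 3"
  by (meson less_5 order.asym)+

lemma cases_5: "(i::5) = 0 \<or> i = 1 \<or> i = 2 \<or> i = 3 \<or> i = 4"
  using UNIV_5 by (metis UNIV_I insertE singletonD)

lemma sum_5: "(\<Sum>i\<in>(UNIV::5 set). f i) = f 0 + f 1 + f 2 + f 3 + f 4"
  unfolding UNIV_5 by (simp add: add.assoc)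

lemma Compl_5: "- {0::5} = {1, 2, 3, 4}" "- {1::5} = {0, 2, 3, 4}" "- {2::5} = {0, 1, 3, 4}"
  "- {3::5} = {0, 1, 2, 4}" "- {4::5} = {0, 1, 2, 3}"
  unfolding Compl_eq_Diff_UNIV UNIV_5 by auto

lemma shuffle_sign_insert:
  assumes "i \<notin> I" "finite I" "finite J"
  shows "shuffle_sign (insert i I) J = shuffle_sign {i} J * shuffle_sign I J"
proof -
  have eq: "{(i', j). i' \<in> I \<and> j \<in> J \<and> j < i'} = Sigma I (\<lambda>i'. {j \<in> J. j < i'})" for I by auto
  have "card (Sigma I (\<lambda>i'. {j \<in> J. j < i'})) = (\<Sum>i\<in>I. card {j \<in> J. j < i})" if "finite I" for I
    using that assms by (intro card_SigmaI) auto
  then show ?thesis unfolding shuffle_sign_def eq using assms by (simp add: power_add)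
qed

text \<open>The coefficient of dx_a dx_b dx_c dx_d in a product of two-forms, one term per choice of
  the pair of indices for the first factor. The coefficient ring is arbitrary since the formula
  serves both power series and their values at the origin.\<close>

definition wedge_coeff :: "('n \<Rightarrow> 'n \<Rightarrow> 'a::comm_ring_1) \<Rightarrow> ('n \<Rightarrow> 'n \<Rightarrow> 'a) \<Rightarrow> 'n \<Rightarrow> 'n \<Rightarrow> 'n \<Rightarrow> 'n \<Rightarrow> 'a" where
  "wedge_coeff w h a b c d = w a b * h c d - w a c * h b d + w a d * h b c
     + w b c * h a d - w b d * h a c + w c d * h a b"

lemma wedge_quadruple:
  assumes "\<omega> \<in> Omega 2" "a < b" "b < c" "c < d"
  shows "wedge \<omega> \<eta> {a, b, c, d} = wedge_coeff (form_matrix \<omega>) (form_matrix \<eta>) a b c d"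
proof -
  let ?K = "{a, b, c, d}"
  let ?Q = "{{a, b}, {a, c}, {a, d}, {b, c}, {b, d}, {c, d}}"
  have ne: "a \<noteq> b" "a \<noteq> c" "a \<noteq> d" "b \<noteq> c" "b \<noteq> d" "c \<noteq> d" "a < c" "a < d" "b < d"
    "\<not> b < a" "\<not> c < a" "\<not> d < a" "\<not> c < b" "\<not> d < b" "\<not> d < c"
    using assms by auto
  have Q: "{I \<in> Pow ?K. card I = 2} = ?Q"
  proof (intro equalityI subsetI)
    fix I assume "I \<in> {I \<in> Pow ?K. card I = 2}"
    then obtain x y where I: "I = {x, y}" "x \<noteq> y" "I \<subseteq> ?K" by (auto simp: card_2_iff)
    then obtain x y where I: "I = {x, y}" "x < y" "I \<subseteq> ?K" by (metis insert_commute linorder_less_linear)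
    then have "x \<in> ?K" "y \<in> ?K" by auto
    then show "I \<in> ?Q" using I(1,2) ne by (elim insertE emptyE) simp_all
  qed (use ne in auto)
  have d: "?K - {a, b} = {c, d}" "?K - {a, c} = {b, d}" "?K - {a, d} = {b, c}" 
    "?K - {b, c} = {a, d}" "?K - {b, d} = {a, c}" "?K - {c, d} = {a, b}" using ne by auto
  have "wedge \<omega> \<eta> ?K = (\<Sum>I\<in>{I \<in> Pow ?K. card I = 2}. shuffle_sign I (?K - I) * \<omega> I * \<eta> (?K - I))"
    unfolding wedge_def by (rule sum.mono_neutral_right) (use assms(1) in \<open>auto simp: Omega_def\<close>)
  also have "\<dots> = wedge_coeff (form_matrix \<omega>) (form_matrix \<eta>) a b c d"
    unfolding Q using ne assms
    by (simp add: d doubleton_eq_iff del: Diff_insert insert_Diff_if)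
       (simp add: shuffle_sign_insert[where I = "{_}"] shuffle_sign_singleton_2 form_matrix_def wedge_coeff_def insert_commute)
  finally show ?thesis .
qed

text \<open>The vector field of a wedge product, read as a four-form: component \<open>i\<close> is
  the coefficient omitting \<open>i\<close>, with the sign of moving dx_i to the front. In the index
  order 0, 1, 2, 3, 4 this sign alternates, starting with plus.\<close>

definition star :: "(5 \<Rightarrow> 5 \<Rightarrow> 'a::comm_ring_1) \<Rightarrow> (5 \<Rightarrow> 5 \<Rightarrow> 'a) \<Rightarrow> 5 \<Rightarrow> 'a" where
  "star w h i = (if i = 0 then wedge_coeff w h 1 2 3 4 else if i = 1 then - wedge_coeff w h 0 2 3 4
    else if i = 2 then wedge_coeff w h 0 1 3 4 else if i = 3 then - wedge_coeff w h 0 1 2 4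
    else wedge_coeff w h 0 1 2 3)"

lemma vf_of_form_wedge:
  assumes "\<omega> \<in> Omega 2"
  shows "vf_of_form (wedge \<omega> \<eta>) = star (form_matrix \<omega>) (form_matrix \<eta>)"
proof
  fix i :: 5
  have sets: "{j \<in> {1, 2, 3, 4}. j < (0::5)} = {}" "{j \<in> {0, 2, 3, 4}. j < (1::5)} = {0}"
    "{j \<in> {0, 1, 3, 4}. j < (2::5)} = {0, 1}" "{j \<in> {0, 1, 2, 4}. j < (3::5)} = {0, 1, 2}" 
    "{j \<in> {0, 1, 2, 3}. j < (4::5)} = {0, 1, 2, 3}"
    by auto
  have "shuffle_sign {0} {1, 2, 3, 4::5} = (1 :: 5 mps)" "shuffle_sign {1} {0, 2, 3, 4::5} = (- 1 :: 5 mps)"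
    "shuffle_sign {2} {0, 1, 3, 4::5} = (1 :: 5 mps)" "shuffle_sign {3} {0, 1, 2, 4::5} = (- 1 :: 5 mps)"
    "shuffle_sign {4} {0, 1, 2, 3::5} = (1 :: 5 mps)"
    unfolding shuffle_sign_singleton sets by simp_all
  then show "vf_of_form (wedge \<omega> \<eta>) i = star (form_matrix \<omega>) (form_matrix \<eta>) i"
    using cases_5[of i] assms by (auto simp: vf_of_form_def Compl_5 star_def wedge_quadruple)
qed

definition antisym_matrix :: "('n \<Rightarrow> 'n \<Rightarrow> 'a::comm_ring_1) \<Rightarrow> bool" where
  "antisym_matrix w \<longleftrightarrow> (\<forall>i. w i i = 0) \<and> (\<forall>i j. w j i = - w i j)"

lemma antisym_form_matrix: "antisym_matrix (form_matrix \<omega>)"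
  using form_matrix_antisym unfolding antisym_matrix_def by auto

lemma star_commute: "star w h = star h w"
  by (rule ext) (simp add: star_def wedge_coeff_def)

lemma star_linear:
  "star (\<lambda>i j. w i j + w' i j) h i = star w h i + star w' h i"
  "star (\<lambda>i j. w i j - w' i j) h i = star w h i - star w' h i"
  by (simp_all add: star_def wedge_coeff_def algebra_simps)

lemma antisym_rules:
  assumes "antisym_matrix (w :: 5 \<Rightarrow> 5 \<Rightarrow> 'a::comm_ring_1)"
  shows "w i i = 0" "w 1 0 = - w 0 1" "w 2 0 = - w 0 2" "w 3 0 = - w 0 3" "w 4 0 = - w 0 4"
    "w 2 1 = - w 1 2" "w 3 1 = - w 1 3" "w 4 1 = - w 1 4" "w 3 2 = - w 2 3" "w 4 2 = - w 2 4" "w 4 3 = - w 3 4"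
  using assms unfolding antisym_matrix_def by blast+

text \<open>The Jacobi identity for three odd elements is the differential of this one.\<close>

lemma star_contraction_cyclic:
  assumes "antisym_matrix (w :: 5 \<Rightarrow> 5 \<Rightarrow> 'a::comm_ring_1)" "antisym_matrix h" "antisym_matrix z"
  shows "(\<Sum>i\<in>UNIV. star w h i * z i j) + (\<Sum>i\<in>UNIV. star h z i * w i j) + (\<Sum>i\<in>UNIV. star z w i * h i j) = 0"
  using cases_5[of j] 
  by (auto simp: sum_5 star_def wedge_coeff_def antisym_rules[OF assms(1)] antisym_rules[OF assms(2)] antisym_rules[OF assms(3)])
     (simp_all add: algebra_simps)

text \<open>Each of the six terms of \<open>wedge_coeff\<close> contains every index exactly once,
  so a matrix acting as a derivation on \<open>w\<close> and \<open>h\<close> acts on the four free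
  indices in turn. The identity holds for each \<open>k\<close> separately.\<close>

lemma wedge_coeff_derivation:
  "wedge_coeff (\<lambda>i j. \<Sum>k\<in>UNIV. A i k * w k j + A j k * w i k) h a b c d
       + wedge_coeff w (\<lambda>i j. \<Sum>k\<in>UNIV. A i k * h k j + A j k * h i k) a b c d =
   (\<Sum>k\<in>UNIV. A a k * wedge_coeff w h k b c d + A b k * wedge_coeff w h a k c d
      + A c k * wedge_coeff w h a b k d + A d k * wedge_coeff w h a b c k)"
  unfolding wedge_coeff_def sum_distrib_right sum_distrib_left sum.distrib[symmetric] sum_subtractf[symmetric]
  by (rule sum.cong) (simp_all add: algebra_simps)

lemma wedge_coeff_swap:
  assumes "antisym_matrix w" "antisym_matrix h"
  shows "wedge_coeff w h b a c d = - wedge_coeff w h a b c d" "wedge_coeff w h a c b d = - wedge_coeff w h a b c d"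
    "wedge_coeff w h a b d c = - wedge_coeff w h a b c d" 
    "wedge_coeff w h a a c d = 0" "wedge_coeff w h a b b d = 0" "wedge_coeff w h a b c c = 0"
    "wedge_coeff w h a b a d = 0" "wedge_coeff w h a b c b = 0" "wedge_coeff w h a b c a = 0"
proof -
  have 0: "w i i = 0" "h i i = 0" for i using assms by (simp_all add: antisym_matrix_def)
  have *: "w b a = - w a b" "h b a = - h a b" "w c b = - w b c" "h c b = - h b c" "w d c = - w c d" "h d c = - h c d"
    using assms unfolding antisym_matrix_def by blast+
  show "wedge_coeff w h b a c d = - wedge_coeff w h a b c d" "wedge_coeff w h a c b d = - wedge_coeff w h a b c d"
    "wedge_coeff w h a b d c = - wedge_coeff w h a b c d"
    unfolding wedge_coeff_def * by (simp_all add: algebra_simps)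
  show "wedge_coeff w h a a c d = 0" "wedge_coeff w h a b b d = 0" "wedge_coeff w h a b c c = 0"
    unfolding wedge_coeff_def 0 by (simp_all add: algebra_simps)
  show "wedge_coeff w h a b a d = 0" "wedge_coeff w h a b c b = 0" 
    unfolding wedge_coeff_def 0 * by (simp_all add: algebra_simps)
  have **: "w b a = - w a b" "h b a = - h a b" "w c a = - w a c" "h c a = - h a c" 
    using assms unfolding antisym_matrix_def by blast+
  show "wedge_coeff w h a b c a = 0"
    unfolding wedge_coeff_def 0 ** by (simp_all add: algebra_simps)
qed

text \<open>Four-forms in five variables are vectors twisted by the volume form. A matrix acting as
  a derivation therefore acts on \<open>star w h\<close> through the dual representation plus a
  multiple of its trace, which vanishes. The trace condition enters by eliminating
  \<open>A 0 0\<close>.\<close>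

lemma star_gl_invariant:
  fixes A :: "5 \<Rightarrow> 5 \<Rightarrow> 'a::comm_ring_1"
  assumes "antisym_matrix w" "antisym_matrix h" "(\<Sum>i\<in>UNIV. A i i) = 0"
  shows "star (\<lambda>i j. \<Sum>k\<in>UNIV. A i k * w k j + A j k * w i k) h i
       + star w (\<lambda>i j. \<Sum>k\<in>UNIV. A i k * h k j + A j k * h i k) i = - (\<Sum>k\<in>UNIV. star w h k * A k i)"
proof -
  let ?A = "\<lambda>w i j. \<Sum>k\<in>UNIV. A i k * w k j + A j k * w i k"
  let ?P = "wedge_coeff w h"
  have tr: "A 0 0 = - (A 1 1 + A 2 2 + A 3 3 + A 4 4)"
    using assms(3) unfolding sum_5 by (simp only: add.assoc eq_neg_iff_add_eq_0)
  note swap = wedge_coeff_swap[OF assms(1,2)]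
  have rot: "?P x y z t = ?P z x y t" "?P t x y z = ?P t z x y" "?P x y z t = - ?P t x y z" for x y z t
    by (simp only: swap(2)[of x y z t] swap(1)[of x z y t] minus_minus)
       (simp only: swap(3)[of t x y z] swap(2)[of t x z y] minus_minus,
        simp only: swap(3)[of x y z t] swap(2)[of x y t z] swap(1)[of x t y z] minus_minus)
  have P: "?P 1 0 3 4 = - ?P 0 1 3 4" "?P 1 2 0 4 = ?P 0 1 2 4" "?P 1 2 3 0 = - ?P 0 1 2 3"
    "?P 0 2 1 4 = - ?P 0 1 2 4" "?P 0 2 3 1 = ?P 0 1 2 3" "?P 2 1 3 4 = - ?P 1 2 3 4"
    "?P 0 1 3 2 = - ?P 0 1 2 3" "?P 3 1 2 4 = ?P 1 2 3 4" "?P 0 3 2 4 = - ?P 0 2 3 4"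
    "?P 4 1 2 3 = - ?P 1 2 3 4" "?P 0 4 2 3 = ?P 0 2 3 4" "?P 0 1 4 3 = - ?P 0 1 3 4"
    using swap(1)[of 0 1 3 4] rot(1)[of 1 2 0 4] rot(3)[of 1 2 3 0] swap(2)[of 0 1 2 4] rot(2)[of 0 2 3 1]
      swap(1)[of 1 2 3 4] swap(3)[of 0 1 2 3] rot(1)[of 1 2 3 4] swap(2)[of 0 2 3 4] rot(3)[of 1 2 3 4]
      rot(2)[of 0 2 3 4] swap(3)[of 0 1 3 4]
    by simp_all
  have D: "wedge_coeff (?A w) h a b c d + wedge_coeff w (?A h) a b c d =
    (\<Sum>k\<in>UNIV. A a k * ?P k b c d + A b k * ?P a k c d + A c k * ?P a b k d + A d k * ?P a b c k)" for a b c d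
    by (rule wedge_coeff_derivation)
  consider "i = 0" | "i = 1" | "i = 2" | "i = 3" | "i = 4" using cases_5 by blast
  then show ?thesis
  proof cases
    case 1
    have "star (?A w) h i + star w (?A h) i = wedge_coeff (?A w) h 1 2 3 4 + wedge_coeff w (?A h) 1 2 3 4"
      by (simp add: 1 star_def)
    then show ?thesis unfolding D unfolding sum_5 swap(4-9) P 1 tr by (simp add: star_def algebra_simps)
  next
    case 2
    have "star (?A w) h i + star w (?A h) i = - (wedge_coeff (?A w) h 0 2 3 4 + wedge_coeff w (?A h) 0 2 3 4)"
      by (simp add: 2 star_def)
    then show ?thesis unfolding D unfolding sum_5 swap(4-9) P 2 tr by (simp add: star_def algebra_simps)
  next
    case 3
    have "star (?A w) h i + star w (?A h) i = wedge_coeff (?A w) h 0 1 3 4 + wedge_coeff w (?A h) 0 1 3 4"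
      by (simp add: 3 star_def)
    then show ?thesis unfolding D unfolding sum_5 swap(4-9) P 3 tr by (simp add: star_def algebra_simps)
  next
    case 4
    have "star (?A w) h i + star w (?A h) i = - (wedge_coeff (?A w) h 0 1 2 4 + wedge_coeff w (?A h) 0 1 2 4)"
      by (simp add: 4 star_def)
    then show ?thesis unfolding D unfolding sum_5 swap(4-9) P 4 tr by (simp add: star_def algebra_simps)
  next
    case 5
    have "star (?A w) h i + star w (?A h) i = wedge_coeff (?A w) h 0 1 2 3 + wedge_coeff w (?A h) 0 1 2 3"
      by (simp add: 5 star_def)
    then show ?thesis unfolding D unfolding sum_5 swap(4-9) P 5 tr by (simp add: star_def algebra_simps)
  qed
qed

text \<open>With \<open>D i j k\<close> as the partial derivative along \<open>i\<close> of the
  entry \<open>(j, k)\<close> of a closed form, the hypothesis is closedness, and the sum is the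
  half of the Leibniz formula for the differential of a wedge product in which this factor is
  differentiated.\<close>

lemma star_closed_sum:
  fixes D :: "5 \<Rightarrow> 5 \<Rightarrow> 5 \<Rightarrow> 'a::comm_ring_1"
  assumes "\<And>i j k. D i j k = D j i k - D k i j"
  shows "(\<Sum>i\<in>UNIV. star (D i) h i) = 0"
proof -
  have *: "D 0 1 2 = D 1 0 2 - D 2 0 1" "D 0 1 3 = D 1 0 3 - D 3 0 1" "D 0 1 4 = D 1 0 4 - D 4 0 1" 
    "D 0 2 3 = D 2 0 3 - D 3 0 2" "D 0 2 4 = D 2 0 4 - D 4 0 2" "D 0 3 4 = D 3 0 4 - D 4 0 3"
    "D 1 2 3 = D 2 1 3 - D 3 1 2" "D 1 2 4 = D 2 1 4 - D 4 1 2" "D 1 3 4 = D 3 1 4 - D 4 1 3"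
    "D 2 3 4 = D 3 2 4 - D 4 2 3"
    by (rule assms)+
  show ?thesis unfolding sum_5 by (simp add: star_def wedge_coeff_def) (simp add: * algebra_simps)
qed

lemma divergence_star:
  assumes w: "antisym_matrix w" "closed_matrix w" and h: "antisym_matrix h" "closed_matrix h"
  shows "divergence (star w h) = 0"
proof -
  have *: "mps_partial i (w j k) = mps_partial j (w i k) - mps_partial k (w i j)"
    if "antisym_matrix w" "closed_matrix w" for w :: "5 \<Rightarrow> 5 \<Rightarrow> 5 mps" and i j k
  proof -
    have 1: "mps_partial i (w j k) + mps_partial j (w k i) + mps_partial k (w i j) = 0" "w k i = - w i k"
      using that unfolding closed_matrix_def antisym_matrix_def by blast+
    have 2: "mps_partial i (w j k) - mps_partial j (w i k) + mps_partial k (w i j) = 0"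
      using 1 by (simp add: mps_partial_uminus)
    have "a = (a - b + c) + (b - c)" for a b c :: "5 mps" by simp
    from this[of "mps_partial i (w j k)" "mps_partial j (w i k)" "mps_partial k (w i j)"] show ?thesis
      unfolding 2 by simp
  qed
  have "divergence (star w h) = (\<Sum>i\<in>UNIV. star (\<lambda>j k. mps_partial i (w j k)) h i) + (\<Sum>i\<in>UNIV. star (\<lambda>j k. mps_partial i (h j k)) w i)"
    unfolding divergence_def star_commute[of _ w] sum.distrib[symmetric]
    by (rule sum.cong) (simp_all add: star_def wedge_coeff_def mps_partial_add mps_partial_diff mps_partial_uminus mps_partial_mult)
  then show ?thesis
    by (simp add: star_closed_sum[OF *[OF w]] star_closed_sum[OF *[OF h]])
qed

text \<open>A divergence-free field preserves the volume form, so its Lie derivative commutes with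
  the identification of four-forms with vector fields; the rest is the Leibniz rule for the wedge
  product. This is the Jacobi identity for one even and two odd elements.\<close>

lemma vf_bracket_star:
  assumes "divergence X = 0" "antisym_matrix w" "antisym_matrix h"
  shows "vf_bracket X (star w h) i = star (lie_matrix X w) h i + star w (lie_matrix X h) i"
proof -
  have A: "(\<Sum>i\<in>UNIV. mps_partial i (X i)) = 0" using assms by (simp add: divergence_def)
  have 1: "vf_apply X (star w h i) = star (\<lambda>i j. vf_apply X (w i j)) h i + star w (\<lambda>i j. vf_apply X (h i j)) i"
    by (simp add: star_def wedge_coeff_def vf_apply_linear vf_apply_mult)
  have 2: "star (lie_matrix X w) h i = star (\<lambda>i j. vf_apply X (w i j)) h i +
     star (\<lambda>i j. \<Sum>k\<in>UNIV. mps_partial i (X k) * w k j + mps_partial j (X k) * w i k) h i" for w h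
    unfolding lie_matrix_def by (rule star_linear)
  show ?thesis
    using star_gl_invariant[OF assms(2,3), of "\<lambda>i k. mps_partial i (X k)" i] A
    unfolding vf_bracket_eq 1 2 star_commute[of w "lie_matrix X h"] vf_apply_def[of "star w h"]
    by (simp add: star_commute[of h] star_commute[of _ w] algebra_simps)
qed

text \<open>For positive \<open>c\<close> this is the integral of t^(c-1) f(tx) over t from 0 to 1,
  the radial averaging in the Poincare lemma. In its uses below, \<open>c\<close> starts as the
  degree of the form (2, or 4 for a divergence-free field) and grows by one with each partial
  derivative.\<close>

definition mps_homotopy :: "nat \<Rightarrow> 'n::finite mps \<Rightarrow> 'n mps" where
  "mps_homotopy c f = Abs_mps (\<lambda>m. mps_coeff f m / of_nat (sum m UNIV + c))"

lemma mps_coeff_homotopy: "mps_coeff (mps_homotopy c f) m = mps_coeff f m / of_nat (sum m UNIV + c)"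
  by (simp add: mps_homotopy_def)

lemma sum_unit_exp [simp]: "sum (unit_exp i) (UNIV :: 'n::finite set) = 1"
  by (simp add: unit_exp_def)

lemma mps_partial_homotopy: "mps_partial i (mps_homotopy c f) = mps_homotopy (Suc c) (mps_partial i f)"
  by (rule mps_eqI) (simp add: mps_coeff_partial mps_coeff_homotopy sum.distrib add_ac)

lemma mps_homotopy_linear:
  "mps_homotopy c 0 = 0" "mps_homotopy c (f + g) = mps_homotopy c f + mps_homotopy c g"
  "mps_homotopy c (f - g) = mps_homotopy c f - mps_homotopy c g" "mps_homotopy c (- f) = - mps_homotopy c f"
  "mps_homotopy c (sum h A) = (\<Sum>a\<in>A. mps_homotopy c (h a))"
  by (auto intro!: mps_eqI simp: mps_coeff_homotopy add_divide_distrib diff_divide_distrib sum_divide_distrib)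

lemma mps_coeff_euler:
  "mps_coeff (\<Sum>i\<in>UNIV. mps_var i * mps_partial i f) m = of_nat (sum m UNIV) * mps_coeff f m"
proof -
  have "mps_coeff (mps_var i * mps_partial i f) m = of_nat (m i) * mps_coeff f m" for i
  proof (cases "m i = 0")
    case False
    then have "m - unit_exp i + unit_exp i = m" by (auto simp: fun_eq_iff unit_exp_def)
    then show ?thesis using False by (simp add: mps_coeff_var_mult mps_coeff_partial)
  qed (simp add: mps_coeff_var_mult)
  then show ?thesis by (simp add: sum_distrib_right)
qed

text \<open>The Euler field multiplies the component of degree \<open>d\<close> by \<open>d\<close>,
  so the left side multiplies by \<open>d + c\<close> what the averaging divided by
  \<open>d + c\<close>; \<open>c > 0\<close> keeps the divisor nonzero in degree 0.\<close>

lemma mps_homotopy_euler: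
  assumes "c > 0"
  shows "of_nat c * mps_homotopy c f + (\<Sum>i\<in>UNIV. mps_var i * mps_partial i (mps_homotopy c f)) = f"
proof (rule mps_eqI)
  fix m :: "'a \<Rightarrow> nat"
  have c: "of_nat k = (mps_const (of_nat k) :: 'a mps)" for k
    by (induction k) (simp_all add: mps_const_simps)
  have "(of_nat (sum m UNIV + c) :: complex) \<noteq> 0" using assms by (metis add_is_0 neq0_conv of_nat_eq_0_iff)
  then show "mps_coeff (of_nat c * mps_homotopy c f + (\<Sum>i\<in>UNIV. mps_var i * mps_partial i (mps_homotopy c f))) m = mps_coeff f m"
    unfolding c mps_coeff_add mps_coeff_euler mps_coeff_const_mult mps_coeff_homotopy
  proof -
    let ?N = "of_nat (sum m UNIV + c) :: complex"
    have "a * (F / N) + b * (F / N) = (b + a) * (F / N)" for a b F N :: complex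
      by (simp add: algebra_simps add_divide_distrib)
    from this[of "of_nat c" _ ?N "of_nat (sum m UNIV)"]
    have "of_nat c * (F / ?N) + of_nat (sum m UNIV) * (F / ?N) = ?N * (F / ?N)" for F
      by (simp only: of_nat_add)
    then show "of_nat c * (mps_coeff f m / ?N) + of_nat (sum m UNIV) * (mps_coeff f m / ?N) = mps_coeff f m"
      using \<open>?N \<noteq> 0\<close> by (metis nonzero_mult_div_cancel_left times_divide_eq_right)
  qed
qed

definition one_form :: "('n::{finite,linorder} \<Rightarrow> 'n mps) \<Rightarrow> 'n dform" where
  "one_form a = (\<lambda>I. if card I = 1 then a (Min I) else 0)"

lemma one_form: "one_form a \<in> Omega 1" "one_form a {j} = a j"
  by (auto simp: one_form_def Omega_def)

text \<open>The cone operator: contraction with the Euler field, averaged along rays.\<close>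

definition poincare_primitive :: "'n::{finite,linorder} dform \<Rightarrow> 'n \<Rightarrow> 'n mps" where
  "poincare_primitive \<omega> j = (\<Sum>i\<in>UNIV. mps_var i * mps_homotopy 2 (form_matrix \<omega> i j))"

lemma ext_d_poincare_primitive:
  assumes "\<omega> \<in> Omega 2" "ext_d \<omega> = 0"
  shows "ext_d (one_form (poincare_primitive \<omega>)) = \<omega>"
proof (rule Omega_2_eqI)
  let ?w = "form_matrix \<omega>" let ?I = "mps_homotopy"
  show "ext_d (one_form (poincare_primitive \<omega>)) \<in> Omega 2"
    using ext_d_Omega[OF one_form(1)] by (simp add: numeral_2_eq_2)
  fix k j :: 'a
  have cl: "mps_partial k (?w i j) - mps_partial j (?w i k) = mps_partial i (?w k j)" for i
  proof -
    have "mps_partial i (?w j k) + mps_partial j (?w k i) + mps_partial k (?w i j) = 0"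
      using assms closed_matrix_iff unfolding closed_matrix_def by blast
    then show ?thesis
      by (simp add: form_matrix_antisym[of \<omega> k i] form_matrix_antisym[of \<omega> k j] mps_partial_uminus 
          algebra_simps add_eq_0_iff2)
  qed
  \<comment> \<open>Differentiating the factor \<open>mps_var i\<close> contributes one copy of the
    averaged entry for each of the two indices; together they give the summand with factor 2 in
    Euler's identity.\<close>
  have d: "(\<Sum>i\<in>UNIV. mps_partial k (mps_var i) * f i) = f k" for k and f :: "'a \<Rightarrow> 'a mps"
    by (simp add: mps_partial_var if_distrib[of "\<lambda>x. x * _"] cong: if_cong)
  have "form_matrix (ext_d (one_form (poincare_primitive \<omega>))) k j =
    (\<Sum>i\<in>UNIV. mps_partial k (mps_var i) * ?I 2 (?w i j)) - (\<Sum>i\<in>UNIV. mps_partial j (mps_var i) * ?I 2 (?w i k))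
    + (\<Sum>i\<in>UNIV. mps_var i * ?I 3 (mps_partial k (?w i j) - mps_partial j (?w i k)))"
    by (simp add: form_matrix_ext_d one_form(2) poincare_primitive_def mps_partial_sum mps_partial_mult
      sum.distrib sum_subtractf mps_partial_homotopy mps_homotopy_linear right_diff_distrib numeral_3_eq_3 numeral_2_eq_2)
  also have "\<dots> = of_nat 2 * ?I 2 (?w k j) + (\<Sum>i\<in>UNIV. mps_var i * mps_partial i (?I 2 (?w k j)))"
    unfolding d cl by (simp add: form_matrix_antisym[of \<omega> j k] mps_homotopy_linear mps_partial_homotopy numeral_3_eq_3 numeral_2_eq_2)
  also have "\<dots> = ?w k j" by (rule mps_homotopy_euler) simp
  finally show "form_matrix (ext_d (one_form (poincare_primitive \<omega>))) k j = ?w k j" .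
qed (use assms in auto)

text \<open>The Poincare lemma replaces the image of \<open>ext_d\<close> by its kernel. Closedness
  is a system of linear equations on the coefficients, which is easy to check for brackets and for
  limits.\<close>

lemma E510_iff: "u \<in> E510 \<longleftrightarrow> divergence (fst u) = 0 \<and> snd u \<in> Omega 2 \<and> ext_d (snd u) = 0"
proof -
  have "\<omega> \<in> ext_d ` Omega 1 \<longleftrightarrow> \<omega> \<in> Omega 2 \<and> ext_d \<omega> = 0" for \<omega> :: "5 dform"
    using ext_d_poincare_primitive[of \<omega>] one_form(1)[of "poincare_primitive \<omega>"] ext_d_ext_d_1[where 'a = 5] ext_d_Omega[of _ 1]
    by (auto simp: numeral_2_eq_2) (metis imageI)
  then show ?thesis by (cases u) (auto simp: E510_def)
qed

section \<open>The super Jacobi identity\<close>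

lemma lie_deriv_linear:
  "lie_deriv (X + Y) \<omega> = lie_deriv X \<omega> + lie_deriv Y \<omega>"
  "lie_deriv (X - Y) \<omega> = lie_deriv X \<omega> - lie_deriv Y \<omega>"
  "lie_deriv (- X) \<omega> = - lie_deriv X \<omega>"
  "lie_deriv X (\<omega> + \<eta>) = lie_deriv X \<omega> + lie_deriv X \<eta>"
  "lie_deriv X (\<omega> - \<eta>) = lie_deriv X \<omega> - lie_deriv X \<eta>"
  "lie_deriv X (- \<omega>) = - lie_deriv X \<omega>"
  "lie_deriv 0 \<omega> = 0" "lie_deriv X 0 = 0"
  by (simp_all add: lie_deriv_def contraction_linear ext_d_linear)

lemma lie_deriv_closed_form:
  assumes "\<omega> \<in> Omega 2" "ext_d \<omega> = 0"
  shows "lie_deriv X \<omega> \<in> Omega 2" "ext_d (lie_deriv X \<omega>) = 0"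
proof -
  have 1: "contraction X \<omega> \<in> Omega 1" using contraction_Omega[of \<omega> 1] assms by (simp add: numeral_2_eq_2)
  show "lie_deriv X \<omega> \<in> Omega 2" using ext_d_Omega[OF 1] assms by (simp add: lie_deriv_closed numeral_2_eq_2)
  show "ext_d (lie_deriv X \<omega>) = 0" using ext_d_ext_d_1[OF 1] assms by (simp add: lie_deriv_closed)
qed

lemma lie_deriv_bracket:
  assumes "\<omega> \<in> Omega 2" "ext_d \<omega> = 0"
  shows "lie_deriv (vf_bracket X Y) \<omega> = lie_deriv X (lie_deriv Y \<omega>) - lie_deriv Y (lie_deriv X \<omega>)"
proof (rule Omega_2_eqI)
  note cl = lie_deriv_closed_form[OF assms]
  show "lie_deriv (vf_bracket X Y) \<omega> \<in> Omega 2" by (rule cl)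
  have "lie_deriv X (lie_deriv Y \<omega>) \<in> Omega 2" for X Y by (rule lie_deriv_closed_form[OF cl])
  then show "lie_deriv X (lie_deriv Y \<omega>) - lie_deriv Y (lie_deriv X \<omega>) \<in> Omega 2"
    by (auto simp: Omega_def)
  have "form_matrix (lie_deriv X (lie_deriv Y \<omega>)) i j = lie_matrix X (lie_matrix Y (form_matrix \<omega>)) i j" for X Y i j
    using form_matrix_lie_deriv[OF assms] by (subst form_matrix_lie_deriv[OF cl]) (simp add: lie_matrix_def)
  then show "form_matrix (lie_deriv (vf_bracket X Y) \<omega>) i j =
    form_matrix (lie_deriv X (lie_deriv Y \<omega>) - lie_deriv Y (lie_deriv X \<omega>)) i j" for i j
    by (simp add: form_matrix_linear form_matrix_lie_deriv[OF assms] lie_matrix_bracket)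
qed

lemma wedge_linear:
  "wedge (\<omega> + \<eta>) \<zeta> = wedge \<omega> \<zeta> + wedge \<eta> \<zeta>" "wedge \<zeta> (\<omega> + \<eta>) = wedge \<zeta> \<omega> + wedge \<zeta> \<eta>"
  "wedge (\<omega> - \<eta>) \<zeta> = wedge \<omega> \<zeta> - wedge \<eta> \<zeta>" "wedge \<zeta> (\<omega> - \<eta>) = wedge \<zeta> \<omega> - wedge \<zeta> \<eta>"
  "wedge (- \<omega>) \<zeta> = - wedge \<omega> \<zeta>" "wedge \<zeta> (- \<omega>) = - wedge \<zeta> \<omega>"
  "wedge 0 \<zeta> = 0" "wedge \<zeta> 0 = 0"
  by (auto simp: wedge_def algebra_simps sum.distrib sum_subtractf sum_negf)

lemma vf_of_form_linear:
  "vf_of_form (\<alpha> + \<beta>) = vf_of_form \<alpha> + vf_of_form \<beta>" "vf_of_form (\<alpha> - \<beta>) = vf_of_form \<alpha> - vf_of_form \<beta>"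
  "vf_of_form (- \<alpha>) = - vf_of_form \<alpha>" "vf_of_form 0 = 0"
  by (auto simp: vf_of_form_def algebra_simps)

lemma vf_bracket_linear:
  "vf_bracket (X + Y) Z = vf_bracket X Z + vf_bracket Y Z" "vf_bracket Z (X + Y) = vf_bracket Z X + vf_bracket Z Y"
  "vf_bracket (X - Y) Z = vf_bracket X Z - vf_bracket Y Z" "vf_bracket Z (X - Y) = vf_bracket Z X - vf_bracket Z Y"
  "vf_bracket (- X) Z = - vf_bracket X Z" "vf_bracket Z (- X) = - vf_bracket Z X"
  "vf_bracket 0 Z = 0" "vf_bracket Z 0 = 0"
  by (auto simp: vf_bracket_eq fun_eq_iff vf_apply_linear vf_apply_add_left vf_apply_diff_left)
     (auto simp: vf_apply_def sum_negf)

lemma vf_bracket_antisym: "vf_bracket X Y = - vf_bracket Y X"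
  by (auto simp: vf_bracket_eq)

lemma E510_bracket_linear:
  "E510_bracket (u + u') v = E510_bracket u v + E510_bracket u' v"
  "E510_bracket v (u + u') = E510_bracket v u + E510_bracket v u'"
  "E510_bracket (u - u') v = E510_bracket u v - E510_bracket u' v"
  "E510_bracket v (u - u') = E510_bracket v u - E510_bracket v u'"
  "E510_bracket (- u) v = - E510_bracket u v"
  "E510_bracket v (- u) = - E510_bracket v u"
  "E510_bracket 0 v = 0" "E510_bracket v 0 = 0"
  by (simp_all add: E510_bracket_def vf_bracket_linear wedge_linear vf_of_form_linear lie_deriv_linear
    prod_eq_iff)

lemma ext_d_scale: "ext_d (\<lambda>I. mps_const c * \<omega> I) = (\<lambda>I. mps_const c * ext_d \<omega> I)"
  by (auto simp: ext_d_def sum_distrib_left mps_partial_const_mult mult_ac)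

lemma divergence_scale: "divergence (\<lambda>i. mps_const c * X i) = mps_const c * divergence X"
  by (simp add: divergence_def mps_partial_const_mult sum_distrib_left)

lemma divergence_linear:
  "divergence (X + Y) = divergence X + divergence Y" "divergence (X - Y) = divergence X - divergence Y"
  "divergence (- X) = - divergence X" "divergence 0 = 0"
  by (simp_all add: divergence_def mps_partial_add mps_partial_diff mps_partial_uminus sum.distrib sum_subtractf sum_negf)

lemma E510_bracket_scale:
  "E510_bracket (elt_scale c u) v = elt_scale c (E510_bracket u v)"
  "E510_bracket v (elt_scale c u) = elt_scale c (E510_bracket v u)"
proof -
  have va: "vf_apply (\<lambda>i. mps_const c * X i) f = mps_const c * vf_apply X f" for c and X :: "5 vfield" and f
    by (simp add: vf_apply_def sum_distrib_left mult.assoc)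
  have vb: "vf_bracket (\<lambda>i. mps_const c * X i) Y = (\<lambda>i. mps_const c * vf_bracket X Y i)"
     "vf_bracket Y (\<lambda>i. mps_const c * X i) = (\<lambda>i. mps_const c * vf_bracket Y X i)" for X Y :: "5 vfield"
    by (auto simp: vf_bracket_eq vf_apply_linear va algebra_simps)
  have w: "wedge (\<lambda>I. mps_const c * \<omega> I) \<eta> = (\<lambda>I. mps_const c * wedge \<omega> \<eta> I)"
    "wedge \<eta> (\<lambda>I. mps_const c * \<omega> I) = (\<lambda>I. mps_const c * wedge \<eta> \<omega> I)" for \<omega> \<eta> :: "5 dform"
    by (auto simp: wedge_def sum_distrib_left mult_ac)
  have v: "vf_of_form (\<lambda>I. mps_const c * \<omega> I) = (\<lambda>i. mps_const c * vf_of_form \<omega> i)" for \<omega> :: "5 dform"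
    by (auto simp: vf_of_form_def mult_ac)
  have ct: "contraction (\<lambda>I. mps_const c * X I) \<omega> = (\<lambda>I. mps_const c * contraction X \<omega> I)"
    "contraction X (\<lambda>I. mps_const c * \<omega> I) = (\<lambda>I. mps_const c * contraction X \<omega> I)" for X and \<omega> :: "5 dform"
    by (auto simp: contraction_def sum_distrib_left mult_ac)
  have l: "lie_deriv (\<lambda>I. mps_const c * X I) \<omega> = (\<lambda>I. mps_const c * lie_deriv X \<omega> I)"
    "lie_deriv X (\<lambda>I. mps_const c * \<omega> I) = (\<lambda>I. mps_const c * lie_deriv X \<omega> I)" for X and \<omega> :: "5 dform"
    by (auto simp: lie_deriv_def ct ext_d_scale distrib_left)
  show "E510_bracket (elt_scale c u) v = elt_scale c (E510_bracket u v)"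
    "E510_bracket v (elt_scale c u) = elt_scale c (E510_bracket v u)"
    by (auto simp: E510_bracket_def elt_scale_def vb w v l algebra_simps)
qed

lemma E510_vector_space:
  "0 \<in> E510" "u \<in> E510 \<Longrightarrow> v \<in> E510 \<Longrightarrow> u + v \<in> E510" "u \<in> E510 \<Longrightarrow> v \<in> E510 \<Longrightarrow> u - v \<in> E510"
  "u \<in> E510 \<Longrightarrow> - u \<in> E510" "u \<in> E510 \<Longrightarrow> elt_scale c u \<in> E510"
  "u \<in> E510 \<Longrightarrow> (fst u, 0) \<in> E510" "u \<in> E510 \<Longrightarrow> (0, snd u) \<in> E510"
  by (auto simp: E510_iff divergence_linear ext_d_linear elt_scale_def divergence_scale ext_d_scale Omega_def fun_eq_iff)

lemma E510_bracket_closed: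
  assumes "u \<in> E510" "v \<in> E510"
  shows "E510_bracket u v \<in> E510"
proof -
  note u = assms(1)[unfolded E510_iff] and v = assms(2)[unfolded E510_iff]
  have "divergence (vf_of_form (wedge (snd u) (snd v))) = 0"
    using u v by (simp add: vf_of_form_wedge divergence_star antisym_form_matrix closed_matrix_iff[symmetric])
  moreover have "divergence (vf_bracket (fst u) (fst v)) = 0"
    using u v by (simp add: divergence_vf_bracket vf_apply_linear)
  ultimately have "divergence (fst (E510_bracket u v)) = 0"
    by (simp add: E510_bracket_def divergence_def mps_partial_add sum.distrib)
  moreover have "snd (E510_bracket u v) \<in> Omega 2"
    using lie_deriv_closed_form(1)[of "snd v" "fst u"] lie_deriv_closed_form(1)[of "snd u" "fst v"] u v
    by (auto simp: E510_bracket_def Omega_def)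
  moreover have "ext_d (snd (E510_bracket u v)) = 0"
    using lie_deriv_closed_form(2)[of "snd v" "fst u"] lie_deriv_closed_form(2)[of "snd u" "fst v"] u v
    by (simp add: E510_bracket_def ext_d_linear)
  ultimately show ?thesis by (simp add: E510_iff)
qed


lemma E510_bracket_even_derivation:
  assumes "u \<in> E510_part 0" "v \<in> E510" "w \<in> E510"
  shows "E510_bracket u (E510_bracket v w) = E510_bracket (E510_bracket u v) w + E510_bracket v (E510_bracket u w)"
proof -
  obtain X Y \<omega> Z \<eta> where uvw: "u = (X, 0)" "v = (Y, \<omega>)" "w = (Z, \<eta>)"
    using assms by (cases u; cases v; cases w) (auto simp: E510_part_def)
  have X: "divergence X = 0" and \<omega>: "\<omega> \<in> Omega 2" "ext_d \<omega> = 0" and \<eta>: "\<eta> \<in> Omega 2" "ext_d \<eta> = 0"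
    using assms uvw by (auto simp: E510_part_def E510_iff)
  have "vf_bracket X (star (form_matrix \<omega>) (form_matrix \<eta>)) =
    star (form_matrix (lie_deriv X \<omega>)) (form_matrix \<eta>) + star (form_matrix \<omega>) (form_matrix (lie_deriv X \<eta>))"
    by (rule ext) (simp add: vf_bracket_star[OF X antisym_form_matrix antisym_form_matrix]
        form_matrix_lie_deriv[OF \<omega>, abs_def] form_matrix_lie_deriv[OF \<eta>, abs_def])
  then have star: "vf_bracket X (vf_of_form (wedge \<omega> \<eta>)) =
    vf_of_form (wedge (lie_deriv X \<omega>) \<eta>) + vf_of_form (wedge \<omega> (lie_deriv X \<eta>))"
    using \<omega> lie_deriv_closed_form[OF \<omega>] by (simp add: vf_of_form_wedge)
  show ?thesis
    unfolding uvw E510_bracket_def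
    by (auto simp: wedge_linear vf_of_form_linear lie_deriv_linear vf_bracket_linear
       vf_bracket_Jacobi[of X Y Z] star lie_deriv_bracket[OF \<omega>] lie_deriv_bracket[OF \<eta>])
qed

text \<open>For the odd part of \<open>w\<close> the claim is that a cyclic sum of Lie derivatives
  vanishes; by Cartan's formula this is the differential of a cyclic sum of contractions, which is
  already zero. For the even part it is the rule for a field acting on a wedge product,
  rearranged.\<close>

lemma E510_bracket_odd_derivation:
  assumes "u \<in> E510_part 1" "v \<in> E510_part 1" "w \<in> E510"
  shows "E510_bracket u (E510_bracket v w) = E510_bracket (E510_bracket u v) w - E510_bracket v (E510_bracket u w)"
proof -
  obtain \<omega> \<eta> Z \<zeta> where uvw: "u = (0, \<omega>)" "v = (0, \<eta>)" "w = (Z, \<zeta>)"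
    using assms by (cases u; cases v; cases w) (auto simp: E510_part_def)
  have Z: "divergence Z = 0" and \<omega>: "\<omega> \<in> Omega 2" "ext_d \<omega> = 0" and \<eta>: "\<eta> \<in> Omega 2" "ext_d \<eta> = 0"
    and \<zeta>: "\<zeta> \<in> Omega 2" "ext_d \<zeta> = 0"
    using assms uvw by (auto simp: E510_part_def E510_iff)
  let ?S = "\<lambda>\<alpha> \<beta>. vf_of_form (wedge \<alpha> \<beta>)"
  have S: "vf_bracket Z (?S \<omega> \<eta>) = ?S (lie_deriv Z \<omega>) \<eta> + ?S \<omega> (lie_deriv Z \<eta>)"
    using E510_bracket_even_derivation[of "(Z, 0)" "(0, \<omega>)" "(0, \<eta>)"] Z \<omega> \<eta>
    by (simp add: E510_part_def E510_iff E510_bracket_def divergence_linear ext_d_linear Omega_def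
        vf_bracket_linear wedge_linear vf_of_form_linear lie_deriv_linear)
  have comm: "?S \<omega> \<eta> = ?S \<eta> \<omega>" if "\<omega> \<in> Omega 2" "\<eta> \<in> Omega 2" for \<omega> \<eta> :: "5 dform"
    using that by (simp add: vf_of_form_wedge star_commute)
  let ?c = "contraction (?S \<omega> \<eta>) \<zeta> + contraction (?S \<eta> \<zeta>) \<omega> + contraction (?S \<zeta> \<omega>) \<eta>"
  have "?c {j} = 0" for j
    using star_contraction_cyclic[OF antisym_form_matrix antisym_form_matrix antisym_form_matrix, of \<omega> \<eta> \<zeta> j] \<omega> \<eta> \<zeta>
    by (simp add: contraction_singleton vf_of_form_wedge)
  moreover have "?c \<in> Omega 1"
    using contraction_Omega[of \<omega> 1] contraction_Omega[of \<eta> 1] contraction_Omega[of \<zeta> 1] \<omega> \<eta> \<zeta>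
    by (simp add: numeral_2_eq_2 Omega_def)
  ultimately have "?c J = 0" for J
    by (cases "card J = 1") (auto simp: Omega_def card_1_singleton_iff)
  then have "?c = 0" by (simp add: fun_eq_iff)
  then have "ext_d ?c = 0" by (simp add: ext_d_linear)
  then have cyc: "lie_deriv (?S \<omega> \<eta>) \<zeta> + lie_deriv (?S \<eta> \<zeta>) \<omega> + lie_deriv (?S \<zeta> \<omega>) \<eta> = 0"
    using \<omega> \<eta> \<zeta> by (simp add: lie_deriv_closed ext_d_linear)
  have sw: "?S \<eta> (lie_deriv Z \<omega>) = ?S (lie_deriv Z \<omega>) \<eta>" "?S \<zeta> \<omega> = ?S \<omega> \<zeta>"
    using comm \<omega> \<eta> \<zeta> lie_deriv_closed_form(1)[OF \<omega>] by blast+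
  have "- ?S \<omega> (lie_deriv Z \<eta>) = - vf_bracket Z (?S \<omega> \<eta>) + ?S \<eta> (lie_deriv Z \<omega>)"
    unfolding S sw by simp
  moreover have "- lie_deriv (?S \<eta> \<zeta>) \<omega> = lie_deriv (?S \<omega> \<eta>) \<zeta> + lie_deriv (?S \<omega> \<zeta>) \<eta>"
  proof -
    have "- b = (a + c) - (a + b + c)" for a b c :: "5 dform" by (simp add: algebra_simps)
    from this[of "lie_deriv (?S \<eta> \<zeta>) \<omega>" "lie_deriv (?S \<omega> \<eta>) \<zeta>" "lie_deriv (?S \<zeta> \<omega>) \<eta>"]
    show ?thesis unfolding cyc unfolding sw by simp
  qed
  moreover have "vf_bracket (?S \<omega> \<eta>) Z = - vf_bracket Z (?S \<omega> \<eta>)" by (rule vf_bracket_antisym)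
  ultimately show ?thesis
    unfolding uvw E510_bracket_def
    by (simp add: wedge_linear vf_of_form_linear lie_deriv_linear vf_bracket_linear)
qed

lemma E510_bracket_commute:
  assumes "u \<in> E510_part p" "v \<in> E510_part q"
  shows "E510_bracket u v = elt_scale (- ((- 1) ^ (p * q))) (E510_bracket v u)"
proof -
  have 1: "elt_scale 1 u = u" "elt_scale (- 1) u = - u" for u
    by (auto simp: elt_scale_def mps_const_simps prod_eq_iff)
  have comm: "vf_of_form (wedge \<omega> \<eta>) = vf_of_form (wedge \<eta> \<omega>)" if "\<omega> \<in> Omega 2" "\<eta> \<in> Omega 2" for \<omega> \<eta> :: "5 dform"
    using that by (simp add: vf_of_form_wedge star_commute)
  show ?thesis using assms comm[of "snd u" "snd v"] vf_bracket_antisym[of "fst u" "fst v"]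
    by (cases "even p"; cases "even q")
       (auto simp: E510_part_def E510_bracket_def 1 wedge_linear vf_of_form_linear lie_deriv_linear vf_bracket_linear E510_iff)
qed

lemma E510_bracket_super_derivation:
  assumes "u \<in> E510_part p" "v \<in> E510_part q" "w \<in> E510"
  shows "E510_bracket u (E510_bracket v w) =
    E510_bracket (E510_bracket u v) w + elt_scale ((- 1) ^ (p * q)) (E510_bracket v (E510_bracket u w))"
proof -
  have 1: "elt_scale 1 u = u" "elt_scale (- 1) u = - u" for u
    by (auto simp: elt_scale_def mps_const_simps prod_eq_iff)
  have E: "u \<in> E510" "v \<in> E510" using assms by (auto simp: E510_part_def)
  consider "even p" | "odd p" "even q" | "odd p" "odd q" by blast
  then show ?thesis
  proof cases
    case 1
    then have "u \<in> E510_part 0" using assms by (auto simp: E510_part_def)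
    then show ?thesis using E510_bracket_even_derivation[of u v w] 1 assms E by (simp add: \<open>elt_scale 1 _ = _\<close>)
  next
    case 2
    then have v: "v \<in> E510_part 0" using assms by (auto simp: E510_part_def)
    \<comment> \<open>For \<open>u\<close> odd and \<open>v\<close> even the identity is the
      derivation property of \<open>v\<close>, solved for another term.\<close>
    have "E510_bracket u v = - E510_bracket v u"
      using E510_bracket_commute[OF assms(1,2)] 2 1 by simp
    then show ?thesis using E510_bracket_even_derivation[OF v E(1) assms(3)] 2
      by (simp add: 1 E510_bracket_linear)
  next
    case 3
    then have "u \<in> E510_part 1" "v \<in> E510_part 1" using assms by (auto simp: E510_part_def)
    then show ?thesis using E510_bracket_odd_derivation[of u v w] 3 assms by (simp add: 1)
  qed
qed

section \<open>Coordinates, degrees and the linearly compact topology\<close>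

lemma elt_coord_Inl [simp]: "elt_coord u (Inl i, m) = mps_coeff (fst u i) m"
  and elt_coord_Inr [simp]: "elt_coord u (Inr I, m) = mps_coeff (snd u I) m"
  by (simp_all add: elt_coord_def)

lemma elt_eqI: "(\<And>b. elt_coord u b = elt_coord v b) \<Longrightarrow> u = v"
proof -
  assume *: "\<And>b. elt_coord u b = elt_coord v b"
  have "fst u i = fst v i" for i using *[of "(Inl i, _)"] by (intro mps_eqI) simp
  moreover have "snd u I = snd v I" for I using *[of "(Inr I, _)"] by (intro mps_eqI) simp
  ultimately show ?thesis by (simp add: prod_eq_iff fun_eq_iff)
qed

lemma elt_coord_linear:
  "elt_coord 0 b = 0" "elt_coord (u + v) b = elt_coord u b + elt_coord v b" "elt_coord (u - v) b = elt_coord u b - elt_coord v b"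
  "elt_coord (- u) b = - elt_coord u b" "elt_coord (elt_scale c u) b = c * elt_coord u b"
  "elt_coord (sum f A) b = (\<Sum>a\<in>A. elt_coord (f a) b)"
proof -
  show *: "elt_coord 0 b = 0" "elt_coord (u + v) b = elt_coord u b + elt_coord v b" "elt_coord (u - v) b = elt_coord u b - elt_coord v b"
  "elt_coord (- u) b = - elt_coord u b" "elt_coord (elt_scale c u) b = c * elt_coord u b" for u v
    by (cases b; cases "fst b"; auto simp: elt_scale_def)+
  show "elt_coord (sum f A) b = (\<Sum>a\<in>A. elt_coord (f a) b)"
    by (induction A rule: infinite_finite_induct) (auto simp: *)
qed

lemma E510_coord_Inr: "u \<in> E510 \<Longrightarrow> card I \<noteq> 2 \<Longrightarrow> elt_coord u (Inr I, m) = 0"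
  by (auto simp: E510_iff Omega_def)

lemma E510_sum: "(\<And>a. a \<in> A \<Longrightarrow> f a \<in> E510) \<Longrightarrow> sum f A \<in> E510"
  by (induction A rule: infinite_finite_induct) (auto simp: E510_vector_space)

text \<open>Twice the multidegree, the odd part being shifted by \<open>- 1/2\<close> in every component. The shift makes the
  degree additive for the bracket of two odd elements, where \<open>dx\<^bsub>- {i}\<^esub>\<close> is identified with \<open>\<partial>/\<partial>x\<^sub>i\<close>.\<close>

definition mdeg :: "coord \<Rightarrow> 5 \<Rightarrow> int" where
  "mdeg = (\<lambda>(b, m) k. 2 * int (m k) + (case b of Inl i \<Rightarrow> if k = i then - 2 else 0 | Inr I \<Rightarrow> if k \<in> I then 1 else - 1))"

text \<open>All gradings are weightings of the same multidegree, so its additivity under the bracket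
  gives that of every grading at once. The factor 2 matches the doubling in
  \<open>mdeg\<close>.\<close>

lemma coord_degree_mdeg:
  assumes "even (\<Sum>k\<in>UNIV. a k)"
  shows "2 * coord_degree a b = (\<Sum>k\<in>UNIV. int (a k) * mdeg b k)"
proof -
  obtain x m where b: "b = (x, m)" by force
  show ?thesis
  proof (cases x)
    case (Inl i)
    have "(\<Sum>k\<in>UNIV. int (a k) * (if k = i then - 2 else 0)) = - 2 * int (a i)"
      by (simp add: if_distrib[of "\<lambda>x. _ * x"] cong: if_cong)
    then show ?thesis by (simp add: b Inl coord_degree_def mdeg_def distrib_left sum.distrib sum_distrib_left mult_ac)
  next
    case (Inr I)
    have ev: "2 * ((\<Sum>k\<in>UNIV. int (a k)) div 2) = (\<Sum>k\<in>UNIV. int (a k))"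
      using assms by (intro dvd_mult_div_cancel) (metis even_of_nat of_nat_sum)
    have "(\<Sum>k\<in>UNIV. int (a k) * (if k \<in> I then 1 else - 1)) = (\<Sum>k\<in>UNIV. 2 * (if k \<in> I then int (a k) else 0) - int (a k))"
      by (rule sum.cong) auto
    also have "\<dots> = 2 * (\<Sum>k\<in>I. int (a k)) - (\<Sum>k\<in>UNIV. int (a k))"
      by (simp add: sum_subtractf sum_distrib_left[symmetric] sum.If_cases)
    finally show ?thesis using ev
      by (simp add: b Inr coord_degree_def mdeg_def distrib_left sum.distrib sum_distrib_left mult_ac)
  qed
qed

lemma mps_coeff_sign_mult: "mps_coeff (shuffle_sign I J * f) m = shuffle_sign I J * mps_coeff f m"
proof -
  have "mps_coeff ((- 1) ^ n * f) m = (- 1) ^ n * mps_coeff f m" for n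
    by (induction n) (simp_all add: mult.assoc)
  then show ?thesis by (simp add: shuffle_sign_def)
qed

lemma sum_nonzero: "sum f A \<noteq> 0 \<Longrightarrow> \<exists>a\<in>A. f a \<noteq> 0"
  by (metis sum.neutral)

section \<open>Additivity of the multidegree under the bracket\<close>

lemma vf_apply_support:
  assumes "mps_coeff (vf_apply X f) m \<noteq> 0"
  shows "\<exists>k m1 m2. mps_coeff (X k) m1 \<noteq> 0 \<and> mps_coeff f m2 \<noteq> 0 \<and> m1 + m2 = m + unit_exp k"
proof -
  obtain k where "mps_coeff (X k * mps_partial k f) m \<noteq> 0"
    using assms sum_nonzero unfolding vf_apply_def mps_coeff_sum by fast
  then obtain m1 m2 where "m1 + m2 = m" "mps_coeff (X k) m1 \<noteq> 0" "mps_coeff (mps_partial k f) m2 \<noteq> 0"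
    by (rule mps_coeff_mult_nonzero)
  then show ?thesis by (intro exI[of _ k] exI[of _ m1] exI[of _ "m2 + unit_exp k"]) (auto simp: mps_coeff_partial add.assoc)
qed

lemma lie_deriv_support:
  assumes "mps_coeff (lie_deriv X \<omega> K) m \<noteq> 0" "ext_d \<omega> = 0"
  shows "\<exists>l m1 J m2. mps_coeff (X l) m1 \<noteq> 0 \<and> mps_coeff (\<omega> J) m2 \<noteq> 0 \<and>
    mdeg (Inr K, m) = mdeg (Inl l, m1) + mdeg (Inr J, m2)"
proof -
  obtain i where i: "i \<in> K" "mps_coeff (shuffle_sign {i} (K - {i}) * mps_partial i (contraction X \<omega> (K - {i}))) m \<noteq> 0"
    using assms sum_nonzero unfolding lie_deriv_closed[OF assms(2)] ext_d_def mps_coeff_sum by fast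
  then have "mps_coeff (contraction X \<omega> (K - {i})) (m + unit_exp i) \<noteq> 0"
    by (auto simp: mps_coeff_sign_mult mps_coeff_partial)
  \<comment> \<open>The contraction removes \<open>l\<close> and the differential then creates
    \<open>i\<close>; \<open>l = i\<close> is possible, hence the form
    \<open>insert l (K - {i})\<close> of the index set.\<close>
  then obtain l where l: "l \<notin> K - {i}" "mps_coeff (shuffle_sign {l} (K - {i}) * X l * \<omega> (insert l (K - {i}))) (m + unit_exp i) \<noteq> 0"
    using sum_nonzero unfolding contraction_def mps_coeff_sum by fast
  then have "mps_coeff (X l * \<omega> (insert l (K - {i}))) (m + unit_exp i) \<noteq> 0"
    by (auto simp: mult.assoc mps_coeff_sign_mult)
  then obtain m1 m2 where m: "m1 + m2 = m + unit_exp i" "mps_coeff (X l) m1 \<noteq> 0" "mps_coeff (\<omega> (insert l (K - {i}))) m2 \<noteq> 0"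
    by (rule mps_coeff_mult_nonzero)
  have "mdeg (Inr K, m) k = (mdeg (Inl l, m1) + mdeg (Inr (insert l (K - {i})), m2)) k" for k
  proof -
    have "int (m1 k) + int (m2 k) = int (m k) + int (unit_exp i k)" using fun_cong[OF m(1), of k] by simp
    then show ?thesis using i(1) l(1) by (auto simp: mdeg_def unit_exp_def split: if_splits)
  qed
  then show ?thesis using m by blast
qed

lemma E510_bracket_support:
  assumes "u \<in> E510" "v \<in> E510" "elt_coord (E510_bracket u v) b \<noteq> 0"
  shows "\<exists>b1 b2. elt_coord u b1 \<noteq> 0 \<and> elt_coord v b2 \<noteq> 0 \<and> mdeg b = mdeg b1 + mdeg b2"
proof -
  obtain x m where b: "b = (x, m)" by force
  have d: "ext_d (snd u) = 0" "ext_d (snd v) = 0" using assms by (auto simp: E510_iff)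
  have vf: "\<exists>k m1 m2. mps_coeff (X k) m1 \<noteq> 0 \<and> mps_coeff (Y i) m2 \<noteq> 0 \<and> mdeg (Inl i, m) = mdeg (Inl k, m1) + mdeg (Inl i, m2)"
    if nz: "mps_coeff (vf_apply X (Y i)) m \<noteq> 0" for X Y :: "5 vfield" and i
  proof -
    obtain k m1 m2 where k: "mps_coeff (X k) m1 \<noteq> 0" "mps_coeff (Y i) m2 \<noteq> 0" "m1 + m2 = m + unit_exp k"
      using vf_apply_support[OF nz] by blast
    have "mdeg (Inl i, m) j = (mdeg (Inl k, m1) + mdeg (Inl i, m2)) j" for j
    proof -
      have "int (m1 j) + int (m2 j) = int (m j) + int (unit_exp k j)" using fun_cong[OF k(3), of j] by simp
      then show ?thesis by (auto simp: mdeg_def unit_exp_def split: if_splits)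
    qed
    then show ?thesis using k by blast
  qed
  show ?thesis
  proof (cases x)
    case (Inl i)
    consider "mps_coeff (vf_apply (fst u) (fst v i)) m \<noteq> 0" | "mps_coeff (vf_apply (fst v) (fst u i)) m \<noteq> 0"
      | "mps_coeff (vf_of_form (wedge (snd u) (snd v)) i) m \<noteq> 0"
      using assms(3) unfolding b Inl by (fastforce simp: E510_bracket_def vf_bracket_eq)
    then show ?thesis
    proof cases
      case 1
      then show ?thesis using vf[of "fst u" "fst v" i] 1 unfolding b Inl by (metis elt_coord_Inl)
    next
      case 2
      then show ?thesis using vf[of "fst v" "fst u" i] 2 unfolding b Inl by (metis elt_coord_Inl add.commute)
    next
      case 3
      then have "mps_coeff (wedge (snd u) (snd v) (- {i})) m \<noteq> 0"
        by (auto simp: vf_of_form_def mps_coeff_sign_mult)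
      then obtain I where I: "I \<subseteq> - {i}" "mps_coeff (shuffle_sign I (- {i} - I) * snd u I * snd v (- {i} - I)) m \<noteq> 0"
        using sum_nonzero unfolding wedge_def mps_coeff_sum by (metis (no_types, lifting) PowD)
      then have "mps_coeff (snd u I * snd v (- {i} - I)) m \<noteq> 0"
        by (auto simp: mult.assoc mps_coeff_sign_mult)
      then obtain m1 m2 where m: "m1 + m2 = m" "mps_coeff (snd u I) m1 \<noteq> 0" "mps_coeff (snd v (- {i} - I)) m2 \<noteq> 0"
        by (rule mps_coeff_mult_nonzero)
      have "mdeg (Inl i, m) j = (mdeg (Inr I, m1) + mdeg (Inr (- {i} - I), m2)) j" for j
      proof -
        have "int (m1 j) + int (m2 j) = int (m j)" using fun_cong[OF m(1), of j] by simp
        then show ?thesis using I(1) by (auto simp: mdeg_def)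
      qed
      then show ?thesis using m unfolding b Inl by (metis elt_coord_Inr ext)
    qed
  next
    case (Inr K)
    consider "mps_coeff (lie_deriv (fst u) (snd v) K) m \<noteq> 0" | "mps_coeff (lie_deriv (fst v) (snd u) K) m \<noteq> 0"
      using assms(3) unfolding b Inr by (fastforce simp: E510_bracket_def)
    then show ?thesis
    proof cases
      case 1
      then show ?thesis using lie_deriv_support[OF 1 d(2)] unfolding b Inr by (metis elt_coord_Inl elt_coord_Inr)
    next
      case 2
      then show ?thesis using lie_deriv_support[OF 2 d(1)] unfolding b Inr by (metis elt_coord_Inl elt_coord_Inr add.commute)
    qed
  qed
qed

lemma E510_bracket_support_degree:
  assumes "u \<in> E510" "v \<in> E510" "elt_coord (E510_bracket u v) b \<noteq> 0"
  shows "\<exists>b1 b2. elt_coord u b1 \<noteq> 0 \<and> elt_coord v b2 \<noteq> 0 \<and> mdeg b = mdeg b1 + mdeg b2 \<and>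
    (\<forall>a. even (\<Sum>k\<in>UNIV. a k) \<longrightarrow> coord_degree a b = coord_degree a b1 + coord_degree a b2)"
proof -
  obtain b1 b2 where *: "elt_coord u b1 \<noteq> 0" "elt_coord v b2 \<noteq> 0" "mdeg b = mdeg b1 + mdeg b2"
    using E510_bracket_support[OF assms] by blast
  moreover have "coord_degree a b = coord_degree a b1 + coord_degree a b2" if "even (\<Sum>k\<in>UNIV. a k)" for a
    using coord_degree_mdeg[OF that, of b] coord_degree_mdeg[OF that, of b1] coord_degree_mdeg[OF that, of b2] *(3)
    by (simp add: distrib_left sum.distrib)
  ultimately show ?thesis by blast
qed

text \<open>The grading of type (2,2,2,2,2). With equal weights it measures the order of vanishing:
  a coefficient of total degree \<open>d\<close> sits at level \<open>2 d - 2\<close> for a field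
  and \<open>2 d - 1\<close> for a two-form.\<close>

definition level :: "coord \<Rightarrow> int" where
  "level = coord_degree (\<lambda>_. 2)"

definition total_degree :: "('n::finite \<Rightarrow> nat) \<Rightarrow> nat" where
  "total_degree m = sum m UNIV"

lemma level_simps: "level (Inl i, m) = 2 * int (total_degree m) - 2"
  "level (Inr I, m) = 2 * int (total_degree m) + 2 * int (card I) - 5"
  by (simp_all add: level_def coord_degree_def total_degree_def sum_distrib_left mult.commute)

lemma level_bracket:
  assumes "u \<in> E510" "v \<in> E510" "elt_coord (E510_bracket u v) b \<noteq> 0"
  shows "\<exists>b1 b2. elt_coord u b1 \<noteq> 0 \<and> elt_coord v b2 \<noteq> 0 \<and> level b = level b1 + level b2"
  using E510_bracket_support_degree[OF assms] unfolding level_def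
  by (metis (mono_tags, lifting) dvd_sum even_numeral)

lemma level_ge: "u \<in> E510 \<Longrightarrow> elt_coord u b \<noteq> 0 \<Longrightarrow> level b \<ge> - 2"
proof -
  assume *: "u \<in> E510" "elt_coord u b \<noteq> 0"
  obtain x m where "b = (x, m)" by force
  then show ?thesis using * E510_coord_Inr[OF *(1), of _ m] by (cases x; cases "card (projr x) = 2") (auto simp: level_simps)
qed

lemma finite_level: "finite {b. level b < q}"
proof (rule finite_subset)
  let ?M = "PiE UNIV (\<lambda>_. {..nat (q + 5)}) :: (5 \<Rightarrow> nat) set"
  show "{b. level b < q} \<subseteq> UNIV \<times> ?M"
  proof
    fix b assume b: "b \<in> {b. level b < q}"
    obtain x m where xm: "b = (x, m)" by force
    \<comment> \<open>The formula for \<open>level\<close> also covers index sets of size other than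
      2; the empty set gives the smallest offset, -5.\<close>
    have "int (total_degree m) \<le> q + 5 \<or> q + 5 < 0" using b by (cases x) (auto simp: xm level_simps)
    moreover have "level b \<ge> - 5" by (cases x) (auto simp: xm level_simps)
    ultimately have "total_degree m \<le> nat (q + 5)" using b by auto
    moreover have "m k \<le> total_degree m" for k unfolding total_degree_def by (rule member_le_sum) auto
    ultimately show "b \<in> UNIV \<times> ?M" using xm order_trans by (auto simp: PiE_def)
  qed
  show "finite ((UNIV :: (5 + 5 set) set) \<times> ?M)"
    by (intro finite_cartesian_product finite_PiE) auto
qed

definition agree_below :: "int \<Rightarrow> elt \<Rightarrow> elt \<Rightarrow> bool" where
  "agree_below q u v \<longleftrightarrow> (\<forall>b. level b < q \<longrightarrow> elt_coord u b = elt_coord v b)"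

lemma agree_belowD: "agree_below q u v \<Longrightarrow> level b < q \<Longrightarrow> elt_coord u b = elt_coord v b"
  and agree_below_zeroD: "agree_below q u 0 \<Longrightarrow> level b < q \<Longrightarrow> elt_coord u b = 0"
  and agree_below_zeroI: "(\<And>b. level b < q \<Longrightarrow> elt_coord u b = 0) \<Longrightarrow> agree_below q u 0"
  by (simp_all add: agree_below_def elt_coord_linear del: split_paired_All)

lemma agree_below_mono: "agree_below q u v \<Longrightarrow> p \<le> q \<Longrightarrow> agree_below p u v"
  by (auto simp: agree_below_def)

text \<open>A basic open set of the product fixes finitely many coordinates. As only finitely many
  coordinates lie below a given level, agreement below some level defines the same
  neighbourhoods.\<close>

lemma openin_E510_top:
  "openin E510_top S \<longleftrightarrow> S \<subseteq> E510 \<and> (\<forall>u\<in>S. \<exists>q. \<forall>v\<in>E510. agree_below q u v \<longrightarrow> v \<in> S)"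
proof
  let ?T = "product_topology (\<lambda>_. discrete_topology UNIV) UNIV :: (coord \<Rightarrow> complex) topology"
  assume "openin E510_top S"
  then obtain U where U: "openin ?T U" "S = elt_coord -` U \<inter> E510"
    unfolding E510_top_def openin_pullback_topology by blast
  have "\<exists>q. \<forall>v\<in>E510. agree_below q u v \<longrightarrow> v \<in> S" if "u \<in> S" for u
  proof -
    have "elt_coord u \<in> U" using U that by auto
    then obtain V where V: "finite {b. V b \<noteq> UNIV}" "elt_coord u \<in> PiE UNIV V" "PiE UNIV V \<subseteq> U"
      using U(1) unfolding openin_product_topology_alt by auto
    define q where "q = Max (insert 0 (level ` {b. V b \<noteq> UNIV})) + 1"
    have q: "level b < q" if "V b \<noteq> UNIV" for b
      using V(1) that unfolding q_def by (intro zless_add1_eq[THEN iffD2]) (auto simp: order.order_iff_strict[symmetric] intro!: Max_ge)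
    have "v \<in> S" if "v \<in> E510" "agree_below q u v" for v
    proof -
      have "elt_coord v b \<in> V b" for b
      proof (cases "V b = UNIV")
        case False
        then have "elt_coord v b = elt_coord u b" using agree_belowD[OF that(2) q[OF False]] by simp
        then show ?thesis using V(2) by (auto simp: PiE_def)
      qed auto
      then show ?thesis using V(3) U(2) that(1) by (auto simp: PiE_def)
    qed
    then show ?thesis by blast
  qed
  then show "S \<subseteq> E510 \<and> (\<forall>u\<in>S. \<exists>q. \<forall>v\<in>E510. agree_below q u v \<longrightarrow> v \<in> S)" using U by auto
next
  let ?T = "product_topology (\<lambda>_. discrete_topology UNIV) UNIV :: (coord \<Rightarrow> complex) topology"
  assume *: "S \<subseteq> E510 \<and> (\<forall>u\<in>S. \<exists>q. \<forall>v\<in>E510. agree_below q u v \<longrightarrow> v \<in> S)"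
  then obtain q where q: "\<And>u v. u \<in> S \<Longrightarrow> v \<in> E510 \<Longrightarrow> agree_below (q u) u v \<Longrightarrow> v \<in> S" by metis
  define U where "U = (\<Union>u\<in>S. PiE UNIV (\<lambda>b. if level b < q u then {elt_coord u b} else UNIV))"
  have "openin ?T U" unfolding U_def
  proof (intro openin_Union ballI, elim imageE)
    fix W u assume W: "W = PiE UNIV (\<lambda>b. if level b < q u then {elt_coord u b} else UNIV)"
    have "finite {b. (if level b < q u then {elt_coord u b} else UNIV) \<noteq> (UNIV :: complex set)}"
      by (rule finite_subset[OF _ finite_level[of "q u"]]) (auto split: if_splits)
    then show "openin ?T W"
      unfolding W openin_PiE_gen by simp
  qed
  moreover have "S = elt_coord -` U \<inter> E510"
  proof (intro equalityI subsetI)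
    fix v assume "v \<in> S"
    then show "v \<in> elt_coord -` U \<inter> E510" using * unfolding U_def by (auto simp: PiE_def intro!: bexI[of _ v])
  next
    fix v assume v: "v \<in> elt_coord -` U \<inter> E510"
    then obtain u where u: "u \<in> S" "elt_coord v \<in> PiE UNIV (\<lambda>b. if level b < q u then {elt_coord u b} else UNIV)"
      unfolding U_def by blast
    have "agree_below (q u) u v" unfolding agree_below_def
    proof (intro allI impI)
      fix b assume "level b < q u" then show "elt_coord u b = elt_coord v b" using PiE_mem[OF u(2), of b] by simp
    qed
    then show "v \<in> S" using q u(1) v by blast
  qed
  ultimately show "openin E510_top S" unfolding E510_top_def openin_pullback_topology by blast
qed

lemma topspace_E510_top [simp]: "topspace E510_top = E510"
  by (simp add: E510_top_def topspace_pullback_topology)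

section \<open>Continuous linear maps and coordinatewise limits\<close>

definition E510_linear :: "(elt \<Rightarrow> elt) \<Rightarrow> bool" where
  "E510_linear T \<longleftrightarrow> (\<forall>u\<in>E510. T u \<in> E510) \<and> (\<forall>u\<in>E510. \<forall>v\<in>E510. T (u + v) = T u + T v) \<and>
     (\<forall>c. \<forall>u\<in>E510. T (elt_scale c u) = elt_scale c (T u))"

lemma elt_scale_simps: "elt_scale 1 u = u" "elt_scale (- 1) u = - u" "elt_scale 0 u = 0"
  by (auto intro!: elt_eqI simp: elt_coord_linear)

lemma E510_linearD:
  assumes "E510_linear T"
  shows "u \<in> E510 \<Longrightarrow> T u \<in> E510" "u \<in> E510 \<Longrightarrow> v \<in> E510 \<Longrightarrow> T (u + v) = T u + T v"
    "u \<in> E510 \<Longrightarrow> T (elt_scale c u) = elt_scale c (T u)" "T 0 = 0"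
    "u \<in> E510 \<Longrightarrow> T (- u) = - T u" "u \<in> E510 \<Longrightarrow> v \<in> E510 \<Longrightarrow> T (u - v) = T u - T v"
    "(\<And>a. a \<in> A \<Longrightarrow> f a \<in> E510) \<Longrightarrow> T (sum f A) = (\<Sum>a\<in>A. T (f a))"
proof -
  show 1: "u \<in> E510 \<Longrightarrow> T u \<in> E510" and 2: "u \<in> E510 \<Longrightarrow> v \<in> E510 \<Longrightarrow> T (u + v) = T u + T v"
    and 3: "u \<in> E510 \<Longrightarrow> T (elt_scale c u) = elt_scale c (T u)" for u v c using assms unfolding E510_linear_def by auto
  show 4: "T 0 = 0" using 3[of 0 0] E510_vector_space(1) by (simp add: elt_scale_simps)
  show 5: "T (- u) = - T u" if "u \<in> E510" for u using 3[OF that, of "- 1"] by (simp add: elt_scale_simps)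
  show "T (u - v) = T u - T v" if "u \<in> E510" "v \<in> E510" for u v
    using 2[of u "- v"] 5[OF that(2)] that E510_vector_space by simp
  show "(\<And>a. a \<in> A \<Longrightarrow> f a \<in> E510) \<Longrightarrow> T (sum f A) = (\<Sum>a\<in>A. T (f a))"
    by (induction A rule: infinite_finite_induct) (auto simp: 4 2 E510_sum)
qed

definition E510_continuous :: "(elt \<Rightarrow> elt) \<Rightarrow> bool" where
  "E510_continuous T \<longleftrightarrow> (\<forall>p. \<exists>q. \<forall>u\<in>E510. agree_below q u 0 \<longrightarrow> agree_below p (T u) 0)"

lemma agree_below_diff: "agree_below q u v \<longleftrightarrow> agree_below q (u - v) 0"
  by (auto simp: agree_below_def elt_coord_linear)

lemma continuous_map_E510:
  assumes "E510_linear T"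
  shows "continuous_map E510_top E510_top T \<longleftrightarrow> E510_continuous T"
proof
  assume c: "continuous_map E510_top E510_top T"
  show "E510_continuous T" unfolding E510_continuous_def
  proof
    fix p
    let ?N = "{u \<in> E510. agree_below p u 0}"
    have "openin E510_top ?N"
      unfolding openin_E510_top by (auto intro!: exI[of _ p] simp: agree_below_def)
    then have "openin E510_top {u \<in> E510. T u \<in> ?N}"
      using c unfolding continuous_map_def by auto
    moreover have "0 \<in> {u \<in> E510. T u \<in> ?N}"
      using E510_vector_space(1) by (auto simp: E510_linearD(4)[OF assms] agree_below_def)
    ultimately obtain q where "\<forall>v\<in>E510. agree_below q 0 v \<longrightarrow> v \<in> {u \<in> E510. T u \<in> ?N}"
      unfolding openin_E510_top by blast
    then show "\<exists>q. \<forall>u\<in>E510. agree_below q u 0 \<longrightarrow> agree_below p (T u) 0"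
      by (intro exI[of _ q]) (auto simp: agree_below_def)
  qed
next
  assume c: "E510_continuous T"
  show "continuous_map E510_top E510_top T" unfolding continuous_map_def
  proof (intro conjI allI impI)
    show "T \<in> topspace E510_top \<rightarrow> topspace E510_top" using E510_linearD(1)[OF assms] by auto
    fix U assume U: "openin E510_top U"
    have "\<exists>q. \<forall>v\<in>E510. agree_below q u v \<longrightarrow> v \<in> E510 \<and> T v \<in> U" if u: "u \<in> E510" "T u \<in> U" for u
    proof -
      obtain p where p: "\<And>v. v \<in> E510 \<Longrightarrow> agree_below p (T u) v \<Longrightarrow> v \<in> U" using U u unfolding openin_E510_top by blast
      obtain q where q: "\<And>u. u \<in> E510 \<Longrightarrow> agree_below q u 0 \<Longrightarrow> agree_below p (T u) 0" using c unfolding E510_continuous_def by blast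
      have "T v \<in> U" if v: "v \<in> E510" "agree_below q u v" for v
      proof (rule p)
        show "T v \<in> E510" using v E510_linearD(1)[OF assms] by auto
        show "agree_below p (T u) (T v)"
          using q[of "u - v"] v u E510_vector_space(3) agree_below_diff[of q u v] agree_below_diff[of p "T u" "T v"]
          by (simp add: E510_linearD(6)[OF assms])
      qed
      then show ?thesis by blast
    qed
    then show "openin E510_top {x \<in> topspace E510_top. T x \<in> U}"
      unfolding openin_E510_top by auto
  qed
qed

text \<open>The coordinates are linearly dependent on \<open>E510\<close>, because of the divergence
  and closedness conditions, so coefficients cannot be read off from basis vectors. In the
  induction, a coordinate \<open>b0\<close> that vanishes wherever those in \<open>B\<close> do is
  dropped; otherwise some \<open>u1\<close> is dual to it modulo \<open>B\<close>, and
  \<open>f\<close> is corrected by \<open>f u1\<close> times that coordinate.\<close>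

lemma functional_vanishing_on_kernel:
  fixes f :: "elt \<Rightarrow> complex"
  assumes "finite B"
    and add: "\<And>u v. u \<in> E510 \<Longrightarrow> v \<in> E510 \<Longrightarrow> f (u + v) = f u + f v"
    and scale: "\<And>c u. u \<in> E510 \<Longrightarrow> f (elt_scale c u) = c * f u"
    and ker: "\<And>u. u \<in> E510 \<Longrightarrow> (\<forall>b\<in>B. elt_coord u b = 0) \<Longrightarrow> f u = 0"
  shows "\<exists>c. \<forall>u\<in>E510. f u = (\<Sum>b\<in>B. c b * elt_coord u b)"
  using assms
proof (induction B arbitrary: f rule: finite_induct)
  case empty
  then show ?case by simp
next
  case (insert b0 B)
  show ?case
  proof (cases "\<forall>u\<in>E510. (\<forall>b\<in>B. elt_coord u b = 0) \<longrightarrow> elt_coord u b0 = 0")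
    case True
    then obtain c where c: "\<forall>u\<in>E510. f u = (\<Sum>b\<in>B. c b * elt_coord u b)"
      using insert.IH[of f] insert.prems by auto
    have "\<forall>u\<in>E510. f u = (\<Sum>b\<in>insert b0 B. (c(b0 := 0)) b * elt_coord u b)"
    proof
      fix u assume "u \<in> E510"
      have "(\<Sum>b\<in>B. (c(b0 := 0)) b * elt_coord u b) = (\<Sum>b\<in>B. c b * elt_coord u b)"
        using insert.hyps by (intro sum.cong) auto
      then show "f u = (\<Sum>b\<in>insert b0 B. (c(b0 := 0)) b * elt_coord u b)" using c \<open>u \<in> E510\<close> insert.hyps by simp
    qed
    then show ?thesis by blast
  next
    case False
    then obtain u0 where u0: "u0 \<in> E510" "\<forall>b\<in>B. elt_coord u0 b = 0" "elt_coord u0 b0 \<noteq> 0" by blast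
    define u1 where "u1 = elt_scale (1 / elt_coord u0 b0) u0"
    have u1: "u1 \<in> E510" "\<forall>b\<in>B. elt_coord u1 b = 0" "elt_coord u1 b0 = 1"
      using u0 by (auto simp: u1_def E510_vector_space elt_coord_linear)
    define g where "g u = f u - elt_coord u b0 * f u1" for u
    have "\<exists>c. \<forall>u\<in>E510. g u = (\<Sum>b\<in>B. c b * elt_coord u b)"
    proof (rule insert.IH)
      show "g (u + v) = g u + g v" if "u \<in> E510" "v \<in> E510" for u v
        using insert.prems(1) that by (simp add: g_def elt_coord_linear algebra_simps)
      show "g (elt_scale c u) = c * g u" if "u \<in> E510" for c u
        using insert.prems(2) that by (simp add: g_def elt_coord_linear algebra_simps)
      show "g u = 0" if u: "u \<in> E510" "\<forall>b\<in>B. elt_coord u b = 0" for u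
      proof -
        let ?v = "u + elt_scale (- elt_coord u b0) u1"
        have "f ?v = 0"
          using u u1 by (intro insert.prems(3)) (auto simp: E510_vector_space elt_coord_linear)
        then show ?thesis using insert.prems(1,2) u u1 by (simp add: g_def E510_vector_space)
      qed
    qed
    then obtain c where c: "\<forall>u\<in>E510. g u = (\<Sum>b\<in>B. c b * elt_coord u b)" by blast
    have "\<forall>u\<in>E510. f u = (\<Sum>b\<in>insert b0 B. (c(b0 := f u1)) b * elt_coord u b)"
    proof
      fix u assume "u \<in> E510"
      have "(\<Sum>b\<in>B. (c(b0 := f u1)) b * elt_coord u b) = (\<Sum>b\<in>B. c b * elt_coord u b)"
        using insert.hyps by (intro sum.cong) auto
      then show "f u = (\<Sum>b\<in>insert b0 B. (c(b0 := f u1)) b * elt_coord u b)" using c \<open>u \<in> E510\<close> insert.hyps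
        by (simp add: g_def algebra_simps)
    qed
    then show ?thesis by blast
  qed
qed

text \<open>Over the discrete field, continuity says that a coordinate of \<open>T u\<close>
  vanishes as soon as finitely many coordinates of \<open>u\<close> do. The finite rows obtained
  from this also make \<open>T\<close> compatible with limits for the usual topology of the complex
  numbers.\<close>

lemma E510_continuous_rows:
  assumes "E510_linear T" "E510_continuous T"
  obtains B c where "finite B" "\<And>u. u \<in> E510 \<Longrightarrow> elt_coord (T u) b = (\<Sum>b'\<in>B. c b' * elt_coord u b')"
proof -
  obtain q where q: "\<And>u. u \<in> E510 \<Longrightarrow> agree_below q u 0 \<Longrightarrow> agree_below (level b + 1) (T u) 0"
    using assms(2) unfolding E510_continuous_def by blast
  have "\<exists>c. \<forall>u\<in>E510. elt_coord (T u) b = (\<Sum>b'\<in>{b. level b < q}. c b' * elt_coord u b')"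
  proof (rule functional_vanishing_on_kernel[OF finite_level])
    fix u assume "u \<in> E510" "\<forall>b\<in>{b. level b < q}. elt_coord u b = 0"
    then have "agree_below (level b + 1) (T u) 0" by (intro q) (auto simp: agree_below_def elt_coord_linear)
    then show "elt_coord (T u) b = 0" by (rule agree_below_zeroD) simp
  qed (simp_all add: E510_linearD[OF assms(1)] elt_coord_linear)
  then show ?thesis using that[OF finite_level] by blast
qed

definition coord_tendsto :: "(nat \<Rightarrow> elt) \<Rightarrow> elt \<Rightarrow> bool" where
  "coord_tendsto s w \<longleftrightarrow> (\<forall>b. (\<lambda>n. elt_coord (s n) b) \<longlonglongrightarrow> elt_coord w b)"

lemma coord_tendsto_unique: "coord_tendsto s u \<Longrightarrow> coord_tendsto s v \<Longrightarrow> u = v"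
  by (rule elt_eqI) (metis LIMSEQ_unique coord_tendsto_def)

lemma coord_tendsto_linear:
  assumes "E510_linear T" "E510_continuous T" "\<And>n. s n \<in> E510" "w \<in> E510" "coord_tendsto s w"
  shows "coord_tendsto (\<lambda>n. T (s n)) (T w)"
  unfolding coord_tendsto_def
proof
  fix b
  obtain B c where *: "finite B" "\<And>u. u \<in> E510 \<Longrightarrow> elt_coord (T u) b = (\<Sum>b'\<in>B. c b' * elt_coord u b')"
    using E510_continuous_rows[OF assms(1,2)] by blast
  have "(\<lambda>n. \<Sum>b'\<in>B. c b' * elt_coord (s n) b') \<longlonglongrightarrow> (\<Sum>b'\<in>B. c b' * elt_coord w b')"
    using assms(5) unfolding coord_tendsto_def by (intro tendsto_intros) auto
  then show "(\<lambda>n. elt_coord (T (s n)) b) \<longlonglongrightarrow> elt_coord (T w) b" using *(2) assms(3,4) by simp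
qed

text \<open>Each defining equation of \<open>E510\<close> involves finitely many coefficients and so
  passes to the limit.\<close>

lemma E510_coord_closed:
  assumes "\<And>n. s n \<in> E510" "coord_tendsto s w"
  shows "w \<in> E510"
proof -
  have e: "(\<lambda>n. mps_coeff (fst (s n) i) m) \<longlonglongrightarrow> mps_coeff (fst w i) m" for i m
    using assms(2)[unfolded coord_tendsto_def, rule_format, of "(Inl i, m)"] by simp
  have o: "(\<lambda>n. mps_coeff (snd (s n) I) m) \<longlonglongrightarrow> mps_coeff (snd w I) m" for I m
    using assms(2)[unfolded coord_tendsto_def, rule_format, of "(Inr I, m)"] by simp
  have fm: "(\<lambda>n. mps_coeff (form_matrix (snd (s n)) i j) m) \<longlonglongrightarrow> mps_coeff (form_matrix (snd w) i j) m" for i j m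
    using o[of "{i, j}" m] by (auto simp: form_matrix_def intro!: tendsto_intros)
  note s = assms(1)[unfolded E510_iff]
  have "divergence (fst w) = 0"
  proof (rule mps_eqI)
    fix m :: "5 \<Rightarrow> nat"
    have "(\<lambda>n. mps_coeff (divergence (fst (s n))) m) \<longlonglongrightarrow> mps_coeff (divergence (fst w)) m"
      unfolding divergence_def mps_coeff_sum mps_coeff_partial by (intro tendsto_intros e)
    then show "mps_coeff (divergence (fst w)) m = mps_coeff 0 m"
      using s by (simp add: LIMSEQ_const_iff)
  qed
  moreover have w: "snd w \<in> Omega 2" unfolding Omega_def
  proof (intro CollectI allI impI mps_eqI)
    fix I :: "5 set" and m assume "card I \<noteq> 2"
    then have "(\<lambda>n. mps_coeff (snd (s n) I) m) = (\<lambda>n. 0)" using s by (auto simp: Omega_def)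
    then show "mps_coeff (snd w I) m = mps_coeff 0 m" using o[of I m] by (simp add: LIMSEQ_const_iff)
  qed
  moreover have "ext_d (snd w) = 0" unfolding closed_matrix_iff[OF w] closed_matrix_def
  proof (intro allI mps_eqI)
    fix i j k :: 5 and m
    let ?f = "\<lambda>\<omega>. mps_partial i (form_matrix \<omega> j k) + mps_partial j (form_matrix \<omega> k i) + mps_partial k (form_matrix \<omega> i j)"
    have "?f (snd (s n)) = 0" for n
      using s[of n] closed_matrix_iff unfolding closed_matrix_def by blast
    moreover have "(\<lambda>n. mps_coeff (?f (snd (s n))) m) \<longlonglongrightarrow> mps_coeff (?f (snd w)) m"
      unfolding mps_coeff_add mps_coeff_partial by (intro tendsto_intros fm)
    ultimately show "mps_coeff (?f (snd w)) m = mps_coeff 0 m" by (simp add: LIMSEQ_const_iff)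
  qed
  ultimately show ?thesis by (simp add: E510_iff)
qed

lemma E510_linear_bracket: "u \<in> E510 \<Longrightarrow> E510_linear (E510_bracket u)" "u \<in> E510 \<Longrightarrow> E510_linear (\<lambda>v. E510_bracket v u)"
  by (simp_all add: E510_linear_def E510_bracket_closed E510_bracket_linear E510_bracket_scale)

lemma agree_below_bracket_add:
  assumes "u \<in> E510" "v \<in> E510" "agree_below p u 0" "agree_below q v 0"
  shows "agree_below (p + q) (E510_bracket u v) 0"
proof (rule agree_below_zeroI)
  fix b assume b: "level b < p + q"
  show "elt_coord (E510_bracket u v) b = 0"
  proof (rule ccontr)
    assume "elt_coord (E510_bracket u v) b \<noteq> 0"
    then obtain b1 b2 where *: "elt_coord u b1 \<noteq> 0" "elt_coord v b2 \<noteq> 0" "level b = level b1 + level b2"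
      using level_bracket assms by blast
    then have "level b1 \<ge> p" "level b2 \<ge> q" using agree_below_zeroD assms(3,4) by (meson not_le)+
    then show False using b * by simp
  qed
qed

text \<open>The least level occurring in the algebra is -2, so a bracket with an arbitrary element
  lowers the order of agreement by at most 2.\<close>

lemma agree_below_bracket:
  assumes "u \<in> E510" "v \<in> E510" "agree_below q u 0"
  shows "agree_below (q - 2) (E510_bracket u v) 0" "agree_below (q - 2) (E510_bracket v u) 0"
proof -
  have "agree_below (- 2) v 0" using level_ge[OF assms(2)] by (intro agree_below_zeroI) force
  then show "agree_below (q - 2) (E510_bracket u v) 0" "agree_below (q - 2) (E510_bracket v u) 0"
    using agree_below_bracket_add[OF assms(1,2,3)] agree_below_bracket_add[OF assms(2,1) _ assms(3)] by fastforce+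
qed

lemma E510_continuous_bracket:
  "u \<in> E510 \<Longrightarrow> E510_continuous (E510_bracket u)" "u \<in> E510 \<Longrightarrow> E510_continuous (\<lambda>v. E510_bracket v u)"
  unfolding E510_continuous_def
  using agree_below_bracket(2) agree_below_bracket(1) by (metis add_diff_cancel_right')+

declare split_paired_All [simp del] split_paired_Ex [simp del]

section \<open>Derivations and the adjoint representation\<close>

lemma E510_linear_restrict: "E510_linear (restrict f E510) \<longleftrightarrow> E510_linear f"
  by (auto simp: E510_linear_def E510_vector_space)

lemma E510_continuous_restrict: "E510_continuous (restrict f E510) \<longleftrightarrow> E510_continuous f"
  by (auto simp: E510_continuous_def)

lemma E510_linear_add: "E510_linear S \<Longrightarrow> E510_linear T \<Longrightarrow> E510_linear (\<lambda>u. S u + T u)"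
proof -
  have "elt_scale c (u + v) = elt_scale c u + elt_scale c v" for c u v
    by (rule elt_eqI) (simp add: elt_coord_linear algebra_simps)
  then show "E510_linear S \<Longrightarrow> E510_linear T \<Longrightarrow> E510_linear (\<lambda>u. S u + T u)"
    by (auto simp: E510_linear_def E510_vector_space)
qed

lemma E510_continuous_add: "E510_continuous S \<Longrightarrow> E510_continuous T \<Longrightarrow> E510_continuous (\<lambda>u. S u + T u)"
  unfolding E510_continuous_def
proof
  fix p
  assume "\<forall>p. \<exists>q. \<forall>u\<in>E510. agree_below q u 0 \<longrightarrow> agree_below p (S u) 0" "\<forall>p. \<exists>q. \<forall>u\<in>E510. agree_below q u 0 \<longrightarrow> agree_below p (T u) 0"
  then obtain q q' where q: "\<forall>u\<in>E510. agree_below q u 0 \<longrightarrow> agree_below p (S u) 0" "\<forall>u\<in>E510. agree_below q' u 0 \<longrightarrow> agree_below p (T u) 0"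
    by meson
  have "agree_below p (S u + T u) 0" if "u \<in> E510" "agree_below (max q q') u 0" for u
  proof -
    have "agree_below p (S u) 0" "agree_below p (T u) 0"
      using q that agree_below_mono[OF that(2)] by auto
    then show ?thesis by (auto intro!: agree_below_zeroI simp: elt_coord_linear agree_below_zeroD)
  qed
  then show "\<exists>q. \<forall>u\<in>E510. agree_below q u 0 \<longrightarrow> agree_below p (S u + T u) 0" by blast
qed

lemma Der_part_simps:
  assumes "D \<in> Der_part p"
  shows "E510_linear D" "E510_continuous D" "D \<in> extensional E510"
    "\<And>u q. u \<in> E510_part q \<Longrightarrow> D u \<in> E510_part (p + q)"
    "\<And>u v q. u \<in> E510_part q \<Longrightarrow> v \<in> E510 \<Longrightarrow>
      D (E510_bracket u v) = E510_bracket (D u) v + elt_scale ((-1) ^ (p * q)) (E510_bracket u (D v))"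
proof -
  show l: "E510_linear D" using assms unfolding Der_part_def E510_linear_def by (auto simp: PiE_iff)
  show "E510_continuous D" using assms continuous_map_E510[OF l] unfolding Der_part_def by auto
  show "D \<in> extensional E510" using assms unfolding Der_part_def by (auto simp: PiE_iff)
  show "\<And>u q. u \<in> E510_part q \<Longrightarrow> D u \<in> E510_part (p + q)" using assms unfolding Der_part_def by blast
  show "\<And>u v q. u \<in> E510_part q \<Longrightarrow> v \<in> E510 \<Longrightarrow>
      D (E510_bracket u v) = E510_bracket (D u) v + elt_scale ((-1) ^ (p * q)) (E510_bracket u (D v))"
    using assms unfolding Der_part_def by blast
qed

lemma Der_partI:
  assumes "E510_linear D" "E510_continuous D" "D \<in> extensional E510"
    "\<And>u q. u \<in> E510_part q \<Longrightarrow> D u \<in> E510_part (p + q)"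
    "\<And>u v q. u \<in> E510_part q \<Longrightarrow> v \<in> E510 \<Longrightarrow>
      D (E510_bracket u v) = E510_bracket (D u) v + elt_scale ((-1) ^ (p * q)) (E510_bracket u (D v))"
  shows "D \<in> Der_part p"
  unfolding Der_part_def using assms continuous_map_E510[OF assms(1)]
  by (auto simp: PiE_iff E510_linear_def)

lemma Der_simps:
  assumes "D \<in> Der"
  shows "E510_linear D" "E510_continuous D" "D \<in> extensional E510" "u \<in> E510 \<Longrightarrow> D u \<in> E510"
proof -
  obtain D1 D2 where D: "D = Der_add D1 D2" "D1 \<in> Der_part 0" "D2 \<in> Der_part 1" using assms unfolding Der_def by blast
  show "E510_linear D" "E510_continuous D" "D \<in> extensional E510"
    unfolding D Der_add_def using Der_part_simps[OF D(2)] Der_part_simps[OF D(3)]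
    by (simp_all add: E510_linear_restrict E510_continuous_restrict E510_linear_add E510_continuous_add)
  then show "u \<in> E510 \<Longrightarrow> D u \<in> E510" by (auto simp: E510_linear_def)
qed

lemma E510_part_simps: "u \<in> E510_part p \<Longrightarrow> u \<in> E510" "E510_part (Suc (Suc p)) = E510_part p"
  "u \<in> E510 \<Longrightarrow> (fst u, 0) \<in> E510_part 0" "u \<in> E510 \<Longrightarrow> (0, snd u) \<in> E510_part 1"
  "0 \<in> E510_part p"
  "u \<in> E510_part p \<Longrightarrow> v \<in> E510_part p \<Longrightarrow> u + v \<in> E510_part p"
  "u \<in> E510_part p \<Longrightarrow> elt_scale c u \<in> E510_part p"
  using E510_vector_space by (auto simp: E510_part_def elt_scale_def)

lemma E510_part_iff_coord:
  assumes "u \<in> E510"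
  shows "u \<in> E510_part q \<longleftrightarrow> (\<forall>x m. isl x = odd q \<longrightarrow> elt_coord u (x, m) = 0)"
proof -
  have "fst u = 0 \<longleftrightarrow> (\<forall>i m. elt_coord u (Inl i, m) = 0)" "snd u = 0 \<longleftrightarrow> (\<forall>I m. elt_coord u (Inr I, m) = 0)"
    by (auto intro!: mps_eqI)
  moreover have "(\<forall>x m. isl x = odd q \<longrightarrow> elt_coord u (x, m) = 0) \<longleftrightarrow>
    (if odd q then \<forall>i m. elt_coord u (Inl i, m) = 0 else \<forall>I m. elt_coord u (Inr I, m) = 0)"
    by (auto simp del: elt_coord_Inl elt_coord_Inr) (metis isl_def, metis sum.collapse(2))
  ultimately show ?thesis using assms by (simp add: E510_part_def)
qed

lemma elt_scale_zero [simp]: "elt_scale c 0 = 0"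
  by (rule elt_eqI) (simp add: elt_coord_linear)

lemma Der_part_add_zero: "D \<in> Der_part p \<Longrightarrow> p = 0 \<or> p = 1 \<Longrightarrow> D \<in> Der"
proof -
  assume D: "D \<in> Der_part p" "p = 0 \<or> p = 1"
  have z: "(\<lambda>u\<in>E510. 0) \<in> Der_part q" for q
    using E510_part_simps(1)
    by (intro Der_partI) (simp_all add: E510_linear_def E510_vector_space E510_continuous_def agree_below_def E510_bracket_closed
      E510_bracket_linear E510_part_simps(5))
  have "D = Der_add D (\<lambda>u\<in>E510. 0)" "D = Der_add (\<lambda>u\<in>E510. 0) D"
    using Der_part_simps(3)[OF D(1)] by (simp_all add: Der_add_def fun_eq_iff restrict_def extensional_def)
  then show "D \<in> Der" using D z unfolding Der_def by (metis (mono_tags, lifting) mem_Collect_eq)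
qed

lemma Der_even_derivation:
  assumes "a \<in> Der_part 0" "u \<in> E510" "v \<in> E510"
  shows "a (E510_bracket u v) = E510_bracket (a u) v + E510_bracket u (a v)"
proof -
  note a = Der_part_simps[OF assms(1)]
  have *: "a (E510_bracket w v) = E510_bracket (a w) v + E510_bracket w (a v)" if "w \<in> E510_part q" for w q
    using a(5)[OF that assms(3)] by (simp add: elt_scale_simps)
  have m: "(fst u, 0) \<in> E510" "(0, snd u) \<in> E510" using assms E510_vector_space by auto
  note h = *[OF E510_part_simps(3)[OF assms(2)]] *[OF E510_part_simps(4)[OF assms(2)]]
  have "a (E510_bracket ((fst u, 0) + (0, snd u)) v) = E510_bracket (a ((fst u, 0) + (0, snd u))) v + E510_bracket ((fst u, 0) + (0, snd u)) (a v)"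
    by (simp only: E510_bracket_linear E510_linearD(2)[OF a(1) m] E510_linearD(2)[OF a(1) E510_bracket_closed[OF m(1) assms(3)] E510_bracket_closed[OF m(2) assms(3)]] h)
      (simp add: algebra_simps)
  then show ?thesis by simp
qed

lemma E510_ad_Der_part:
  assumes "u \<in> E510_part p"
  shows "E510_ad u \<in> Der_part p"
proof (rule Der_partI)
  have u: "u \<in> E510" using assms E510_part_simps by blast
  show "E510_linear (E510_ad u)" "E510_continuous (E510_ad u)"
    unfolding E510_ad_def using E510_linear_bracket(1)[OF u] E510_continuous_bracket(1)[OF u]
    by (simp_all add: E510_linear_restrict E510_continuous_restrict)
  show "E510_ad u v \<in> E510_part (p + q)" if "v \<in> E510_part q" for v q
    using that assms E510_bracket_closed[of u v]
    by (auto simp: E510_ad_def E510_part_def E510_bracket_def vf_bracket_linear wedge_linear vf_of_form_linear lie_deriv_linear)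
  fix v w q assume v: "v \<in> E510_part q" and w: "w \<in> E510"
  then show "E510_ad u (E510_bracket v w) = E510_bracket (E510_ad u v) w + elt_scale ((- 1) ^ (p * q)) (E510_bracket v (E510_ad u w))"
    using E510_bracket_super_derivation[OF assms v w] E510_part_simps(1)[OF v] E510_bracket_closed
    by (simp add: E510_ad_def)
qed (simp add: E510_ad_def)

lemma E510_ad_add: "Der_add (E510_ad u) (E510_ad v) = E510_ad (u + v)"
  by (auto simp: Der_add_def E510_ad_def E510_bracket_linear fun_eq_iff restrict_def)

lemma E510_ad_scale: "Der_scale c (E510_ad u) = E510_ad (elt_scale c u)"
  by (auto simp: Der_scale_def E510_ad_def E510_bracket_scale fun_eq_iff restrict_def)

lemma E510_ad_Der: "u \<in> E510 \<Longrightarrow> E510_ad u \<in> Der"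
proof -
  assume u: "u \<in> E510"
  have "E510_ad u = Der_add (E510_ad (fst u, 0)) (E510_ad (0, snd u))"
    unfolding E510_ad_add by simp
  then show "E510_ad u \<in> Der"
    using E510_ad_Der_part E510_part_simps(3,4)[OF u] unfolding Der_def by blast
qed

lemma Der_ad_apply: "u \<in> E510 \<Longrightarrow> Der_ad a D u = a (D u) - D (a u)"
  by (simp add: Der_ad_def Der_bracket_def elt_scale_simps)

lemma Der_ad_E510_ad:
  assumes "a \<in> Der_part 0" "u \<in> E510"
  shows "Der_ad a (E510_ad u) = E510_ad (a u)"
proof
  fix v
  have "a v \<in> E510" if "v \<in> E510" using Der_part_simps(1)[OF assms(1)] that by (auto simp: E510_linear_def)
  then show "Der_ad a (E510_ad u) v = E510_ad (a u) v"
    using Der_even_derivation[OF assms, of v]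
    by (cases "v \<in> E510") (auto simp: Der_ad_def Der_bracket_def elt_scale_simps E510_ad_def)
qed

lemma E510_funpow: "E510_linear a \<Longrightarrow> u \<in> E510 \<Longrightarrow> (a ^^ n) u \<in> E510"
  by (induction n) (auto simp: E510_linear_def)

lemma Der_ad_funpow_E510_ad:
  assumes "a \<in> Der_part 0" "u \<in> E510"
  shows "(Der_ad a ^^ n) (E510_ad u) = E510_ad ((a ^^ n) u)"
  using assms by (induction n) (auto simp: Der_ad_E510_ad E510_funpow Der_part_simps(1))

section \<open>Constant and linear fields, and faithfulness of the adjoint representation\<close>

definition const_vf :: "5 \<Rightarrow> elt" where
  "const_vf k = ((\<lambda>i. if i = k then 1 else 0), 0)"

definition linear_vf :: "5 \<Rightarrow> 5 \<Rightarrow> elt" where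
  "linear_vf i j = ((\<lambda>k. if k = j then mps_var i else 0), 0)"

lemma mps_partial_one [simp]: "mps_partial i 1 = 0"
  using mps_partial_const[of i 1] by (simp add: mps_const_simps)

lemma vf_apply_single: "vf_apply (\<lambda>i. if i = k then g else 0) f = g * mps_partial k f"
  by (simp add: vf_apply_def if_distrib[of "\<lambda>x. x * _"] cong: if_cong)

lemma const_vf_E510: "const_vf k \<in> E510_part 0"
  by (auto simp: const_vf_def E510_part_def E510_iff divergence_def ext_d_linear Omega_def if_distrib[of "mps_partial _"] cong: if_cong)

lemma linear_vf_E510: "i \<noteq> j \<Longrightarrow> linear_vf i j \<in> E510_part 0"
  by (auto simp: linear_vf_def E510_part_def E510_iff divergence_def ext_d_linear Omega_def mps_partial_var
      if_distrib[of "mps_partial _"] cong: if_cong)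

lemma fst_bracket_even: "snd v = 0 \<Longrightarrow> fst (E510_bracket v w) = vf_bracket (fst v) (fst w)"
  and snd_bracket_even: "snd v = 0 \<Longrightarrow> snd (E510_bracket v w) = lie_deriv (fst v) (snd w)"
  by (simp_all add: E510_bracket_def wedge_linear vf_of_form_linear lie_deriv_linear)

lemma bracket_even_antisym: "v \<in> E510_part 0 \<Longrightarrow> w \<in> E510 \<Longrightarrow> E510_bracket w v = - E510_bracket v w"
proof -
  assume "v \<in> E510_part 0" "w \<in> E510"
  then have "snd v = 0" by (auto simp: E510_part_def)
  then show ?thesis
    by (simp add: E510_bracket_def wedge_linear vf_of_form_linear lie_deriv_linear vf_bracket_antisym[of "fst w"] prod_eq_iff)
qed

lemma coord_form_matrix:
  assumes "i \<noteq> j"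
  shows "elt_coord u (Inr {i, j}, m) = (if i < j then 1 else - 1) * mps_coeff (form_matrix (snd u) i j) m"
  using assms by (auto simp: form_matrix_def)

lemma coord_bracket_const_vf:
  assumes "w \<in> E510"
  shows "elt_coord (E510_bracket (const_vf k) w) (x, m) = of_nat (Suc (m k)) * elt_coord w (x, m + unit_exp k)"
proof (cases x)
  case (Inl i)
  have "vf_bracket (fst (const_vf k)) (fst w) i = mps_partial k (fst w i)"
    by (simp add: vf_bracket_eq const_vf_def vf_apply_single vf_apply_linear)
       (simp add: vf_apply_def if_distrib[of "mps_partial _"] cong: if_cong)
  then show ?thesis by (simp add: Inl fst_bracket_even const_vf_def mps_coeff_partial)
next
  case (Inr I)
  have k: "const_vf k \<in> E510" using const_vf_E510 E510_part_simps by blast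
  have w: "snd w \<in> Omega 2" "ext_d (snd w) = 0" using assms by (auto simp: E510_iff)
  show ?thesis
  proof (cases "card I = 2")
    case True
    then obtain i j where I: "I = {i, j}" "i \<noteq> j" by (auto simp: card_2_iff)
    have "form_matrix (lie_deriv (fst (const_vf k)) (snd w)) i j = mps_partial k (form_matrix (snd w) i j)"
      unfolding form_matrix_lie_deriv[OF w] lie_matrix_def const_vf_def fst_conv vf_apply_single
      by (simp add: if_distrib[of "mps_partial _"] cong: if_cong)
    then show ?thesis unfolding Inr I coord_form_matrix[OF I(2)]
      by (simp add: snd_bracket_even const_vf_def mps_coeff_partial)
  next
    case False
    then show ?thesis unfolding Inr by (metis E510_coord_Inr E510_bracket_closed k assms mult_zero_right)
  qed
qed

lemma form_matrix_bracket_linear_vf: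
  assumes "w \<in> E510"
  shows "form_matrix (snd (E510_bracket (linear_vf i j) w)) p q = mps_var i * mps_partial j (form_matrix (snd w) p q) +
    (if p = i then form_matrix (snd w) j q else 0) + (if q = i then form_matrix (snd w) p j else 0)"
proof -
  have w: "snd w \<in> Omega 2" "ext_d (snd w) = 0" using assms by (auto simp: E510_iff)
  have "form_matrix (snd (E510_bracket (linear_vf i j) w)) p q = lie_matrix (fst (linear_vf i j)) (form_matrix (snd w)) p q"
    using form_matrix_lie_deriv[OF w] by (simp add: snd_bracket_even linear_vf_def)
  then show ?thesis
    by (simp add: lie_matrix_def linear_vf_def vf_apply_single if_distrib[of "mps_partial _"] if_distrib[of "\<lambda>x. x * _"]
       mps_partial_var sum.distrib cong: if_cong)
qed

lemma vf_bracket_linear_vf: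
  "fst (E510_bracket (linear_vf i j) w) k = mps_var i * mps_partial j (fst w k) - (if k = j then fst w i else 0)"
proof -
  have "vf_apply Y (if k = j then mps_var i else 0) = (if k = j then Y i else 0)" for Y :: "5 vfield"
    by (simp add: vf_apply_def mps_partial_var if_distrib[of "\<lambda>x. _ * x"] cong: if_cong)
  then show ?thesis by (simp add: fst_bracket_even linear_vf_def vf_bracket_eq vf_apply_single)
qed

lemma mps_coeff_var_mult_0 [simp]: "mps_coeff (mps_var i * f) 0 = 0"
  by (simp add: mps_coeff_var_mult)

lemma ex_other_5: "\<exists>l::5. l \<noteq> i \<and> l \<noteq> j"
proof -
  have "(0::5) \<noteq> 1" "(0::5) \<noteq> 2" "(1::5) \<noteq> 2" by simp_all
  then show ?thesis by metis
qed

text \<open>A quantitative form of faithfulness: a coordinate at a nonconstant monomial is detected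
  by a bracket with a constant field, one at the constant monomial by a bracket with a linear field.
  As \<open>v\<close> depends only on the coordinate, statements about brackets transfer to the
  elements themselves; injectivity, convergence and continuity are each obtained in this
  way.\<close>

lemma coord_from_bracket:
  "\<exists>v\<in>E510. \<exists>c b'. \<forall>w\<in>E510. elt_coord w b = c * elt_coord (E510_bracket w v) b'"
proof -
  obtain x m where b: "b = (x, m)" by force
  have even: "\<exists>v\<in>E510. \<exists>c b'. \<forall>w\<in>E510. elt_coord w b = c * elt_coord (E510_bracket w v) b'"
    if v: "v \<in> E510_part 0" and *: "\<And>w. w \<in> E510 \<Longrightarrow> elt_coord w b = c * elt_coord (E510_bracket v w) b'" for v c b'
    using * E510_part_simps(1)[OF v] bracket_even_antisym[OF v]
    by (intro bexI[of _ v] exI[of _ "- c"] exI[of _ b']) (auto simp: elt_coord_linear)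
  show ?thesis
  proof (cases "m = 0")
    case False
    then obtain k where k: "m k \<noteq> 0" by (auto simp: fun_eq_iff)
    have m: "m - unit_exp k + unit_exp k = m" using k by (auto simp: fun_eq_iff unit_exp_def)
    have "elt_coord w b = (1 / of_nat (m k)) * elt_coord (E510_bracket (const_vf k) w) (x, m - unit_exp k)" if "w \<in> E510" for w
      unfolding b coord_bracket_const_vf[OF that] m using k by simp
    then show ?thesis by (rule even[OF const_vf_E510])
  next
    case m: True
    show ?thesis
    proof (cases x)
      case (Inl i)
      obtain j where j: "j \<noteq> i" using ex_other_5 by metis
      have "elt_coord w b = - 1 * elt_coord (E510_bracket (linear_vf i j) w) (Inl j, 0)" for w
        unfolding b Inl m by (simp add: vf_bracket_linear_vf)
      then show ?thesis using even[OF linear_vf_E510[of i j]] j by metis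
    next
      case (Inr I)
      show ?thesis
      proof (cases "card I = 2")
        case True
        then obtain j k where I: "I = {j, k}" "j \<noteq> k" by (auto simp: card_2_iff)
        \<comment> \<open>With \<open>i\<close> outside \<open>{j, k}\<close>, the Lie derivative
          along \<open>linear_vf i j\<close> replaces dx_j by dx_i, so the coefficient at
          \<open>{j, k}\<close> reappears at \<open>{i, k}\<close>; \<open>s\<close> corrects the
          two orderings.\<close>
        obtain i where i: "i \<noteq> j" "i \<noteq> k" using ex_other_5 by metis
        define s where "s = (if j < k then 1 else - 1 :: complex) * (if i < k then 1 else - 1)"
        have "elt_coord w b = s * elt_coord (E510_bracket (linear_vf i j) w) (Inr {i, k}, 0)" if "w \<in> E510" for w
          unfolding b Inr m I coord_form_matrix[OF I(2)] coord_form_matrix[OF i(2)] form_matrix_bracket_linear_vf[OF that]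
          using i by (simp add: s_def)
        then show ?thesis using even[OF linear_vf_E510[of i j]] i(1) by metis
      next
        case False
        then have "\<forall>w\<in>E510. elt_coord w b = 0 * elt_coord (E510_bracket w 0) b"
          using E510_coord_Inr unfolding b Inr by simp
        then show ?thesis using E510_vector_space(1) by blast
      qed
    qed
  qed
qed

lemma E510_ad_inject:
  assumes "u \<in> E510" "v \<in> E510" "E510_ad u = E510_ad v"
  shows "u = v"
proof (rule elt_eqI)
  fix b
  obtain w c b' where *: "w \<in> E510" "\<forall>x\<in>E510. elt_coord x b = c * elt_coord (E510_bracket x w) b'"
    using coord_from_bracket by blast
  have "E510_bracket u w = E510_bracket v w" using fun_cong[OF assms(3), of w] *(1) by (simp add: E510_ad_def)
  then show "elt_coord u b = elt_coord v b" using * assms by simp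
qed

lemma Der_bracket_E510_ad:
  assumes "u \<in> E510_part p" "v \<in> E510_part q"
  shows "Der_bracket p q (E510_ad u) (E510_ad v) = E510_ad (E510_bracket u v)"
proof
  fix w
  have "u \<in> E510" "v \<in> E510" using assms E510_part_simps by blast+
  then show "Der_bracket p q (E510_ad u) (E510_ad v) w = E510_ad (E510_bracket u v) w"
    using E510_bracket_super_derivation[OF assms, of w]
    by (cases "w \<in> E510") (simp_all add: Der_bracket_def E510_ad_def E510_bracket_closed)
qed

section \<open>Exponentials of derivations\<close>

definition exp_partial_sum :: "(elt \<Rightarrow> elt) \<Rightarrow> complex \<Rightarrow> elt \<Rightarrow> nat \<Rightarrow> elt" where
  "exp_partial_sum a t u N = (\<Sum>n<N. elt_scale (t ^ n / fact n) ((a ^^ n) u))"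

lemma exp_partial_sum_E510: "E510_linear a \<Longrightarrow> u \<in> E510 \<Longrightarrow> exp_partial_sum a t u N \<in> E510"
  unfolding exp_partial_sum_def by (intro E510_sum E510_vector_space E510_funpow)

lemma coord_exp_partial_sum:
  "elt_coord (exp_partial_sum a t u N) b = (\<Sum>n<N. t ^ n / fact n * elt_coord ((a ^^ n) u) b)"
  by (simp add: exp_partial_sum_def elt_coord_linear)

lemma ex_coord_tendsto:
  assumes "\<And>b. convergent (\<lambda>n. elt_coord (s n) b)"
  shows "\<exists>w. coord_tendsto s w"
proof -
  define w :: elt where "w = ((\<lambda>i. Abs_mps (\<lambda>m. lim (\<lambda>n. elt_coord (s n) (Inl i, m)))), (\<lambda>I. Abs_mps (\<lambda>m. lim (\<lambda>n. elt_coord (s n) (Inr I, m)))))"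
  have "elt_coord w b = lim (\<lambda>n. elt_coord (s n) b)" for b
    by (cases b; cases "fst b") (auto simp: w_def elt_coord_def)
  then show ?thesis using assms convergent_LIMSEQ_iff unfolding coord_tendsto_def by metis
qed

text \<open>Convergence is only assumed for the series on \<open>Der\<close>. Its partial sums at
  \<open>v\<close> are the brackets of the partial sums of the series on the algebra with
  \<open>v\<close>; by \<open>coord_from_bracket\<close> the latter series converges too, and
  bracketing with \<open>v\<close> commutes with the limit \<open>w\<close>.\<close>

lemma exp_ad_E510_ad:
  assumes "a \<in> Der_part 0" "exp_ad a t \<phi>" "\<phi> \<in> Der \<rightarrow> Der" "u \<in> E510"
  shows "\<exists>w\<in>E510. coord_tendsto (exp_partial_sum a t u) w \<and> \<phi> (E510_ad u) = E510_ad w"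
proof -
  let ?s = "exp_partial_sum a t u"
  note a = Der_part_simps[OF assms(1)]
  have s: "?s N \<in> E510" for N using exp_partial_sum_E510[OF a(1) assms(4)] .
  have conv: "(\<lambda>N. elt_coord (E510_bracket (?s N) v) b) \<longlonglongrightarrow> elt_coord (\<phi> (E510_ad u) v) b" if v: "v \<in> E510" for v b
  proof -
    have "(\<lambda>n. t ^ n / fact n * elt_coord ((Der_ad a ^^ n) (E510_ad u) v) b) sums elt_coord (\<phi> (E510_ad u) v) b"
      using assms(2) E510_ad_Der[OF assms(4)] v unfolding exp_ad_def by blast
    moreover have "(\<Sum>n<N. t ^ n / fact n * elt_coord ((Der_ad a ^^ n) (E510_ad u) v) b) = elt_coord (E510_bracket (?s N) v) b" for N
    proof -
      have "E510_bracket (?s N) v = (\<Sum>n<N. E510_bracket (elt_scale (t ^ n / fact n) ((a ^^ n) u)) v)"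
        unfolding exp_partial_sum_def using E510_linear_bracket(2)[OF v]
        by (rule E510_linearD(7)) (intro E510_vector_space E510_funpow a(1) assms(4))
      then show ?thesis using v unfolding Der_ad_funpow_E510_ad[OF assms(1,4)]
        by (simp add: E510_ad_def E510_bracket_scale elt_coord_linear)
    qed
    ultimately show ?thesis unfolding sums_def by simp
  qed
  have "convergent (\<lambda>N. elt_coord (?s N) b)" for b
  proof -
    obtain v c b' where *: "v \<in> E510" "\<forall>x\<in>E510. elt_coord x b = c * elt_coord (E510_bracket x v) b'"
      using coord_from_bracket by blast
    have "(\<lambda>N. c * elt_coord (E510_bracket (?s N) v) b') \<longlonglongrightarrow> c * elt_coord (\<phi> (E510_ad u) v) b'"
      by (intro tendsto_intros conv *(1))
    then show ?thesis using *(2) s unfolding convergent_def by auto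
  qed
  then obtain w where w: "coord_tendsto ?s w" using ex_coord_tendsto[of ?s] by blast
  then have wE: "w \<in> E510" using E510_coord_closed s by blast
  have \<phi>: "\<phi> (E510_ad u) \<in> Der" using assms(3) E510_ad_Der[OF assms(4)] by auto
  have "\<phi> (E510_ad u) v = E510_ad w v" for v
  proof (cases "v \<in> E510")
    case True
    have "coord_tendsto (\<lambda>N. E510_bracket (?s N) v) (E510_bracket w v)"
      by (rule coord_tendsto_linear[OF E510_linear_bracket(2)[OF True] E510_continuous_bracket(2)[OF True] s wE w])
    moreover have "coord_tendsto (\<lambda>N. E510_bracket (?s N) v) (\<phi> (E510_ad u) v)"
      using conv[OF True] by (simp add: coord_tendsto_def)
    ultimately show ?thesis using True coord_tendsto_unique by (simp add: E510_ad_def)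
  next
    case False
    then show ?thesis using Der_simps(3)[OF \<phi>] by (simp add: E510_ad_def extensional_def)
  qed
  then have "\<phi> (E510_ad u) = E510_ad w" ..
  then show ?thesis using w wE by blast
qed

text \<open>When \<open>A n\<close> is a coordinate of \<open>((ad a) ^^ n) D u\<close>, this says that
  \<open>exp (t ad a) (exp (s ad a) D) = exp ((s + t) ad a) D\<close>.\<close>

lemma exponential_double_series:
  fixes A :: "nat \<Rightarrow> complex"
  assumes summ: "\<And>z. summable (\<lambda>n. z ^ n / fact n * A n)"
    and inner: "\<And>m. (\<lambda>n. s ^ n / fact n * A (n + m)) sums B m"
  shows "(\<lambda>m. t ^ m / fact m * B m) sums (\<Sum>k. (s + t) ^ k / fact k * A k)"
proof -
  define g where "g = (\<lambda>(m, n). t ^ m / fact m * (s ^ n / fact n * A (n + m)))"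
  let ?I = "Sigma (UNIV :: nat set) (\<lambda>k. {..k})"
  define h where "h = (\<lambda>(k, m). t ^ m / fact m * (s ^ (k - m) / fact (k - m) * A k))"
  have binom: "(\<Sum>m\<le>k. t ^ m / fact m * (s ^ (k - m) / fact (k - m) * A)) = (s + t) ^ k / fact k * A" for k A and s t :: complex
  proof -
    have "(s + t) ^ k = (\<Sum>m\<le>k. of_nat (k choose m) * t ^ m * s ^ (k - m))" by (metis add.commute binomial_ring)
    then have "(s + t) ^ k / fact k * A = (\<Sum>m\<le>k. of_nat (k choose m) * t ^ m * s ^ (k - m) / fact k * A)"
      by (simp add: sum_divide_distrib sum_distrib_right)
    also have "\<dots> = (\<Sum>m\<le>k. t ^ m / fact m * (s ^ (k - m) / fact (k - m) * A))"
      by (rule sum.cong) (simp_all add: binomial_fact field_simps)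
    finally show ?thesis by simp
  qed
  have abs: "(\<lambda>x. norm (h x)) summable_on ?I"
  proof -
    let ?r = "norm s + norm t"
    have n: "(\<Sum>m\<le>k. norm (h (k, m))) = norm (of_real (?r ^ k) / fact k * A k)" for k
    proof -
      have "(\<Sum>m\<le>k. norm (h (k, m))) = (\<Sum>m\<le>k. norm t ^ m / fact m * (norm s ^ (k - m) / fact (k - m) * norm (A k)))"
        by (simp add: h_def norm_mult norm_divide norm_power)
      also have "of_real \<dots> = (of_real (norm s) + of_real (norm t)) ^ k / fact k * (of_real (norm (A k)) :: complex)"
        unfolding binom[of "of_real (norm t)" "of_real (norm s)" k "of_real (norm (A k))", symmetric] by simp
      also have "\<dots> = of_real (norm (of_real (?r ^ k) / fact k * A k))"
        by (simp add: norm_mult norm_divide norm_power) (metis abs_of_nonneg add_nonneg_nonneg norm_ge_zero norm_of_real of_real_add)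
      finally show ?thesis by (metis of_real_eq_iff)
    qed
    \<comment> \<open>A power series that converges at the larger radius \<open>?r + 1\<close>
      converges absolutely at \<open>?r\<close>.\<close>
    have "summable (\<lambda>k. norm (A k / fact k * of_real ?r ^ k))"
    proof (rule powser_insidea[of _ "of_real (?r + 1)"])
      have "norm (of_real x :: complex) < norm (of_real (x + 1) :: complex)" if "x \<ge> 0" for x
        using that by (simp only: norm_of_real)
      then show "norm (of_real ?r :: complex) < norm (of_real (?r + 1) :: complex)" by (meson add_nonneg_nonneg norm_ge_zero)
    qed (use summ[of "of_real (?r + 1)"] in \<open>simp add: mult_ac\<close>)
    then have "summable (\<lambda>k. norm (\<Sum>m\<le>k. norm (h (k, m))))"
      unfolding n by (simp add: norm_mult norm_divide norm_power mult_ac)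
    then have "(\<lambda>k. norm (\<Sum>m\<le>k. norm (h (k, m)))) summable_on UNIV"
      by (intro norm_summable_imp_summable_on) simp
    then show ?thesis
      by (intro Infinite_Sum.abs_summable_on_Sigma_iff[THEN iffD2]) simp
  qed
  have "(h has_sum infsum h ?I) ?I"
    using abs_summable_summable[OF abs] by simp
  moreover have "(\<lambda>k. \<Sum>m\<le>k. h (k, m)) = (\<lambda>k. (s + t) ^ k / fact k * A k)"
    by (simp only: h_def prod.case binom)
  ultimately have "((\<lambda>k. (s + t) ^ k / fact k * A k) has_sum infsum h ?I) UNIV"
    using has_sum_Sigma'[where f = h and A = UNIV and B = "\<lambda>k. {..k}" and b = "\<lambda>k. \<Sum>m\<le>k. h (k, m)"]
    by (metis (no_types, lifting) finite_atMost has_sum_finite)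
  then have 1: "infsum h ?I = (\<Sum>k. (s + t) ^ k / fact k * A k)"
    using has_sum_imp_sums sums_unique by blast
  have g: "(g has_sum infsum h ?I) (UNIV \<times> UNIV)"
  proof -
    \<comment> \<open>The substitution \<open>k = n + m\<close> carries all pairs to the triangle;
      the same family is thus summed along diagonals on one side and along rows on the
      other.\<close>
    have "bij_betw (\<lambda>(m, n). (n + m, m)) (UNIV \<times> UNIV) ?I"
      by (rule bij_betwI[of _ _ _ "\<lambda>(k, m). (m, k - m)"]) auto
    then have "((\<lambda>x. h ((\<lambda>(m, n). (n + m, m)) x)) has_sum infsum h ?I) (UNIV \<times> UNIV)"
      using \<open>(h has_sum infsum h ?I) ?I\<close> has_sum_reindex_bij_betw by fastforce
    moreover have "(\<lambda>x. h ((\<lambda>(m, n). (n + m, m)) x)) = g" by (auto simp: g_def h_def)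
    ultimately show ?thesis by simp
  qed
  have "((\<lambda>n. g (m, n)) has_sum t ^ m / fact m * B m) UNIV" for m
  proof -
    have "(\<lambda>n. g (m, n)) summable_on UNIV"
      using summable_on_SigmaD1[of "\<lambda>m n. g (m, n)" UNIV "\<lambda>_. UNIV" m] has_sum_imp_summable[OF g] by auto
    moreover have "(\<lambda>n. g (m, n)) sums (t ^ m / fact m * B m)"
      unfolding g_def using sums_mult[OF inner[of m], of "t ^ m / fact m"] by simp
    ultimately show ?thesis by (metis has_sum_imp_sums has_sum_infsum sums_unique2)
  qed
  then have "((\<lambda>m. t ^ m / fact m * B m) has_sum infsum h ?I) UNIV"
    using has_sum_Sigma'[OF g, of "\<lambda>m. t ^ m / fact m * B m"] by blast
  then show ?thesis unfolding 1 by (rule has_sum_imp_sums)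
qed


lemma Der_ad_funpow_E510:
  assumes "a \<in> Der_part 0" "\<And>u. u \<in> E510 \<Longrightarrow> D u \<in> E510" "u \<in> E510"
  shows "(Der_ad a ^^ n) D u \<in> E510"
  using assms(3)
proof (induction n arbitrary: u)
  case (Suc n)
  then show ?case using E510_linearD(1)[OF Der_part_simps(1)[OF assms(1)]]
    by (simp add: Der_ad_apply E510_vector_space)
qed (use assms in auto)

text \<open>One application of the adjoint action of \<open>a\<close> to a map subtracts its value
  at \<open>a u\<close> from \<open>a\<close> of its value at \<open>u\<close>. The second passes
  through the series because \<open>a\<close> is continuous, the first by the induction hypothesis
  at \<open>a u\<close>; hence \<open>u\<close> is kept arbitrary.\<close>

lemma exp_ad_Der_ad_funpow:
  assumes "a \<in> Der_part 0" "exp_ad a s \<phi>" "\<phi> \<in> Der \<rightarrow> Der" "D \<in> Der" "u \<in> E510"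
  shows "(\<lambda>n. s ^ n / fact n * elt_coord ((Der_ad a ^^ (n + m)) D u) b) sums elt_coord ((Der_ad a ^^ m) (\<phi> D) u) b"
  using assms(5)
proof (induction m arbitrary: u b)
  case 0
  then show ?case using assms unfolding exp_ad_def by simp
next
  case (Suc m)
  note a = Der_part_simps[OF assms(1)]
  have D: "(Der_ad a ^^ n) D u \<in> E510" if "u \<in> E510" for n u
    using that Der_simps(4)[OF assms(4)] Der_ad_funpow_E510[OF assms(1)] by blast
  have "\<phi> D \<in> Der" using assms by auto
  then have G: "(Der_ad a ^^ m) (\<phi> D) u \<in> E510" if "u \<in> E510" for u
    using that Der_simps(4) Der_ad_funpow_E510[OF assms(1)] by blast
  let ?s = "\<lambda>N. \<Sum>n<N. elt_scale (s ^ n / fact n) ((Der_ad a ^^ (n + m)) D u)"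
  have s: "?s N \<in> E510" for N by (intro E510_sum E510_vector_space D Suc.prems)
  have "coord_tendsto ?s ((Der_ad a ^^ m) (\<phi> D) u)"
    using Suc.IH[OF Suc.prems] unfolding coord_tendsto_def sums_def by (simp add: elt_coord_linear)
  then have "coord_tendsto (\<lambda>N. a (?s N)) (a ((Der_ad a ^^ m) (\<phi> D) u))"
    by (intro coord_tendsto_linear[OF a(1,2) s G[OF Suc.prems]])
  moreover have "a (?s N) = (\<Sum>n<N. elt_scale (s ^ n / fact n) (a ((Der_ad a ^^ (n + m)) D u)))" for N
  proof -
    have "a (?s N) = (\<Sum>n<N. a (elt_scale (s ^ n / fact n) ((Der_ad a ^^ (n + m)) D u)))"
      by (rule E510_linearD(7)[OF a(1)]) (intro E510_vector_space D Suc.prems)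
    then show ?thesis using E510_linearD(3)[OF a(1) D[OF Suc.prems]] by simp
  qed
  ultimately have 1: "(\<lambda>n. s ^ n / fact n * elt_coord (a ((Der_ad a ^^ (n + m)) D u)) b) sums elt_coord (a ((Der_ad a ^^ m) (\<phi> D) u)) b"
    unfolding coord_tendsto_def sums_def by (simp add: elt_coord_linear)
  have au: "a u \<in> E510" using E510_linearD(1)[OF a(1) Suc.prems] .
  have "(\<lambda>n. s ^ n / fact n * elt_coord (a ((Der_ad a ^^ (n + m)) D u)) b - s ^ n / fact n * elt_coord ((Der_ad a ^^ (n + m)) D (a u)) b)
     sums (elt_coord (a ((Der_ad a ^^ m) (\<phi> D) u)) b - elt_coord ((Der_ad a ^^ m) (\<phi> D) (a u)) b)"
    by (rule sums_diff[OF 1 Suc.IH[OF au]])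
  then show ?case using Suc.prems
    by (simp add: Der_ad_apply elt_coord_linear right_diff_distrib)
qed

text \<open>For opposite parameters only the term of index 0 of the combined series is nonzero.
  Existence of the exponential at every \<open>z\<close> supplies the absolute convergence that the
  rearrangement requires.\<close>

lemma exp_ad_compose:
  assumes "a \<in> Der_part 0" "exp_ad a s \<phi>" "\<phi> \<in> Der \<rightarrow> Der" "exp_ad a t \<psi>" "\<psi> \<in> Der \<rightarrow> Der"
    "\<And>z. \<exists>\<theta>. exp_ad a z \<theta>" "s + t = 0" "D \<in> Der"
  shows "\<psi> (\<phi> D) = D"
proof
  have m: "\<phi> D \<in> Der" "\<psi> (\<phi> D) \<in> Der" using assms by auto
  fix u
  show "\<psi> (\<phi> D) u = D u"
  proof (cases "u \<in> E510")
    case True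
    show ?thesis
    proof (rule elt_eqI)
      fix b
      let ?A = "\<lambda>n. elt_coord ((Der_ad a ^^ n) D u) b"
      have 1: "(\<lambda>m. t ^ m / fact m * elt_coord ((Der_ad a ^^ m) (\<phi> D) u) b) sums (\<Sum>k. (s + t) ^ k / fact k * ?A k)"
      proof (rule exponential_double_series)
        show "summable (\<lambda>n. z ^ n / fact n * ?A n)" for z
          using assms(6)[of z] assms(8) True unfolding exp_ad_def by (meson sums_summable)
        show "(\<lambda>n. s ^ n / fact n * ?A (n + m)) sums elt_coord ((Der_ad a ^^ m) (\<phi> D) u) b" for m
          by (rule exp_ad_Der_ad_funpow[OF assms(1-3,8) True])
      qed
      have 2: "(\<lambda>m. t ^ m / fact m * elt_coord ((Der_ad a ^^ m) (\<phi> D) u) b) sums elt_coord (\<psi> (\<phi> D) u) b"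
        using assms(4) m(1) True unfolding exp_ad_def by blast
      have 3: "(\<Sum>k. (s + t) ^ k / fact k * ?A k) = elt_coord (D u) b"
      proof -
        have "(\<lambda>k. (0::complex) ^ k / fact k * ?A k) = (\<lambda>k. if k = 0 then ?A 0 else 0)" by auto
        then show ?thesis unfolding assms(7) using sums_unique[OF sums_single[of 0 "\<lambda>_. ?A 0"]] by simp
      qed
      show "elt_coord (\<psi> (\<phi> D) u) b = elt_coord (D u) b" using sums_unique2[OF 2 1] unfolding 3 .
    qed
  next
    case False
    then show ?thesis using Der_simps(3)[OF m(2)] Der_simps(3)[OF assms(8)] by (simp add: extensional_def)
  qed
qed

section \<open>Automorphisms and conjugation\<close>

definition E510_aut :: "(elt \<Rightarrow> elt) \<Rightarrow> bool" where
  "E510_aut \<psi> \<longleftrightarrow> E510_linear \<psi> \<and> E510_continuous \<psi> \<and> (\<forall>q. \<forall>u\<in>E510_part q. \<psi> u \<in> E510_part q) \<and>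
     (\<forall>u\<in>E510. \<forall>v\<in>E510. \<psi> (E510_bracket u v) = E510_bracket (\<psi> u) (\<psi> v))"

definition E510_aut_pair :: "(elt \<Rightarrow> elt) \<Rightarrow> (elt \<Rightarrow> elt) \<Rightarrow> bool" where
  "E510_aut_pair \<psi> \<psi>' \<longleftrightarrow> E510_aut \<psi> \<and> E510_aut \<psi>' \<and> (\<forall>u\<in>E510. \<psi>' (\<psi> u) = u \<and> \<psi> (\<psi>' u) = u)"

lemma E510_aut_pair_sym: "E510_aut_pair \<psi> \<psi>' \<Longrightarrow> E510_aut_pair \<psi>' \<psi>"
  by (auto simp: E510_aut_pair_def)

lemma E510_linear_compose: "E510_linear S \<Longrightarrow> E510_linear T \<Longrightarrow> E510_linear (\<lambda>u. S (T u))"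
  by (auto simp: E510_linear_def)

lemma E510_continuous_compose:
  "E510_continuous S \<Longrightarrow> E510_continuous T \<Longrightarrow> E510_linear T \<Longrightarrow> E510_continuous (\<lambda>u. S (T u))"
  unfolding E510_continuous_def E510_linear_def by metis

lemma E510_aut_compose: "E510_aut S \<Longrightarrow> E510_aut T \<Longrightarrow> E510_aut (\<lambda>u. S (T u))"
  unfolding E510_aut_def
  using E510_linear_compose[of S T] E510_continuous_compose[of S T] E510_linearD(1)[of T] by simp

lemma E510_aut_pair_compose:
  "E510_aut_pair S S' \<Longrightarrow> E510_aut_pair T T' \<Longrightarrow> E510_aut_pair (\<lambda>u. S (T u)) (\<lambda>u. T' (S' u))"
  unfolding E510_aut_pair_def using E510_aut_compose[of S T] E510_aut_compose[of T' S']
  by (auto simp: E510_aut_def E510_linear_def)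

lemma E510_aut_pair_id: "E510_aut_pair (\<lambda>u. u) (\<lambda>u. u)"
  by (auto simp: E510_aut_pair_def E510_aut_def E510_linear_def E510_continuous_def)

lemma E510_aut_split:
  assumes "E510_aut \<psi>" "u \<in> E510"
  shows "\<psi> (fst u, 0) = (fst (\<psi> u), 0)" "\<psi> (0, snd u) = (0, snd (\<psi> u))"
proof -
  have p: "\<psi> (fst u, 0) \<in> E510_part 0" "\<psi> (0, snd u) \<in> E510_part 1"
    using assms E510_part_simps(3,4)[OF assms(2)] unfolding E510_aut_def by auto
  have m: "(fst u, 0) \<in> E510" "(0, snd u) \<in> E510" using assms E510_vector_space by auto
  have "\<psi> ((fst u, 0) + (0, snd u)) = \<psi> (fst u, 0) + \<psi> (0, snd u)"
    using assms(1) m by (intro E510_linearD(2)) (auto simp: E510_aut_def)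
  then have "\<psi> u = \<psi> (fst u, 0) + \<psi> (0, snd u)" by simp
  then show "\<psi> (fst u, 0) = (fst (\<psi> u), 0)" "\<psi> (0, snd u) = (0, snd (\<psi> u))"
    using p by (auto simp: E510_part_def prod_eq_iff)
qed

lemma E510_subalgebra_aut:
  assumes "E510_aut_pair \<psi> \<psi>'" "E510_subalgebra M"
  shows "E510_subalgebra (\<psi> ` M)"
proof -
  have aut: "E510_aut \<psi>" using assms by (simp add: E510_aut_pair_def)
  then have lin: "E510_linear \<psi>" and br: "\<And>u v. u \<in> E510 \<Longrightarrow> v \<in> E510 \<Longrightarrow> \<psi> (E510_bracket u v) = E510_bracket (\<psi> u) (\<psi> v)"
    by (auto simp: E510_aut_def)
  have M: "M \<subseteq> E510" "0 \<in> M" "\<And>u v. u \<in> M \<Longrightarrow> v \<in> M \<Longrightarrow> u + v \<in> M" "\<And>c u. u \<in> M \<Longrightarrow> elt_scale c u \<in> M"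
    "\<And>u. u \<in> M \<Longrightarrow> (fst u, 0) \<in> M" "\<And>u. u \<in> M \<Longrightarrow> (0, snd u) \<in> M"
    "\<And>u v. u \<in> M \<Longrightarrow> v \<in> M \<Longrightarrow> E510_bracket u v \<in> M"
    using assms(2) by (auto simp: E510_subalgebra_def)
  note E = subsetD[OF M(1)]
  show ?thesis unfolding E510_subalgebra_def
  proof (intro conjI ballI allI; (elim imageE)?)
    show "\<psi> ` M \<subseteq> E510" using E E510_linearD(1)[OF lin] by auto
    show "0 \<in> \<psi> ` M" using M(2) E510_linearD(4)[OF lin] by (metis image_eqI)
  next
    fix x y u v assume *: "x = \<psi> u" "u \<in> M" "y = \<psi> v" "v \<in> M"
    then show "x + y \<in> \<psi> ` M" using E510_linearD(2)[OF lin E E, of u v] M(3)[of u v] by (metis image_eqI)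
    show "E510_bracket x y \<in> \<psi> ` M" using br[OF E E, of u v] M(7)[of u v] * by (metis image_eqI)
  next
    fix x u c assume *: "x = \<psi> u" "u \<in> M"
    then show "elt_scale c x \<in> \<psi> ` M" using E510_linearD(3)[OF lin E, of u c] M(4)[of u c] by (metis image_eqI)
    show "(fst x, 0) \<in> \<psi> ` M" "(0, snd x) \<in> \<psi> ` M"
      using E510_aut_split[OF aut E[OF *(2)]] * M(5,6)[OF *(2)] by (metis image_eqI)+
  qed
qed

lemma E510_aut_pair_image:
  assumes "E510_aut_pair \<psi> \<psi>'" "M \<subseteq> E510"
  shows "\<psi> ` M \<subseteq> E510" "\<psi>' ` (\<psi> ` M) = M" "\<psi> ` E510 = E510"
proof -
  have *: "\<psi> u \<in> E510" "\<psi>' u \<in> E510" "\<psi>' (\<psi> u) = u" "\<psi> (\<psi>' u) = u" if "u \<in> E510" for u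
    using assms that by (auto simp: E510_aut_pair_def E510_aut_def E510_linear_def)
  show "\<psi> ` M \<subseteq> E510" using assms * by auto
  show "\<psi>' ` (\<psi> ` M) = M" using assms(2) *(3) by (force simp: image_image)
  show "\<psi> ` E510 = E510"
  proof
    show "E510 \<subseteq> \<psi> ` E510"
    proof
      fix u assume "u \<in> E510" then show "u \<in> \<psi> ` E510" using *(2,4)[of u] by (metis image_eqI)
    qed
  qed (use * in auto)
qed

lemma maximal_open_subalgebra_aut:
  assumes "E510_aut_pair \<psi> \<psi>'" "maximal_open_subalgebra M"
  shows "maximal_open_subalgebra (\<psi> ` M)"
proof -
  have M: "E510_subalgebra M" "openin E510_top M" "M \<noteq> E510" "M \<subseteq> E510"
    "\<And>N. E510_subalgebra N \<Longrightarrow> M \<subseteq> N \<Longrightarrow> N \<noteq> E510 \<Longrightarrow> N = M"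
    using assms(2) by (auto simp: maximal_open_subalgebra_def E510_subalgebra_def)
  note sym = E510_aut_pair_sym[OF assms(1)]
  note image = E510_aut_pair_image[OF assms(1)] and image' = E510_aut_pair_image[OF sym]
  have lin: "E510_linear \<psi>'" "E510_continuous \<psi>'" using assms by (auto simp: E510_aut_pair_def E510_aut_def)
  show ?thesis unfolding maximal_open_subalgebra_def
  proof (intro conjI allI impI)
    show "E510_subalgebra (\<psi> ` M)" by (rule E510_subalgebra_aut[OF assms(1) M(1)])
    show "\<psi> ` M \<noteq> E510"
    proof
      assume "\<psi> ` M = E510"
      then have "\<psi>' ` (\<psi> ` M) = \<psi>' ` E510" by simp
      then show False using image(2)[OF M(4)] image'(3)[OF subset_refl] M(3) by simp
    qed
    show "openin E510_top (\<psi> ` M)" unfolding openin_E510_top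
    proof (intro conjI ballI)
      show "\<psi> ` M \<subseteq> E510" using image M by blast
      fix x assume "x \<in> \<psi> ` M"
      then obtain u where u: "u \<in> M" "x = \<psi> u" by blast
      then have uE: "u \<in> E510" "x \<in> E510" "\<psi>' x = u" using M(4) image assms by (auto simp: E510_aut_pair_def)
      obtain q where q: "\<And>v. v \<in> E510 \<Longrightarrow> agree_below q u v \<Longrightarrow> v \<in> M" using M(2) u(1) unfolding openin_E510_top by blast
      obtain p where p: "\<And>v. v \<in> E510 \<Longrightarrow> agree_below p v 0 \<Longrightarrow> agree_below q (\<psi>' v) 0"
        using lin(2) unfolding E510_continuous_def by blast
      have "v \<in> \<psi> ` M" if v: "v \<in> E510" "agree_below p x v" for v
      proof -
        have "agree_below q (\<psi>' (x - v)) 0" using p v uE agree_below_diff E510_vector_space by blast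
        then have "agree_below q u (\<psi>' v)" using E510_linearD(6)[OF lin(1) uE(2) v(1)] uE(3) agree_below_diff by metis
        then have "\<psi>' v \<in> M" using q E510_linearD(1)[OF lin(1) v(1)] by blast
        then show ?thesis using assms(1) v(1) unfolding E510_aut_pair_def by (metis image_eqI)
      qed
      then show "\<exists>q. \<forall>v\<in>E510. agree_below q x v \<longrightarrow> v \<in> \<psi> ` M" by blast
    qed
    fix N assume N: "E510_subalgebra N \<and> \<psi> ` M \<subseteq> N \<and> N \<noteq> E510"
    then have NE: "N \<subseteq> E510" by (auto simp: E510_subalgebra_def)
    have "E510_subalgebra (\<psi>' ` N)" using E510_subalgebra_aut[OF sym] N by blast
    moreover have "M \<subseteq> \<psi>' ` N" using N image(2)[OF M(4)] by blast
    moreover have "\<psi>' ` N \<noteq> E510" using N image'(2)[OF NE] image(3)[OF NE] by metis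
    ultimately have "\<psi>' ` N = M" using M(5) by blast
    then show "N = \<psi> ` M" using image'(2)[OF NE] by metis
  qed
qed

lemma E510_ad_continuous_map: "continuous_map E510_top Der_top E510_ad"
  unfolding Der_top_def continuous_map_in_subtopology continuous_map_componentwise
proof (intro conjI ballI)
  show "E510_ad ` topspace E510_top \<subseteq> extensional E510" by (auto simp: E510_ad_def)
  show "E510_ad \<in> topspace E510_top \<rightarrow> Der" using E510_ad_Der by auto
  fix v assume v: "v \<in> E510"
  have "continuous_map E510_top E510_top (\<lambda>u. E510_bracket u v)"
    using continuous_map_E510 E510_linear_bracket(2)[OF v] E510_continuous_bracket(2)[OF v] by blast
  then show "continuous_map E510_top E510_top (\<lambda>u. E510_ad u v)" using v by (simp add: E510_ad_def)
qed

lemma continuous_Der_autD: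
  assumes "continuous_Der_aut \<phi>"
  shows "\<phi> \<in> Bij Der" "\<phi> \<in> Der \<rightarrow> Der" "D \<in> Der \<Longrightarrow> D' \<in> Der \<Longrightarrow> \<phi> (Der_add D D') = Der_add (\<phi> D) (\<phi> D')"
    "D \<in> Der \<Longrightarrow> \<phi> (Der_scale c D) = Der_scale c (\<phi> D)"
    "D \<in> Der_part p \<Longrightarrow> D' \<in> Der_part q \<Longrightarrow> \<phi> (Der_bracket p q D D') = Der_bracket p q (\<phi> D) (\<phi> D')"
    "continuous_map Der_top Der_top \<phi>"
  using assms Bij_imp_funcset unfolding continuous_Der_aut_def by blast+

text \<open>The map \<open>\<phi>\<close> sends the adjoint copy of the algebra into itself, and
  \<open>\<psi>\<close> is its transport. Linearity and brackets transfer by injectivity of the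
  adjoint representation, parity by passing to the limit in the partial sums.\<close>

lemma aut_of_exponential:
  assumes "continuous_Der_aut \<phi>" "a \<in> Der_part 0" "exp_ad a t \<phi>"
  shows "\<exists>\<psi>. E510_aut \<psi> \<and> (\<forall>u\<in>E510. \<phi> (E510_ad u) = E510_ad (\<psi> u))"
proof -
  note \<phi> = continuous_Der_autD[OF assms(1)] and a = Der_part_simps[OF assms(2)]
  have "\<forall>u. \<exists>w. u \<in> E510 \<longrightarrow> w \<in> E510 \<and> coord_tendsto (exp_partial_sum a t u) w \<and> \<phi> (E510_ad u) = E510_ad w"
    using exp_ad_E510_ad[OF assms(2,3) \<phi>(2)] by blast
  then obtain \<psi> where \<psi>: "\<And>u. u \<in> E510 \<Longrightarrow> \<psi> u \<in> E510" "\<And>u. u \<in> E510 \<Longrightarrow> coord_tendsto (exp_partial_sum a t u) (\<psi> u)"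
    "\<And>u. u \<in> E510 \<Longrightarrow> \<phi> (E510_ad u) = E510_ad (\<psi> u)" by metis
  have lin: "E510_linear \<psi>" unfolding E510_linear_def
  proof (intro conjI ballI allI \<psi>(1))
    fix u v assume uv: "u \<in> E510" "v \<in> E510"
    have "E510_ad (\<psi> (u + v)) = E510_ad (\<psi> u + \<psi> v)"
      using \<phi>(3)[OF E510_ad_Der E510_ad_Der, OF uv] uv by (simp add: \<psi>(3) E510_ad_add E510_vector_space)
    then show "\<psi> (u + v) = \<psi> u + \<psi> v" using E510_ad_inject \<psi>(1) uv E510_vector_space by meson
  next
    fix c u assume u: "u \<in> E510"
    have "E510_ad (\<psi> (elt_scale c u)) = E510_ad (elt_scale c (\<psi> u))"
      using \<phi>(4)[OF E510_ad_Der[OF u], of c] u by (simp add: \<psi>(3) E510_ad_scale E510_vector_space)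
    then show "\<psi> (elt_scale c u) = elt_scale c (\<psi> u)" using E510_ad_inject \<psi>(1) u E510_vector_space by meson
  qed
  have part: "\<psi> u \<in> E510_part q" if u: "u \<in> E510_part q" for u q
  proof -
    have "(a ^^ n) u \<in> E510_part q" for n using u a(4)[of _ q] by (induction n) auto
    then have s: "exp_partial_sum a t u N \<in> E510_part q" for N unfolding exp_partial_sum_def
      by (induction N) (auto simp: E510_part_simps)
    have uE: "u \<in> E510" using u E510_part_simps by blast
    note lim = \<psi>(2)[OF uE, unfolded coord_tendsto_def, rule_format]
    have z: "elt_coord (\<psi> u) b = 0" if "\<And>N. elt_coord (exp_partial_sum a t u N) b = 0" for b
      using lim[of b] that by (simp add: LIMSEQ_const_iff)
    show ?thesis unfolding E510_part_iff_coord[OF \<psi>(1)[OF uE]]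
      using z s E510_part_iff_coord[OF exp_partial_sum_E510[OF a(1) uE]] by blast
  qed
  have hom: "\<psi> (E510_bracket u v) = E510_bracket (\<psi> u) (\<psi> v)" if uv: "u \<in> E510_part p" "v \<in> E510_part q" for u v p q
  proof -
    have E: "u \<in> E510" "v \<in> E510" using uv E510_part_simps by blast+
    have "E510_ad (\<psi> (E510_bracket u v)) = E510_ad (E510_bracket (\<psi> u) (\<psi> v))"
      using \<phi>(5)[OF E510_ad_Der_part E510_ad_Der_part, OF uv] E
      by (simp add: \<psi>(3) Der_bracket_E510_ad[OF uv] Der_bracket_E510_ad[OF part part, OF uv] E510_bracket_closed)
    then show ?thesis using E510_ad_inject \<psi>(1) E E510_bracket_closed by meson
  qed
  \<comment> \<open>The bracket of derivations is only defined for given parities, so the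
    homomorphism property, known for homogeneous pairs, is extended to one argument at a
    time.\<close>
  have hom2: "\<psi> (E510_bracket u v) = E510_bracket (\<psi> u) (\<psi> v)" if u: "u \<in> E510_part p" and v: "v \<in> E510" for u v p
  proof -
    have m: "u \<in> E510" "(fst v, 0) \<in> E510" "(0, snd v) \<in> E510" using u v E510_vector_space E510_part_simps by auto
    have "\<psi> (E510_bracket u ((fst v, 0) + (0, snd v))) = E510_bracket (\<psi> u) (\<psi> ((fst v, 0) + (0, snd v)))"
      by (simp only: E510_bracket_linear E510_linearD(2)[OF lin m(2,3)] E510_linearD(2)[OF lin E510_bracket_closed[OF m(1,2)] E510_bracket_closed[OF m(1,3)]]
        hom[OF u E510_part_simps(3)[OF v]] hom[OF u E510_part_simps(4)[OF v]])
    then show ?thesis by simp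
  qed
  have hom3: "\<psi> (E510_bracket u v) = E510_bracket (\<psi> u) (\<psi> v)" if u: "u \<in> E510" and v: "v \<in> E510" for u v
  proof -
    have m: "v \<in> E510" "(fst u, 0) \<in> E510" "(0, snd u) \<in> E510" using u v E510_vector_space by auto
    have "\<psi> (E510_bracket ((fst u, 0) + (0, snd u)) v) = E510_bracket (\<psi> ((fst u, 0) + (0, snd u))) (\<psi> v)"
      by (simp only: E510_bracket_linear E510_linearD(2)[OF lin m(2,3)] E510_linearD(2)[OF lin E510_bracket_closed[OF m(2,1)] E510_bracket_closed[OF m(3,1)]]
        hom2[OF E510_part_simps(3)[OF u] v] hom2[OF E510_part_simps(4)[OF u] v])
    then show ?thesis by simp
  qed
  \<comment> \<open>The topology of \<open>Der\<close> is pointwise convergence: evaluation at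
    \<open>v\<close> makes each bracket of \<open>\<psi> u\<close> with \<open>v\<close> continuous
    in \<open>u\<close>, and the coordinates of \<open>\<psi> u\<close> are, up to scalars,
    coordinates of such brackets.\<close>
  have cont: "E510_continuous (\<lambda>u. E510_bracket (\<psi> u) v)" if v: "v \<in> E510" for v
  proof -
    have c: "continuous_map E510_top Der_top (\<phi> \<circ> E510_ad)"
      by (rule continuous_map_compose[OF E510_ad_continuous_map \<phi>(6)])
    have "continuous_map Der_top E510_top (\<lambda>D. D v)"
      unfolding Der_top_def using v by (intro continuous_map_from_subtopology continuous_map_product_projection)
    then have "continuous_map E510_top E510_top ((\<lambda>D. D v) \<circ> (\<phi> \<circ> E510_ad))"
      using c continuous_map_compose by blast
    then have "continuous_map E510_top E510_top (\<lambda>u. E510_bracket (\<psi> u) v)"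
      by (rule continuous_map_eq) (use \<psi> v in \<open>auto simp: E510_ad_def\<close>)
    then show ?thesis
      using continuous_map_E510[OF E510_linear_compose[OF E510_linear_bracket(2)[OF v] lin]] by blast
  qed
  have "E510_continuous \<psi>" unfolding E510_continuous_def
  proof
    fix p
    have "\<exists>q. \<forall>u\<in>E510. agree_below q u 0 \<longrightarrow> elt_coord (\<psi> u) b = 0" for b
    proof -
      obtain v c b' where v: "v \<in> E510" "\<forall>w\<in>E510. elt_coord w b = c * elt_coord (E510_bracket w v) b'"
        using coord_from_bracket by blast
      obtain q where "\<forall>u\<in>E510. agree_below q u 0 \<longrightarrow> agree_below (level b' + 1) (E510_bracket (\<psi> u) v) 0"
        using cont[OF v(1)] unfolding E510_continuous_def by blast
      then show ?thesis using v(2) \<psi>(1) agree_below_zeroD[of "level b' + 1" _ b'] by (intro exI[of _ q]) auto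
    qed
    then obtain q where q: "\<And>b u. u \<in> E510 \<Longrightarrow> agree_below (q b) u 0 \<Longrightarrow> elt_coord (\<psi> u) b = 0" by metis
    define Q where "Q = Max (insert 0 (q ` {b. level b < p}))"
    have "agree_below p (\<psi> u) 0" if u: "u \<in> E510" "agree_below Q u 0" for u
    proof (rule agree_below_zeroI)
      fix b assume "level b < p"
      then have "q b \<le> Q" unfolding Q_def using finite_level[of p] by (intro Max_ge) auto
      then show "elt_coord (\<psi> u) b = 0" using q u agree_below_mono by blast
    qed
    then show "\<exists>q. \<forall>u\<in>E510. agree_below q u 0 \<longrightarrow> agree_below p (\<psi> u) 0" by blast
  qed
  then have "E510_aut \<psi>" using lin part hom3 by (simp add: E510_aut_def)
  then show ?thesis using \<psi>(3) by blast
qed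

definition implements_aut :: "((elt \<Rightarrow> elt) \<Rightarrow> elt \<Rightarrow> elt) \<Rightarrow> (elt \<Rightarrow> elt) \<Rightarrow> (elt \<Rightarrow> elt) \<Rightarrow> bool" where
  "implements_aut \<phi> \<psi> \<psi>' \<longleftrightarrow> \<phi> \<in> Bij Der \<and> E510_aut_pair \<psi> \<psi>' \<and> (\<forall>u\<in>E510. \<phi> (E510_ad u) = E510_ad (\<psi> u))"

text \<open>Exponentiability also provides the exponential at parameter -1, which induces the
  inverse automorphism.\<close>

lemma exponential_implements_aut:
  assumes "continuous_Der_aut \<phi>" "exponentiable a" "exp_ad a 1 \<phi>"
  shows "\<exists>\<psi> \<psi>'. implements_aut \<phi> \<psi> \<psi>'"
proof -
  have a: "a \<in> Der_part 0" "\<And>t. \<exists>\<phi>. continuous_Der_aut \<phi> \<and> exp_ad a t \<phi>" using assms by (auto simp: exponentiable_def)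
  obtain \<phi>' where \<phi>': "continuous_Der_aut \<phi>'" "exp_ad a (- 1) \<phi>'" using a(2) by blast
  obtain \<psi> where \<psi>: "E510_aut \<psi>" "\<And>u. u \<in> E510 \<Longrightarrow> \<phi> (E510_ad u) = E510_ad (\<psi> u)"
    using aut_of_exponential[OF assms(1) a(1) assms(3)] by blast
  obtain \<psi>' where \<psi>': "E510_aut \<psi>'" "\<And>u. u \<in> E510 \<Longrightarrow> \<phi>' (E510_ad u) = E510_ad (\<psi>' u)"
    using aut_of_exponential[OF \<phi>'(1) a(1) \<phi>'(2)] by blast
  note p = continuous_Der_autD(2)[OF assms(1)] and p' = continuous_Der_autD(2)[OF \<phi>'(1)]
  have E: "\<psi> u \<in> E510" "\<psi>' u \<in> E510" if "u \<in> E510" for u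
    using \<psi>(1) \<psi>'(1) that by (auto simp: E510_aut_def E510_linear_def)
  have "\<psi>' (\<psi> u) = u" "\<psi> (\<psi>' u) = u" if u: "u \<in> E510" for u
  proof -
    have "\<phi>' (\<phi> (E510_ad u)) = E510_ad u" "\<phi> (\<phi>' (E510_ad u)) = E510_ad u"
      using exp_ad_compose[OF a(1) assms(3) p \<phi>'(2) p' _ _ E510_ad_Der[OF u]]
        exp_ad_compose[OF a(1) \<phi>'(2) p' assms(3) p _ _ E510_ad_Der[OF u]] a(2) by auto
    then show "\<psi>' (\<psi> u) = u" "\<psi> (\<psi>' u) = u"
      using u E \<psi>(2) \<psi>'(2) E510_ad_inject by (metis, metis)
  qed
  then show ?thesis using \<psi> \<psi>' continuous_Der_autD(1)[OF assms(1)] unfolding implements_aut_def E510_aut_pair_def by blast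
qed

lemma inner_automorphism_implements_aut:
  assumes "\<phi> \<in> inner_automorphisms"
  shows "\<exists>\<psi> \<psi>'. implements_aut \<phi> \<psi> \<psi>'"
  using assms unfolding inner_automorphisms_def
proof (induction rule: generate.induct)
  case one
  have "(\<lambda>x\<in>Der. x) \<in> Bij Der" by (rule id_Bij)
  then show ?case using E510_aut_pair_id E510_ad_Der unfolding BijGroup_def implements_aut_def by (auto intro!: exI[of _ "\<lambda>u. u"])
next
  case (incl \<phi>)
  then show ?case using exponential_implements_aut by blast
next
  case (inv \<phi>)
  then obtain \<psi> \<psi>' where *: "\<phi> \<in> Bij Der" "E510_aut_pair \<psi> \<psi>'" "\<And>u. u \<in> E510 \<Longrightarrow> \<phi> (E510_ad u) = E510_ad (\<psi> u)"
    using exponential_implements_aut unfolding implements_aut_def by blast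
  have b: "bij_betw \<phi> Der Der" using *(1) by (auto simp: Bij_def)
  have "inv_into Der \<phi> (E510_ad u) = E510_ad (\<psi>' u)" if u: "u \<in> E510" for u
  proof -
    have "\<psi>' u \<in> E510" "\<psi> (\<psi>' u) = u" using u *(2) by (auto simp: E510_aut_pair_def E510_aut_def E510_linear_def)
    then show ?thesis using *(3)[of "\<psi>' u"] inv_into_f_f[of \<phi> Der "E510_ad (\<psi>' u)"] b E510_ad_Der[of "\<psi>' u"]
      by (simp add: bij_betw_def)
  qed
  then show ?case
    using E510_aut_pair_sym[OF *(2)] E510_ad_Der restrict_inv_into_Bij[OF *(1)] unfolding implements_aut_def inv_BijGroup[OF *(1)]
    by (intro exI[of _ \<psi>'] exI[of _ \<psi>]) auto
next
  case (eng \<phi>1 \<phi>2)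
  then obtain S S' T T' where *: "implements_aut \<phi>1 S S'" "implements_aut \<phi>2 T T'" by blast
  then have "compose Der \<phi>1 \<phi>2 \<in> Bij Der" by (auto simp: implements_aut_def compose_Bij)
  moreover have "\<phi>1 \<otimes>\<^bsub>BijGroup Der\<^esub> \<phi>2 = compose Der \<phi>1 \<phi>2" using * by (auto simp: BijGroup_def implements_aut_def)
  moreover have "compose Der \<phi>1 \<phi>2 (E510_ad u) = E510_ad (S (T u))" if u: "u \<in> E510" for u
    using * u E510_ad_Der[OF u] by (auto simp: compose_def implements_aut_def E510_aut_pair_def E510_aut_def E510_linear_def)
  ultimately show ?case
    using * E510_aut_pair_compose[of S S' T T'] unfolding implements_aut_def by metis
qed

lemma E510_ad_image_inject:
  assumes "A \<subseteq> E510" "B \<subseteq> E510" "E510_ad ` A = E510_ad ` B"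
  shows "A = B"
  by (rule inj_on_image_eq_iff[THEN iffD1, of E510_ad E510]) (use assms E510_ad_inject in \<open>auto simp: inj_on_def\<close>)

lemma implements_aut_image:
  assumes "implements_aut \<phi> \<psi> \<psi>'" "M \<subseteq> E510"
  shows "\<phi> ` (E510_ad ` M) = E510_ad ` (\<psi> ` M)"
  using assms unfolding implements_aut_def image_image by (intro image_cong) auto

lemma conjugate_maximal_open_subalgebra:
  assumes "conjugate M M'" "maximal_open_subalgebra M"
  shows "maximal_open_subalgebra M'"
proof -
  obtain \<phi> where \<phi>: "\<phi> \<in> inner_automorphisms" "\<phi> ` (E510_ad ` M) = E510_ad ` M'" "M \<subseteq> E510" "M' \<subseteq> E510"
    using assms(1) unfolding conjugate_def by blast
  obtain \<psi> \<psi>' where \<psi>: "implements_aut \<phi> \<psi> \<psi>'" using inner_automorphism_implements_aut[OF \<phi>(1)] by blast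
  then have pair: "E510_aut_pair \<psi> \<psi>'" by (simp add: implements_aut_def)
  have "M' = \<psi> ` M"
    using implements_aut_image[OF \<psi> \<phi>(3)] \<phi>(2,4) E510_aut_pair_image(1)[OF pair \<phi>(3)] E510_ad_image_inject by metis
  then show ?thesis using maximal_open_subalgebra_aut[OF pair assms(2)] by simp
qed

lemma inner_automorphisms_subset: "{\<phi>. continuous_Der_aut \<phi> \<and> (\<exists>a. exponentiable a \<and> exp_ad a 1 \<phi>)} \<subseteq> carrier (BijGroup Der)"
  using continuous_Der_autD(1) by (auto simp: BijGroup_def)

section \<open>Conjugacy as an equivalence relation\<close>

lemma conjugate_sym:
  assumes "conjugate M M'"
  shows "conjugate M' M"
proof -
  obtain \<phi> where \<phi>: "\<phi> \<in> inner_automorphisms" "\<phi> ` (E510_ad ` M) = E510_ad ` M'" "M \<subseteq> E510" "M' \<subseteq> E510"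
    using assms(1) unfolding conjugate_def by blast
  have G: "group (BijGroup Der)" by (rule group_BijGroup)
  have B: "\<phi> \<in> Bij Der" using inner_automorphism_implements_aut[OF \<phi>(1)] by (auto simp: implements_aut_def)
  have "m_inv (BijGroup Der) \<phi> \<in> inner_automorphisms"
    using group.generate_m_inv_closed[OF G inner_automorphisms_subset] \<phi>(1) unfolding inner_automorphisms_def by blast
  moreover have "m_inv (BijGroup Der) \<phi> ` (E510_ad ` M') = E510_ad ` M"
  proof -
    have b: "inj_on \<phi> Der" using B by (auto simp: Bij_def bij_betw_def)
    have sub: "E510_ad ` M \<subseteq> Der" using \<phi>(3) E510_ad_Der by auto
    then have "\<phi> ` (E510_ad ` M) \<subseteq> Der" using Bij_imp_funcset[OF B] by auto
    then have "(\<lambda>x\<in>Der. inv_into Der \<phi> x) ` \<phi> ` (E510_ad ` M) = inv_into Der \<phi> ` \<phi> ` (E510_ad ` M)"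
      by (intro image_cong) auto
    then show ?thesis unfolding inv_BijGroup[OF B] \<phi>(2)[symmetric]
      using inv_into_image_cancel[OF b sub] by simp
  qed
  ultimately show ?thesis using \<phi>(3,4) unfolding conjugate_def by blast
qed

lemma conjugate_trans:
  assumes "conjugate M M'" "conjugate M' M''"
  shows "conjugate M M''"
proof -
  obtain \<phi> where \<phi>: "\<phi> \<in> inner_automorphisms" "\<phi> ` (E510_ad ` M) = E510_ad ` M'" "M \<subseteq> E510" "M' \<subseteq> E510"
    using assms(1) unfolding conjugate_def by blast
  obtain \<phi>' where \<phi>': "\<phi>' \<in> inner_automorphisms" "\<phi>' ` (E510_ad ` M') = E510_ad ` M''" "M'' \<subseteq> E510"
    using assms(2) unfolding conjugate_def by blast
  have B: "\<phi> \<in> Bij Der" "\<phi>' \<in> Bij Der" using inner_automorphism_implements_aut \<phi>(1) \<phi>'(1) by (auto simp: implements_aut_def)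
  have "\<phi>' \<otimes>\<^bsub>BijGroup Der\<^esub> \<phi> \<in> inner_automorphisms"
    using \<phi>(1) \<phi>'(1) unfolding inner_automorphisms_def by (intro generate.eng)
  moreover have "\<phi>' \<otimes>\<^bsub>BijGroup Der\<^esub> \<phi> = compose Der \<phi>' \<phi>" using B by (simp add: BijGroup_def)
  moreover have "compose Der \<phi>' \<phi> ` (E510_ad ` M) = E510_ad ` M''"
  proof -
    have "compose Der \<phi>' \<phi> ` (E510_ad ` M) = \<phi>' ` \<phi> ` (E510_ad ` M)"
      unfolding image_image using \<phi>(3) E510_ad_Der by (intro image_cong) (auto simp: compose_def)
    then show ?thesis using \<phi>(2) \<phi>'(2) by simp
  qed
  ultimately show ?thesis using \<phi>(3) \<phi>'(3) unfolding conjugate_def by metis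
qed

lemma conjugate_refl: "M \<subseteq> E510 \<Longrightarrow> conjugate M M"
proof -
  assume M: "M \<subseteq> E510"
  have "\<one>\<^bsub>BijGroup Der\<^esub> \<in> inner_automorphisms" unfolding inner_automorphisms_def by (rule generate.one)
  moreover have "\<one>\<^bsub>BijGroup Der\<^esub> ` (E510_ad ` M) = E510_ad ` M"
    using M E510_ad_Der by (force simp: BijGroup_def image_image)
  ultimately show ?thesis using M unfolding conjugate_def by blast
qed

section \<open>Exponentials of locally nilpotent derivations\<close>

text \<open>The recursion is applied to the coordinates of \<open>(a ^^ n) [(a ^^ i) u, (a ^^ j) v]\<close>, which gives
  \<open>exp a [u, v] = [exp a u, exp a v]\<close>, and to those of \<open>(a ^^ i) (((ad a) ^^ n) D (((- a) ^^ j) u))\<close>, which gives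
  \<open>exp (ad a) D = exp a \<circ> D \<circ> exp (- a)\<close>.\<close>

lemma binomial_recursion:
  fixes c :: "nat \<Rightarrow> nat \<Rightarrow> nat \<Rightarrow> complex"
  assumes "\<And>n i j. c (Suc n) i j = c n (Suc i) j + c n i (Suc j)"
  shows "c n i j = (\<Sum>k\<le>n. of_nat (n choose k) * c 0 (i + k) (j + (n - k)))"
proof (induction n arbitrary: i j)
  case (Suc n)
  let ?f = "\<lambda>k. c 0 (i + k) (j + (Suc n - k))"
  have 1: "(\<Sum>k\<le>n. of_nat (n choose k) * c 0 (Suc i + k) (j + (n - k))) = (\<Sum>k\<le>n. of_nat (n choose k) * ?f (Suc k))"
    by (intro sum.cong) auto
  have 2: "(\<Sum>k\<le>n. of_nat (n choose k) * c 0 (i + k) (Suc j + (n - k))) = (\<Sum>k\<le>n. of_nat (n choose k) * ?f k)"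
    by (intro sum.cong) (auto simp: Suc_diff_le)
  have "(\<Sum>k\<le>n. of_nat (n choose k) * ?f k) = ?f 0 + (\<Sum>k\<le>n. of_nat (n choose Suc k) * ?f (Suc k))"
  proof -
    have "(\<Sum>k\<le>n. of_nat (n choose k) * ?f k) = (\<Sum>k\<le>Suc n. of_nat (n choose k) * ?f k)" by simp
    then show ?thesis by (simp only: sum.atMost_Suc_shift binomial_n_0 of_nat_1 mult_1)
  qed
  then have "c (Suc n) i j = ?f 0 + (\<Sum>k\<le>n. of_nat (Suc n choose Suc k) * ?f (Suc k))"
    unfolding assms Suc.IH 1 2 by (simp add: distrib_right sum.distrib)
  also have "\<dots> = (\<Sum>k\<le>Suc n. of_nat (Suc n choose k) * ?f k)"
    by (simp only: sum.atMost_Suc_shift binomial_n_0 of_nat_1 mult_1)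
  finally show ?case .
qed simp

text \<open>A Cauchy product of two exponential sums that are finite in each coordinate. The bounds
  are not symmetric: \<open>K\<close> serves all \<open>l\<close>, while \<open>L\<close> only has
  to serve the finitely many \<open>k < K\<close>, since the cut-off in the second variable may
  depend on \<open>k\<close>.\<close>

lemma exponential_double_sum:
  fixes c :: "nat \<Rightarrow> nat \<Rightarrow> nat \<Rightarrow> complex"
  assumes rec: "\<And>n i j. c (Suc n) i j = c n (Suc i) j + c n i (Suc j)"
    and K: "\<And>k l. k \<ge> K \<Longrightarrow> c 0 k l = 0" and L: "\<And>k l. k < K \<Longrightarrow> l \<ge> L \<Longrightarrow> c 0 k l = 0"
  shows "(\<lambda>n. t ^ n / fact n * c n 0 0) sums (\<Sum>k<K. \<Sum>l<L. t ^ k / fact k * (t ^ l / fact l * c 0 k l))"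
proof -
  define d where "d k l = t ^ k / fact k * (t ^ l / fact l * c 0 k l)" for k l
  have n: "t ^ n / fact n * c n 0 0 = (\<Sum>k\<le>n. d k (n - k))" for n
  proof -
    have "t ^ n / fact n * (of_nat (n choose k) * c 0 k (n - k)) = d k (n - k)" if "k \<le> n" for k
      using that by (simp add: d_def binomial_fact field_simps power_add[symmetric])
    then show ?thesis unfolding binomial_recursion[of c, OF rec, of n] sum_distrib_left by simp
  qed
  have d0: "d k l = 0" if "k \<ge> K \<or> l \<ge> L" for k l
    using that K[of k l] L[of k l] by (cases "k < K") (auto simp: d_def)
  have "(\<lambda>n. \<Sum>k\<le>n. d k (n - k)) sums (\<Sum>n<K + L. \<Sum>k\<le>n. d k (n - k))"
    by (rule sums_finite) (auto intro!: sum.neutral d0)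
  also have "(\<Sum>n<K + L. \<Sum>k\<le>n. d k (n - k)) = (\<Sum>(k, l)\<in>{(k, l). k + l < K + L}. d k l)"
    using sum.triangle_reindex[of "\<lambda>k l. d k l" "K + L"] by simp
  also have "\<dots> = (\<Sum>(k, l)\<in>{..<K} \<times> {..<L}. d k l)"
  proof (rule sum.mono_neutral_right)
    show "finite {(k, l). k + l < K + L}"
      by (rule finite_subset[of _ "{..<K + L} \<times> {..<K + L}"]) auto
    show "\<forall>p\<in>{(k, l). k + l < K + L} - {..<K} \<times> {..<L}. (case p of (k, l) \<Rightarrow> d k l) = 0"
    proof
      fix p assume p: "p \<in> {(k, l). k + l < K + L} - {..<K} \<times> {..<L}"
      obtain k l where kl: "p = (k, l)" by force
      then have "k \<ge> K \<or> l \<ge> L" using p by auto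
      then show "(case p of (k, l) \<Rightarrow> d k l) = 0" using d0 kl by simp
    qed
  qed auto
  also have "\<dots> = (\<Sum>k<K. \<Sum>l<L. d k l)" by (simp add: sum.cartesian_product)
  finally show ?thesis unfolding n d_def .
qed

text \<open>The bound may depend on the coordinate but not on \<open>u\<close>. Each coordinate of
  the exponential is then a finite sum of the same length for all elements, which gives its
  continuity.\<close>

definition locally_nilpotent :: "(elt \<Rightarrow> elt) \<Rightarrow> bool" where
  "locally_nilpotent a \<longleftrightarrow> (\<forall>b. \<exists>N. \<forall>n\<ge>N. \<forall>u\<in>E510. elt_coord ((a ^^ n) u) b = 0)"

lemma locally_nilpotent_uniform:
  assumes "locally_nilpotent a"
  shows "\<exists>N. \<forall>n\<ge>N. \<forall>u\<in>E510. agree_below q ((a ^^ n) u) 0"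
proof -
  obtain N where N: "\<And>b n u. n \<ge> N b \<Longrightarrow> u \<in> E510 \<Longrightarrow> elt_coord ((a ^^ n) u) b = 0"
    using assms unfolding locally_nilpotent_def by metis
  have "agree_below q ((a ^^ n) u) 0" if "n \<ge> Max (insert 0 (N ` {b. level b < q}))" "u \<in> E510" for n u
  proof (rule agree_below_zeroI)
    fix b assume "level b < q"
    then have "N b \<le> Max (insert 0 (N ` {b. level b < q}))" using finite_level[of q] by (intro Max_ge) auto
    then show "elt_coord ((a ^^ n) u) b = 0" using N that by auto
  qed
  then show ?thesis by blast
qed

definition exp_elt :: "(elt \<Rightarrow> elt) \<Rightarrow> complex \<Rightarrow> elt \<Rightarrow> elt" where
  "exp_elt a t u = (SOME w. coord_tendsto (exp_partial_sum a t u) w)"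

lemma exp_elt_tendsto:
  assumes "locally_nilpotent a" "u \<in> E510"
  shows "coord_tendsto (exp_partial_sum a t u) (exp_elt a t u)"
proof -
  have "convergent (\<lambda>N. elt_coord (exp_partial_sum a t u N) b)" for b
  proof -
    obtain N where N: "\<forall>n\<ge>N. elt_coord ((a ^^ n) u) b = 0"
      using assms unfolding locally_nilpotent_def by blast
    have "(\<lambda>n. t ^ n / fact n * elt_coord ((a ^^ n) u) b) sums (\<Sum>n<N. t ^ n / fact n * elt_coord ((a ^^ n) u) b)"
      by (rule sums_finite) (use N in auto)
    then show ?thesis unfolding coord_exp_partial_sum sums_def convergent_def by blast
  qed
  then obtain w where "coord_tendsto (exp_partial_sum a t u) w" using ex_coord_tendsto by blast
  then show ?thesis unfolding exp_elt_def by (rule someI)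
qed

lemma exp_elt_sums:
  assumes "locally_nilpotent a" "u \<in> E510"
  shows "(\<lambda>n. t ^ n / fact n * elt_coord ((a ^^ n) u) b) sums elt_coord (exp_elt a t u) b"
  using exp_elt_tendsto[OF assms, of t] unfolding coord_tendsto_def coord_exp_partial_sum sums_def by blast

lemma coord_exp_elt:
  assumes "locally_nilpotent a" "u \<in> E510" "\<And>n. n \<ge> N \<Longrightarrow> elt_coord ((a ^^ n) u) b = 0"
  shows "elt_coord (exp_elt a t u) b = (\<Sum>n<N. t ^ n / fact n * elt_coord ((a ^^ n) u) b)"
proof -
  have "(\<lambda>n. t ^ n / fact n * elt_coord ((a ^^ n) u) b) sums (\<Sum>n<N. t ^ n / fact n * elt_coord ((a ^^ n) u) b)"
    by (rule sums_finite) (use assms(3) in auto)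
  then show ?thesis using exp_elt_sums[OF assms(1,2)] sums_unique2 by blast
qed

lemma exp_elt_E510: "locally_nilpotent a \<Longrightarrow> E510_linear a \<Longrightarrow> u \<in> E510 \<Longrightarrow> exp_elt a t u \<in> E510"
  using E510_coord_closed exp_elt_tendsto exp_partial_sum_E510 by blast

text \<open>A coordinate of \<open>T u\<close> vanishes once \<open>u\<close> vanishes below some
  level, so the exponential series stays finite after applying \<open>T\<close>, with a length
  independent of \<open>u\<close> and \<open>t\<close>.\<close>

lemma exp_elt_apply:
  assumes "locally_nilpotent a" "E510_linear a" "E510_linear T" "E510_continuous T"
  shows "\<exists>L0. \<forall>L\<ge>L0. \<forall>u\<in>E510. elt_coord (T ((a ^^ L) u)) b = 0 \<and>
    (\<forall>t. elt_coord (T (exp_elt a t u)) b = (\<Sum>l<L. t ^ l / fact l * elt_coord (T ((a ^^ l) u)) b))"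
proof -
  obtain q where q: "\<And>u. u \<in> E510 \<Longrightarrow> agree_below q u 0 \<Longrightarrow> agree_below (level b + 1) (T u) 0"
    using assms(4) unfolding E510_continuous_def by blast
  obtain L0 where L0: "\<And>n u. n \<ge> L0 \<Longrightarrow> u \<in> E510 \<Longrightarrow> agree_below q ((a ^^ n) u) 0"
    using locally_nilpotent_uniform[OF assms(1)] by blast
  note pow = E510_funpow[OF assms(2)]
  have zero: "elt_coord (T ((a ^^ L) u)) b = 0" if "L \<ge> L0" "u \<in> E510" for L u
    using q[OF pow L0] that by (intro agree_below_zeroD[of "level b + 1"]) auto
  have "elt_coord (T (exp_elt a t u)) b = (\<Sum>l<L. t ^ l / fact l * elt_coord (T ((a ^^ l) u)) b)" if L: "L \<ge> L0" and u: "u \<in> E510" for L u t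
  proof -
    have "(\<lambda>n. t ^ n / fact n * elt_coord (T ((a ^^ n) u)) b) sums elt_coord (T (exp_elt a t u)) b"
    proof -
      have "T (exp_partial_sum a t u N) = (\<Sum>n<N. elt_scale (t ^ n / fact n) (T ((a ^^ n) u)))" for N
      proof -
        have "T (exp_partial_sum a t u N) = (\<Sum>n<N. T (elt_scale (t ^ n / fact n) ((a ^^ n) u)))"
          unfolding exp_partial_sum_def by (rule E510_linearD(7)[OF assms(3)]) (intro E510_vector_space pow u)
        then show ?thesis using E510_linearD(3)[OF assms(3) pow[OF u]] by simp
      qed
      moreover have "coord_tendsto (\<lambda>N. T (exp_partial_sum a t u N)) (T (exp_elt a t u))"
        by (rule coord_tendsto_linear[OF assms(3,4) exp_partial_sum_E510[OF assms(2) u] exp_elt_E510[OF assms(1,2) u] exp_elt_tendsto[OF assms(1) u]])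
      ultimately show ?thesis unfolding coord_tendsto_def sums_def by (simp add: elt_coord_linear)
    qed
    moreover have "(\<lambda>n. t ^ n / fact n * elt_coord (T ((a ^^ n) u)) b) sums (\<Sum>n<L. t ^ n / fact n * elt_coord (T ((a ^^ n) u)) b)"
      by (rule sums_finite) (use zero u L in auto)
    ultimately show ?thesis using sums_unique2 by blast
  qed
  then show ?thesis using zero by blast
qed

lemma E510_linear_id: "E510_linear (\<lambda>u. u)" and E510_continuous_id: "E510_continuous (\<lambda>u. u)"
  by (auto simp: E510_linear_def E510_continuous_def)

lemma E510_linear_funpow: "E510_linear a \<Longrightarrow> E510_linear (a ^^ n)"
proof (induction n)
  case 0 then show ?case by (simp add: E510_linear_def)
next
  case (Suc n) then show ?case using E510_linear_compose[of a "a ^^ n"] by (simp add: o_def)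
qed

lemma E510_continuous_funpow: "E510_linear a \<Longrightarrow> E510_continuous a \<Longrightarrow> E510_continuous (a ^^ n)"
proof (induction n)
  case 0 then show ?case using E510_continuous_id by (simp add: id_def)
next
  case (Suc n) then show ?case using E510_continuous_compose[of a "a ^^ n"] E510_linear_funpow by (simp add: o_def)
qed

lemma exp_elt_linear:
  assumes "locally_nilpotent a" "E510_linear a" 
  shows "E510_linear (exp_elt a t)"
  unfolding E510_linear_def
proof (intro conjI ballI allI exp_elt_E510[OF assms])
  note pow = E510_linear_funpow[OF assms(2)]
  fix u v assume uv: "u \<in> E510" "v \<in> E510"
  show "exp_elt a t (u + v) = exp_elt a t u + exp_elt a t v"
  proof (rule elt_eqI)
    fix b
    have "(\<lambda>n. t ^ n / fact n * elt_coord ((a ^^ n) u) b + t ^ n / fact n * elt_coord ((a ^^ n) v) b) sums (elt_coord (exp_elt a t u) b + elt_coord (exp_elt a t v) b)"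
      by (intro sums_add exp_elt_sums assms uv)
    then have "(\<lambda>n. t ^ n / fact n * elt_coord ((a ^^ n) (u + v)) b) sums elt_coord (exp_elt a t u + exp_elt a t v) b"
      using E510_linearD(2)[OF pow uv] by (simp add: elt_coord_linear distrib_left)
    then show "elt_coord (exp_elt a t (u + v)) b = elt_coord (exp_elt a t u + exp_elt a t v) b"
      using exp_elt_sums[OF assms(1) E510_vector_space(2)[OF uv]] sums_unique2 by blast
  qed
next
  note pow = E510_linear_funpow[OF assms(2)]
  fix c u assume u: "u \<in> E510"
  show "exp_elt a t (elt_scale c u) = elt_scale c (exp_elt a t u)"
  proof (rule elt_eqI)
    fix b
    have "(\<lambda>n. c * (t ^ n / fact n * elt_coord ((a ^^ n) u) b)) sums (c * elt_coord (exp_elt a t u) b)"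
      by (intro sums_mult exp_elt_sums assms u)
    then have "(\<lambda>n. t ^ n / fact n * elt_coord ((a ^^ n) (elt_scale c u)) b) sums elt_coord (elt_scale c (exp_elt a t u)) b"
      using E510_linearD(3)[OF pow u] by (simp add: elt_coord_linear mult_ac)
    then show "elt_coord (exp_elt a t (elt_scale c u)) b = elt_coord (elt_scale c (exp_elt a t u)) b"
      using exp_elt_sums[OF assms(1) E510_vector_space(5)[OF u]] sums_unique2 by blast
  qed
qed

lemma common_bound:
  fixes q :: "'a \<Rightarrow> 'b :: linorder"
  assumes "finite A" "A \<noteq> {}"
  shows "\<exists>Q. \<forall>x\<in>A. q x \<le> Q"
  using assms by (intro exI[of _ "Max (q ` A)"]) auto

lemma exp_elt_continuous:
  assumes "locally_nilpotent a" "E510_linear a" "E510_continuous a"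
  shows "E510_continuous (exp_elt a t)"
  unfolding E510_continuous_def
proof
  fix p
  obtain N where N: "\<And>n u. n \<ge> N \<Longrightarrow> u \<in> E510 \<Longrightarrow> agree_below p ((a ^^ n) u) 0"
    using locally_nilpotent_uniform[OF assms(1)] by blast
  have "\<forall>n. \<exists>q. \<forall>u\<in>E510. agree_below q u 0 \<longrightarrow> agree_below p ((a ^^ n) u) 0"
    using E510_continuous_funpow[OF assms(2,3)] unfolding E510_continuous_def by blast
  then obtain q where q: "\<And>n u. u \<in> E510 \<Longrightarrow> agree_below (q n) u 0 \<Longrightarrow> agree_below p ((a ^^ n) u) 0" by metis
  obtain Q where Q: "\<forall>n\<in>{..N}. q n \<le> Q" using common_bound[of "{..N}" q] by auto
  have "agree_below p (exp_elt a t u) 0" if u: "u \<in> E510" "agree_below Q u 0" for u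
  proof (rule agree_below_zeroI)
    fix b assume b: "level b < p"
    have "elt_coord ((a ^^ n) u) b = 0" for n
    proof (cases "n \<le> N")
      case True
      then show ?thesis using q[OF u(1)] agree_below_mono[OF u(2)] Q agree_below_zeroD[OF _ b] by auto
    next
      case False
      then show ?thesis using agree_below_zeroD[OF N b] u by simp
    qed
    then show "elt_coord (exp_elt a t u) b = 0" using coord_exp_elt[OF assms(1) u(1), of 0 b t] by simp
  qed
  then show "\<exists>q. \<forall>u\<in>E510. agree_below q u 0 \<longrightarrow> agree_below p (exp_elt a t u) 0" by blast
qed

lemma exp_elt_part:
  assumes "locally_nilpotent a" "a \<in> Der_part 0" "u \<in> E510_part q"
  shows "exp_elt a t u \<in> E510_part q"
proof -
  note a = Der_part_simps[OF assms(2)]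
  have uE: "u \<in> E510" using assms E510_part_simps by blast
  have n: "(a ^^ n) u \<in> E510_part q" for n using assms(3) a(4)[of _ q] by (induction n) auto
  have z: "elt_coord (exp_elt a t u) b = 0" if "\<And>n. elt_coord ((a ^^ n) u) b = 0" for b
    using coord_exp_elt[OF assms(1) uE, of 0 b t] that by simp
  show ?thesis unfolding E510_part_iff_coord[OF exp_elt_E510[OF assms(1) a(1) uE]]
    using z n E510_part_iff_coord[OF E510_funpow[OF a(1) uE]] by blast
qed

lemma exp_elt_bracket:
  assumes "locally_nilpotent a" "a \<in> Der_part 0" "u \<in> E510" "v \<in> E510"
  shows "exp_elt a t (E510_bracket u v) = E510_bracket (exp_elt a t u) (exp_elt a t v)"
proof (rule elt_eqI)
  fix b
  note a = Der_part_simps[OF assms(2)] and pow = E510_funpow[OF Der_part_simps(1)[OF assms(2)]]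
  define c where "c n i j = elt_coord ((a ^^ n) (E510_bracket ((a ^^ i) u) ((a ^^ j) v))) b" for n i j
  have rec: "c (Suc n) i j = c n (Suc i) j + c n i (Suc j)" for n i j
  proof -
    have B: "E510_bracket ((a ^^ i) u) ((a ^^ j) v) \<in> E510" for i j
      using E510_bracket_closed pow assms by blast
    have "a (E510_bracket ((a ^^ i) u) ((a ^^ j) v)) = E510_bracket ((a ^^ Suc i) u) ((a ^^ j) v) + E510_bracket ((a ^^ i) u) ((a ^^ Suc j) v)"
      using Der_even_derivation[OF assms(2) pow[OF assms(3)] pow[OF assms(4)]] by simp
    moreover have "(a ^^ Suc n) w = (a ^^ n) (a w)" for w by (simp add: funpow_swap1)
    ultimately show ?thesis unfolding c_def
      using E510_linearD(2)[OF E510_linear_funpow[OF a(1)] B B] by (simp only: elt_coord_linear)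
  qed
  have eE: "exp_elt a t x \<in> E510" if "x \<in> E510" for x using exp_elt_E510[OF assms(1) a(1) that] .
  \<comment> \<open>Bracketing lowers the order of agreement by 2; starting from
    \<open>level b + 3\<close> leaves \<open>level b + 1\<close>, which still covers the coordinate
    \<open>b\<close>.\<close>
  obtain N where N: "\<And>n u. n \<ge> N \<Longrightarrow> u \<in> E510 \<Longrightarrow> agree_below (level b + 3) ((a ^^ n) u) 0"
    using locally_nilpotent_uniform[OF assms(1)] by blast
  have cN: "elt_coord (E510_bracket ((a ^^ k) u) w) b = 0" if "k \<ge> N" "w \<in> E510" for k w
    using agree_below_zeroD[OF agree_below_bracket(1)[OF pow[OF assms(3)] that(2) N[OF that(1) assms(3)]], of b] by simp
  obtain K0 where K0: "\<And>K. K \<ge> K0 \<Longrightarrow> elt_coord (E510_bracket (exp_elt a t u) (exp_elt a t v)) b = (\<Sum>l<K. t ^ l / fact l * elt_coord (E510_bracket ((a ^^ l) u) (exp_elt a t v)) b)"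
    using exp_elt_apply[OF assms(1) a(1) E510_linear_bracket(2)[OF eE[OF assms(4)]] E510_continuous_bracket(2)[OF eE[OF assms(4)]], of b] assms(3) by blast
  \<comment> \<open>The successor makes \<open>{..<K}\<close> nonempty, as
    \<open>common_bound\<close> requires.\<close>
  define K where "K = Suc (max N K0)"
  have "\<forall>k. \<exists>L0. \<forall>L\<ge>L0. elt_coord (E510_bracket ((a ^^ k) u) ((a ^^ L) v)) b = 0 \<and>
    elt_coord (E510_bracket ((a ^^ k) u) (exp_elt a t v)) b = (\<Sum>l<L. t ^ l / fact l * elt_coord (E510_bracket ((a ^^ k) u) ((a ^^ l) v)) b)"
    using exp_elt_apply[OF assms(1) a(1) E510_linear_bracket(1) E510_continuous_bracket(1), OF pow pow, OF assms(3,3), of _ b] assms(4) by blast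
  then obtain L0 where "\<forall>k. \<forall>L\<ge>L0 k. elt_coord (E510_bracket ((a ^^ k) u) ((a ^^ L) v)) b = 0 \<and>
    elt_coord (E510_bracket ((a ^^ k) u) (exp_elt a t v)) b = (\<Sum>l<L. t ^ l / fact l * elt_coord (E510_bracket ((a ^^ k) u) ((a ^^ l) v)) b)"
    by (rule choice[THEN exE])
  then have L0: "\<And>k L. L \<ge> L0 k \<Longrightarrow> elt_coord (E510_bracket ((a ^^ k) u) ((a ^^ L) v)) b = 0"
    "\<And>k L. L \<ge> L0 k \<Longrightarrow> elt_coord (E510_bracket ((a ^^ k) u) (exp_elt a t v)) b = (\<Sum>l<L. t ^ l / fact l * elt_coord (E510_bracket ((a ^^ k) u) ((a ^^ l) v)) b)"
    by blast+
  obtain L where L: "\<forall>k\<in>{..<K}. L0 k \<le> L" using common_bound[of "{..<K}" L0] by (auto simp: K_def)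
  have "(\<lambda>n. t ^ n / fact n * c n 0 0) sums (\<Sum>k<K. \<Sum>l<L. t ^ k / fact k * (t ^ l / fact l * c 0 k l))"
  proof (rule exponential_double_sum[of c, OF rec])
    show "c 0 k l = 0" if "k \<ge> K" for k l using cN[of k "(a ^^ l) v"] that pow[OF assms(4)] by (simp add: c_def K_def)
    show "c 0 k l = 0" if "k < K" "l \<ge> L" for k l using L0(1)[of k l] L that order_trans[of "L0 k" L l] by (auto simp: c_def)
  qed
  moreover have "(\<lambda>n. t ^ n / fact n * c n 0 0) sums elt_coord (exp_elt a t (E510_bracket u v)) b"
    unfolding c_def using exp_elt_sums[OF assms(1) E510_bracket_closed[OF assms(3,4)]] by simp
  moreover have "(\<Sum>k<K. \<Sum>l<L. t ^ k / fact k * (t ^ l / fact l * c 0 k l)) = elt_coord (E510_bracket (exp_elt a t u) (exp_elt a t v)) b"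
  proof -
    have "(\<Sum>l<L. t ^ k / fact k * (t ^ l / fact l * c 0 k l)) = t ^ k / fact k * elt_coord (E510_bracket ((a ^^ k) u) (exp_elt a t v)) b" if "k < K" for k
      using L0(2)[of k L] L that by (simp add: c_def sum_distrib_left)
    then show ?thesis using K0[of K] by (simp add: K_def)
  qed
  ultimately show "elt_coord (exp_elt a t (E510_bracket u v)) b = elt_coord (E510_bracket (exp_elt a t u) (exp_elt a t v)) b"
    using sums_unique2 by metis
qed

lemma Der_ad_linear:
  assumes "E510_linear a" "E510_linear G"
  shows "E510_linear ((Der_ad a ^^ n) G)"
proof (induction n)
  case (Suc n)
  let ?H = "(Der_ad a ^^ n) G"
  have "E510_linear (\<lambda>u. a (?H u) + - (?H (a u)))"
  proof (rule E510_linear_add)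
    show "E510_linear (\<lambda>u. a (?H u))" by (rule E510_linear_compose[OF assms(1) Suc.IH])
    have "E510_linear (\<lambda>u. ?H (a u))" by (rule E510_linear_compose[OF Suc.IH assms(1)])
    then show "E510_linear (\<lambda>u. - (?H (a u)))"
      by (auto simp: E510_linear_def E510_vector_space intro!: elt_eqI) (simp_all add: elt_coord_linear)
  qed
  then show ?case by (auto simp: E510_linear_def Der_ad_apply E510_vector_space)
qed (use assms in simp)

lemma exp_elt_conjugation_sums:
  assumes "locally_nilpotent a" "E510_linear a" "E510_continuous a" "E510_linear G" "E510_continuous G" "u \<in> E510"
  shows "(\<lambda>n. t ^ n / fact n * elt_coord ((Der_ad a ^^ n) G u) b) sums elt_coord (exp_elt a t (G (exp_elt a (- t) u))) b"
proof -
  note lin = E510_linear_funpow[OF assms(2)] and pow = E510_funpow[OF assms(2)]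
  \<comment> \<open>The \<open>j\<close>-th power of \<open>- a\<close> applied to \<open>u\<close>;
    with this sign both terms of the recursion for \<open>c\<close> are positive.\<close>
  define x where "x j = elt_scale ((- 1) ^ j) ((a ^^ j) u)" for j
  have x: "x j \<in> E510" "x (Suc j) = - a (x j)" for j
    using E510_linearD(3)[OF assms(2) pow[OF assms(6)]] pow[OF assms(6)]
    by (auto simp: x_def E510_vector_space intro!: elt_eqI) (simp add: elt_coord_linear)
  define c where "c n i j = elt_coord ((a ^^ i) ((Der_ad a ^^ n) G (x j))) b" for n i j
  have rec: "c (Suc n) i j = c n (Suc i) j + c n i (Suc j)" for n i j
  proof -
    note H = Der_ad_linear[OF assms(2,4), of n]
    note 1 = E510_linearD(1)[OF assms(2) x(1)[of j]] 
    note 2 = E510_linearD(1)[OF assms(2) E510_linearD(1)[OF H x(1)[of j]]] E510_linearD(1)[OF H 1]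
    have "(Der_ad a ^^ Suc n) G (x j) = a ((Der_ad a ^^ n) G (x j)) - (Der_ad a ^^ n) G (a (x j))"
      using x by (simp add: Der_ad_apply)
    then show ?thesis
      using E510_linearD(6)[OF lin 2] E510_linearD(5)[OF H 1] E510_linearD(5)[OF lin 2(2)]
      by (simp only: c_def x(2) elt_coord_linear funpow_Suc_right o_apply diff_conv_add_uminus minus_minus)
  qed
  obtain K0 where K0: "\<And>K u. K \<ge> K0 \<Longrightarrow> u \<in> E510 \<Longrightarrow> elt_coord ((a ^^ K) u) b = 0 \<and> elt_coord (exp_elt a t u) b = (\<Sum>l<K. t ^ l / fact l * elt_coord ((a ^^ l) u) b)"
    using exp_elt_apply[OF assms(1,2) E510_linear_id E510_continuous_id, of b] by blast
  have eE: "exp_elt a (- t) u \<in> E510" using exp_elt_E510[OF assms(1,2,6)] .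
  have GE: "G v \<in> E510" if "v \<in> E510" for v using E510_linearD(1)[OF assms(4) that] .
  define K where "K = Suc K0"
  have "\<forall>k. \<exists>L0. \<forall>L\<ge>L0. elt_coord ((a ^^ k) (G ((a ^^ L) u))) b = 0 \<and>
    elt_coord ((a ^^ k) (G (exp_elt a (- t) u))) b = (\<Sum>l<L. (- t) ^ l / fact l * elt_coord ((a ^^ k) (G ((a ^^ l) u))) b)"
    using exp_elt_apply[OF assms(1,2) E510_linear_compose[OF lin assms(4)] E510_continuous_compose[OF E510_continuous_funpow[OF assms(2,3)] assms(5,4)], of _ b] assms(6) by blast
  then obtain L0 where "\<forall>k. \<forall>L\<ge>L0 k. elt_coord ((a ^^ k) (G ((a ^^ L) u))) b = 0 \<and>
    elt_coord ((a ^^ k) (G (exp_elt a (- t) u))) b = (\<Sum>l<L. (- t) ^ l / fact l * elt_coord ((a ^^ k) (G ((a ^^ l) u))) b)"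
    by (rule choice[THEN exE])
  then have L0: "\<And>k L. L \<ge> L0 k \<Longrightarrow> elt_coord ((a ^^ k) (G ((a ^^ L) u))) b = 0"
    "\<And>k L. L \<ge> L0 k \<Longrightarrow> elt_coord ((a ^^ k) (G (exp_elt a (- t) u))) b = (\<Sum>l<L. (- t) ^ l / fact l * elt_coord ((a ^^ k) (G ((a ^^ l) u))) b)"
    by blast+
  obtain L where L: "\<forall>k\<in>{..<K}. L0 k \<le> L" using common_bound[of "{..<K}" L0] by (auto simp: K_def)
  have cx: "c 0 k l = (- 1) ^ l * elt_coord ((a ^^ k) (G ((a ^^ l) u))) b" for k l
    using E510_linearD(3)[OF assms(4) pow[OF assms(6)]] E510_linearD(3)[OF lin GE[OF pow[OF assms(6)]]]
    by (simp add: c_def x_def elt_coord_linear)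
  have "(\<lambda>n. t ^ n / fact n * c n 0 0) sums (\<Sum>k<K. \<Sum>l<L. t ^ k / fact k * (t ^ l / fact l * c 0 k l))"
  proof (rule exponential_double_sum[of c, OF rec])
    show "c 0 k l = 0" if "k \<ge> K" for k l using K0[of k "G (x l)"] GE[OF x(1)] that by (simp add: c_def K_def)
    show "c 0 k l = 0" if "k < K" "l \<ge> L" for k l using L0(1)[of k l] L that order_trans[of "L0 k" L l] by (auto simp: cx)
  qed
  moreover have "c n 0 0 = elt_coord ((Der_ad a ^^ n) G u) b" for n by (simp add: c_def x_def elt_scale_simps)
  moreover have "(\<Sum>k<K. \<Sum>l<L. t ^ k / fact k * (t ^ l / fact l * c 0 k l)) = elt_coord (exp_elt a t (G (exp_elt a (- t) u))) b"
  proof -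
    have pm: "t ^ l * (- 1) ^ l = (- t) ^ l" for l by (metis mult.commute mult_minus1 power_mult_distrib)
    have "(\<Sum>l<L. t ^ k / fact k * (t ^ l / fact l * c 0 k l)) = t ^ k / fact k * elt_coord ((a ^^ k) (G (exp_elt a (- t) u))) b" if "k < K" for k
      using L0(2)[of k L] L that by (simp add: cx sum_distrib_left flip: pm) (simp add: mult_ac)
    then show ?thesis using K0[of K "G (exp_elt a (- t) u)"] GE[OF eE] by (simp add: K_def)
  qed
  ultimately show ?thesis by simp
qed

text \<open>The conjugation formula applied to the identity map, which commutes with
  \<open>a\<close>: only the term of index 0 remains.\<close>

lemma exp_elt_inverse:
  assumes "locally_nilpotent a" "E510_linear a" "E510_continuous a" "u \<in> E510"
  shows "exp_elt a t (exp_elt a (- t) u) = u"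
proof (rule elt_eqI)
  fix b
  have "(Der_ad a ^^ Suc n) (\<lambda>u. u) v = 0" if "v \<in> E510" for n v
    using that
  proof (induction n arbitrary: v)
    case (Suc n)
    then show ?case using E510_linearD(1)[OF assms(2)] E510_linearD(4)[OF assms(2)] by (simp add: Der_ad_apply)
  qed (simp add: Der_ad_apply)
  then have "elt_coord ((Der_ad a ^^ n) (\<lambda>u. u) u) b = (if n = 0 then elt_coord u b else 0)" for n
    using assms(4) by (cases n) (auto simp: elt_coord_linear simp del: funpow.simps(2))
  then have "(\<lambda>n. t ^ n / fact n * elt_coord ((Der_ad a ^^ n) (\<lambda>u. u) u) b) = (\<lambda>n. if n = 0 then elt_coord u b else 0)"
    by (intro ext) simp
  then have "(\<lambda>n. t ^ n / fact n * elt_coord ((Der_ad a ^^ n) (\<lambda>u. u) u) b) sums elt_coord u b"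
    using sums_single[of 0 "\<lambda>_. elt_coord u b"] by simp
  then show "elt_coord (exp_elt a t (exp_elt a (- t) u)) b = elt_coord u b"
    using exp_elt_conjugation_sums[OF assms(1-3) E510_linear_id E510_continuous_id assms(4)] sums_unique2 by blast
qed

lemma exp_elt_aut_pair:
  assumes "locally_nilpotent a" "a \<in> Der_part 0"
  shows "E510_aut_pair (exp_elt a t) (exp_elt a (- t))"
proof -
  note a = Der_part_simps[OF assms(2)]
  have "E510_aut (exp_elt a t)" for t
    unfolding E510_aut_def using exp_elt_linear[OF assms(1) a(1)] exp_elt_continuous[OF assms(1) a(1,2)]
      exp_elt_part[OF assms] exp_elt_bracket[OF assms] by simp
  then show ?thesis unfolding E510_aut_pair_def
    using exp_elt_inverse[OF assms(1) a(1,2), of _ t] exp_elt_inverse[OF assms(1) a(1,2), of _ "- t"] by simp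
qed

section \<open>Automorphisms of the derivation algebra given by conjugation\<close>

definition Der_conj :: "(elt \<Rightarrow> elt) \<Rightarrow> (elt \<Rightarrow> elt) \<Rightarrow> (elt \<Rightarrow> elt) \<Rightarrow> elt \<Rightarrow> elt" where
  "Der_conj \<psi> \<psi>' = (\<lambda>D\<in>Der. \<lambda>u\<in>E510. \<psi> (D (\<psi>' u)))"

lemma E510_part_cong: "even (p + q) \<Longrightarrow> E510_part p = E510_part q"
  by (auto simp: E510_part_def)

text \<open>Parities are natural numbers, but the defining conditions depend only on
  \<open>p\<close> modulo 2.\<close>

lemma Der_part_Der: "D \<in> Der_part p \<Longrightarrow> D \<in> Der"
proof -
  assume D: "D \<in> Der_part p"
  note s = Der_part_simps[OF D]
  define r where "r = p mod 2"
  have "D \<in> Der_part r"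
  proof (rule Der_partI[OF s(1-3)])
    show "D u \<in> E510_part (r + q)" if "u \<in> E510_part q" for u q
      using s(4)[OF that] E510_part_cong[of "p + q" "r + q"] unfolding r_def by auto
    have "(- 1 :: complex) ^ (p * q) = (- 1) ^ (r * q)" for q
      by (simp add: minus_one_power_iff r_def)
    then show "D (E510_bracket u v) = E510_bracket (D u) v + elt_scale ((- 1) ^ (r * q)) (E510_bracket u (D v))"
      if "u \<in> E510_part q" "v \<in> E510" for u v q using s(5)[OF that] by simp
  qed
  moreover have "r = 0 \<or> r = 1" unfolding r_def by auto
  ultimately show "D \<in> Der" using Der_part_add_zero by blast
qed

lemma Der_conj_part:
  assumes "E510_aut_pair \<psi> \<psi>'" "D \<in> Der_part p"
  shows "Der_conj \<psi> \<psi>' D \<in> Der_part p"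
proof (rule Der_partI)
  have aut: "E510_linear \<psi>" "E510_continuous \<psi>" "E510_linear \<psi>'" "E510_continuous \<psi>'"
    "\<And>u q. u \<in> E510_part q \<Longrightarrow> \<psi> u \<in> E510_part q" "\<And>u q. u \<in> E510_part q \<Longrightarrow> \<psi>' u \<in> E510_part q"
    "\<And>u v. u \<in> E510 \<Longrightarrow> v \<in> E510 \<Longrightarrow> \<psi> (E510_bracket u v) = E510_bracket (\<psi> u) (\<psi> v)"
    "\<And>u v. u \<in> E510 \<Longrightarrow> v \<in> E510 \<Longrightarrow> \<psi>' (E510_bracket u v) = E510_bracket (\<psi>' u) (\<psi>' v)"
    "\<And>u. u \<in> E510 \<Longrightarrow> \<psi> (\<psi>' u) = u"
    using assms(1) by (auto simp: E510_aut_pair_def E510_aut_def)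
  note D = Der_part_simps[OF assms(2)] and E = E510_linearD(1)[OF aut(1)] E510_linearD(1)[OF aut(3)]
  have DE: "D u \<in> E510" if "u \<in> E510" for u using E510_linearD(1)[OF D(1) that] .
  have eq: "Der_conj \<psi> \<psi>' D = (\<lambda>u\<in>E510. \<psi> (D (\<psi>' u)))" using Der_part_Der[OF assms(2)] by (simp add: Der_conj_def)
  show "E510_linear (Der_conj \<psi> \<psi>' D)" "E510_continuous (Der_conj \<psi> \<psi>' D)"
    unfolding eq E510_linear_restrict E510_continuous_restrict
    using E510_linear_compose[OF aut(1) E510_linear_compose[OF D(1) aut(3)]]
      E510_continuous_compose[OF aut(2) E510_continuous_compose[OF D(2) aut(4,3)] E510_linear_compose[OF D(1) aut(3)]]
    by simp_all
  show "Der_conj \<psi> \<psi>' D \<in> extensional E510" unfolding eq by simp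
  show "Der_conj \<psi> \<psi>' D u \<in> E510_part (p + q)" if "u \<in> E510_part q" for u q
    unfolding eq using aut(5)[OF D(4)[OF aut(6)[OF that]]] E510_part_simps(1)[OF that] by simp
  fix u v q assume u: "u \<in> E510_part q" and v: "v \<in> E510"
  have uE: "u \<in> E510" using u E510_part_simps by blast
  have "\<psi> (D (\<psi>' (E510_bracket u v))) = E510_bracket (\<psi> (D (\<psi>' u))) v + elt_scale ((- 1) ^ (p * q)) (E510_bracket u (\<psi> (D (\<psi>' v))))"
    using D(5)[OF aut(6)[OF u] E(2)[OF v]] uE v
    by (simp add: aut(7,8,9) E DE E510_bracket_closed E510_vector_space E510_linearD(2,3)[OF aut(1)])
  then show "Der_conj \<psi> \<psi>' D (E510_bracket u v) = E510_bracket (Der_conj \<psi> \<psi>' D u) v + elt_scale ((- 1) ^ (p * q)) (E510_bracket u (Der_conj \<psi> \<psi>' D v))"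
    unfolding eq using uE v E510_bracket_closed by simp
qed

lemma Der_add_Der_part:
  assumes "D \<in> Der_part p" "D' \<in> Der_part p"
  shows "Der_add D D' \<in> Der_part p"
proof (rule Der_partI)
  note D = Der_part_simps[OF assms(1)] and D' = Der_part_simps[OF assms(2)]
  show "E510_linear (Der_add D D')" "E510_continuous (Der_add D D')" "Der_add D D' \<in> extensional E510"
    unfolding Der_add_def E510_linear_restrict E510_continuous_restrict
    by (simp_all add: E510_linear_add E510_continuous_add D D')
  show "Der_add D D' u \<in> E510_part (p + q)" if "u \<in> E510_part q" for u q
    using E510_part_simps(6)[OF D(4) D'(4), OF that that] E510_part_simps(1)[OF that] by (simp add: Der_add_def)
  fix u v q assume u: "u \<in> E510_part q" and v: "v \<in> E510"
  show "Der_add D D' (E510_bracket u v) = E510_bracket (Der_add D D' u) v + elt_scale ((- 1) ^ (p * q)) (E510_bracket u (Der_add D D' v))"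
    using D(5)[OF u v] D'(5)[OF u v] E510_part_simps(1)[OF u] v E510_bracket_closed[of u v]
    by (intro elt_eqI) (simp add: Der_add_def E510_bracket_linear elt_coord_linear algebra_simps)
qed

lemma E510_scale_map:
  "E510_linear T \<Longrightarrow> E510_linear (\<lambda>u. elt_scale c (T u))" "E510_continuous T \<Longrightarrow> E510_continuous (\<lambda>u. elt_scale c (T u))"
proof -
  have "elt_scale c (elt_scale d u) = elt_scale d (elt_scale c u)" "elt_scale c (u + v) = elt_scale c u + elt_scale c v" for d u v
    by (rule elt_eqI, simp add: elt_coord_linear algebra_simps)+
  then show "E510_linear T \<Longrightarrow> E510_linear (\<lambda>u. elt_scale c (T u))" by (simp add: E510_linear_def E510_vector_space)
  have "agree_below q (elt_scale c u) 0" if "agree_below q u 0" for q u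
    using agree_below_zeroD[OF that] by (auto intro!: agree_below_zeroI simp: elt_coord_linear)
  then show "E510_continuous T \<Longrightarrow> E510_continuous (\<lambda>u. elt_scale c (T u))"
    unfolding E510_continuous_def by meson
qed

lemma Der_scale_Der_part:
  assumes "D \<in> Der_part p"
  shows "Der_scale c D \<in> Der_part p"
proof (rule Der_partI)
  note D = Der_part_simps[OF assms(1)]
  show "E510_linear (Der_scale c D)" "E510_continuous (Der_scale c D)"
    unfolding Der_scale_def E510_linear_restrict E510_continuous_restrict
    by (rule E510_scale_map(1)[OF D(1)] E510_scale_map(2)[OF D(2)])+
  show "Der_scale c D \<in> extensional E510" unfolding Der_scale_def by simp
  show "Der_scale c D u \<in> E510_part (p + q)" if "u \<in> E510_part q" for u q
    using E510_part_simps(7)[OF D(4)[OF that]] E510_part_simps(1)[OF that] by (simp add: Der_scale_def)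
  fix u v q assume u: "u \<in> E510_part q" and v: "v \<in> E510"
  show "Der_scale c D (E510_bracket u v) = E510_bracket (Der_scale c D u) v + elt_scale ((- 1) ^ (p * q)) (E510_bracket u (Der_scale c D v))"
    using D(5)[OF u v] E510_part_simps(1)[OF u] v E510_bracket_closed[of u v]
    by (intro elt_eqI) (simp add: Der_scale_def E510_bracket_scale elt_coord_linear algebra_simps)
qed

lemma Der_bracket_Der_part:
  assumes "D \<in> Der_part p" "D' \<in> Der_part q"
  shows "Der_bracket p q D D' \<in> Der_part (p + q)"
proof (rule Der_partI)
  note D = Der_part_simps[OF assms(1)] and D' = Der_part_simps[OF assms(2)]
  let ?s = "\<lambda>n. (- 1 :: complex) ^ n"
  let ?B = "\<lambda>u. D (D' u) + elt_scale (- ?s (p * q)) (D' (D u))"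
  have eq: "Der_bracket p q D D' = restrict ?B E510"
    by (auto simp: Der_bracket_def fun_eq_iff restrict_def intro!: elt_eqI) (simp add: elt_coord_linear)
  show "E510_linear (Der_bracket p q D D')" "E510_continuous (Der_bracket p q D D')" "Der_bracket p q D D' \<in> extensional E510"
    unfolding eq E510_linear_restrict E510_continuous_restrict
    using E510_linear_add[OF E510_linear_compose[OF D(1) D'(1)] E510_scale_map(1)[OF E510_linear_compose[OF D'(1) D(1)]]]
      E510_continuous_add[OF E510_continuous_compose[OF D(2) D'(2,1)] E510_scale_map(2)[OF E510_continuous_compose[OF D'(2) D(2,1)]]]
    by simp_all
  show "Der_bracket p q D D' u \<in> E510_part (p + q + r)" if "u \<in> E510_part r" for u r
    using E510_part_simps(6)[OF D(4)[OF D'(4)[OF that]] E510_part_simps(7)[OF D'(4)[OF D(4)[OF that], folded add.left_commute[of p]]]]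
      E510_part_simps(1)[OF that] by (simp add: eq add.assoc)
  fix u v r assume u: "u \<in> E510_part r" and v: "v \<in> E510"
  have uE: "u \<in> E510" using u E510_part_simps by blast
  note L = E510_linearD(1)[OF D(1)] E510_linearD(1)[OF D'(1)]
  have 1: "D (D' (E510_bracket u v)) = E510_bracket (D (D' u)) v + elt_scale (?s (p * (q + r))) (E510_bracket (D' u) (D v))
     + elt_scale (?s (q * r)) (E510_bracket (D u) (D' v) + elt_scale (?s (p * r)) (E510_bracket u (D (D' v))))"
    using D'(5)[OF u v] D(5)[OF D'(4)[OF u] v] D(5)[OF u L(2)[OF v]] uE v
    by (simp add: E510_linearD(2,3)[OF D(1)] L E510_bracket_closed E510_vector_space)
  have 2: "D' (D (E510_bracket u v)) = E510_bracket (D' (D u)) v + elt_scale (?s (q * (p + r))) (E510_bracket (D u) (D' v))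
     + elt_scale (?s (p * r)) (E510_bracket (D' u) (D v) + elt_scale (?s (q * r)) (E510_bracket u (D' (D v))))"
    using D(5)[OF u v] D'(5)[OF D(4)[OF u] v] D'(5)[OF u L(1)[OF v]] uE v
    by (simp add: E510_linearD(2,3)[OF D'(1)] L E510_bracket_closed E510_vector_space)
  have s: "?s (q * (p + r)) = ?s (p * q) * ?s (q * r)" "?s (p * (q + r)) = ?s (p * q) * ?s (p * r)"
    "?s ((p + q) * r) = ?s (p * r) * ?s (q * r)" "?s (p * q) * (?s (p * q) * x) = x" for x
    by (simp_all add: power_add[symmetric] algebra_simps mult.assoc[symmetric])
  have "?B (E510_bracket u v) = E510_bracket (?B u) v + elt_scale (?s ((p + q) * r)) (E510_bracket u (?B v))"
    unfolding 1 2 s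
    by (rule elt_eqI) (simp add: s(4) E510_bracket_linear E510_bracket_scale elt_coord_linear algebra_simps)
  then show "Der_bracket p q D D' (E510_bracket u v) = E510_bracket (Der_bracket p q D D' u) v + elt_scale (?s ((p + q) * r)) (E510_bracket u (Der_bracket p q D D' v))"
    using uE v E510_bracket_closed by (simp add: eq)
qed


lemma Der_add_Der: "D \<in> Der \<Longrightarrow> D' \<in> Der \<Longrightarrow> Der_add D D' \<in> Der"
proof -
  assume "D \<in> Der" "D' \<in> Der"
  then obtain A B A' B' where *: "D = Der_add A B" "D' = Der_add A' B'" "A \<in> Der_part 0" "B \<in> Der_part 1" "A' \<in> Der_part 0" "B' \<in> Der_part 1"
    unfolding Der_def by blast
  have "Der_add D D' = Der_add (Der_add A A') (Der_add B B')"
    unfolding * by (auto simp: Der_add_def fun_eq_iff restrict_def algebra_simps)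
  then show ?thesis using Der_add_Der_part * unfolding Der_def by blast
qed

lemma Der_scale_Der: "D \<in> Der \<Longrightarrow> Der_scale c D \<in> Der"
proof -
  assume "D \<in> Der"
  then obtain A B where *: "D = Der_add A B" "A \<in> Der_part 0" "B \<in> Der_part 1" unfolding Der_def by blast
  have "elt_scale c (u + v) = elt_scale c u + elt_scale c v" for u v
    by (rule elt_eqI) (simp add: elt_coord_linear algebra_simps)
  then have "Der_scale c D = Der_add (Der_scale c A) (Der_scale c B)"
    unfolding * by (auto simp: Der_add_def Der_scale_def fun_eq_iff restrict_def)
  then show ?thesis using Der_scale_Der_part * unfolding Der_def by blast
qed

lemma Der_conj_apply: "D \<in> Der \<Longrightarrow> u \<in> E510 \<Longrightarrow> Der_conj \<psi> \<psi>' D u = \<psi> (D (\<psi>' u))"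
  by (simp add: Der_conj_def)

lemma continuous_Der_aut_conj:
  assumes "E510_aut_pair \<psi> \<psi>'"
  shows "continuous_Der_aut (Der_conj \<psi> \<psi>')"
proof -
  have lin: "E510_linear \<psi>" "E510_linear \<psi>'" "E510_continuous \<psi>" using assms by (auto simp: E510_aut_pair_def E510_aut_def)
  note E = E510_linearD(1)[OF lin(1)] E510_linearD(1)[OF lin(2)]
  have add: "Der_conj \<psi> \<psi>' (Der_add D D') = Der_add (Der_conj \<psi> \<psi>' D) (Der_conj \<psi> \<psi>' D')"
    if "D \<in> Der" "D' \<in> Der" "E510_aut_pair \<psi> \<psi>'" for \<psi> \<psi>' D D'
  proof -
    have lin: "E510_linear \<psi>" "E510_linear \<psi>'" using that(3) by (auto simp: E510_aut_pair_def E510_aut_def)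
    have "\<psi> (D (\<psi>' u) + D' (\<psi>' u)) = \<psi> (D (\<psi>' u)) + \<psi> (D' (\<psi>' u))" if u: "u \<in> E510" for u
      using E510_linearD(2)[OF lin(1)] Der_simps(4) \<open>D \<in> Der\<close> \<open>D' \<in> Der\<close> E510_linearD(1)[OF lin(2) u] by blast
    then show ?thesis using that(1,2) Der_add_Der E510_linearD(1)[OF lin(2)]
      by (auto simp: Der_conj_def Der_add_def fun_eq_iff restrict_def)
  qed
  have closed: "Der_conj \<psi> \<psi>' D \<in> Der" if "D \<in> Der" "E510_aut_pair \<psi> \<psi>'" for \<psi> \<psi>' D
  proof -
    obtain A B where *: "D = Der_add A B" "A \<in> Der_part 0" "B \<in> Der_part 1" using \<open>D \<in> Der\<close> unfolding Der_def by blast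
    have "Der_conj \<psi> \<psi>' D = Der_add (Der_conj \<psi> \<psi>' A) (Der_conj \<psi> \<psi>' B)"
      unfolding *(1) using add Der_part_Der * that(2) by blast
    then show ?thesis using Der_conj_part[OF that(2)] * unfolding Der_def by blast
  qed
  have inverse: "Der_conj \<psi>' \<psi> (Der_conj \<psi> \<psi>' D) = D" if "D \<in> Der" "E510_aut_pair \<psi> \<psi>'" for \<psi> \<psi>' D
  proof
    fix u
    have p: "\<And>u. u \<in> E510 \<Longrightarrow> \<psi>' (\<psi> u) = u" "\<And>u. u \<in> E510 \<Longrightarrow> \<psi> u \<in> E510"
      using that(2) by (auto simp: E510_aut_pair_def E510_aut_def E510_linear_def)
    have "Der_conj \<psi>' \<psi> (Der_conj \<psi> \<psi>' D) u = undefined" if "u \<notin> E510"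
      using closed[OF \<open>D \<in> Der\<close> \<open>E510_aut_pair \<psi> \<psi>'\<close>] that by (simp add: Der_conj_def)
    then show "Der_conj \<psi>' \<psi> (Der_conj \<psi> \<psi>' D) u = D u"
      using closed[OF that] p Der_simps(3)[OF that(1)] Der_simps(4)[OF that(1)] that(1)
      by (cases "u \<in> E510") (auto simp: Der_conj_apply extensional_def)
  qed
  show ?thesis unfolding continuous_Der_aut_def
  proof (intro conjI ballI allI)
    have "bij_betw (Der_conj \<psi> \<psi>') Der Der"
      by (rule bij_betwI[of _ _ _ "Der_conj \<psi>' \<psi>"])
        (use closed inverse assms E510_aut_pair_sym[OF assms] in auto)
    then show "Der_conj \<psi> \<psi>' \<in> Bij Der" by (simp add: Bij_def Der_conj_def)
    show "Der_conj \<psi> \<psi>' (Der_add D D') = Der_add (Der_conj \<psi> \<psi>' D) (Der_conj \<psi> \<psi>' D')" if "D \<in> Der" "D' \<in> Der" for D D'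
      by (rule add[OF that assms])
    show "Der_conj \<psi> \<psi>' (Der_scale c D) = Der_scale c (Der_conj \<psi> \<psi>' D)" if "D \<in> Der" for c D
      using that Der_scale_Der[OF that] E510_linearD(3)[OF lin(1) Der_simps(4)[OF that E(2)]] E(2)
      by (auto simp: Der_conj_def Der_scale_def fun_eq_iff restrict_def)
    show "Der_conj \<psi> \<psi>' ` Der_part p \<subseteq> Der_part p" for p using Der_conj_part[OF assms] by blast
    show "Der_conj \<psi> \<psi>' (Der_bracket p q D D') = Der_bracket p q (Der_conj \<psi> \<psi>' D) (Der_conj \<psi> \<psi>' D')"
      if "D \<in> Der_part p" "D' \<in> Der_part q" for p q D D'
    proof
      fix u
      have D: "D \<in> Der" "D' \<in> Der" "Der_bracket p q D D' \<in> Der"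
        using that Der_bracket_Der_part Der_part_Der by blast+
      show "Der_conj \<psi> \<psi>' (Der_bracket p q D D') u = Der_bracket p q (Der_conj \<psi> \<psi>' D) (Der_conj \<psi> \<psi>' D') u"
      proof (cases "u \<in> E510")
        case True
        have "\<psi>' (\<psi> v) = v" if "v \<in> E510" for v using assms that by (auto simp: E510_aut_pair_def)
        then show ?thesis using True D Der_simps(4)[OF D(1)] Der_simps(4)[OF D(2)] E
          by (simp add: Der_conj_apply Der_bracket_def E510_linearD(3,6)[OF lin(1)] E510_vector_space)
      next
        case False
        then show ?thesis using D by (simp add: Der_conj_def Der_bracket_def)
      qed
    qed
    show "continuous_map Der_top Der_top (Der_conj \<psi> \<psi>')"
      unfolding Der_top_def continuous_map_in_subtopology continuous_map_componentwise
    proof (intro conjI ballI)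
      show "Der_conj \<psi> \<psi>' ` topspace (subtopology (product_topology (\<lambda>_. E510_top) E510) Der) \<subseteq> extensional E510"
        using closed[OF _ assms] Der_simps(3) by auto
      show "Der_conj \<psi> \<psi>' \<in> topspace (subtopology (product_topology (\<lambda>_. E510_top) E510) Der) \<rightarrow> Der"
        using closed[OF _ assms] by auto
      fix u assume u: "u \<in> E510"
      have "continuous_map (subtopology (product_topology (\<lambda>_. E510_top) E510) Der) E510_top (\<lambda>D. D (\<psi>' u))"
        using E(2)[OF u] by (intro continuous_map_from_subtopology continuous_map_product_projection)
      moreover have "continuous_map E510_top E510_top \<psi>" using continuous_map_E510[OF lin(1)] lin(3) by blast
      ultimately have "continuous_map (subtopology (product_topology (\<lambda>_. E510_top) E510) Der) E510_top (\<psi> \<circ> (\<lambda>D. D (\<psi>' u)))"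
        by (rule continuous_map_compose)
      then show "continuous_map (subtopology (product_topology (\<lambda>_. E510_top) E510) Der) E510_top (\<lambda>D. Der_conj \<psi> \<psi>' D u)"
        by (rule continuous_map_eq) (use u in \<open>auto simp: Der_conj_apply\<close>)
    qed
  qed
qed

lemma exp_ad_Der_conj:
  assumes "locally_nilpotent a" "a \<in> Der_part 0"
  shows "exp_ad a t (Der_conj (exp_elt a t) (exp_elt a (- t)))"
  unfolding exp_ad_def
proof (intro ballI allI)
  note a = Der_part_simps[OF assms(2)]
  fix D u b assume "D \<in> Der" "u \<in> E510"
  then show "(\<lambda>n. t ^ n / fact n * elt_coord ((Der_ad a ^^ n) D u) b) sums elt_coord (Der_conj (exp_elt a t) (exp_elt a (- t)) D u) b"
    using exp_elt_conjugation_sums[OF assms(1) a(1,2) Der_simps(1,2)[of D]] by (simp add: Der_conj_apply)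
qed

lemma locally_nilpotent_conjugate:
  assumes "locally_nilpotent a" "a \<in> Der_part 0" "M \<subseteq> E510"
  shows "conjugate M (exp_elt a 1 ` M)"
proof -
  let ?\<phi> = "Der_conj (exp_elt a 1) (exp_elt a (- 1))"
  note pair = exp_elt_aut_pair[OF assms(1,2)]
  have "exponentiable a" unfolding exponentiable_def
    using assms(2) continuous_Der_aut_conj[OF pair] exp_ad_Der_conj[OF assms(1,2)] by blast
  then have inner: "?\<phi> \<in> inner_automorphisms" unfolding inner_automorphisms_def
    using continuous_Der_aut_conj[OF pair[of 1]] exp_ad_Der_conj[OF assms(1,2), of 1] by (intro generate.incl) blast
  have "?\<phi> (E510_ad u) = E510_ad (exp_elt a 1 u)" if u: "u \<in> E510" for u
  proof
    fix v
    have aut: "E510_aut (exp_elt a 1)" "E510_aut (exp_elt a (- 1))" "\<And>v. v \<in> E510 \<Longrightarrow> exp_elt a 1 (exp_elt a (- 1) v) = v"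
      using pair[of 1] by (auto simp: E510_aut_pair_def)
    have E: "exp_elt a (- 1) v \<in> E510" if "v \<in> E510" using aut(2) that by (auto simp: E510_aut_def E510_linear_def)
    show "?\<phi> (E510_ad u) v = E510_ad (exp_elt a 1 u) v"
    proof (cases "v \<in> E510")
      case True
      then show ?thesis using aut u E E510_ad_Der[OF u] by (simp add: Der_conj_apply E510_ad_def E510_aut_def)
    next
      case False
      then show ?thesis using E510_ad_Der[OF u] by (simp add: Der_conj_def E510_ad_def)
    qed
  qed
  then have "?\<phi> ` (E510_ad ` M) = E510_ad ` (exp_elt a 1 ` M)"
    unfolding image_image using assms(3) by (intro image_cong) auto
  then show ?thesis using inner assms(3) E510_aut_pair_image(1)[OF pair assms(3)] unfolding conjugate_def by blast
qed

section \<open>Transvections and their effect on values at the origin\<close>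

lemma mdeg_ge: "mdeg b k \<ge> - 2"
  by (cases b; cases "fst b") (auto simp: mdeg_def)

lemma linear_vf_support: "elt_coord (linear_vf i j) b \<noteq> 0 \<Longrightarrow> b = (Inl j, unit_exp i)"
  by (cases b; cases "fst b") (auto simp: linear_vf_def mps_coeff_var split: if_splits)

text \<open>Each bracket with x_i d/dx_j raises the entry \<open>i\<close> of the doubled
  multidegree by 2, and that entry is never below -2. A given coordinate is therefore out of reach
  after finitely many steps, for all \<open>u\<close> at once.\<close>

lemma locally_nilpotent_linear_vf:
  assumes "i \<noteq> j"
  shows "locally_nilpotent (E510_ad (elt_scale s (linear_vf i j)))"
  unfolding locally_nilpotent_def
proof
  fix b
  let ?x = "elt_scale s (linear_vf i j)"
  have x1: "?x \<in> E510_part 0" by (rule E510_part_simps(7)[OF linear_vf_E510[OF assms]])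
  note x = x1 E510_part_simps(1)[OF x1]
  note ad = Der_part_simps[OF E510_ad_Der_part[OF x(1)]]
  have supp: "mdeg b i \<ge> 2 * int n - 2" if "u \<in> E510" "elt_coord ((E510_ad ?x ^^ n) u) b \<noteq> 0" for n u b
    using that(2)
  proof (induction n arbitrary: b)
    case 0
    then show ?case using mdeg_ge[of b i] by simp
  next
    case (Suc n)
    have E: "(E510_ad ?x ^^ n) u \<in> E510" using E510_funpow[OF ad(1) that(1)] .
    then have "elt_coord (E510_bracket ?x ((E510_ad ?x ^^ n) u)) b \<noteq> 0"
      using Suc.prems restrict_apply'[OF E, of "E510_bracket ?x"] by (simp flip: E510_ad_def)
    then obtain b1 b2 where b: "elt_coord ?x b1 \<noteq> 0" "elt_coord ((E510_ad ?x ^^ n) u) b2 \<noteq> 0" "mdeg b = mdeg b1 + mdeg b2"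
      using E510_bracket_support[OF x(2) E] by blast
    then have "b1 = (Inl j, unit_exp i)" using linear_vf_support by (simp add: elt_coord_linear)
    then have "mdeg b1 i = 2" using assms by (simp add: mdeg_def)
    then show ?case using b(3) Suc.IH[OF b(2)] by simp
  qed
  have "elt_coord ((E510_ad ?x ^^ n) u) b = 0" if "n \<ge> nat (mdeg b i + 3)" "u \<in> E510" for n u
    using supp[OF that(2), of n b] that(1) mdeg_ge[of b i] by linarith
  then show "\<exists>N. \<forall>n\<ge>N. \<forall>u\<in>E510. elt_coord ((E510_ad ?x ^^ n) u) b = 0" by blast
qed

definition const_matrix :: "elt \<Rightarrow> 5 \<Rightarrow> 5 \<Rightarrow> complex" where
  "const_matrix u p q = mps_coeff (form_matrix (snd u) p q) 0"

lemma const_matrix_antisym: "const_matrix u p p = 0" "const_matrix u q p = - const_matrix u p q"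
  by (simp_all add: const_matrix_def form_matrix_antisym[of "snd u" q])

lemma const_matrix_coord: "p \<noteq> q \<Longrightarrow> const_matrix u p q = (if p < q then 1 else - 1) * elt_coord u (Inr {p, q}, 0)"
  unfolding const_matrix_def by (simp add: coord_form_matrix del: elt_coord_Inr)

lemma const_matrix_linear:
  "const_matrix (u + v) p q = const_matrix u p q + const_matrix v p q"
  "const_matrix (elt_scale c u) p q = c * const_matrix u p q"
  by (simp_all add: const_matrix_def form_matrix_linear elt_scale_def)

lemma const_matrix_bracket_linear_vf:
  "w \<in> E510 \<Longrightarrow> const_matrix (E510_bracket (linear_vf i j) w) p q =
     (if p = i then const_matrix w j q else 0) + (if q = i then const_matrix w p j else 0)"
  by (simp add: const_matrix_def form_matrix_bracket_linear_vf)

text \<open>On values at the origin the exponential stops after the linear term: the square of the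
  infinitesimal action involves only the entry \<open>(j, j)\<close>, which is zero in an
  antisymmetric matrix.\<close>

lemma transvection:
  assumes "i \<noteq> j"
  shows "\<exists>\<psi>. (\<forall>M\<subseteq>E510. conjugate M (\<psi> ` M)) \<and> (\<forall>u\<in>E510. \<forall>p q. const_matrix (\<psi> u) p q =
    const_matrix u p q + s * ((if p = i then const_matrix u j q else 0) + (if q = i then const_matrix u p j else 0)))"
proof -
  let ?x = "elt_scale s (linear_vf i j)" let ?a = "E510_ad ?x"
  have x: "?x \<in> E510_part 0" by (rule E510_part_simps(7)[OF linear_vf_E510[OF assms]])
  note ln = locally_nilpotent_linear_vf[OF assms, of s] and der = E510_ad_Der_part[OF x]
  have a1: "const_matrix (?a w) p q = s * ((if p = i then const_matrix w j q else 0) + (if q = i then const_matrix w p j else 0))" if "w \<in> E510" for w p q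
    using that by (simp add: E510_ad_def E510_bracket_scale const_matrix_linear const_matrix_bracket_linear_vf)
  have "const_matrix (exp_elt ?a 1 u) p q = const_matrix u p q + const_matrix (?a u) p q" if u: "u \<in> E510" for u p q
  proof (cases "p = q")
    case True
    then show ?thesis by (simp add: const_matrix_antisym(1))
  next
    case False
    have pow: "(?a ^^ n) u \<in> E510" for n using E510_funpow[OF Der_part_simps(1)[OF der] u] .
    have "const_matrix (?a (?a w)) p q = 0" if w: "w \<in> E510" for w p q
      using a1[OF w] a1[OF E510_linearD(1)[OF Der_part_simps(1)[OF der] w]] assms by (simp add: const_matrix_antisym(1))
    then have zero: "const_matrix ((?a ^^ n) u) p q = 0" if n: "n \<ge> 2" for n
    proof -
      obtain m where "n = Suc (Suc m)" using n by (metis add_2_eq_Suc le_Suc_ex)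
      then show ?thesis using \<open>\<And>w p q. w \<in> E510 \<Longrightarrow> const_matrix (?a (?a w)) p q = 0\<close>[OF pow[of m]] by simp
    qed
    let ?b = "(Inr {p, q}, 0) :: coord"
    have "elt_coord ((?a ^^ n) u) ?b = 0" if "n \<ge> 2" for n
      using zero[OF that] const_matrix_coord[OF False] by (auto split: if_splits)
    then have "elt_coord (exp_elt ?a 1 u) ?b = (\<Sum>n<2. 1 ^ n / fact n * elt_coord ((?a ^^ n) u) ?b)"
      by (intro coord_exp_elt[OF ln u])
    also have "\<dots> = elt_coord u ?b + elt_coord (?a u) ?b" by (simp add: numeral_2_eq_2)
    finally show ?thesis unfolding const_matrix_coord[OF False] by (simp add: distrib_left)
  qed
  then show ?thesis using locally_nilpotent_conjugate[OF ln der] a1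
    by (intro exI[of _ "exp_elt ?a 1"]) simp
qed

section \<open>Proper open subalgebras\<close>

text \<open>The coefficient at \<open>m\<close>, where \<open>n = m i\<close>, of the solution \<open>g\<close> of \<open>(\<Sum>k. c k * \<partial>/\<partial>x\<^sub>k) g = f\<close> with
  \<open>g = 0\<close> on \<open>x\<^sub>i = 0\<close>.\<close>

primrec integral_coeff :: "('n::finite \<Rightarrow> complex) \<Rightarrow> 'n \<Rightarrow> 'n mps \<Rightarrow> nat \<Rightarrow> ('n \<Rightarrow> nat) \<Rightarrow> complex" where
  "integral_coeff c i f 0 m = 0"
| "integral_coeff c i f (Suc n) m = (mps_coeff f (m(i := n)) -
     (\<Sum>k\<in>UNIV - {i}. c k * of_nat (Suc (m k)) * integral_coeff c i f n (m(i := n) + unit_exp k))) / (c i * of_nat (Suc n))"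

lemma total_degree_add: "total_degree (m + n) = total_degree m + total_degree n"
  by (simp add: total_degree_def sum.distrib)

lemma total_degree_unit_exp [simp]: "total_degree (unit_exp i) = 1"
  by (simp add: total_degree_def)

text \<open>The equation is solved by recursion on the exponent of x_i, the other directions moving
  to the right-hand side. The recursion respects total degree up to a shift by one, so a right-hand
  side of order \<open>d\<close> has a solution of order \<open>d + 1\<close>.\<close>

lemma ex_directional_integral:
  fixes c :: "'n::finite \<Rightarrow> complex"
  assumes "c i \<noteq> 0"
  shows "\<exists>g. (\<Sum>k\<in>UNIV. mps_const (c k) * mps_partial k g) = f \<and>
    (\<forall>d. (\<forall>m. total_degree m < d \<longrightarrow> mps_coeff f m = 0) \<longrightarrow> (\<forall>m. total_degree m \<le> d \<longrightarrow> mps_coeff g m = 0))"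
proof (intro exI conjI allI impI)
  let ?G = "integral_coeff c i f"
  let ?g = "Abs_mps (\<lambda>m. ?G (m i) m)"
  show "(\<Sum>k\<in>UNIV. mps_const (c k) * mps_partial k ?g) = f"
  proof (rule mps_eqI)
    fix m :: "'n \<Rightarrow> nat"
    have upd: "(m + unit_exp i)(i := m i) = m" by (auto simp: fun_eq_iff)
    have "?G (Suc (m i)) (m + unit_exp i) = (mps_coeff f m -
      (\<Sum>k\<in>UNIV - {i}. c k * of_nat (Suc (m k)) * ?G (m i) (m + unit_exp k))) / (c i * of_nat (Suc (m i)))"
      unfolding integral_coeff.simps upd by simp
    then have "c i * of_nat (Suc (m i)) * ?G (Suc (m i)) (m + unit_exp i) = mps_coeff f m -
      (\<Sum>k\<in>UNIV - {i}. c k * of_nat (Suc (m k)) * ?G (m i) (m + unit_exp k))"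
      using assms by (simp del: of_nat_Suc integral_coeff.simps)
    moreover have "mps_coeff (\<Sum>k\<in>UNIV. mps_const (c k) * mps_partial k ?g) m =
      c i * of_nat (Suc (m i)) * ?G (Suc (m i)) (m + unit_exp i) + (\<Sum>k\<in>UNIV - {i}. c k * of_nat (Suc (m k)) * ?G (m i) (m + unit_exp k))"
    proof -
      have "mps_coeff (\<Sum>k\<in>UNIV. mps_const (c k) * mps_partial k ?g) m =
        (\<Sum>k\<in>UNIV. c k * (of_nat (Suc (m k)) * ?G ((m + unit_exp k) i) (m + unit_exp k)))"
        by (simp only: mps_coeff_sum mps_coeff_const_mult mps_coeff_partial mps_coeff_Abs)
      also have "\<dots> = c i * (of_nat (Suc (m i)) * ?G ((m + unit_exp i) i) (m + unit_exp i)) +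
        (\<Sum>k\<in>UNIV - {i}. c k * (of_nat (Suc (m k)) * ?G ((m + unit_exp k) i) (m + unit_exp k)))"
        by (rule sum.remove) auto
      finally show ?thesis by (simp add: mult.assoc del: integral_coeff.simps of_nat_Suc)
    qed
    ultimately show "mps_coeff (\<Sum>k\<in>UNIV. mps_const (c k) * mps_partial k ?g) m = mps_coeff f m" by simp
  qed
  fix d and m :: "'n \<Rightarrow> nat"
  assume f: "\<forall>m. total_degree m < d \<longrightarrow> mps_coeff f m = 0" and m: "total_degree m \<le> d"
  have "?G n m = 0" if "total_degree m \<le> d" "m i = n" for n m
    using that
  proof (induction n arbitrary: m)
    case (Suc n)
    have "m(i := n) + unit_exp i = m" using Suc.prems by (auto simp: fun_eq_iff)
    then have t: "Suc (total_degree (m(i := n))) = total_degree m"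
      using total_degree_add[of "m(i := n)" "unit_exp i"] by simp
    have "?G n (m(i := n) + unit_exp k) = 0" if "k \<noteq> i" for k
    proof (rule Suc.IH)
      show "total_degree (m(i := n) + unit_exp k) \<le> d" unfolding total_degree_add using t Suc.prems by simp
      show "(m(i := n) + unit_exp k) i = n" using that by simp
    qed
    then show ?case using f t Suc.prems by simp
  qed simp
  then show "mps_coeff ?g m = 0" using m by simp
qed

lemma mps_coeff_homotopy_zero: "mps_coeff f m = 0 \<Longrightarrow> mps_coeff (mps_homotopy c f) m = 0"
  by (simp add: mps_coeff_homotopy)

lemma mps_coeff_var_mult_zero:
  assumes "\<And>m. total_degree m < d \<Longrightarrow> mps_coeff f m = 0" "total_degree m < Suc d"
  shows "mps_coeff (mps_var i * f) m = 0"
proof (cases "m i = 0")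
  case False
  then have "m - unit_exp i + unit_exp i = m" by (auto simp: fun_eq_iff unit_exp_def)
  then have "total_degree (m - unit_exp i) < d" using assms(2) total_degree_add[of "m - unit_exp i" "unit_exp i"] by simp
  then show ?thesis using assms(1) by (simp add: mps_coeff_var_mult)
qed (simp add: mps_coeff_var_mult)

lemma mps_coeff_partial_zero:
  assumes "\<And>m. total_degree m < Suc d \<Longrightarrow> mps_coeff f m = 0" "total_degree m < d"
  shows "mps_coeff (mps_partial i f) m = 0"
  using assms by (simp add: mps_coeff_partial total_degree_add)

text \<open>The Poincare lemma for the four-form of \<open>X\<close>, with an antisymmetric bivector
  as potential; the constant 4 is the degree of the form. The factor x_i or x_j in the potential
  gains one order of vanishing.\<close>

lemma divergence_free_potential:
  assumes "divergence X = 0" "\<And>i m. total_degree m < d \<Longrightarrow> mps_coeff (X i) m = 0"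
  shows "\<exists>B. (\<forall>i j. B j i = - B i j) \<and> (\<forall>i. (\<Sum>j\<in>UNIV. mps_partial j (B i j)) = (X :: 5 vfield) i) \<and>
    (\<forall>i j m. total_degree m < Suc d \<longrightarrow> mps_coeff (B i j) m = 0)"
proof (intro exI conjI allI impI)
  let ?I = "mps_homotopy"
  let ?B = "\<lambda>i j. mps_var j * ?I 4 (X i) - mps_var i * ?I 4 (X j)"
  show "?B j i = - ?B i j" for i j by simp
  show "mps_coeff (?B i j) m = 0" if "total_degree m < Suc d" for i j m
    using mps_coeff_var_mult_zero[OF mps_coeff_homotopy_zero[OF assms(2)] that] by simp
  fix i
  have 1: "(\<Sum>j\<in>UNIV. mps_partial j (mps_var j * g)) = 5 * g + (\<Sum>j\<in>UNIV. mps_var j * mps_partial j g)" for g :: "5 mps"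
    by (simp add: mps_partial_mult mps_partial_var sum.distrib)
  have 2: "(\<Sum>j\<in>UNIV. mps_partial j (mps_var i * ?I 4 (X j))) = ?I 4 (X i)"
  proof -
    have "(\<Sum>j\<in>UNIV. mps_partial j (mps_var i * ?I 4 (X j))) = (\<Sum>j\<in>UNIV. (if j = i then ?I 4 (X j) else 0)) + mps_var i * ?I 5 (divergence X)"
      by (simp add: mps_partial_mult mps_partial_var mps_partial_homotopy divergence_def mps_homotopy_linear sum.distrib sum_distrib_left
          if_distrib[of "\<lambda>x. x * _"] cong: if_cong)
    then show ?thesis using assms(1) by (simp add: mps_homotopy_linear)
  qed
  have "(\<Sum>j\<in>UNIV. mps_partial j (?B i j)) = of_nat 4 * ?I 4 (X i) + (\<Sum>j\<in>UNIV. mps_var j * mps_partial j (?I 4 (X i)))"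
    unfolding mps_partial_diff sum_subtractf 1 2 by simp
  also have "\<dots> = X i" by (rule mps_homotopy_euler) simp
  finally show "(\<Sum>j\<in>UNIV. mps_partial j (?B i j)) = X i" .
qed

definition const_field :: "(5 \<Rightarrow> complex) \<Rightarrow> elt" where
  "const_field c = ((\<lambda>k. mps_const (c k)), 0)"

lemma const_field_E510: "const_field c \<in> E510_part 0"
  by (auto simp: const_field_def E510_part_def E510_iff divergence_def Omega_def ext_d_linear)

lemma coord_bracket_const_field:
  assumes "w \<in> E510"
  shows "elt_coord (E510_bracket (const_field c) w) (x, m) = (\<Sum>k\<in>UNIV. c k * (of_nat (Suc (m k)) * elt_coord w (x, m + unit_exp k)))"
proof -
  have "const_field c = (\<Sum>k\<in>UNIV. elt_scale (c k) (const_vf k))"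
  proof (rule elt_eqI)
    fix b
    show "elt_coord (const_field c) b = elt_coord (\<Sum>k\<in>UNIV. elt_scale (c k) (const_vf k)) b"
      unfolding elt_coord_linear by (cases b; cases "fst b")
        (auto simp: const_field_def const_vf_def if_distrib[of "\<lambda>x. mps_coeff x _"] mps_coeff_const one_mps_def
          if_distrib[of "\<lambda>x. _ * x"] cong: if_cong)
  qed
  moreover have "E510_bracket (\<Sum>k\<in>UNIV. elt_scale (c k) (const_vf k)) w = (\<Sum>k\<in>UNIV. E510_bracket (elt_scale (c k) (const_vf k)) w)"
    by (rule E510_linearD(7)[OF E510_linear_bracket(2)[OF assms]]) (use E510_vector_space(5) const_vf_E510 E510_part_simps(1) in blast)
  ultimately show ?thesis
    by (simp only: elt_coord_linear E510_bracket_scale coord_bracket_const_vf[OF assms])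
qed

text \<open>A coefficient of total degree \<open>k\<close> has level \<open>2 k - 2\<close> or
  \<open>2 k - 1\<close>, according to parity, so the bound \<open>2 d - 2\<close> cuts off exactly
  the orders below \<open>d\<close> for both parities.\<close>

lemma agree_below_even:
  assumes "u \<in> E510"
  shows "agree_below (2 * int d - 2) u 0 \<longleftrightarrow> (\<forall>x m. total_degree m < d \<longrightarrow> elt_coord u (x, m) = 0)"
proof
  assume *: "agree_below (2 * int d - 2) u 0"
  show "\<forall>x m. total_degree m < d \<longrightarrow> elt_coord u (x, m) = 0"
  proof (intro allI impI)
    fix x and m :: "5 \<Rightarrow> nat" assume m: "total_degree m < d"
    show "elt_coord u (x, m) = 0"
    proof (cases "\<exists>I. x = Inr I \<and> card I \<noteq> 2")
      case True
      then show ?thesis using E510_coord_Inr[OF assms] by auto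
    next
      case False
      then have "level (x, m) < 2 * int d - 2" using m by (cases x) (auto simp: level_simps)
      then show ?thesis by (rule agree_below_zeroD[OF *])
    qed
  qed
next
  assume *: "\<forall>x m. total_degree m < d \<longrightarrow> elt_coord u (x, m) = 0"
  show "agree_below (2 * int d - 2) u 0"
  proof (rule agree_below_zeroI)
    fix b assume b: "level b < 2 * int d - 2"
    obtain x m where xm: "b = (x, m)" by force
    show "elt_coord u b = 0"
    proof (cases "\<exists>I. x = Inr I \<and> card I \<noteq> 2")
      case True
      then show ?thesis using E510_coord_Inr[OF assms] xm by auto
    next
      case False
      then have "total_degree m < d" using b xm by (cases x) (auto simp: level_simps)
      then show ?thesis using * xm by simp
    qed
  qed
qed

text \<open>The equation is solved on potentials: constant-coefficient operators commute with
  partial derivatives, and a field with an antisymmetric potential is divergence free, just as the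
  differential of a one-form is closed. Passing to the potential gains one order, solving gains
  another, and differentiating loses one, which leaves \<open>Suc d\<close>.\<close>

lemma bracket_const_field_surj:
  assumes c: "c i \<noteq> 0" and Z: "Z \<in> E510" "agree_below (2 * int d - 2) Z 0"
  shows "\<exists>W\<in>E510. agree_below (2 * int (Suc d) - 2) W 0 \<and> E510_bracket (const_field c) W = Z"
proof -
  have "\<forall>f. \<exists>g. (\<Sum>k\<in>UNIV. mps_const (c k) * mps_partial k g) = f \<and>
    (\<forall>d. (\<forall>m. total_degree m < d \<longrightarrow> mps_coeff f m = 0) \<longrightarrow> (\<forall>m. total_degree m \<le> d \<longrightarrow> mps_coeff g m = 0))"
    using ex_directional_integral[of c i] c by blast
  then obtain J where "\<forall>f. (\<Sum>k\<in>UNIV. mps_const (c k) * mps_partial k (J f)) = f \<and>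
    (\<forall>d. (\<forall>m. total_degree m < d \<longrightarrow> mps_coeff f m = 0) \<longrightarrow> (\<forall>m. total_degree m \<le> d \<longrightarrow> mps_coeff (J f) m = 0))"
    by (rule choice[THEN exE])
  then have J: "\<And>f. (\<Sum>k\<in>UNIV. mps_const (c k) * mps_partial k (J f)) = f"
    "\<And>f d m. (\<And>m. total_degree m < d \<Longrightarrow> mps_coeff f m = 0) \<Longrightarrow> total_degree m \<le> d \<Longrightarrow> mps_coeff (J f) m = 0"
    by blast+
  let ?D = "\<lambda>g. \<Sum>k\<in>UNIV. mps_const (c k) * mps_partial k g"
  have DP: "?D (mps_partial j g) = mps_partial j (?D g)" for j g
    by (simp add: mps_partial_sum mps_partial_const_mult mps_partial_commute[of j])
  have Zc: "elt_coord Z (x, m) = 0" if "total_degree m < d" for x m using Z agree_below_even that by blast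
  have Ze: "mps_coeff (fst Z j) m = 0" if "total_degree m < d" for j m using Zc[OF that, of "Inl j"] by simp
  have Zo: "mps_coeff (snd Z I) m = 0" if "total_degree m < d" for I m using Zc[OF that, of "Inr I"] by simp
  have Z': "divergence (fst Z) = 0" "snd Z \<in> Omega 2" "ext_d (snd Z) = 0" using Z(1) by (auto simp: E510_iff)
  obtain B where B: "\<And>i j. B j i = - B i j" "\<And>i. (\<Sum>j\<in>UNIV. mps_partial j (B i j)) = fst Z i"
    "\<And>i j m. total_degree m < Suc d \<Longrightarrow> mps_coeff (B i j) m = 0"
    using divergence_free_potential[OF Z'(1) Ze] by metis
  \<comment> \<open>\<open>J\<close> is a mere choice of solutions, not known to be linear; using it
    for \<open>i < j\<close> and reflecting keeps the potential antisymmetric.\<close>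
  define C where "C i j = (if i < j then J (B i j) else if j < i then - J (B j i) else 0)" for i j
  have C: "C j i = - C i j" "?D (C i j) = B i j" "total_degree m < Suc (Suc d) \<Longrightarrow> mps_coeff (C i j) m = 0" for i j m
  proof -
    show "C j i = - C i j" by (auto simp: C_def)
    have "B i i = 0"
    proof (rule mps_eqI)
      fix m have "mps_coeff (B i i) m = - mps_coeff (B i i) m" using B(1)[of i i] by (metis mps_coeff_uminus)
      then show "mps_coeff (B i i) m = mps_coeff 0 m" by simp
    qed
    then show "?D (C i j) = B i j" using J(1)[of "B i j"] J(1)[of "B j i"] B(1)[of j i]
      by (auto simp: C_def mps_partial_uminus sum_negf not_less_iff_gr_or_eq)
    show "mps_coeff (C i j) m = 0" if "total_degree m < Suc (Suc d)"
      using J(2)[of "Suc d" "B i j" m] J(2)[of "Suc d" "B j i" m] B(3) that by (auto simp: C_def)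
  qed
  define \<alpha> where "\<alpha> = poincare_primitive (snd Z)"
  have \<alpha>: "mps_coeff (\<alpha> j) m = 0" if "total_degree m < Suc d" for j m
  proof -
    have "mps_coeff (form_matrix (snd Z) i j) m = 0" if "total_degree m < d" for i m
      using Zo[OF that] by (auto simp: form_matrix_def)
    then have "mps_coeff (mps_var i * mps_homotopy 2 (form_matrix (snd Z) i j)) m = 0" for i
      using mps_coeff_var_mult_zero[OF mps_coeff_homotopy_zero that] by blast
    then show ?thesis by (simp add: \<alpha>_def poincare_primitive_def)
  qed
  define \<beta> where "\<beta> = one_form (\<lambda>j. J (\<alpha> j))"
  define W :: elt where "W = ((\<lambda>i. \<Sum>j\<in>UNIV. mps_partial j (C i j)), ext_d \<beta>)"
  have fW: "form_matrix (ext_d \<beta>) i j = mps_partial i (J (\<alpha> j)) - mps_partial j (J (\<alpha> i))" for i j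
    by (simp add: form_matrix_ext_d \<beta>_def one_form(2))
  have \<beta>1: "\<beta> \<in> Omega 1" unfolding \<beta>_def by (rule one_form)
  have W: "W \<in> E510"
  proof -
    have "divergence (fst W) = 0"
    proof (rule mps_eqI)
      fix m
      have "divergence (fst W) = (\<Sum>i\<in>UNIV. \<Sum>j\<in>UNIV. mps_partial i (mps_partial j (C i j)))"
        by (simp add: W_def divergence_def mps_partial_sum)
      also have "\<dots> = (\<Sum>j\<in>UNIV. \<Sum>i\<in>UNIV. mps_partial i (mps_partial j (C i j)))" by (rule sum.swap)
      also have "\<dots> = - (\<Sum>i\<in>UNIV. \<Sum>j\<in>UNIV. mps_partial i (mps_partial j (C i j)))"
        unfolding sum_negf[symmetric]
      proof (intro sum.cong refl)
        fix j i show "mps_partial i (mps_partial j (C i j)) = - mps_partial j (mps_partial i (C j i))"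
          unfolding C(1)[of j i] mps_partial_uminus minus_minus by (rule mps_partial_commute)
      qed
      also have "\<dots> = - divergence (fst W)" by (simp add: W_def divergence_def mps_partial_sum)
      finally have "mps_coeff (divergence (fst W)) m = - mps_coeff (divergence (fst W)) m" by (metis mps_coeff_uminus)
      then show "mps_coeff (divergence (fst W)) m = mps_coeff 0 m" by simp
    qed
    then show ?thesis using ext_d_Omega[OF \<beta>1] ext_d_ext_d_1[OF \<beta>1] by (simp add: E510_iff W_def numeral_2_eq_2)
  qed
  have "elt_coord W (x, m) = 0" if m: "total_degree m < Suc d" for x m
  proof (cases x)
    case (Inl i)
    show ?thesis unfolding Inl using mps_coeff_partial_zero[OF C(3) m] by (simp add: W_def)
  next
    case (Inr I)
    show ?thesis
    proof (cases "card I = 2")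
      case True
      then obtain i j where I: "I = {i, j}" "i \<noteq> j" by (auto simp: card_2_iff)
      have "mps_coeff (mps_partial k (J (\<alpha> l))) m = 0" for k l
        by (rule mps_coeff_partial_zero[OF _ m]) (use J(2)[OF \<alpha>] in auto)
      then show ?thesis unfolding Inr I coord_form_matrix[OF I(2)] by (simp add: W_def fW)
    next
      case False
      then show ?thesis using E510_coord_Inr[OF W] Inr by simp
    qed
  qed
  then have "agree_below (2 * int (Suc d) - 2) W 0" using agree_below_even[OF W] by blast
  moreover have "E510_bracket (const_field c) W = Z"
  proof (rule elt_eqI)
    fix b :: coord
    obtain x m where b: "b = (x, m)" by force
    have Dc: "mps_coeff (?D g) m = (\<Sum>k\<in>UNIV. c k * (of_nat (Suc (m k)) * mps_coeff g (m + unit_exp k)))" for g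
      by (simp only: mps_coeff_sum mps_coeff_const_mult mps_coeff_partial)
    have *: "elt_coord (E510_bracket (const_field c) W) b = (\<Sum>k\<in>UNIV. c k * (of_nat (Suc (m k)) * elt_coord W (x, m + unit_exp k)))"
      unfolding b by (rule coord_bracket_const_field[OF W])
    show "elt_coord (E510_bracket (const_field c) W) b = elt_coord Z b"
    proof (cases x)
      case (Inl i)
      have "elt_coord (E510_bracket (const_field c) W) b = mps_coeff (?D (fst W i)) m" unfolding * Dc Inl by simp
      also have "?D (fst W i) = (\<Sum>j\<in>UNIV. ?D (mps_partial j (C i j)))"
        by (simp add: W_def mps_partial_sum sum_distrib_left) (rule sum.swap)
      also have "\<dots> = fst Z i" unfolding DP C(2) B(2) ..
      finally show ?thesis by (simp add: b Inl)
    next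
      case (Inr I)
      show ?thesis
      proof (cases "card I = 2")
        case True
        then obtain i j where I: "I = {i, j}" "i \<noteq> j" by (auto simp: card_2_iff)
        have Dd: "?D (f - g) = ?D f - ?D g" for f g by (simp add: mps_partial_diff right_diff_distrib sum_subtractf)
        have "form_matrix (snd Z) i j = mps_partial i (\<alpha> j) - mps_partial j (\<alpha> i)"
          using form_matrix_ext_d[of "one_form \<alpha>" i j] ext_d_poincare_primitive[OF Z'(2,3)] by (simp add: \<alpha>_def one_form(2))
        also have "\<dots> = ?D (form_matrix (snd W) i j)" by (simp only: W_def snd_conv fW Dd DP J(1))
        finally have "mps_coeff (form_matrix (snd Z) i j) m = (\<Sum>k\<in>UNIV. c k * (of_nat (Suc (m k)) * mps_coeff (form_matrix (snd W) i j) (m + unit_exp k)))"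
          by (simp only: Dc)
        then show ?thesis unfolding * unfolding b Inr I coord_form_matrix[OF I(2)] by (simp add: sum_distrib_left mult_ac)
      next
        case False
        then show ?thesis unfolding * unfolding b Inr by (simp add: E510_coord_Inr[OF W] E510_coord_Inr[OF Z(1)] del: elt_coord_Inr)
      qed
    qed
  qed
  ultimately show ?thesis using W by blast
qed

lemma E510_subalgebra_diff: "E510_subalgebra M \<Longrightarrow> u \<in> M \<Longrightarrow> v \<in> M \<Longrightarrow> u - v \<in> M"
proof -
  assume *: "E510_subalgebra M" "u \<in> M" "v \<in> M"
  then have "u + elt_scale (- 1) v \<in> M" unfolding E510_subalgebra_def by blast
  then show ?thesis by (simp add: elt_scale_simps)
qed

text \<open>Descending induction on the order of vanishing, from an order at which openness puts
  everything into \<open>M\<close>. An element of order \<open>d\<close> is the bracket of the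
  constant field \<open>c\<close> with some \<open>W\<close> of order \<open>d + 1\<close>;
  replacing \<open>c\<close> by the given field, which differs from it by terms of level at least 0,
  changes the bracket by an element of order \<open>d + 1\<close>.\<close>

lemma open_subalgebra_vanishing:
  assumes M: "E510_subalgebra M" "openin E510_top M" "M \<noteq> E510" and u: "u \<in> M"
  shows "mps_coeff (fst u i) 0 = 0"
proof (rule ccontr)
  assume ne: "mps_coeff (fst u i) 0 \<noteq> 0"
  define c where "c k = mps_coeff (fst u k) 0" for k
  define X where "X = (fst u, 0 :: 5 dform)"
  have ME: "M \<subseteq> E510" "0 \<in> M" "X \<in> M" using M(1) u by (auto simp: E510_subalgebra_def X_def)
  have C: "const_field c \<in> E510" using const_field_E510 E510_part_simps by blast
  have X: "X \<in> E510" "X - const_field c \<in> E510" using ME C E510_vector_space(3) by blast+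
  have "elt_coord (X - const_field c) (x, m) = 0" if "total_degree m < 1" for x m
  proof -
    have "m = 0" using that by (auto simp: total_degree_def)
    then show ?thesis by (cases x) (auto simp: elt_coord_linear X_def const_field_def c_def mps_coeff_const)
  qed
  then have X0: "agree_below 0 (X - const_field c) 0" using agree_below_even[OF X(2), of 1] by simp
  have lower: "v \<in> M" if h: "\<And>v. v \<in> E510 \<Longrightarrow> agree_below (2 * int (Suc d) - 2) v 0 \<Longrightarrow> v \<in> M" "v \<in> E510" "agree_below (2 * int d - 2) v 0" for d v
  proof -
    obtain W where W: "W \<in> E510" "agree_below (2 * int (Suc d) - 2) W 0" "E510_bracket (const_field c) W = v"
      using bracket_const_field_surj[of c i v d] ne h(2,3) unfolding c_def by blast
    have "W \<in> M" using h(1) W by blast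
    then have 1: "E510_bracket X W \<in> M" using ME M(1) by (auto simp: E510_subalgebra_def)
    have "E510_bracket (X - const_field c) W \<in> M"
      using h(1)[OF E510_bracket_closed[OF X(2) W(1)]] agree_below_bracket_add[OF X(2) W(1) X0 W(2)] by simp
    then have "E510_bracket X W - E510_bracket (X - const_field c) W \<in> M" using 1 E510_subalgebra_diff[OF M(1)] by blast
    then show ?thesis using W(3) by (simp add: E510_bracket_linear)
  qed
  obtain q where q: "\<And>v. v \<in> E510 \<Longrightarrow> agree_below q 0 v \<Longrightarrow> v \<in> M" using M(2) ME(2) unfolding openin_E510_top by blast
  define d where "d = nat (q + 2)"
  have start: "v \<in> M" if "v \<in> E510" "agree_below (2 * int d - 2) v 0" for v
  proof (rule q[OF that(1)])
    \<comment> \<open>Below level -2 there is nothing to compare, so in the second case agreement is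
      automatic.\<close>
    have "q \<le> 2 * int d - 2 \<or> q < - 2" unfolding d_def by auto
    then show "agree_below q 0 v"
    proof
      assume "q \<le> 2 * int d - 2"
      then have "agree_below q v 0" using agree_below_mono that(2) by blast
      then show ?thesis by (auto simp: agree_below_def)
    next
      assume "q < - 2"
      then show ?thesis using level_ge[OF that(1)] by (force simp: agree_below_def elt_coord_linear)
    qed
  qed
  have "\<forall>v. v \<in> E510 \<longrightarrow> agree_below (2 * int n - 2) v 0 \<longrightarrow> v \<in> M" if "n \<le> d" for n
    using that
  proof (induction rule: inc_induct)
    case base
    then show ?case using start by blast
  next
    case (step n)
    then show ?case using lower[of n] by blast
  qed
  from this[of 0] have "v \<in> M" if "v \<in> E510" for v
    using that level_ge[OF that] by (force intro!: agree_below_zeroI)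
  then show False using M(3) ME(1) by blast
qed

section \<open>First-order data of an open subalgebra\<close>

lemma mps_coeff_mult_0: "mps_coeff (f * g) 0 = mps_coeff f 0 * mps_coeff g 0"
proof -
  have "{p. fst p + snd p = (0 :: 'a \<Rightarrow> nat)} = {(0, 0)}" by (auto simp: fun_eq_iff)
  then show ?thesis by (simp add: mps_coeff_mult)
qed

lemma total_degree_0: "total_degree m = 0 \<longleftrightarrow> m = 0"
  by (auto simp: total_degree_def)

lemma total_degree_1:
  assumes "total_degree m = 1"
  obtains r where "m = unit_exp r"
proof -
  have "m \<noteq> 0" using assms total_degree_0[of m] by auto
  then obtain r where "m r \<noteq> 0" by (auto simp: fun_eq_iff)
  then have m: "m - unit_exp r + unit_exp r = m" by (auto simp: fun_eq_iff unit_exp_def)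
  then have "total_degree (m - unit_exp r) = 0" using assms total_degree_add[of "m - unit_exp r" "unit_exp r"] by simp
  then have "m - unit_exp r = 0" by (simp only: total_degree_0)
  then have "m = unit_exp r" using m by simp
  then show ?thesis by (rule that)
qed

lemma mps_coeff_mult_unit_exp:
  "mps_coeff (f * g) (unit_exp r) = mps_coeff f 0 * mps_coeff g (unit_exp r) + mps_coeff f (unit_exp r) * mps_coeff g 0"
proof -
  have "p = (0, unit_exp r) \<or> p = (unit_exp r, 0)" if p: "fst p + snd p = unit_exp r" for p :: "('a \<Rightarrow> nat) \<times> _"
  proof -
    have "total_degree (fst p) + total_degree (snd p) = 1" using p total_degree_add by (metis total_degree_unit_exp)
    then consider "total_degree (fst p) = 0" | "total_degree (snd p) = 0" by arith
    then show ?thesis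
    proof cases
      case 1
      then have "fst p = 0" by (simp only: total_degree_0)
      then show ?thesis using p by (metis add_0 prod.collapse)
    next
      case 2
      then have "snd p = 0" by (simp only: total_degree_0)
      then show ?thesis using p by (metis add.right_neutral prod.collapse)
    qed
  qed
  then have "{p. fst p + snd p = (unit_exp r :: 'a \<Rightarrow> nat)} = {(0, unit_exp r), (unit_exp r, 0)}" by auto
  then show ?thesis by (simp add: mps_coeff_mult)
qed

section \<open>Values at the origin and linear parts in a proper open subalgebra\<close>

definition proper_open_subalgebra :: "elt set \<Rightarrow> bool" where
  "proper_open_subalgebra M \<longleftrightarrow> E510_subalgebra M \<and> openin E510_top M \<and> M \<noteq> E510"

definition linear_part :: "elt \<Rightarrow> 5 \<Rightarrow> 5 \<Rightarrow> complex" where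
  "linear_part u p k = mps_coeff (fst u k) (unit_exp p)"

definition matrix_action :: "(5 \<Rightarrow> 5 \<Rightarrow> complex) \<Rightarrow> (5 \<Rightarrow> 5 \<Rightarrow> complex) \<Rightarrow> 5 \<Rightarrow> 5 \<Rightarrow> complex" where
  "matrix_action A c p q = (\<Sum>k\<in>UNIV. A p k * c k q + A q k * c p k)"

lemma const_matrix_antisym_matrix: "antisym_matrix (const_matrix u)"
  using const_matrix_antisym unfolding antisym_matrix_def by blast

lemma mps_coeff_star_0: "mps_coeff (star w h i) 0 = star (\<lambda>p q. mps_coeff (w p q) 0) (\<lambda>p q. mps_coeff (h p q) 0) i"
  by (simp add: star_def wedge_coeff_def mps_coeff_mult_0)

context
  fixes M :: "elt set"
  assumes M: "proper_open_subalgebra M"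
begin

lemma proper_open_subalgebraD: "M \<subseteq> E510" "0 \<in> M" "u \<in> M \<Longrightarrow> v \<in> M \<Longrightarrow> u + v \<in> M" "u \<in> M \<Longrightarrow> elt_scale c u \<in> M"
  "u \<in> M \<Longrightarrow> (fst u, 0) \<in> M" "u \<in> M \<Longrightarrow> (0, snd u) \<in> M" "u \<in> M \<Longrightarrow> v \<in> M \<Longrightarrow> E510_bracket u v \<in> M"
  using M unfolding proper_open_subalgebra_def E510_subalgebra_def by blast+

lemma proper_open_vanishing: "u \<in> M \<Longrightarrow> mps_coeff (fst u i) 0 = 0"
  using open_subalgebra_vanishing M unfolding proper_open_subalgebra_def by blast

lemma fst_odd_bracket:
  assumes "u \<in> M" "v \<in> M"
  shows "\<exists>w\<in>M. fst w = star (form_matrix (snd u)) (form_matrix (snd v))"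
proof
  show "E510_bracket (0, snd u) (0, snd v) \<in> M" by (intro proper_open_subalgebraD(6,7) assms)
  have "snd u \<in> Omega 2" using assms proper_open_subalgebraD(1) by (auto simp: E510_iff)
  then show "fst (E510_bracket (0, snd u) (0, snd v)) = star (form_matrix (snd u)) (form_matrix (snd v))"
    by (simp add: E510_bracket_def vf_bracket_linear vf_of_form_wedge)
qed

lemma const_matrices_isotropic:
  assumes "c \<in> const_matrix ` M" "d \<in> const_matrix ` M"
  shows "star c d i = 0"
proof -
  obtain u v where uv: "u \<in> M" "v \<in> M" "c = const_matrix u" "d = const_matrix v" using assms by blast
  obtain w where w: "w \<in> M" "fst w = star (form_matrix (snd u)) (form_matrix (snd v))" using fst_odd_bracket[OF uv(1,2)] by blast
  have "star c d i = mps_coeff (fst w i) 0" unfolding w(2) mps_coeff_star_0 uv(3,4) const_matrix_def ..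
  then show ?thesis using proper_open_vanishing[OF w(1)] by simp
qed

lemma const_matrix_combination:
  assumes "c \<in> const_matrix ` M" "d \<in> const_matrix ` M"
  shows "(\<lambda>p q. x * c p q + y * d p q) \<in> const_matrix ` M"
proof -
  obtain u v where uv: "u \<in> M" "v \<in> M" "c = const_matrix u" "d = const_matrix v" using assms by blast
  have "const_matrix (elt_scale x u + elt_scale y v) = (\<lambda>p q. x * c p q + y * d p q)"
    by (intro ext) (simp add: const_matrix_linear uv)
  moreover have "elt_scale x u + elt_scale y v \<in> M" by (intro proper_open_subalgebraD(3,4) uv(1,2))
  ultimately show ?thesis by (metis imageI)
qed

lemma const_matrix_scale: "c \<in> const_matrix ` M \<Longrightarrow> (\<lambda>p q. x * c p q) \<in> const_matrix ` M"
  using const_matrix_combination[of c c x 0] by simp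

text \<open>The fields of \<open>M\<close> vanish at the origin, so the term differentiating the
  coefficients of the form drops out there and only the linear part acts.\<close>

lemma const_matrix_action:
  assumes "u \<in> M" "c \<in> const_matrix ` M"
  shows "matrix_action (linear_part u) c \<in> const_matrix ` M"
proof -
  obtain v where v: "v \<in> M" "c = const_matrix v" using assms by blast
  have w: "E510_bracket (fst u, 0) (0, snd v) \<in> M" by (rule proper_open_subalgebraD(7)[OF proper_open_subalgebraD(5)[OF assms(1)] proper_open_subalgebraD(6)[OF v(1)]])
  have cl: "snd v \<in> Omega 2" "ext_d (snd v) = 0" using v proper_open_subalgebraD(1) by (auto simp: E510_iff)
  have "const_matrix (E510_bracket (fst u, 0) (0, snd v)) p q = matrix_action (linear_part u) c p q" for p q
    using proper_open_vanishing[OF assms(1)]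
    by (simp add: const_matrix_def snd_bracket_even form_matrix_lie_deriv[OF cl] lie_matrix_def vf_apply_def matrix_action_def
       mps_coeff_mult_0 mps_coeff_partial linear_part_def v(2))
  then have "const_matrix (E510_bracket (fst u, 0) (0, snd v)) = matrix_action (linear_part u) c" by blast
  then show ?thesis using w by (metis imageI)
qed

end

section \<open>Criteria for containment in the four graded subalgebras\<close>

definition pair_matrix :: "5 \<Rightarrow> 5 \<Rightarrow> 5 \<Rightarrow> 5 \<Rightarrow> complex" where
  "pair_matrix i j p q = (if p = i \<and> q = j then 1 else if p = j \<and> q = i then - 1 else 0)"

text \<open>The bounds on \<open>a\<close> give every coordinate of total degree at least 2 a
  nonnegative degree: fields need \<open>a k \<le> 2 * lo\<close>, and two-forms need half the sum
  of the weights to be at most \<open>4 * lo\<close>. Only the coefficients of order 0 and 1 remain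
  to be checked.\<close>

lemma graded_subalgebraI:
  assumes u: "u \<in> E510" and a: "\<And>k. lo \<le> a k" "\<And>k. a k \<le> 2 * lo" "(\<Sum>k\<in>UNIV. int (a k)) div 2 \<le> 4 * int lo"
    and E0: "\<And>i. mps_coeff (fst u i) 0 = 0"
    and E1: "\<And>p i. a p < a i \<Longrightarrow> linear_part u p i = 0"
    and O0: "\<And>p q. p \<noteq> q \<Longrightarrow> int (a p) + int (a q) < (\<Sum>k\<in>UNIV. int (a k)) div 2 \<Longrightarrow> const_matrix u p q = 0"
    and O1: "\<And>p q r. p \<noteq> q \<Longrightarrow> int (a p) + int (a q) + int (a r) < (\<Sum>k\<in>UNIV. int (a k)) div 2 \<Longrightarrow>
      mps_coeff (form_matrix (snd u) p q) (unit_exp r) = 0"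
  shows "u \<in> graded_subalgebra a"
proof -
  let ?S = "(\<Sum>k\<in>UNIV. int (a k)) div 2"
  have "coord_degree a b \<ge> 0" if nz: "elt_coord u b \<noteq> 0" for b
  proof -
    obtain x m where b: "b = (x, m)" by force
    let ?d = "\<Sum>k\<in>UNIV. int (m k) * int (a k)"
    have unit: "(\<Sum>k\<in>UNIV. int (unit_exp r k) * int (a k)) = int (a r)" for r
      by (simp add: unit_exp_def if_distrib[of "\<lambda>x. int x * _"] cong: if_cong)
    have "(\<Sum>k\<in>UNIV. int (m k) * int lo) \<le> ?d" using a(1) by (intro sum_mono mult_left_mono) auto
    then have d: "int (total_degree m) * int lo \<le> ?d" by (simp add: total_degree_def sum_distrib_right)
    have d2: "2 * int lo \<le> ?d" if "total_degree m \<ge> 2"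
      using d mult_right_mono[of 2 "int (total_degree m)" "int lo"] that by linarith
    consider "m = 0" | r where "m = unit_exp r" | "total_degree m \<ge> 2"
      using total_degree_0[of m] total_degree_1[of m] by (metis One_nat_def less_2_cases not_le)
    note m_cases = this
    show ?thesis
    proof (cases x)
      case (Inl i)
      have deg: "coord_degree a b = ?d - int (a i)" by (simp add: b Inl coord_degree_def)
      show ?thesis
      proof (cases rule: m_cases)
        case 1
        then show ?thesis using nz E0 b Inl by simp
      next
        case (2 r)
        then have "\<not> a r < a i" using nz E1[of r i] b Inl by (auto simp: linear_part_def)
        then show ?thesis using unit[of r] 2 deg by simp
      next
        case 3
        then show ?thesis using d2 a(2)[of i] deg by linarith
      qed
    next
      case (Inr I)
      then have "card I = 2" using nz E510_coord_Inr[OF u] b by blast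
      then obtain p q where I: "I = {p, q}" "p \<noteq> q" by (auto simp: card_2_iff)
      have deg: "coord_degree a b = ?d + int (a p) + int (a q) - ?S" using I(2) by (simp add: b Inr I(1) coord_degree_def)
      have nz': "mps_coeff (form_matrix (snd u) p q) m \<noteq> 0" using nz unfolding b Inr I coord_form_matrix[OF I(2)] by auto
      show ?thesis
      proof (cases rule: m_cases)
        case 1
        then have "\<not> int (a p) + int (a q) < ?S" using nz' O0[OF I(2)] by (auto simp: const_matrix_def)
        then show ?thesis using deg 1 by simp
      next
        case (2 r)
        then have "\<not> int (a p) + int (a q) + int (a r) < ?S" using nz' O1[OF I(2)] by blast
        then show ?thesis using unit[of r] 2 deg by simp
      next
        case 3
        then show ?thesis using d2 a(1)[of p] a(1)[of q] a(3) deg by linarith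
      qed
    qed
  qed
  then show ?thesis using u by (simp add: graded_subalgebra_def)
qed

text \<open>The names refer to the values of odd elements at the origin: a line \<open>l\<close>,
  \<open>W\<close> of dimension 2 or 3, or zero. In \<open>type_space\<close> the index
  \<open>5\<close> is \<open>0\<close>, so the variables of weight 1 are those with indices 0 and
  4.\<close>

abbreviation (input) type_line :: "5 \<Rightarrow> nat" where "type_line \<equiv> (\<lambda>_. 1)(1 := 2)"
abbreviation (input) type_plane :: "5 \<Rightarrow> nat" where "type_plane \<equiv> (\<lambda>_. 2)(1 := 3, 2 := 3)"
abbreviation (input) type_space :: "5 \<Rightarrow> nat" where "type_space \<equiv> (\<lambda>_. 2)(4 := 1, 5 := 1)"
abbreviation (input) type_principal :: "5 \<Rightarrow> nat" where "type_principal \<equiv> (\<lambda>_. 2)"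

lemma subset_principal:
  assumes "proper_open_subalgebra M" "\<And>c p q. c \<in> const_matrix ` M \<Longrightarrow> c p q = 0"
  shows "M \<subseteq> graded_subalgebra type_principal"
proof
  fix u assume u: "u \<in> M"
  show "u \<in> graded_subalgebra type_principal"
    by (rule graded_subalgebraI[where lo = 2])
      (use u proper_open_subalgebraD(1)[OF assms(1)] proper_open_vanishing[OF assms(1)] assms(2) in auto)
qed

lemma subset_line:
  assumes M: "proper_open_subalgebra M" and "pair_matrix 1 2 \<in> const_matrix ` M" "pair_matrix 1 3 \<in> const_matrix ` M"
    and c: "\<And>c p q. c \<in> const_matrix ` M \<Longrightarrow> p \<noteq> 1 \<Longrightarrow> q \<noteq> 1 \<Longrightarrow> c p q = 0"
  shows "M \<subseteq> graded_subalgebra type_line"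
proof
  fix u assume u: "u \<in> M"
  have act: "matrix_action (linear_part u) (pair_matrix 1 2) p 2 = 0" if "p \<noteq> 1" for p
    using c[OF const_matrix_action[OF M u assms(2)]] that by simp
  then have 1: "linear_part u p 1 = 0" if "p \<noteq> 1" "p \<noteq> 2" for p
    using act[of p] that by (simp add: matrix_action_def pair_matrix_def sum_5)
  \<comment> \<open>For row 2 the previous identity would concern the diagonal entry
    \<open>(2, 2)\<close>, which is always zero; hence the second form dx_1 dx_3.\<close>
  have "matrix_action (linear_part u) (pair_matrix 1 3) 2 3 = 0"
    using c[OF const_matrix_action[OF M u assms(3)]] by simp
  then have 2: "linear_part u 2 1 = 0" by (simp add: matrix_action_def pair_matrix_def sum_5)
  show "u \<in> graded_subalgebra type_line"
  proof (rule graded_subalgebraI[where lo = 1])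
    show "linear_part u p i = 0" if "type_line p < type_line i" for p i
      using that 1 2 by (cases "p = 2") (auto split: if_splits)
    show "const_matrix u p q = 0" if "int (type_line p) + int (type_line q) < (\<Sum>k\<in>UNIV. int (type_line k)) div 2" for p q
      using that c[of "const_matrix u" p q] u by (auto simp: sum_5 split: if_splits)
    have ge: "1 \<le> type_line k" for k by simp
    then show "mps_coeff (form_matrix (snd u) p q) (unit_exp r) = 0"
      if "int (type_line p) + int (type_line q) + int (type_line r) < (\<Sum>k\<in>UNIV. int (type_line k)) div 2" for p q r
    proof -
      have "(\<Sum>k\<in>UNIV. int (type_line k)) div 2 = 3" by (simp add: sum_5)
      then show ?thesis using that ge[of p] ge[of q] ge[of r] by linarith
    qed
  qed (use u proper_open_subalgebraD(1)[OF M] proper_open_vanishing[OF M] in \<open>auto simp: sum_5\<close>)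
qed

lemma subset_plane:
  assumes M: "proper_open_subalgebra M" and "pair_matrix 1 2 \<in> const_matrix ` M"
    and c: "\<And>c p q. c \<in> const_matrix ` M \<Longrightarrow> p \<notin> {1, 2} \<or> q \<notin> {1, 2} \<Longrightarrow> c p q = 0"
  shows "M \<subseteq> graded_subalgebra type_plane"
proof
  fix u assume u: "u \<in> M"
  have act: "matrix_action (linear_part u) (pair_matrix 1 2) p q = 0" if "p \<notin> {1, 2}" for p q
    using c[OF const_matrix_action[OF M u assms(2)]] that by blast
  have 1: "linear_part u p 1 = 0" "linear_part u p 2 = 0" if "p \<notin> {1, 2}" for p
    using act[of p 2] act[of p 1] that by (simp_all add: matrix_action_def pair_matrix_def sum_5)
  show "u \<in> graded_subalgebra type_plane"
  proof (rule graded_subalgebraI[where lo = 2])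
    show "linear_part u p i = 0" if "type_plane p < type_plane i" for p i
      using that 1[of p] by (auto split: if_splits)
    show "const_matrix u p q = 0" if "int (type_plane p) + int (type_plane q) < (\<Sum>k\<in>UNIV. int (type_plane k)) div 2" for p q
      using that c[of "const_matrix u" p q] u by (auto simp: sum_5 split: if_splits)
    have ge: "2 \<le> type_plane k" for k by simp
    then show "mps_coeff (form_matrix (snd u) p q) (unit_exp r) = 0"
      if "int (type_plane p) + int (type_plane q) + int (type_plane r) < (\<Sum>k\<in>UNIV. int (type_plane k)) div 2" for p q r
    proof -
      have "(\<Sum>k\<in>UNIV. int (type_plane k)) div 2 = 6" by (simp add: sum_5)
      then show ?thesis using that ge[of p] ge[of q] ge[of r] by linarith
    qed
  qed (use u proper_open_subalgebraD(1)[OF M] proper_open_vanishing[OF M] in \<open>auto simp: sum_5\<close>)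
qed

lemma star_pair_matrix:
  assumes "antisym_matrix c"
  shows "star c (pair_matrix 1 2) 0 = c 3 4" "star c (pair_matrix 1 2) 3 = - c 0 4" "star c (pair_matrix 1 2) 4 = c 0 3"
    "star c (pair_matrix 1 3) 0 = - c 2 4" "star c (pair_matrix 1 3) 2 = c 0 4" "star c (pair_matrix 1 3) 4 = - c 0 2"
    "star c (pair_matrix 2 3) 0 = c 1 4" "star c (pair_matrix 2 3) 1 = - c 0 4" "star c (pair_matrix 2 3) 4 = c 0 1"
  by (simp_all add: star_def wedge_coeff_def pair_matrix_def)

text \<open>Isotropy against the three pairs leaves no value outside their span, and stability of
  that span restricts the linear parts. The degree condition also excludes x_r dx_4 dx_5 with
  \<open>r\<close> in \<open>{4, 5}\<close>; this follows from brackets of odd elements, whose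
  linear parts obey the same restriction.\<close>

lemma subset_space:
  assumes M: "proper_open_subalgebra M"
    and E: "pair_matrix 1 2 \<in> const_matrix ` M" "pair_matrix 1 3 \<in> const_matrix ` M" "pair_matrix 2 3 \<in> const_matrix ` M"
  shows "M \<subseteq> graded_subalgebra type_space"
proof
  fix u assume u: "u \<in> M"
  have c: "c p q = 0" if c: "c \<in> const_matrix ` M" and pq: "p \<in> {0, 4}" for c p q
  proof -
    have as: "antisym_matrix c" using c const_matrix_antisym_matrix by blast
    note s = star_pair_matrix[OF as] and iso = const_matrices_isotropic[OF M c]
    have "c 3 4 = 0" "c 0 4 = 0" "c 0 3 = 0" "c 2 4 = 0" "c 0 2 = 0" "c 1 4 = 0" "c 0 1 = 0"
      using s iso[OF E(1)] iso[OF E(2)] iso[OF E(3)] by auto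
    then show ?thesis using cases_5[of q] pq by (auto simp: antisym_rules[OF as])
  qed
  have lin: "linear_part u p i = 0" if u: "u \<in> M" and p: "p \<in> {0, 4}" and i: "i \<in> {1, 2, 3}" for u p i
  proof -
    have "matrix_action (linear_part u) (pair_matrix 1 2) p q = 0" "matrix_action (linear_part u) (pair_matrix 1 3) p q = 0" for q
      using c[OF const_matrix_action[OF M u E(1)] p] c[OF const_matrix_action[OF M u E(2)] p] by blast+
    from this(1)[of 1] this(1)[of 2] this(2)[of 1] show ?thesis
      using p i by (auto simp: matrix_action_def pair_matrix_def sum_5)
  qed
  text \<open>The coefficient of \<open>x\<^sub>r \<partial>/\<partial>x\<^sub>3\<close> in the bracket of two odd elements.\<close>
  have br: "const_matrix u 1 2 * mps_coeff (form_matrix (snd v) 0 4) (unit_exp r) +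
      mps_coeff (form_matrix (snd u) 0 4) (unit_exp r) * const_matrix v 1 2 = 0"
    if uv: "u \<in> M" "v \<in> M" and r: "r \<in> {0, 4}" for u v r
  proof -
    obtain w where w: "w \<in> M" "fst w = star (form_matrix (snd u)) (form_matrix (snd v))" using fst_odd_bracket[OF M uv] by blast
    have z: "mps_coeff (form_matrix (snd u) p q) 0 = 0" "mps_coeff (form_matrix (snd u) q p) 0 = 0" if "u \<in> M" "p \<in> {0, 4}" for u p q
      using c[of "const_matrix u" p q] const_matrix_antisym(2)[of u q p] that by (auto simp: const_matrix_def)
    have "linear_part w r 3 = 0" using lin[OF w(1) r] by simp
    then have "mps_coeff (wedge_coeff (form_matrix (snd u)) (form_matrix (snd v)) 0 1 2 4) (unit_exp r) = 0"
      by (simp add: linear_part_def w(2) star_def)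
    then show ?thesis
      using z[OF uv(1), of 0] z[OF uv(1), of 4] z[OF uv(2), of 0] z[OF uv(2), of 4]
      by (simp add: wedge_coeff_def mps_coeff_mult_unit_exp const_matrix_def add.commute)
  qed
  obtain v where v: "v \<in> M" "const_matrix v = pair_matrix 1 2" using E(1) by auto
  have lin04: "mps_coeff (form_matrix (snd u) 0 4) (unit_exp r) = 0" if "r \<in> {0, 4}" for r
  proof -
    \<comment> \<open>In the square of \<open>v\<close> the unwanted coefficient appears twice and
      so vanishes; the bracket of \<open>u\<close> with \<open>v\<close> then isolates that of
      \<open>u\<close>.\<close>
    have "mps_coeff (form_matrix (snd v) 0 4) (unit_exp r) = 0"
      using br[OF v(1) v(1) that] v(2) by (simp add: pair_matrix_def)
    then show ?thesis using br[OF u v(1) that] v(2) by (simp add: pair_matrix_def)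
  qed
  have type_eq: "type_space k = (if k \<in> {0, 4} then 1 else 2)" for k by simp
  have S: "(\<Sum>k\<in>UNIV. int (type_space k)) div 2 = 4" by (simp add: sum_5)
  show "u \<in> graded_subalgebra type_space"
  proof (rule graded_subalgebraI[where lo = 1])
    show "linear_part u p i = 0" if "type_space p < type_space i" for p i
      using that lin[OF u, of p i] cases_5[of i] unfolding type_eq by (auto split: if_splits)
    show "const_matrix u p q = 0" if "int (type_space p) + int (type_space q) < (\<Sum>k\<in>UNIV. int (type_space k)) div 2" for p q
      using that c[of "const_matrix u" p q] c[of "const_matrix u" q p] u const_matrix_antisym(2)[of u q p] unfolding S unfolding type_eq
      by (auto split: if_splits)
    show "mps_coeff (form_matrix (snd u) p q) (unit_exp r) = 0"
      if "p \<noteq> q" "int (type_space p) + int (type_space q) + int (type_space r) < (\<Sum>k\<in>UNIV. int (type_space k)) div 2" for p q r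
    proof -
      have "p \<in> {0, 4}" "q \<in> {0, 4}" "r \<in> {0, 4}" using that(2) unfolding S unfolding type_eq by (auto split: if_splits)
      then show ?thesis using lin04[of r] that(1) form_matrix_antisym[of "snd u" 4 0] by auto
    qed
  qed (use u proper_open_subalgebraD(1)[OF M] proper_open_vanishing[OF M] S in \<open>auto simp: type_eq\<close>)
qed


section \<open>Normal forms under linear coordinate changes\<close>

text \<open>The effect of a transvection on values at the origin: it substitutes dx_j + s dx_i for
  dx_j, so \<open>s\<close> times row \<open>j\<close> is added to row \<open>i\<close>, and
  likewise for columns.\<close>

definition row_operation :: "5 \<Rightarrow> 5 \<Rightarrow> complex \<Rightarrow> (5 \<Rightarrow> 5 \<Rightarrow> complex) \<Rightarrow> 5 \<Rightarrow> 5 \<Rightarrow> complex" where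
  "row_operation i j s c p q = c p q + s * ((if p = i then c j q else 0) + (if q = i then c p j else 0))"

text \<open>Carrying maximality along keeps the isotropy constraints available after every change of
  coordinates.\<close>

definition moves_to :: "elt set \<Rightarrow> elt set \<Rightarrow> bool" where
  "moves_to M M' \<longleftrightarrow> conjugate M M' \<and> maximal_open_subalgebra M'"

lemma moves_to_refl: "maximal_open_subalgebra M \<Longrightarrow> moves_to M M"
  by (simp add: moves_to_def conjugate_refl maximal_open_subalgebra_def E510_subalgebra_def)

lemma moves_to_trans: "moves_to M M' \<Longrightarrow> moves_to M' M'' \<Longrightarrow> moves_to M M''"
  using conjugate_trans unfolding moves_to_def by blast

lemma moves_to_maximal: "moves_to M M' \<Longrightarrow> maximal_open_subalgebra M'"
  by (simp add: moves_to_def)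

lemma maximal_proper_open: "maximal_open_subalgebra M \<Longrightarrow> proper_open_subalgebra M"
  by (simp add: maximal_open_subalgebra_def proper_open_subalgebra_def)

lemma row_operation_move:
  assumes "maximal_open_subalgebra M" "i \<noteq> j"
  shows "\<exists>M'. moves_to M M' \<and> (\<forall>c\<in>const_matrix ` M. row_operation i j s c \<in> const_matrix ` M')"
proof -
  have ME: "M \<subseteq> E510" using assms(1) by (simp add: maximal_open_subalgebra_def E510_subalgebra_def)
  obtain \<psi> where "(\<forall>M\<subseteq>E510. conjugate M (\<psi> ` M)) \<and> (\<forall>u\<in>E510. \<forall>p q. const_matrix (\<psi> u) p q =
    const_matrix u p q + s * ((if p = i then const_matrix u j q else 0) + (if q = i then const_matrix u p j else 0)))"
    using transvection[OF assms(2), of s] by (elim exE)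
  then have \<psi>: "\<And>M. M \<subseteq> E510 \<Longrightarrow> conjugate M (\<psi> ` M)" "\<And>u p q. u \<in> E510 \<Longrightarrow> const_matrix (\<psi> u) p q =
    const_matrix u p q + s * ((if p = i then const_matrix u j q else 0) + (if q = i then const_matrix u p j else 0))"
    by (elim conjE; simp)+
  have "moves_to M (\<psi> ` M)"
    using \<psi>(1)[OF ME] conjugate_maximal_open_subalgebra assms(1) unfolding moves_to_def by blast
  moreover have "row_operation i j s c \<in> const_matrix ` \<psi> ` M" if c: "c \<in> const_matrix ` M" for c
  proof -
    obtain u where u: "u \<in> M" "c = const_matrix u" using c by blast
    then have "row_operation i j s c = const_matrix (\<psi> u)"
      using \<psi>(2)[of u] ME by (auto simp: row_operation_def fun_eq_iff)
    then show ?thesis using u(1) by blast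
  qed
  ultimately show ?thesis by blast
qed

lemma antisym_matrix_eqI:
  assumes "antisym_matrix (c :: 5 \<Rightarrow> 5 \<Rightarrow> 'a::comm_ring_1)" "antisym_matrix d"
    "c 0 1 = d 0 1" "c 0 2 = d 0 2" "c 0 3 = d 0 3" "c 0 4 = d 0 4" "c 1 2 = d 1 2" "c 1 3 = d 1 3" "c 1 4 = d 1 4"
    "c 2 3 = d 2 3" "c 2 4 = d 2 4" "c 3 4 = d 3 4"
  shows "c = d"
proof (intro ext)
  fix p q
  show "c p q = d p q"
    using cases_5[of p] cases_5[of q]
    by (elim disjE) (simp_all add: antisym_rules[OF assms(1)] antisym_rules[OF assms(2)] assms(3-))
qed

lemma pair_matrix_scale:
  assumes "proper_open_subalgebra N" "(\<lambda>p q. x * pair_matrix i j p q) \<in> const_matrix ` N" "x \<noteq> 0"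
  shows "pair_matrix i j \<in> const_matrix ` N"
  using const_matrix_scale[OF assms(1,2), of "1 / x"] assms(3) by simp

lemma antisym_pair_matrix: "i \<noteq> j \<Longrightarrow> antisym_matrix (\<lambda>p q. x * pair_matrix i j p q)"
  by (auto simp: antisym_matrix_def pair_matrix_def)

lemma normal_form_entry:
  assumes M: "maximal_open_subalgebra M" and c: "c \<in> const_matrix ` M" "c i j \<noteq> 0"
  shows "\<exists>M' c'. moves_to M M' \<and> c' \<in> const_matrix ` M' \<and> c' 1 2 \<noteq> 0"
proof -
  have "\<exists>M1 c1 q. moves_to M M1 \<and> c1 \<in> const_matrix ` M1 \<and> c1 1 q \<noteq> 0"
  proof (cases "\<exists>q. c 1 q \<noteq> 0")
    case True
    then show ?thesis using moves_to_refl[OF M] c by blast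
  next
    case False
    have "antisym_matrix c" using c(1) const_matrix_antisym_matrix by blast
    then have "c j i = - c i j" unfolding antisym_matrix_def by blast
    then have i: "i \<noteq> 1" "j \<noteq> 1" using c(2) False by (metis, metis neg_equal_0_iff_equal)
    obtain M1 where M1: "moves_to M M1" "\<forall>c\<in>const_matrix ` M. row_operation 1 i 1 c \<in> const_matrix ` M1"
      using row_operation_move[OF M, of 1 i 1] i by auto
    have "row_operation 1 i 1 c 1 j \<noteq> 0" using False c i by (simp add: row_operation_def)
    then show ?thesis using M1 c(1) by blast
  qed
  then obtain M1 c1 q where M1: "moves_to M M1" "c1 \<in> const_matrix ` M1" "c1 1 q \<noteq> 0" by blast
  show ?thesis
  proof (cases "c1 1 2 = 0")
    case True
    then have q: "q \<noteq> 2" using M1 by auto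
    obtain M2 where M2: "moves_to M1 M2" "\<forall>c\<in>const_matrix ` M1. row_operation 2 q 1 c \<in> const_matrix ` M2"
      using row_operation_move[OF moves_to_maximal[OF M1(1)], of 2 q 1] q by auto
    have "row_operation 2 q 1 c1 1 2 \<noteq> 0" using True M1(3) by (simp add: row_operation_def)
    then show ?thesis using M2 M1 moves_to_trans by blast
  qed (use M1 in blast)
qed

lemma normal_form_clear_row:
  assumes M: "maximal_open_subalgebra M" and c: "c \<in> const_matrix ` M" "c 1 2 \<noteq> 0" and k: "k \<noteq> 1" "k \<noteq> 2"
  shows "\<exists>M' c'. moves_to M M' \<and> c' \<in> const_matrix ` M' \<and> c' 1 2 \<noteq> 0 \<and> c' k 1 = 0 \<and> c' k 2 = 0 \<and>
    (\<forall>l. l \<noteq> k \<longrightarrow> c' l 1 = c l 1 \<and> c' l 2 = c l 2)"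
proof -
  have as: "antisym_matrix c" using c(1) const_matrix_antisym_matrix by blast
  have c0: "c 1 1 = 0" "c 2 2 = 0" "c 2 1 = - c 1 2" using antisym_rules[OF as] by auto
  \<comment> \<open>Row 1 with factor \<open>s\<close> clears the entry \<open>(k, 2)\<close>, and
    row 2 with factor \<open>t\<close> clears \<open>(k, 1)\<close>; the sign of \<open>t\<close>
    comes from \<open>c 2 1 = - c 1 2\<close>. Neither spoils the other because diagonal entries
    vanish.\<close>
  define s where "s = - c k 2 / c 1 2"
  obtain M1 where M1: "moves_to M M1" "row_operation k 1 s c \<in> const_matrix ` M1"
    using row_operation_move[OF M, of k 1 s] k c(1) by auto
  let ?c1 = "row_operation k 1 s c"
  define t where "t = c k 1 / c 1 2"
  obtain M2 where M2: "moves_to M1 M2" "row_operation k 2 t ?c1 \<in> const_matrix ` M2"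
    using row_operation_move[OF moves_to_maximal[OF M1(1)], of k 2 t] k M1(2) by auto
  let ?c2 = "row_operation k 2 t ?c1"
  have "?c2 1 2 \<noteq> 0 \<and> ?c2 k 1 = 0 \<and> ?c2 k 2 = 0 \<and> (\<forall>l. l \<noteq> k \<longrightarrow> ?c2 l 1 = c l 1 \<and> ?c2 l 2 = c l 2)"
    using k c(2) c0 by (simp add: row_operation_def s_def t_def)
  then show ?thesis using moves_to_trans[OF M1(1) M2(1)] M2(2) by blast
qed

text \<open>Row operations detach the indices 1 and 2 from 3, 4 and 0. The square of the resulting
  form vanishes, and its mixed term is dx_1 dx_2 times the remaining block, which must therefore be
  zero.\<close>

lemma normal_form_first:
  assumes M: "maximal_open_subalgebra M" and c: "c \<in> const_matrix ` M" "c i j \<noteq> 0"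
  shows "\<exists>M'. moves_to M M' \<and> pair_matrix 1 2 \<in> const_matrix ` M'"
proof -
  obtain M1 c1 where 1: "moves_to M M1" "c1 \<in> const_matrix ` M1" "c1 1 2 \<noteq> 0"
    using normal_form_entry[OF assms] by blast
  have ne: "(3::5) \<noteq> 1" "(3::5) \<noteq> 2" "(4::5) \<noteq> 1" "(4::5) \<noteq> 2" "(0::5) \<noteq> 1" "(0::5) \<noteq> 2" by simp_all
  obtain M2 c2 where 2: "moves_to M1 M2 \<and> c2 \<in> const_matrix ` M2 \<and> c2 1 2 \<noteq> 0 \<and> c2 3 1 = 0 \<and> c2 3 2 = 0 \<and>
    (\<forall>l. l \<noteq> 3 \<longrightarrow> c2 l 1 = c1 l 1 \<and> c2 l 2 = c1 l 2)"
    using normal_form_clear_row[OF moves_to_maximal[OF 1(1)] 1(2,3) ne(1,2)] by blast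
  then have 2: "moves_to M1 M2" "c2 \<in> const_matrix ` M2" "c2 1 2 \<noteq> 0" "c2 3 1 = 0" "c2 3 2 = 0" by blast+
  obtain M3 c3 where 3: "moves_to M2 M3 \<and> c3 \<in> const_matrix ` M3 \<and> c3 1 2 \<noteq> 0 \<and> c3 4 1 = 0 \<and> c3 4 2 = 0 \<and>
    (\<forall>l. l \<noteq> 4 \<longrightarrow> c3 l 1 = c2 l 1 \<and> c3 l 2 = c2 l 2)"
    using normal_form_clear_row[OF moves_to_maximal[OF 2(1)] 2(2,3) ne(3,4)] by blast
  then have 3: "moves_to M2 M3" "c3 \<in> const_matrix ` M3" "c3 1 2 \<noteq> 0" "c3 4 1 = 0" "c3 4 2 = 0" "c3 3 1 = 0" "c3 3 2 = 0"
    using 2(4,5) by (blast, blast, blast, blast, blast, simp, simp)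
  obtain M4 d where 4: "moves_to M3 M4 \<and> d \<in> const_matrix ` M4 \<and> d 1 2 \<noteq> 0 \<and> d 0 1 = 0 \<and> d 0 2 = 0 \<and>
    (\<forall>l. l \<noteq> 0 \<longrightarrow> d l 1 = c3 l 1 \<and> d l 2 = c3 l 2)"
    using normal_form_clear_row[OF moves_to_maximal[OF 3(1)] 3(2,3) ne(5,6)] by blast
  then have 4: "moves_to M3 M4" "d \<in> const_matrix ` M4" "d 1 2 \<noteq> 0" "d 0 1 = 0" "d 0 2 = 0" "d 4 1 = 0" "d 4 2 = 0" "d 3 1 = 0" "d 3 2 = 0"
    using 3(4-) by (blast, blast, blast, blast, blast, simp, simp, simp, simp)
  have max: "maximal_open_subalgebra M4" by (rule moves_to_maximal[OF 4(1)])
  note iso = const_matrices_isotropic[OF maximal_proper_open[OF max] 4(2) 4(2)]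
  have as: "antisym_matrix d" using 4(2) const_matrix_antisym_matrix by blast
  have d: "d 1 3 = 0" "d 2 3 = 0" "d 1 4 = 0" "d 2 4 = 0" using 4(4-) antisym_rules[OF as] by auto
  have "d 3 4 = 0" "d 0 4 = 0" "d 0 3 = 0"
    using iso[of 0] iso[of 3] iso[of 4] 4(3) by (simp_all add: star_def wedge_coeff_def d 4(4,5))
  moreover define x where "x = d 1 2"
  ultimately have eq: "d = (\<lambda>p q. x * pair_matrix 1 2 p q)"
    using d 4(4,5) by (intro antisym_matrix_eqI[OF as antisym_pair_matrix]) (simp_all add: pair_matrix_def)
  have "x \<noteq> 0" using 4(3) by (simp add: x_def)
  moreover have "(\<lambda>p q. x * pair_matrix 1 2 p q) \<in> const_matrix ` M4" using 4(2) unfolding eq .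
  ultimately have "pair_matrix 1 2 \<in> const_matrix ` M4"
    using pair_matrix_scale[OF maximal_proper_open[OF max]] by blast
  then show ?thesis using moves_to_trans 1(1) 2(1) 3(1) 4(1) by blast
qed

lemma row_operation_pair_matrix:
  assumes "j \<notin> {1, 2} \<or> (i, j) \<in> {(1, 2), (2, 1)}"
  shows "row_operation i j s (pair_matrix 1 2) = pair_matrix 1 2"
  using assms by (auto simp: row_operation_def pair_matrix_def fun_eq_iff)

lemma row_operation_move_pair:
  assumes "maximal_open_subalgebra M" "i \<noteq> j" "j \<notin> {1, 2} \<or> (i, j) \<in> {(1, 2), (2, 1)}"
    "pair_matrix 1 2 \<in> const_matrix ` M" "c \<in> const_matrix ` M"
  shows "\<exists>M'. moves_to M M' \<and> pair_matrix 1 2 \<in> const_matrix ` M' \<and> row_operation i j s c \<in> const_matrix ` M'"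
  using row_operation_move[OF assms(1,2), of s] row_operation_pair_matrix[OF assms(3), of s] assms(4,5) by metis

lemma normal_form_second:
  assumes M: "maximal_open_subalgebra M" and E: "pair_matrix 1 2 \<in> const_matrix ` M"
    and c: "c \<in> const_matrix ` M" "c p q \<noteq> 0" "p \<notin> {1, 2} \<or> q \<notin> {1, 2}"
  shows "\<exists>M'. moves_to M M' \<and> pair_matrix 1 2 \<in> const_matrix ` M' \<and> pair_matrix 1 3 \<in> const_matrix ` M'"
proof -
  have iso: "c 3 4 = 0" "c 0 4 = 0" "c 0 3 = 0" if "maximal_open_subalgebra M" "pair_matrix 1 2 \<in> const_matrix ` M" "c \<in> const_matrix ` M" for M c
  proof -
    have as: "antisym_matrix c" using that(3) const_matrix_antisym_matrix by blast
    show "c 3 4 = 0" "c 0 4 = 0" "c 0 3 = 0"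
      using star_pair_matrix[OF as] const_matrices_isotropic[OF maximal_proper_open[OF that(1)] that(3,2)] by auto
  qed
  have "\<exists>k. k \<notin> {1, 2} \<and> (c 1 k \<noteq> 0 \<or> c 2 k \<noteq> 0)"
  proof (rule ccontr)
    assume "\<not> ?thesis"
    then have z': "c 1 k = 0 \<and> c 2 k = 0" if "k \<notin> {1, 2}" for k using that by blast
    have z: "c 1 0 = 0" "c 2 0 = 0" "c 1 3 = 0" "c 2 3 = 0" "c 1 4 = 0" "c 2 4 = 0"
      using z'[of 0] z'[of 3] z'[of 4] by simp_all
    have as: "antisym_matrix c" using c(1) const_matrix_antisym_matrix by blast
    have "c 0 1 = 0" "c 0 2 = 0" using z antisym_rules[OF as] by auto
    then have "c = (\<lambda>p q. c 1 2 * pair_matrix 1 2 p q)"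
      using z iso[OF M E c(1)] by (intro antisym_matrix_eqI[OF as antisym_pair_matrix]) (simp_all add: pair_matrix_def)
    then have "c p q = c 1 2 * pair_matrix 1 2 p q" by metis
    then show False using c(2,3) by (auto simp: pair_matrix_def split: if_splits)
  qed
  then obtain k where k: "k \<notin> {1, 2}" "c 1 k \<noteq> 0 \<or> c 2 k \<noteq> 0" by blast
  have "\<exists>M1 c1. moves_to M M1 \<and> pair_matrix 1 2 \<in> const_matrix ` M1 \<and> c1 \<in> const_matrix ` M1 \<and> c1 1 k \<noteq> 0"
  proof (cases "c 1 k = 0")
    case True
    have "row_operation 1 2 1 c 1 k \<noteq> 0" using True k by (simp add: row_operation_def)
    moreover have "\<exists>M'. moves_to M M' \<and> pair_matrix 1 2 \<in> const_matrix ` M' \<and> row_operation 1 2 1 c \<in> const_matrix ` M'"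
      by (rule row_operation_move_pair[OF M _ _ E c(1)]) simp_all
    ultimately show ?thesis by blast
  next
    case False
    then show ?thesis using moves_to_refl[OF M] E c(1) by blast
  qed
  then obtain M1 c1 where 1: "moves_to M M1" "pair_matrix 1 2 \<in> const_matrix ` M1" "c1 \<in> const_matrix ` M1" "c1 1 k \<noteq> 0" by blast
  note max1 = moves_to_maximal[OF 1(1)]
  have "\<exists>M2 c2. moves_to M1 M2 \<and> pair_matrix 1 2 \<in> const_matrix ` M2 \<and> c2 \<in> const_matrix ` M2 \<and> c2 1 3 \<noteq> 0"
  proof (cases "c1 1 3 = 0")
    case True
    then have "k \<noteq> 3" using 1(4) by auto
    moreover have "row_operation 3 k 1 c1 1 3 \<noteq> 0" using True 1(4) by (simp add: row_operation_def)
    moreover have "\<exists>M'. moves_to M1 M' \<and> pair_matrix 1 2 \<in> const_matrix ` M' \<and> row_operation 3 k 1 c1 \<in> const_matrix ` M'"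
      using \<open>k \<noteq> 3\<close> k(1) by (intro row_operation_move_pair[OF max1 _ _ 1(2,3)]) auto
    ultimately show ?thesis by blast
  next
    case False
    then show ?thesis using moves_to_refl[OF max1] 1 by blast
  qed
  then obtain M2 c2 where 2: "moves_to M1 M2" "pair_matrix 1 2 \<in> const_matrix ` M2" "c2 \<in> const_matrix ` M2" "c2 1 3 \<noteq> 0" by blast
  define c3 where "c3 = row_operation 4 3 (- c2 1 4 / c2 1 3) c2"
  obtain M3 where 3: "moves_to M2 M3" "pair_matrix 1 2 \<in> const_matrix ` M3" "c3 \<in> const_matrix ` M3"
    using row_operation_move_pair[OF moves_to_maximal[OF 2(1)] _ _ 2(2,3), of 4 3 "- c2 1 4 / c2 1 3"] unfolding c3_def by auto
  have c3: "c3 1 3 \<noteq> 0" "c3 1 4 = 0" using 2(4) by (simp_all add: c3_def row_operation_def)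
  define c4 where "c4 = row_operation 0 3 (- c3 1 0 / c3 1 3) c3"
  obtain M4 where 4: "moves_to M3 M4" "pair_matrix 1 2 \<in> const_matrix ` M4" "c4 \<in> const_matrix ` M4"
    using row_operation_move_pair[OF moves_to_maximal[OF 3(1)] _ _ 3(2,3), of 0 3 "- c3 1 0 / c3 1 3"] unfolding c4_def by auto
  have c4: "c4 1 3 \<noteq> 0" "c4 1 4 = 0" "c4 1 0 = 0" using c3 by (simp_all add: c4_def row_operation_def)
  define c5 where "c5 = row_operation 2 1 (- c4 2 3 / c4 1 3) c4"
  obtain M5 where 5: "moves_to M4 M5" "pair_matrix 1 2 \<in> const_matrix ` M5" "c5 \<in> const_matrix ` M5"
    using row_operation_move_pair[OF moves_to_maximal[OF 4(1)] _ _ 4(2,3), of 2 1 "- c4 2 3 / c4 1 3"] unfolding c5_def by auto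
  have c5: "c5 1 3 \<noteq> 0" "c5 1 4 = 0" "c5 1 0 = 0" "c5 2 3 = 0" using c4 by (simp_all add: c5_def row_operation_def)
  define d where "d = (\<lambda>p q. (1 / c5 1 3) * c5 p q + (- c5 1 2 / c5 1 3) * pair_matrix 1 2 p q)"
  note max5 = moves_to_maximal[OF 5(1)] 
  have dM: "d \<in> const_matrix ` M5" unfolding d_def by (rule const_matrix_combination[OF maximal_proper_open[OF max5] 5(3,2)])
  have d: "d 1 3 = 1" "d 1 4 = 0" "d 1 0 = 0" "d 2 3 = 0" "d 1 2 = 0"
    using c5 by (simp_all add: d_def pair_matrix_def field_simps)
  note diso = iso[OF max5 5(2) dM] and ii = const_matrices_isotropic[OF maximal_proper_open[OF max5] dM dM]
  have as: "antisym_matrix d" using dM const_matrix_antisym_matrix by blast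
  have d01: "d 0 1 = 0" using d antisym_rules[OF as] by simp
  have "d 2 4 = 0" "d 0 2 = 0"
    using ii[of 0] ii[of 4] by (simp_all add: star_def wedge_coeff_def d d01 diso)
  then have "d = (\<lambda>p q. 1 * pair_matrix 1 3 p q)"
    using d d01 diso by (intro antisym_matrix_eqI[OF as antisym_pair_matrix]) (simp_all add: pair_matrix_def)
  then have "pair_matrix 1 3 \<in> const_matrix ` M5" using dM by simp
  then show ?thesis using moves_to_trans 1(1) 2(1) 3(1) 4(1) 5(1,2) by blast
qed

text \<open>Isotropy against the two known pairs makes \<open>c 2 3\<close> the only nonzero entry,
  up to order, that avoids index 1. After subtracting multiples of these pairs, the vanishing square
  removes (1, 4) and (0, 1), so no change of coordinates is involved.\<close>

lemma third_pair:
  assumes M: "proper_open_subalgebra M" and E: "pair_matrix 1 2 \<in> const_matrix ` M" "pair_matrix 1 3 \<in> const_matrix ` M"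
    and c: "c \<in> const_matrix ` M" "c p q \<noteq> 0" "p \<noteq> 1" "q \<noteq> 1"
  shows "pair_matrix 2 3 \<in> const_matrix ` M"
proof -
  have as: "antisym_matrix c" using c(1) const_matrix_antisym_matrix by blast
  have z: "c 3 4 = 0" "c 0 4 = 0" "c 0 3 = 0" "c 2 4 = 0" "c 0 2 = 0"
    using star_pair_matrix[OF as] const_matrices_isotropic[OF M c(1) E(1)] const_matrices_isotropic[OF M c(1) E(2)] by auto
  have c23: "c 2 3 \<noteq> 0" using c(2-4) cases_5[of p] cases_5[of q] antisym_rules[OF as] z by auto
  define d where "d = (\<lambda>p q. (1 / c 2 3) * c p q + (- c 1 2 / c 2 3) * pair_matrix 1 2 p q)"
  define e where "e = (\<lambda>p q. 1 * d p q + (- c 1 3 / c 2 3) * pair_matrix 1 3 p q)"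
  have "d \<in> const_matrix ` M" unfolding d_def by (rule const_matrix_combination[OF M c(1) E(1)])
  then have eM: "e \<in> const_matrix ` M" unfolding e_def by (rule const_matrix_combination[OF M _ E(2)])
  have as': "antisym_matrix e" using eM const_matrix_antisym_matrix by blast
  have e: "e 2 3 = 1" "e 1 2 = 0" "e 1 3 = 0" "e 3 4 = 0" "e 0 4 = 0" "e 0 3 = 0" "e 2 4 = 0" "e 0 2 = 0"
    using c23 z by (simp_all add: e_def d_def pair_matrix_def)
  have "e 1 4 = 0" "e 0 1 = 0"
    using const_matrices_isotropic[OF M eM eM, of 0] const_matrices_isotropic[OF M eM eM, of 4] by (simp_all add: star_def wedge_coeff_def e)
  then have "e = (\<lambda>p q. 1 * pair_matrix 2 3 p q)"
    using e by (intro antisym_matrix_eqI[OF as' antisym_pair_matrix]) (simp_all add: pair_matrix_def)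
  then show ?thesis using eM by simp
qed


section \<open>Maximality of the graded subalgebras\<close>

lemma graded_subalgebra_is_subalgebra:
  assumes "even (\<Sum>k\<in>UNIV. a k)"
  shows "E510_subalgebra (graded_subalgebra a)"
  unfolding E510_subalgebra_def
proof (intro conjI ballI allI)
  have G: "u \<in> graded_subalgebra a \<longleftrightarrow> u \<in> E510 \<and> (\<forall>b. elt_coord u b \<noteq> 0 \<longrightarrow> coord_degree a b \<ge> 0)" for u
    by (simp add: graded_subalgebra_def)
  show "graded_subalgebra a \<subseteq> E510" using G by blast
  show "0 \<in> graded_subalgebra a" using E510_vector_space(1) by (simp add: G elt_coord_linear)
  fix u assume u: "u \<in> graded_subalgebra a"
  then have uE: "u \<in> E510" using G by blast
  show "elt_scale c u \<in> graded_subalgebra a" for c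
    using u E510_vector_space(5) by (simp add: G elt_coord_linear)
  have "elt_coord (fst u, 0) b \<noteq> 0 \<Longrightarrow> elt_coord u b \<noteq> 0" "elt_coord (0, snd u) b \<noteq> 0 \<Longrightarrow> elt_coord u b \<noteq> 0" for b
    by (cases b; cases "fst b"; auto)+
  then show "(fst u, 0) \<in> graded_subalgebra a" "(0, snd u) \<in> graded_subalgebra a"
    using u E510_vector_space(6,7)[OF uE] unfolding G by blast+
  fix v assume v: "v \<in> graded_subalgebra a"
  then have vE: "v \<in> E510" using G by blast
  have "elt_coord (u + v) b \<noteq> 0 \<Longrightarrow> elt_coord u b \<noteq> 0 \<or> elt_coord v b \<noteq> 0" for b by (auto simp: elt_coord_linear)
  then show "u + v \<in> graded_subalgebra a" using u v E510_vector_space(2)[OF uE vE] unfolding G by blast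
  have "coord_degree a b \<ge> 0" if nz: "elt_coord (E510_bracket u v) b \<noteq> 0" for b
  proof -
    obtain b1 b2 where b: "elt_coord u b1 \<noteq> 0" "elt_coord v b2 \<noteq> 0" "coord_degree a b = coord_degree a b1 + coord_degree a b2"
      using E510_bracket_support_degree[OF uE vE nz] assms by blast
    then have "coord_degree a b1 \<ge> 0" "coord_degree a b2 \<ge> 0" using u v unfolding G by blast+
    then show ?thesis using b(3) by simp
  qed
  then show "E510_bracket u v \<in> graded_subalgebra a" using E510_bracket_closed[OF uE vE] unfolding G by blast
qed

text \<open>A coordinate of level at least twice the sum \<open>A\<close> of the weights has total
  degree at least \<open>A\<close>, which outweighs any single weight and half their sum; only the
  finitely many coordinates below that level are constrained.\<close>

lemma openin_graded_subalgebra: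
  assumes a: "\<And>k. a k \<ge> 1"
  shows "openin E510_top (graded_subalgebra a)"
  unfolding openin_E510_top
proof (intro conjI ballI)
  show "graded_subalgebra a \<subseteq> E510" by (auto simp: graded_subalgebra_def)
  fix u assume u: "u \<in> graded_subalgebra a"
  define A where "A = (\<Sum>k\<in>UNIV. int (a k))"
  have A0: "A \<ge> 0" unfolding A_def by (rule sum_nonneg) simp
  have aA: "int (a i) \<le> A" for i unfolding A_def by (rule member_le_sum) auto
  have "v \<in> graded_subalgebra a" if v: "v \<in> E510" "agree_below (2 * A) u v" for v
  proof -
    have "coord_degree a b \<ge> 0" if nz: "elt_coord v b \<noteq> 0" for b
    proof (cases "level b < 2 * A")
      case True
      then have "elt_coord u b \<noteq> 0" using agree_belowD[OF v(2)] nz by simp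
      then show ?thesis using u by (simp add: graded_subalgebra_def)
    next
      case False
      obtain x m where b: "b = (x, m)" by force
      have "int (m k) * 1 \<le> int (m k) * int (a k)" for k using a[of k] by (intro mult_left_mono) auto
      then have d: "int (total_degree m) \<le> (\<Sum>k\<in>UNIV. int (m k) * int (a k))"
        unfolding total_degree_def of_nat_sum by (intro sum_mono) simp
      show ?thesis
      proof (cases x)
        case (Inl i)
        then show ?thesis using d False aA[of i] by (simp add: b level_simps coord_degree_def)
      next
        case (Inr I)
        then have "card I = 2" using nz E510_coord_Inr[OF v(1)] b by blast
        then have "int (total_degree m) \<ge> A" using False by (simp add: b Inr level_simps)
        moreover have "(\<Sum>i\<in>I. int (a i)) \<ge> 0" by (rule sum_nonneg) simp
        moreover have "A div 2 \<le> A" using A0 by simp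
        ultimately show ?thesis using d by (simp add: b Inr coord_degree_def A_def)
      qed
    qed
    then show ?thesis using v(1) by (simp add: graded_subalgebra_def)
  qed
  then show "\<exists>q. \<forall>v\<in>E510. agree_below q u v \<longrightarrow> v \<in> graded_subalgebra a" by blast
qed

lemma graded_subalgebra_proper:
  assumes a: "\<And>k. a k \<ge> 1"
  shows "graded_subalgebra a \<noteq> E510"
proof
  assume "graded_subalgebra a = E510"
  then have "const_vf 1 \<in> graded_subalgebra a" using const_vf_E510 E510_part_simps(1) by blast
  moreover have "elt_coord (const_vf 1) (Inl 1, 0) \<noteq> 0"
    by (simp add: const_vf_def one_mps_def mps_coeff_const)
  ultimately have "coord_degree a (Inl 1, 0) \<ge> 0" unfolding graded_subalgebra_def by blast
  then show False using a[of 1] by (simp add: coord_degree_def)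
qed

text \<open>A subspace containing an open subspace is open, so the constraints on proper open
  subalgebras apply to every competitor of a graded one.\<close>

lemma supalgebra_proper_open:
  assumes a: "\<And>k. a k \<ge> 1" and N: "E510_subalgebra N" "graded_subalgebra a \<subseteq> N" "N \<noteq> E510"
  shows "proper_open_subalgebra N"
proof -
  have NE: "N \<subseteq> E510" "\<And>u v. u \<in> N \<Longrightarrow> v \<in> N \<Longrightarrow> u + v \<in> N" using N(1) by (auto simp: E510_subalgebra_def)
  have "0 \<in> graded_subalgebra a" using E510_vector_space(1) by (simp add: graded_subalgebra_def elt_coord_linear)
  then obtain q where q: "\<And>v. v \<in> E510 \<Longrightarrow> agree_below q 0 v \<Longrightarrow> v \<in> graded_subalgebra a"
    using openin_graded_subalgebra[of a, OF a] unfolding openin_E510_top by meson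
  have "openin E510_top N" unfolding openin_E510_top
  proof (intro conjI ballI NE(1) exI impI)
    fix u v assume *: "u \<in> N" "v \<in> E510" "agree_below q u v"
    have "agree_below q 0 (v - u)" using *(3) by (simp add: agree_below_def elt_coord_linear)
    then have "v - u \<in> N" using q[of "v - u"] * NE(1) N(2) E510_vector_space(3) by blast
    then have "u + (v - u) \<in> N" using NE(2) * by blast
    then show "v \<in> N" by simp
  qed
  then show ?thesis using N by (simp add: proper_open_subalgebra_def)
qed

lemma maximal_graded_subalgebraI:
  assumes a: "\<And>k. a k \<ge> 1" "even (\<Sum>k\<in>UNIV. a k)"
    and sub: "\<And>N. proper_open_subalgebra N \<Longrightarrow> graded_subalgebra a \<subseteq> N \<Longrightarrow> N \<subseteq> graded_subalgebra a"
  shows "maximal_open_subalgebra (graded_subalgebra a)"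
  unfolding maximal_open_subalgebra_def
proof (intro conjI allI impI)
  show "E510_subalgebra (graded_subalgebra a)" by (rule graded_subalgebra_is_subalgebra[OF a(2)])
  show "openin E510_top (graded_subalgebra a)" by (rule openin_graded_subalgebra[OF a(1)])
  show "graded_subalgebra a \<noteq> E510" by (rule graded_subalgebra_proper[OF a(1)])
  fix N assume "E510_subalgebra N \<and> graded_subalgebra a \<subseteq> N \<and> N \<noteq> E510"
  then have N: "E510_subalgebra N" "graded_subalgebra a \<subseteq> N" "N \<noteq> E510" by blast+
  then have "N \<subseteq> graded_subalgebra a" using sub supalgebra_proper_open[of a N, OF a(1) N] by blast
  then show "N = graded_subalgebra a" using N(2) by blast
qed

section \<open>Linear fields and constant forms in graded subalgebras\<close>

lemma linear_vf_graded:
  assumes "i \<noteq> j" "a j \<le> a i"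
  shows "linear_vf i j \<in> graded_subalgebra a"
proof -
  have "coord_degree a b \<ge> 0" if "elt_coord (linear_vf i j) b \<noteq> 0" for b
    using linear_vf_support[OF that] assms(2)
    by (simp add: coord_degree_def unit_exp_def if_distrib[of "\<lambda>x. int x * _"] cong: if_cong)
  then show ?thesis using E510_part_simps(1)[OF linear_vf_E510[OF assms(1)]] by (simp add: graded_subalgebra_def)
qed

definition const_form :: "5 \<Rightarrow> 5 \<Rightarrow> elt" where
  "const_form i j = (0, \<lambda>I. if I = {i, j} then if i < j then 1 else - 1 else 0)"

lemma const_form:
  assumes "i \<noteq> j"
  shows "const_form i j \<in> E510" "const_matrix (const_form i j) = pair_matrix i j"
proof -
  let ?\<omega> = "snd (const_form i j)"
  have 2: "?\<omega> \<in> Omega 2" using assms by (auto simp: const_form_def Omega_def)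
  have "mps_partial k (form_matrix ?\<omega> p q) = 0" for k p q
    by (auto simp: form_matrix_def const_form_def mps_partial_uminus)
  then have "ext_d ?\<omega> = 0" unfolding closed_matrix_iff[OF 2] by (simp add: closed_matrix_def)
  then show "const_form i j \<in> E510" using 2 by (simp add: E510_iff const_form_def divergence_linear)
  have c: "mps_coeff (1 :: 5 mps) 0 = 1" by (simp add: one_mps_def mps_coeff_const)
  show "const_matrix (const_form i j) = pair_matrix i j"
  proof (intro ext)
    fix p q
    show "const_matrix (const_form i j) p q = pair_matrix i j p q"
      using assms by (auto simp: const_matrix_def form_matrix_def const_form_def pair_matrix_def doubleton_eq_iff c)
  qed
qed

lemma const_form_graded:
  assumes "i \<noteq> j" "(\<Sum>k\<in>UNIV. int (a k)) div 2 \<le> int (a i) + int (a j)"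
  shows "const_form i j \<in> graded_subalgebra a"
proof -
  have "coord_degree a b \<ge> 0" if nz: "elt_coord (const_form i j) b \<noteq> 0" for b
  proof -
    obtain x m where b: "b = (x, m)" by force
    have "x = Inr {i, j} \<and> m = 0"
      using nz unfolding b by (cases x) (auto simp: const_form_def one_mps_def mps_coeff_const split: if_splits)
    then show ?thesis using assms by (simp add: b coord_degree_def)
  qed
  then show ?thesis using const_form(1)[OF assms(1)] by (simp add: graded_subalgebra_def)
qed

lemma pair_matrix_graded:
  assumes "graded_subalgebra a \<subseteq> N" "i \<noteq> j" "(\<Sum>k\<in>UNIV. int (a k)) div 2 \<le> int (a i) + int (a j)"
  shows "pair_matrix i j \<in> const_matrix ` N"
  using const_form_graded[OF assms(2,3)] const_form(2)[OF assms(2)] assms(1) by (metis image_eqI subsetD)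

text \<open>The derivative of \<open>row_operation\<close> in the parameter. Here coordinates stay
  fixed: linear fields that already belong to the subalgebra act on its values at the
  origin.\<close>

definition row_action :: "5 \<Rightarrow> 5 \<Rightarrow> (5 \<Rightarrow> 5 \<Rightarrow> complex) \<Rightarrow> 5 \<Rightarrow> 5 \<Rightarrow> complex" where
  "row_action i j c p q = (if p = i then c j q else 0) + (if q = i then c p j else 0)"

lemma row_action_graded:
  assumes N: "proper_open_subalgebra N" "graded_subalgebra a \<subseteq> N" and ij: "i \<noteq> j" "a j \<le> a i" and c: "c \<in> const_matrix ` N"
  shows "row_action i j c \<in> const_matrix ` N"
proof -
  have "linear_vf i j \<in> N" using linear_vf_graded[OF ij] N(2) by blast
  then have "matrix_action (linear_part (linear_vf i j)) c \<in> const_matrix ` N" by (rule const_matrix_action[OF N(1) _ c])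
  moreover have "linear_part (linear_vf i j) p k = (if k = j then if p = i then 1 else 0 else 0)" for p k
    by (simp add: linear_part_def linear_vf_def mps_coeff_var)
  then have "matrix_action (linear_part (linear_vf i j)) c = row_action i j c"
    by (auto simp: matrix_action_def row_action_def sum.distrib fun_eq_iff if_distrib[of "\<lambda>x. x * _"] cong: if_cong)
  ultimately show ?thesis by simp
qed

lemma ex_other3_5: "\<exists>l::5. l \<noteq> i \<and> l \<noteq> j \<and> l \<noteq> k"
proof -
  have "card {i, j, k} < CARD(5)" by (simp add: card_insert_if)
  then have "{i, j, k} \<noteq> UNIV" by (metis less_irrefl)
  then show ?thesis by auto
qed

text \<open>All fields x_i d/dx_j with distinct indices act here, so a nonzero value at the origin
  would produce some dx_k dx_l and then every coordinate pair; but dx_1 dx_2 and dx_3 dx_4 have a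
  nonzero product.\<close>

lemma maximal_principal: "maximal_open_subalgebra (graded_subalgebra type_principal)"
proof (rule maximal_graded_subalgebraI)
  fix N assume N: "proper_open_subalgebra N" "graded_subalgebra type_principal \<subseteq> N"
  note act = row_action_graded[OF N _ order_refl]
  let ?P = "\<lambda>i j. pair_matrix i j \<in> const_matrix ` N"
  have swap: "?P l k" if "?P k l" "k \<noteq> l" for k l
  proof -
    have "(\<lambda>p q. - 1 * pair_matrix k l p q) = pair_matrix l k" using that(2) by (auto simp: pair_matrix_def fun_eq_iff)
    then show ?thesis using const_matrix_scale[OF N(1) that(1), of "- 1"] by simp
  qed
  have move: "?P p l" if "?P k l" "k \<noteq> l" "p \<noteq> l" for k l p
  proof (cases "p = k")
    case False
    have "row_action p k (pair_matrix k l) = pair_matrix p l"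
      using that(2,3) False by (intro ext) (auto simp: row_action_def pair_matrix_def)
    then show ?thesis using act[OF False that(1)] by simp
  qed (use that in simp)
  have all: "?P a b" if "?P k l" "k \<noteq> l" "a \<noteq> b" for k l a b
  proof (cases "a = l")
    case True
    then show ?thesis using move[OF that(1,2), of b] swap[of b l] that(3) by auto
  next
    case False
    then have "?P l a" using move[OF that(1,2), of a] swap[of a l] by auto
    then have "?P b a" using move[of l a b] False that(3) by auto
    then show ?thesis using swap[of b a] that(3) by auto
  qed
  show "N \<subseteq> graded_subalgebra type_principal"
  proof (rule subset_principal[OF N(1)], rule ccontr)
    fix c p q assume c: "c \<in> const_matrix ` N" "c p q \<noteq> 0"
    have as: "antisym_matrix c" using c(1) const_matrix_antisym_matrix by blast
    then have pq: "p \<noteq> q" "c q p = - c p q" using c(2) unfolding antisym_matrix_def by blast+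
    obtain k where k: "k \<noteq> p" "k \<noteq> q" using ex_other_5 by metis
    obtain l where l: "l \<noteq> p" "l \<noteq> q" "l \<noteq> k" using ex_other3_5 by metis
    \<comment> \<open>Carrying \<open>p\<close> to \<open>k\<close> and then \<open>q\<close> to
      \<open>l\<close>, both new indices, retains the entry \<open>(p, q)\<close> and removes all
      others.\<close>
    have "row_action l q (row_action k p c) = (\<lambda>x y. c p q * pair_matrix k l x y)"
      using k l pq by (auto simp: row_action_def pair_matrix_def fun_eq_iff)
    then have "?P k l" using act[OF l(2) act[OF k(1) c(1)]] pair_matrix_scale[OF N(1), of "c p q" k l] c(2) by simp
    then have "?P 1 2" "?P 3 4" using all[of k l] l(3) by auto
    then have "star (pair_matrix 3 4) (pair_matrix 1 2) 0 = 0" using const_matrices_isotropic[OF N(1)] by blast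
    then show False by (simp add: star_def wedge_coeff_def pair_matrix_def)
  qed
qed simp_all

text \<open>All four forms dx_1 dx_j have degree 0, and isotropy against them leaves no entry that
  avoids the index 1.\<close>

lemma maximal_line: "maximal_open_subalgebra (graded_subalgebra type_line)"
proof (rule maximal_graded_subalgebraI)
  fix N assume N: "proper_open_subalgebra N" "graded_subalgebra type_line \<subseteq> N"
  have S: "(\<Sum>k\<in>UNIV. int (type_line k)) div 2 = 3" by (simp add: sum_5)
  have P: "pair_matrix 1 j \<in> const_matrix ` N" if "j \<noteq> 1" for j
    using that by (intro pair_matrix_graded[OF N(2)]) (simp_all only: S, simp_all)
  show "N \<subseteq> graded_subalgebra type_line"
  proof (rule subset_line[OF N(1) P P])
    fix c p q assume c: "c \<in> const_matrix ` N" and pq: "p \<noteq> (1::5)" "q \<noteq> (1::5)"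
    have as: "antisym_matrix c" using c const_matrix_antisym_matrix by blast
    have "star c (pair_matrix 1 4) 0 = c 2 3" by (simp add: star_def wedge_coeff_def pair_matrix_def)
    then have "c 2 3 = 0" using const_matrices_isotropic[OF N(1) c P[of 4]] by simp
    moreover have "c 3 4 = 0" "c 0 4 = 0" "c 0 3 = 0" "c 2 4 = 0" "c 0 2 = 0"
      using star_pair_matrix[OF as] const_matrices_isotropic[OF N(1) c P[of 2]] const_matrices_isotropic[OF N(1) c P[of 3]] by auto
    ultimately show "c p q = 0"
      using pq cases_5[of p] cases_5[of q] antisym_rules[OF as] by auto
  qed simp_all
qed (simp_all add: sum_5)

text \<open>A nonzero entry (1, k) with \<open>k\<close> outside the plane would, under the linear
  fields of \<open>N\<close>, produce dx_1 dx_3 and dx_2 dx_4, whose product is nonzero. An entry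
  (2, k) is carried to (1, k) by x_1 d/dx_2.\<close>

lemma maximal_plane: "maximal_open_subalgebra (graded_subalgebra type_plane)"
proof (rule maximal_graded_subalgebraI)
  fix N assume N: "proper_open_subalgebra N" "graded_subalgebra type_plane \<subseteq> N"
  note act = row_action_graded[OF N]
  have S: "(\<Sum>k\<in>UNIV. int (type_plane k)) div 2 = 6" by (simp add: sum_5)
  have E: "pair_matrix 1 2 \<in> const_matrix ` N"
    by (intro pair_matrix_graded[OF N(2)]) (simp_all only: S, simp_all)
  have z1: "c 1 k = 0" if c: "c \<in> const_matrix ` N" and k: "k \<notin> {1, 2}" for c k
  proof (rule ccontr)
    assume nz: "c 1 k \<noteq> 0"
    have as: "antisym_matrix c" using c const_matrix_antisym_matrix by blast
    then have ck: "c k 1 = - c 1 k" "c 1 1 = 0" unfolding antisym_matrix_def by blast+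
    have 1: "row_action 2 1 c \<in> const_matrix ` N" by (rule act) (use c in simp_all)
    have 2: "pair_matrix 2 l \<in> const_matrix ` N" if l: "l \<notin> {1, 2}" "l \<noteq> k" for l
    proof -
      \<comment> \<open>The entry (1, k) is carried to (2, k) and then to (2, l); since
        \<open>l\<close> differs from 1, 2 and \<open>k\<close>, no other entry survives.\<close>
      have "row_action l k (row_action 2 1 c) = (\<lambda>x y. c 1 k * pair_matrix 2 l x y)"
        using k l ck by (auto simp: row_action_def pair_matrix_def fun_eq_iff)
      moreover have "row_action l k (row_action 2 1 c) \<in> const_matrix ` N" by (rule act) (use 1 k l in simp_all)
      ultimately show ?thesis using pair_matrix_scale[OF N(1), of "c 1 k" 2 l] nz by simp
    qed
    obtain l where l: "l \<notin> {1, 2}" "l \<noteq> k" using ex_other3_5[of 1 2 k] by blast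
    have "row_action k l (pair_matrix 2 l) = pair_matrix 2 k"
      using k l by (auto simp: row_action_def pair_matrix_def fun_eq_iff)
    moreover have "row_action k l (pair_matrix 2 l) \<in> const_matrix ` N" by (rule act) (use 2[OF l] k l in simp_all)
    ultimately have 3: "pair_matrix 2 m \<in> const_matrix ` N" if "m \<notin> {1, 2}" for m
      using 2[OF that] by (cases "m = k") simp_all
    have "row_action 1 2 (pair_matrix 2 3) = pair_matrix 1 3" by (auto simp: row_action_def pair_matrix_def fun_eq_iff)
    moreover have "row_action 1 2 (pair_matrix 2 3) \<in> const_matrix ` N" by (rule act) (use 3[of 3] in simp_all)
    ultimately have "star (pair_matrix 2 4) (pair_matrix 1 3) 0 = 0" using const_matrices_isotropic[OF N(1) 3[of 4]] by simp
    then show False by (simp add: star_def wedge_coeff_def pair_matrix_def)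
  qed
  have z2: "c 2 k = 0" if c: "c \<in> const_matrix ` N" and k: "k \<notin> {1, 2}" for c k
  proof -
    have "row_action 1 2 c \<in> const_matrix ` N" by (rule act) (use c in simp_all)
    then have "row_action 1 2 c 1 k = 0" using z1 k by blast
    then show ?thesis using k by (simp add: row_action_def)
  qed
  show "N \<subseteq> graded_subalgebra type_plane"
  proof (rule subset_plane[OF N(1) E])
    fix c and p q :: 5 assume c: "c \<in> const_matrix ` N" and pq: "p \<notin> {1, 2} \<or> q \<notin> {1, 2}"
    have as: "antisym_matrix c" using c const_matrix_antisym_matrix by blast
    have 1: "c 3 4 = 0" "c 0 4 = 0" "c 0 3 = 0"
      using star_pair_matrix[OF as] const_matrices_isotropic[OF N(1) c E] by auto
    have 2: "c 1 3 = 0" "c 1 4 = 0" "c 2 3 = 0" "c 2 4 = 0" "c 1 0 = 0" "c 2 0 = 0"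
      using z1[OF c] z2[OF c] by simp_all
    have 3: "c 0 1 = 0" "c 0 2 = 0" using 2(5,6) antisym_rules[OF as] by simp_all
    define x where "x = c 1 2"
    have "c = (\<lambda>p q. x * pair_matrix 1 2 p q)"
      using 1 2 3 by (intro antisym_matrix_eqI[OF as antisym_pair_matrix]) (simp_all add: pair_matrix_def x_def)
    then have "c p q = x * pair_matrix 1 2 p q" by metis
    then show "c p q = 0" using pq by (auto simp: pair_matrix_def)
  qed
qed (simp_all add: sum_5)

lemma maximal_space: "maximal_open_subalgebra (graded_subalgebra type_space)"
proof (rule maximal_graded_subalgebraI)
  fix N assume N: "proper_open_subalgebra N" "graded_subalgebra type_space \<subseteq> N"
  have S: "(\<Sum>k\<in>UNIV. int (type_space k)) div 2 = 4" by (simp add: sum_5)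
  show "N \<subseteq> graded_subalgebra type_space"
    by (intro subset_space[OF N(1)] pair_matrix_graded[OF N(2)]) (simp_all only: S, simp_all)
qed (simp_all add: sum_5)

lemma maximal_subset_eq:
  assumes "maximal_open_subalgebra M" "maximal_open_subalgebra G" "M \<subseteq> G"
  shows "M = G"
  using assms unfolding maximal_open_subalgebra_def by blast

text \<open>The cases follow the values at the origin: none, only multiples of dx_1 dx_2, only
  multiples of dx_1, or all three pairs. Containment then means equality, both sides being
  maximal.\<close>

lemma maximal_moves_to_graded:
  assumes M: "maximal_open_subalgebra M"
  shows "\<exists>a\<in>{type_line, type_plane, type_space, type_principal}. moves_to M (graded_subalgebra a)"
proof (cases "\<exists>c\<in>const_matrix ` M. \<exists>p q. c p q \<noteq> 0")
  case False
  then have "M \<subseteq> graded_subalgebra type_principal"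
    by (intro subset_principal[OF maximal_proper_open[OF M]]) blast
  then have "M = graded_subalgebra type_principal" using maximal_subset_eq[OF M maximal_principal] by blast
  then show ?thesis using moves_to_refl[OF M] by blast
next
  case True
  then obtain M1 where M1: "moves_to M M1" "pair_matrix 1 2 \<in> const_matrix ` M1"
    using normal_form_first[OF M] by blast
  note max1 = moves_to_maximal[OF M1(1)]
  show ?thesis
  proof (cases "\<forall>c\<in>const_matrix ` M1. \<forall>p q. p \<notin> {1, 2} \<or> q \<notin> {1, 2} \<longrightarrow> c p q = 0")
    case True
    then have "M1 \<subseteq> graded_subalgebra type_plane"
      by (intro subset_plane[OF maximal_proper_open[OF max1] M1(2)]) blast
    then have "M1 = graded_subalgebra type_plane" using maximal_subset_eq[OF max1 maximal_plane] by blast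
    then show ?thesis using M1(1) by blast
  next
    case False
    then obtain M2 where M2: "moves_to M1 M2" "pair_matrix 1 2 \<in> const_matrix ` M2" "pair_matrix 1 3 \<in> const_matrix ` M2"
      using normal_form_second[OF max1 M1(2)] by blast
    note max2 = moves_to_maximal[OF M2(1)]
    show ?thesis
    proof (cases "\<forall>c\<in>const_matrix ` M2. \<forall>p q. p \<noteq> 1 \<longrightarrow> q \<noteq> 1 \<longrightarrow> c p q = 0")
      case True
      then have "M2 \<subseteq> graded_subalgebra type_line"
        by (intro subset_line[OF maximal_proper_open[OF max2] M2(2,3)]) blast
      then have "M2 = graded_subalgebra type_line" using maximal_subset_eq[OF max2 maximal_line] by blast
      then show ?thesis using moves_to_trans[OF M1(1) M2(1)] by blast
    next
      case False
      then have "pair_matrix 2 3 \<in> const_matrix ` M2"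
        using third_pair[OF maximal_proper_open[OF max2] M2(2,3)] by blast
      then have "M2 \<subseteq> graded_subalgebra type_space"
        by (rule subset_space[OF maximal_proper_open[OF max2] M2(2,3)])
      then have "M2 = graded_subalgebra type_space" using maximal_subset_eq[OF max2 maximal_space] by blast
      then show ?thesis using moves_to_trans[OF M1(1) M2(1)] by blast
    qed
  qed
qed

theorem theorem8p5:
  fixes M :: "elt set"
  shows "maximal_open_subalgebra M \<longleftrightarrow>
    (\<exists>a \<in> {(\<lambda>_. 1)(1 := 2), (\<lambda>_. 2)(1 := 3, 2 := 3), (\<lambda>_. 2)(4 := 1, 5 := 1), (\<lambda>_. 2)}.
       conjugate (graded_subalgebra a) M)"
proof
  assume "maximal_open_subalgebra M"
  then show "\<exists>a \<in> {(\<lambda>_. 1)(1 := 2), (\<lambda>_. 2)(1 := 3, 2 := 3), (\<lambda>_. 2)(4 := 1, 5 := 1), (\<lambda>_. 2)}.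
       conjugate (graded_subalgebra a) M"
    using maximal_moves_to_graded conjugate_sym unfolding moves_to_def by blast
next
  assume "\<exists>a \<in> {(\<lambda>_. 1)(1 := 2), (\<lambda>_. 2)(1 := 3, 2 := 3), (\<lambda>_. 2)(4 := 1, 5 := 1), (\<lambda>_. 2)}.
       conjugate (graded_subalgebra a) M"
  then show "maximal_open_subalgebra M"
    using maximal_line maximal_plane maximal_space maximal_principal conjugate_maximal_open_subalgebra by blast
qed

end
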